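(* Let $R$ be an Artin algebra with duality functor $\mathrm{D}(-)$. For a finitely generated $R$-module $N$ the following conditions are equivalent. (i) The injective dimension $\mathrm{id}_R N$ is finite. (ii) $\widetilde{\mathrm{Tor}}{}^R_i(-,N)=0$ for all $i\in\mathbb{Z}$. (iii) There is an integer $i\le 0$ with $\widetilde{\mathrm{Tor}}{}^R_i(M,N)=0$ for all finitely generated $R^\circ$-modules $M$. (iv) $\widetilde{\mathrm{Tor}}{}^R_0(\mathrm{D}(N),N)=0$.
   Context: An $R$-module is a left $R$-module; $R^\circ$ is the opposite ring, so $R^\circ$-modules are right $R$-modules. Complexes are indexed homologically. An Artin algebra $R$ is an algebra over a commutative artinian ring $\Bbbk$ that is finitely generated as a $\Bbbk$-module; its duality functor is $\mathrm{D}(-)=\mathrm{Hom}_{\Bbbk}(-,E)$, where $E$ is the injective hull of $\Bbbk/\mathrm{Jac}(\Bbbk)$; it gives a duality between finitely generated $R$-modules and finitely generated $R^\circ$-modules. For an $R^\circ$-complex $X$ and an $R$-complex $Y$, the unbounded tensor product $X\,\overline{\otimes}_R\,Y$ is the $\Bbbk$-complex with degree $n$ term $\prod_{i\in\mathbb{Z}} X_i\otimes_R Y_{n-i}$ and differential given on elementary tensors by $\partial(x\otimes y)=\partial^X(x)\otimes y+(-1)^{i}x\otimes\partial^Y(y)$ for $x\in X_i$. It contains the usual tensor product $X\otimes_R Y$ (with degree $n$ term $\coprod_{i} X_i\otimes_R Y_{n-i}$) as a subcomplex, and the stable tensor product is $X\,\widetilde{\otimes}_R\,Y=(X\,\overline{\otimes}_R\,Y)/(X\otimes_R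 Y)$. For an $R^\circ$-module $M$ with projective resolution $P\to M$ and an $R$-module $N$ with injective resolution $N\to I$, the stable homology modules are $\widetilde{\mathrm{Tor}}{}^R_i(M,N)=\mathrm{H}_{i+1}(P\,\widetilde{\otimes}_R\,I)$, $i\in\mathbb{Z}$. They are independent of the choice of resolutions and functorial in both arguments. $\widetilde{\mathrm{Tor}}{}^R_i(-,N)=0$ means vanishing on all $R^\circ$-modules. *)

theory Defs
  imports
    "HOL-Library.Equipollence"
    "HOL-Library.Extended_Nat"
    "HOL-Algebra.Free_Abelian_Groups"
    "HOL-Algebra.Ideal"
    "HOL-Algebra.Module"
begin

section \<open>Modules over arbitrary rings\<close>

text \<open>
  The locale \<^locale>\<open>module\<close> of the library demands a commutative ring. Here the ring is
  arbitrary; modules are still carried by the library's record \<^type>\<open>module\<close>, whose fields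
  \<^const>\<open>mult\<close> and \<^const>\<open>one\<close> are meaningless for a module. The library's
  \<^locale>\<open>submodule\<close> does not assume commutativity.
\<close>

locale left_module = R?: ring R + M?: abelian_group M
  for R :: "('r, 'c) ring_scheme" (structure) and M :: "('r, 'm, 'd) module_scheme" (structure) +
  assumes smult_closed [simp, intro]:
      "\<lbrakk>a \<in> carrier R; x \<in> carrier M\<rbrakk> \<Longrightarrow> a \<odot>\<^bsub>M\<^esub> x \<in> carrier M"
    and smult_l_distr:
      "\<lbrakk>a \<in> carrier R; b \<in> carrier R; x \<in> carrier M\<rbrakk>
        \<Longrightarrow> (a \<oplus>\<^bsub>R\<^esub> b) \<odot>\<^bsub>M\<^esub> x = a \<odot>\<^bsub>M\<^esub> x \<oplus>\<^bsub>M\<^esub> b \<odot>\<^bsub>M\<^esub> x"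
    and smult_r_distr:
      "\<lbrakk>a \<in> carrier R; x \<in> carrier M; y \<in> carrier M\<rbrakk>
        \<Longrightarrow> a \<odot>\<^bsub>M\<^esub> (x \<oplus>\<^bsub>M\<^esub> y) = a \<odot>\<^bsub>M\<^esub> x \<oplus>\<^bsub>M\<^esub> a \<odot>\<^bsub>M\<^esub> y"
    and smult_assoc:
      "\<lbrakk>a \<in> carrier R; b \<in> carrier R; x \<in> carrier M\<rbrakk>
        \<Longrightarrow> (a \<otimes>\<^bsub>R\<^esub> b) \<odot>\<^bsub>M\<^esub> x = a \<odot>\<^bsub>M\<^esub> (b \<odot>\<^bsub>M\<^esub> x)"
    and smult_one [simp]: "x \<in> carrier M \<Longrightarrow> \<one>\<^bsub>R\<^esub> \<odot>\<^bsub>M\<^esub> x = x"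

text \<open>
  A right \<open>R\<close>-module is a left module over \<open>op_ring R\<close>; in it \<open>r \<odot> x\<close> stands for \<open>x \<cdot> r\<close>.
\<close>

definition op_ring :: "('r, 'c) ring_scheme \<Rightarrow> ('r, 'c) ring_scheme" where
  "op_ring R = R\<lparr>mult := \<lambda>x y. y \<otimes>\<^bsub>R\<^esub> x\<rparr>"

definition regular_module :: "('r, 'c) ring_scheme \<Rightarrow> ('r, 'r) module" where
  "regular_module R =
    \<lparr>carrier = carrier R, mult = mult R, one = \<one>\<^bsub>R\<^esub>, zero = \<zero>\<^bsub>R\<^esub>, add = add R, smult = mult R\<rparr>"

definition trivial_module :: "('r, 'm) module \<Rightarrow> bool" where
  "trivial_module M \<longleftrightarrow> carrier M = {\<zero>\<^bsub>M\<^esub>}"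

definition fin_gen_module :: "('r, 'c) ring_scheme \<Rightarrow> ('r, 'm) module \<Rightarrow> bool" where
  "fin_gen_module R M \<longleftrightarrow>
    (\<exists>B. finite B \<and> B \<subseteq> carrier M \<and> \<Inter> {S. submodule S R M \<and> B \<subseteq> S} = carrier M)"

definition mod_hom :: "('r, 'c) ring_scheme \<Rightarrow> ('r, 'm) module \<Rightarrow> ('r, 'n) module \<Rightarrow> ('m \<Rightarrow> 'n) set" where
  "mod_hom R M N = {f \<in> carrier M \<rightarrow> carrier N.
     (\<forall>x\<in>carrier M. \<forall>y\<in>carrier M. f (x \<oplus>\<^bsub>M\<^esub> y) = f x \<oplus>\<^bsub>N\<^esub> f y) \<and>
     (\<forall>a\<in>carrier R. \<forall>x\<in>carrier M. f (a \<odot>\<^bsub>M\<^esub> x) = a \<odot>\<^bsub>N\<^esub> f x)}"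

text \<open>
  Quotient by a submodule \<open>S\<close>, with cosets as elements; all the cosets in the union in the
  scalar multiplication are equal. Likewise, \<open>quot_map N T f\<close> is the map into the quotient of
  \<open>N\<close> by \<open>T\<close> that sends the coset of \<open>x\<close> to the coset of \<open>f x\<close>.
\<close>

definition quot_map :: "('r, 'n) module \<Rightarrow> 'n set \<Rightarrow> ('m \<Rightarrow> 'n) \<Rightarrow> 'm set \<Rightarrow> 'n set" where
  "quot_map N T f C = (\<Union>x\<in>C. T +>\<^bsub>N\<^esub> f x)"

definition quot_module :: "('r, 'm) module \<Rightarrow> 'm set \<Rightarrow> ('r, 'm set) module" where
  "quot_module M S =
    \<lparr>carrier = a_rcosets\<^bsub>M\<^esub> S, mult = undefined, one = undefined, zero = S, add = set_add M,
     smult = (\<lambda>a. quot_map M S (\<lambda>x. a \<odot>\<^bsub>M\<^esub> x))\<rparr>"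

section \<open>Projective and injective modules\<close>

text \<open>
  HOL cannot quantify over all types, so "all modules" means all modules whose carrier lies in
  a type \<open>'u\<close>, a universe passed as a type argument. If \<open>'u\<close> is infinite and the ring embeds in
  it, \<open>'u\<close> contains copies of all left ideals (so Baer's criterion applies), of all finitely
  generated modules, and of a free cover of each module in \<open>'u\<close>. Injectivity of any module,
  and projectivity of a module in \<open>'u\<close>, then do not depend on \<open>'u\<close>, and modules in \<open>'u\<close> have
  projective resolutions in \<open>'u\<close>. An algebra that is finitely generated as a \<open>K\<close>-module embeds in
  every infinite \<open>'u\<close> in which \<open>K\<close> embeds.
\<close>

definition projective_module ::
  "'u itself \<Rightarrow> ('r, 'c) ring_scheme \<Rightarrow> ('r, 'm) module \<Rightarrow> bool" where
  "projective_module U R P \<longleftrightarrow> left_module R P \<and>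
    (\<forall>(A :: ('r, 'u) module) (B :: ('r, 'u) module) g f.
      left_module R A \<and> left_module R B \<and> g \<in> mod_hom R A B \<and> g ` carrier A = carrier B \<and>
      f \<in> mod_hom R P B \<longrightarrow>
      (\<exists>h\<in>mod_hom R P A. \<forall>x\<in>carrier P. g (h x) = f x))"

definition injective_module ::
  "'u itself \<Rightarrow> ('r, 'c) ring_scheme \<Rightarrow> ('r, 'm) module \<Rightarrow> bool" where
  "injective_module U R I \<longleftrightarrow> left_module R I \<and>
    (\<forall>(A :: ('r, 'u) module) (B :: ('r, 'u) module) g f.
      left_module R A \<and> left_module R B \<and> g \<in> mod_hom R A B \<and> inj_on g (carrier A) \<and>
      f \<in> mod_hom R A I \<longrightarrow>
      (\<exists>h\<in>mod_hom R B I. \<forall>x\<in>carrier A. h (g x) = f x))"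

definition injective_hull ::
  "'u itself \<Rightarrow> ('r, 'c) ring_scheme \<Rightarrow> ('r, 'm) module \<Rightarrow> ('r, 'e) module \<Rightarrow> bool" where
  "injective_hull U R A E \<longleftrightarrow> injective_module U R E \<and>
    (\<exists>\<iota>\<in>mod_hom R A E. inj_on \<iota> (carrier A) \<and>
      (\<forall>S. submodule S R E \<and> S \<inter> \<iota> ` carrier A = {\<zero>\<^bsub>E\<^esub>} \<longrightarrow> S = {\<zero>\<^bsub>E\<^esub>}))"

section \<open>Complexes and resolutions\<close>

text \<open>Homological indexing: \<open>cdiff X n\<close> maps degree \<open>n\<close> to degree \<open>n - 1\<close>.\<close>

record ('r, 'm) cplx =
  cobj :: "int \<Rightarrow> ('r, 'm) module"
  cdiff :: "int \<Rightarrow> 'm \<Rightarrow> 'm"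

definition is_complex :: "('r, 'c) ring_scheme \<Rightarrow> ('r, 'm) cplx \<Rightarrow> bool" where
  "is_complex R X \<longleftrightarrow> (\<forall>n. left_module R (cobj X n) \<and>
     cdiff X n \<in> mod_hom R (cobj X n) (cobj X (n - 1)) \<and>
     (\<forall>x\<in>carrier (cobj X n). cdiff X (n - 1) (cdiff X n x) = \<zero>\<^bsub>cobj X (n - 2)\<^esub>))"

definition cycles :: "('r, 'm) cplx \<Rightarrow> int \<Rightarrow> 'm set" where
  "cycles X n = {x \<in> carrier (cobj X n). cdiff X n x = \<zero>\<^bsub>cobj X (n - 1)\<^esub>}"

definition boundaries :: "('r, 'm) cplx \<Rightarrow> int \<Rightarrow> 'm set" where
  "boundaries X n = cdiff X (n + 1) ` carrier (cobj X (n + 1))"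

definition homology_module :: "('r, 'm) cplx \<Rightarrow> int \<Rightarrow> ('r, 'm set) module" where
  "homology_module X n = quot_module ((cobj X n)\<lparr>carrier := cycles X n\<rparr>) (boundaries X n)"

definition quot_complex :: "('r, 'm) cplx \<Rightarrow> (int \<Rightarrow> 'm set) \<Rightarrow> ('r, 'm set) cplx" where
  "quot_complex X S =
    \<lparr>cobj = (\<lambda>n. quot_module (cobj X n) (S n)),
     cdiff = (\<lambda>n. quot_map (cobj X (n - 1)) (S (n - 1)) (cdiff X n))\<rparr>"

definition projective_resolution ::
  "'u itself \<Rightarrow> ('r, 'c) ring_scheme \<Rightarrow> ('r, 'm) module \<Rightarrow> ('r, 'u) cplx \<Rightarrow> ('u \<Rightarrow> 'm) \<Rightarrow> bool" where
  "projective_resolution U R M P \<epsilon> \<longleftrightarrow> is_complex R P \<and>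
     (\<forall>n. projective_module U R (cobj P n)) \<and> (\<forall>n<0. trivial_module (cobj P n)) \<and>
     \<epsilon> \<in> mod_hom R (cobj P 0) M \<and> \<epsilon> ` carrier (cobj P 0) = carrier M \<and>
     {x \<in> carrier (cobj P 0). \<epsilon> x = \<zero>\<^bsub>M\<^esub>} = boundaries P 0 \<and>
     (\<forall>n>0. cycles P n = boundaries P n)"

definition injective_resolution ::
  "'u itself \<Rightarrow> ('r, 'c) ring_scheme \<Rightarrow> ('r, 'm) module \<Rightarrow> ('r, 'u) cplx \<Rightarrow> ('m \<Rightarrow> 'u) \<Rightarrow> bool" where
  "injective_resolution U R N I \<eta> \<longleftrightarrow> is_complex R I \<and>
     (\<forall>n. injective_module U R (cobj I n)) \<and> (\<forall>n>0. trivial_module (cobj I n)) \<and>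
     \<eta> \<in> mod_hom R N (cobj I 0) \<and> inj_on \<eta> (carrier N) \<and>
     \<eta> ` carrier N = cycles I 0 \<and>
     (\<forall>n<0. cycles I n = boundaries I n)"

text \<open>The infimum of the empty set is \<open>\<infinity>\<close>; the zero module has dimension \<open>0\<close> here.\<close>

definition inj_dim :: "'u itself \<Rightarrow> ('r, 'c) ring_scheme \<Rightarrow> ('r, 'm) module \<Rightarrow> enat" where
  "inj_dim U R N = Inf (enat ` {d. \<exists>(I :: ('r, 'u) cplx) \<eta>. injective_resolution U R N I \<eta> \<and>
     (\<forall>n < - int d. trivial_module (cobj I n))})"

section \<open>Artin algebras and their duality\<close>

definition artinian_ring :: "('k, 'c) ring_scheme \<Rightarrow> bool" where
  "artinian_ring K \<longleftrightarrow> cring K \<and>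
    (\<forall>J :: nat \<Rightarrow> 'k set. (\<forall>n. ideal (J n) K \<and> J (Suc n) \<subseteq> J n) \<longrightarrow> (\<exists>m. \<forall>n\<ge>m. J n = J m))"

text \<open>
  One record carries both the ring structure of \<open>R\<close> and its structure of a \<open>K\<close>-module. The last
  two assumptions say that \<open>K\<close> acts through the centre of \<open>R\<close>; the library's locale
  \<^locale>\<open>algebra\<close> requires \<open>R\<close> to be commutative.
\<close>

locale artin_algebra = R: ring R + KR: module K R
  for K :: "'k ring" and R :: "('k, 'r) module" +
  assumes artinian: "artinian_ring K"
    and fin_gen: "fin_gen_module K R"
    and smult_mult_left:
      "\<lbrakk>a \<in> carrier K; x \<in> carrier R; y \<in> carrier R\<rbrakk>
        \<Longrightarrow> (a \<odot>\<^bsub>R\<^esub> x) \<otimes>\<^bsub>R\<^esub> y = a \<odot>\<^bsub>R\<^esub> (x \<otimes>\<^bsub>R\<^esub> y)"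
    and smult_mult_right:
      "\<lbrakk>a \<in> carrier K; x \<in> carrier R; y \<in> carrier R\<rbrakk>
        \<Longrightarrow> x \<otimes>\<^bsub>R\<^esub> (a \<odot>\<^bsub>R\<^esub> y) = a \<odot>\<^bsub>R\<^esub> (x \<otimes>\<^bsub>R\<^esub> y)"

text \<open>The \<open>K\<close>-module underlying a left or right \<open>R\<close>-module.\<close>

definition restrict_scalars :: "('k, 'r) module \<Rightarrow> ('r, 'm) module \<Rightarrow> ('k, 'm) module" where
  "restrict_scalars R M =
    \<lparr>carrier = carrier M, mult = mult M, one = \<one>\<^bsub>M\<^esub>, zero = \<zero>\<^bsub>M\<^esub>, add = add M,
     smult = (\<lambda>a x. (a \<odot>\<^bsub>R\<^esub> \<one>\<^bsub>R\<^esub>) \<odot>\<^bsub>M\<^esub> x)\<rparr>"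

text \<open>For a commutative ring.\<close>

definition jacobson_radical :: "('k, 'c) ring_scheme \<Rightarrow> 'k set" where
  "jacobson_radical K = {x \<in> carrier K. \<forall>J. maximalideal J K \<longrightarrow> x \<in> J}"

definition residue_module :: "('k, 'c) ring_scheme \<Rightarrow> ('k, 'k set) module" where
  "residue_module K = quot_module (regular_module K) (jacobson_radical K)"

text \<open>
  \<open>Hom\<^sub>K(N, E)\<close> with the action \<open>(\<phi> \<cdot> r)(x) = \<phi>(r x)\<close>, a right \<open>R\<close>-module for a left
  \<open>R\<close>-module \<open>N\<close>.
\<close>

definition dual_module ::
  "'k ring \<Rightarrow> ('k, 'r) module \<Rightarrow> ('k, 'e) module \<Rightarrow> ('r, 'n) module \<Rightarrow> ('r, 'n \<Rightarrow> 'e) module" where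
  "dual_module K R E N =
    \<lparr>carrier = mod_hom K (restrict_scalars R N) E \<inter> extensional (carrier N),
     mult = undefined, one = undefined,
     zero = (\<lambda>x\<in>carrier N. \<zero>\<^bsub>E\<^esub>),
     add = (\<lambda>\<phi> \<psi>. \<lambda>x\<in>carrier N. \<phi> x \<oplus>\<^bsub>E\<^esub> \<psi> x),
     smult = (\<lambda>r \<phi>. \<lambda>x\<in>carrier N. \<phi> (r \<odot>\<^bsub>N\<^esub> x))\<rparr>"

section \<open>Tensor products\<close>

text \<open>
  Throughout, \<open>X\<close> is a right and \<open>Y\<close> a left \<open>R\<close>-module. The tensor product is the free abelian
  group on \<open>X \<times> Y\<close> modulo \<open>tensor_rels\<close>, with \<open>K\<close> acting by \<open>a (x \<otimes> y) = (a x) \<otimes> y\<close>. The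
  record \<open>pre_tensor\<close> only lists the data to be passed to the quotient; it is not itself a
  \<open>K\<close>-module, since its action is not additive in the scalar.
\<close>

definition pre_tensor ::
  "('k, 'r) module \<Rightarrow> ('r, 'x) module \<Rightarrow> ('r, 'y) module \<Rightarrow> ('k, ('x \<times> 'y) \<Rightarrow>\<^sub>0 int) module" where
  "pre_tensor R X Y =
    \<lparr>carrier = carrier (free_Abelian_group (carrier X \<times> carrier Y)),
     mult = undefined, one = undefined, zero = 0, add = (+),
     smult = (\<lambda>a. frag_extend (\<lambda>(x, y). frag_of (a \<odot>\<^bsub>restrict_scalars R X\<^esub> x, y)))\<rparr>"

definition tensor_rels ::
  "('k, 'r) module \<Rightarrow> ('r, 'x) module \<Rightarrow> ('r, 'y) module \<Rightarrow> (('x \<times> 'y) \<Rightarrow>\<^sub>0 int) set" where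
  "tensor_rels R X Y = generate (free_Abelian_group (carrier X \<times> carrier Y))
    ({frag_of (x \<oplus>\<^bsub>X\<^esub> x', y) - frag_of (x, y) - frag_of (x', y) | x x' y.
        x \<in> carrier X \<and> x' \<in> carrier X \<and> y \<in> carrier Y} \<union>
     {frag_of (x, y \<oplus>\<^bsub>Y\<^esub> y') - frag_of (x, y) - frag_of (x, y') | x y y'.
        x \<in> carrier X \<and> y \<in> carrier Y \<and> y' \<in> carrier Y} \<union>
     {frag_of (r \<odot>\<^bsub>X\<^esub> x, y) - frag_of (x, r \<odot>\<^bsub>Y\<^esub> y) | r x y.
        r \<in> carrier R \<and> x \<in> carrier X \<and> y \<in> carrier Y})"

definition tensor_module ::
  "('k, 'r) module \<Rightarrow> ('r, 'x) module \<Rightarrow> ('r, 'y) module \<Rightarrow> ('k, (('x \<times> 'y) \<Rightarrow>\<^sub>0 int) set) module" where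
  "tensor_module R X Y = quot_module (pre_tensor R X Y) (tensor_rels R X Y)"

text \<open>The map \<open>f \<otimes> g\<close> with values in the tensor product of \<open>X'\<close> and \<open>Y'\<close>.\<close>

definition tensor_map ::
  "('k, 'r) module \<Rightarrow> ('r, 'x2) module \<Rightarrow> ('r, 'y2) module \<Rightarrow> ('x \<Rightarrow> 'x2) \<Rightarrow> ('y \<Rightarrow> 'y2) \<Rightarrow>
    (('x \<times> 'y) \<Rightarrow>\<^sub>0 int) set \<Rightarrow> (('x2 \<times> 'y2) \<Rightarrow>\<^sub>0 int) set" where
  "tensor_map R X' Y' f g = quot_map (pre_tensor R X' Y') (tensor_rels R X' Y')
     (frag_extend (\<lambda>(x, y). frag_of (f x, g y)))"

definition prod_module :: "(int \<Rightarrow> ('k, 'm) module) \<Rightarrow> ('k, int \<Rightarrow> 'm) module" where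
  "prod_module M =
    \<lparr>carrier = {t. \<forall>i. t i \<in> carrier (M i)}, mult = undefined, one = undefined,
     zero = (\<lambda>i. \<zero>\<^bsub>M i\<^esub>), add = (\<lambda>s t i. s i \<oplus>\<^bsub>M i\<^esub> t i), smult = (\<lambda>a t i. a \<odot>\<^bsub>M i\<^esub> t i)\<rparr>"

definition coprod_submodule :: "(int \<Rightarrow> ('k, 'm) module) \<Rightarrow> (int \<Rightarrow> 'm) set" where
  "coprod_submodule M = {t. (\<forall>i. t i \<in> carrier (M i)) \<and> finite {i. t i \<noteq> \<zero>\<^bsub>M i\<^esub>}}"

text \<open>
  The component in \<open>X\<^sub>i \<otimes> Y\<^sub>n\<^sub>-\<^sub>1\<^sub>-\<^sub>i\<close> of the differential of \<open>t\<close>, an element of degree \<open>n\<close>, receives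
  \<open>\<partial>\<^sup>X \<otimes> 1\<close> of the component of \<open>t\<close> in \<open>X\<^sub>i\<^sub>+\<^sub>1 \<otimes> Y\<^sub>n\<^sub>-\<^sub>1\<^sub>-\<^sub>i\<close> and \<open>(-1)\<^sup>i (1 \<otimes> \<partial>\<^sup>Y)\<close> of that in
  \<open>X\<^sub>i \<otimes> Y\<^sub>n\<^sub>-\<^sub>i\<close>.
\<close>

definition unbounded_tensor ::
  "('k, 'r) module \<Rightarrow> ('r, 'x) cplx \<Rightarrow> ('r, 'y) cplx \<Rightarrow>
    ('k, int \<Rightarrow> (('x \<times> 'y) \<Rightarrow>\<^sub>0 int) set) cplx" where
  "unbounded_tensor R X Y =
    \<lparr>cobj = (\<lambda>n. prod_module (\<lambda>i. tensor_module R (cobj X i) (cobj Y (n - i)))),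
     cdiff = (\<lambda>n t i.
       let T = tensor_module R (cobj X i) (cobj Y (n - 1 - i));
           u = tensor_map R (cobj X i) (cobj Y (n - 1 - i)) (cdiff X (i + 1)) (\<lambda>y. y) (t (i + 1));
           v = tensor_map R (cobj X i) (cobj Y (n - 1 - i)) (\<lambda>x. x) (cdiff Y (n - i)) (t i)
       in u \<oplus>\<^bsub>T\<^esub> (if even i then v else \<ominus>\<^bsub>T\<^esub> v))\<rparr>"

definition stable_tensor ::
  "('k, 'r) module \<Rightarrow> ('r, 'x) cplx \<Rightarrow> ('r, 'y) cplx \<Rightarrow>
    ('k, (int \<Rightarrow> (('x \<times> 'y) \<Rightarrow>\<^sub>0 int) set) set) cplx" where
  "stable_tensor R X Y = quot_complex (unbounded_tensor R X Y)
     (\<lambda>n. coprod_submodule (\<lambda>i. tensor_module R (cobj X i) (cobj Y (n - i))))"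

section \<open>Stable homology\<close>

definition chosen_proj_res ::
  "'u itself \<Rightarrow> ('r, 'c) ring_scheme \<Rightarrow> ('r, 'm) module \<Rightarrow> ('r, 'u) cplx" where
  "chosen_proj_res U R M = (SOME P. \<exists>\<epsilon>. projective_resolution U R M P \<epsilon>)"

definition chosen_inj_res ::
  "'u itself \<Rightarrow> ('r, 'c) ring_scheme \<Rightarrow> ('r, 'm) module \<Rightarrow> ('r, 'u) cplx" where
  "chosen_inj_res U R N = (SOME I. \<exists>\<eta>. injective_resolution U R N I \<eta>)"

text \<open>
  The value of \<open>stable_Tor U R i M N\<close> is independent, up to isomorphism, of the chosen
  resolutions.
\<close>

definition stable_Tor ::
  "'u itself \<Rightarrow> ('k, 'r) module \<Rightarrow> int \<Rightarrow> ('r, 'm) module \<Rightarrow> ('r, 'n) module \<Rightarrow>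
    ('k, (int \<Rightarrow> (('u \<times> 'u) \<Rightarrow>\<^sub>0 int) set) set set) module" where
  "stable_Tor U R i M N = homology_module
     (stable_tensor R (chosen_proj_res U (op_ring R) M) (chosen_inj_res U R N)) (i + 1)"

end

(*
  If the injective dimension of N is finite, an injective resolution I of N is contractible in
  high degrees, and tensoring the contraction with a projective resolution exhibits every stable
  cycle as a boundary.

  Conversely, resolve D(N) by finitely generated free modules Q_j = R^{m_j} with differential
  Delta. The injective modules J^j = D(Q_j) form an injective resolution of N, and Q_i (x) J^j is
  the finite power (J^j)^{m_i}. Call w_0, w_1, ... with w_j in Q_{j+1} (x) J^j a chain if
  (1 (x) d) w_j = (Delta (x) 1) w_{j+1}. By duality, functionals on Q_j (x) J^j are the same as
  homomorphisms J^j -> J^j. If for some n each chain of length n with (1 (x) d)(Delta (x) 1) w_0 = 0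
  satisfies ev((Delta (x) 1) w_0) = 0, where ev is the evaluation Q_0 (x) D(Q_0) -> E, then ev can
  be extended step by step, by injectivity of E, to functionals that amount to a chain endomorphism
  of J over the identity of N vanishing above degree n. This endomorphism is homotopic to the
  identity, so J is contractible in high degrees and N has finite injective dimension.
  Otherwise the descending chain condition on the submodules of the modules of finite length
  Q_{j+1} (x) J^j yields an infinite chain with ev((Delta (x) 1) w_0) nonzero.

  Let M be the cokernel of Delta: Q_{k+1} -> Q_k, that is, D(N) for k = 0 and the k-th syzygy of
  D(N) for k > 0. Comparison maps between the chosen resolutions P, I and Q, J carry the tail of
  the infinite chain to a stable cycle t of degree 1 - k, and back-and-forth they give functionals
  Theta_i on P_i (x) I^{i+k} with Theta_i o (d (x) 1) = Theta_{i+1} o (1 (x) d). The value of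
  Theta_i at (1 (x) d) t_i does not depend on i and is ev((Delta (x) 1) w_0), which is nonzero,
  while it would be zero for large i if t were a boundary modulo the coproduct. So stable Tor in
  degree -k does not vanish on M.
*)
theory Submission
  imports Defs
begin

section \<open>Modules over an arbitrary ring and change of universe\<close>

subsection \<open>Modules, submodules and homomorphisms\<close>

text \<open>Neither independence of resolutions nor long exact sequences enter.
  \<open>stable_Tor\<close> is computed from chosen resolutions, about which nothing more is known;
  a class is shown to be nonzero because a functional with values in \<open>E\<close> takes a
  nonzero value on it. The composites of comparison maps are not identities, but they are identities
  over \<open>N\<close> and over the module that the free modules resolve, and the value of the
  functional sees no more than that.

  The obstacle is that infinite injective dimension provides, for each n, only a chain of length n,
  whereas a stable class is an infinite sequence. Finite length over \<open>K\<close> bridges the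
  gap, as in a Mittag-Leffler argument; this is where finite generation of \<open>N\<close> enters,
  together with reflexivity of D.

  All degrees i \<le> 0 are reached with one infinite chain: the detected value is the same at each
  place of the chain, so D(N) may be replaced by its k-th syzygy at the cost of a shift by k.

  The notions of projective and injective module test modules in one type \<open>'u\<close> only, so
  a size bound accompanies most liftings and extensions.\<close>

lemma submoduleD:
  assumes "submodule S R M"
  shows "S \<subseteq> carrier M" "x \<in> S \<Longrightarrow> x \<in> carrier M" "\<zero>\<^bsub>M\<^esub> \<in> S"
    "x \<in> S \<Longrightarrow> y \<in> S \<Longrightarrow> x \<oplus>\<^bsub>M\<^esub> y \<in> S" "a \<in> carrier R \<Longrightarrow> x \<in> S \<Longrightarrow> a \<odot>\<^bsub>M\<^esub> x \<in> S"
    "x \<in> S \<Longrightarrow> \<ominus>\<^bsub>M\<^esub> x \<in> S"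
    "x \<in> S \<Longrightarrow> y \<in> S \<Longrightarrow> x \<ominus>\<^bsub>M\<^esub> y \<in> S"
proof -
  interpret S: submodule S R M by fact
  show 1: "S \<subseteq> carrier M" "x \<in> S \<Longrightarrow> x \<in> carrier M" "\<zero>\<^bsub>M\<^esub> \<in> S"
    "x \<in> S \<Longrightarrow> y \<in> S \<Longrightarrow> x \<oplus>\<^bsub>M\<^esub> y \<in> S" "a \<in> carrier R \<Longrightarrow> x \<in> S \<Longrightarrow> a \<odot>\<^bsub>M\<^esub> x \<in> S"
    for x y
    using S.subset S.one_closed S.m_closed by auto
  show 2: "x \<in> S \<Longrightarrow> \<ominus>\<^bsub>M\<^esub> x \<in> S" for x using S.m_inv_closed by (simp add: a_inv_def)
  show "x \<in> S \<Longrightarrow> y \<in> S \<Longrightarrow> x \<ominus>\<^bsub>M\<^esub> y \<in> S" using 1 2 by (simp add: a_minus_def)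
qed

context left_module
begin

lemma smult_l_null [simp]: "x \<in> carrier M \<Longrightarrow> \<zero>\<^bsub>R\<^esub> \<odot>\<^bsub>M\<^esub> x = \<zero>\<^bsub>M\<^esub>"
  using smult_l_distr[of "\<zero>\<^bsub>R\<^esub>" "\<zero>\<^bsub>R\<^esub>" x]
  by (metis M.add.l_cancel_one' R.r_zero R.zero_closed smult_closed)

lemma smult_r_null [simp]: "a \<in> carrier R \<Longrightarrow> a \<odot>\<^bsub>M\<^esub> \<zero>\<^bsub>M\<^esub> = \<zero>\<^bsub>M\<^esub>"
  using smult_r_distr[of a "\<zero>\<^bsub>M\<^esub>" "\<zero>\<^bsub>M\<^esub>"]
  by (metis M.add.l_cancel_one' M.r_zero M.zero_closed smult_closed)

lemma smult_l_minus: "a \<in> carrier R \<Longrightarrow> x \<in> carrier M \<Longrightarrow> (\<ominus>\<^bsub>R\<^esub> a) \<odot>\<^bsub>M\<^esub> x = \<ominus>\<^bsub>M\<^esub> (a \<odot>\<^bsub>M\<^esub> x)"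
  using smult_l_distr[of "\<ominus>\<^bsub>R\<^esub> a" a x]
  by (simp add: R.l_neg M.minus_equality)

lemma smult_r_minus: "a \<in> carrier R \<Longrightarrow> x \<in> carrier M \<Longrightarrow> a \<odot>\<^bsub>M\<^esub> (\<ominus>\<^bsub>M\<^esub> x) = \<ominus>\<^bsub>M\<^esub> (a \<odot>\<^bsub>M\<^esub> x)"
  using smult_r_distr[of a "\<ominus>\<^bsub>M\<^esub> x" x]
  by (simp add: M.l_neg M.minus_equality)

lemma smult_l_diff: "a \<in> carrier R \<Longrightarrow> b \<in> carrier R \<Longrightarrow> x \<in> carrier M \<Longrightarrow>
    (a \<ominus>\<^bsub>R\<^esub> b) \<odot>\<^bsub>M\<^esub> x = a \<odot>\<^bsub>M\<^esub> x \<ominus>\<^bsub>M\<^esub> b \<odot>\<^bsub>M\<^esub> x"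
  by (simp add: a_minus_def smult_l_distr smult_l_minus)

lemma diff_eq_zeroD: "x \<ominus>\<^bsub>M\<^esub> y = \<zero>\<^bsub>M\<^esub> \<Longrightarrow> x \<in> carrier M \<Longrightarrow> y \<in> carrier M \<Longrightarrow> x = y"
  using M.minus_equality[of x "\<ominus>\<^bsub>M\<^esub> y"] by (simp add: a_minus_def)

lemma diff_add_cancel: "x \<in> carrier M \<Longrightarrow> y \<in> carrier M \<Longrightarrow> (x \<ominus>\<^bsub>M\<^esub> y) \<oplus>\<^bsub>M\<^esub> y = x"
  by (simp add: a_minus_def M.a_assoc M.l_neg)

lemma diff_self: "x \<in> carrier M \<Longrightarrow> x \<ominus>\<^bsub>M\<^esub> x = \<zero>\<^bsub>M\<^esub>"
  by (simp add: a_minus_def M.r_neg)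

lemma set_add_commute:
  assumes "A \<subseteq> carrier M" "B \<subseteq> carrier M"
  shows "A <+>\<^bsub>M\<^esub> B = B <+>\<^bsub>M\<^esub> A"
proof -
  have "A <+>\<^bsub>M\<^esub> B \<subseteq> B <+>\<^bsub>M\<^esub> A" if "A \<subseteq> carrier M" "B \<subseteq> carrier M" for A B
  proof
    fix z assume "z \<in> A <+>\<^bsub>M\<^esub> B"
    then obtain a b where *: "a \<in> A" "b \<in> B" "z = a \<oplus>\<^bsub>M\<^esub> b" by (auto simp: set_add_def')
    then have "z = b \<oplus>\<^bsub>M\<^esub> a" using that M.a_comm by blast
    then show "z \<in> B <+>\<^bsub>M\<^esub> A" unfolding set_add_def' using * by blast
  qed
  then show ?thesis using assms by blast
qed

lemma minus_as_smult: "x \<in> carrier M \<Longrightarrow> \<ominus>\<^bsub>M\<^esub> x = (\<ominus>\<^bsub>R\<^esub> \<one>\<^bsub>R\<^esub>) \<odot>\<^bsub>M\<^esub> x"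
  by (simp add: smult_l_minus)

text \<open>Negation is the action of the scalar -1, so closure under the action already yields the
  inverses that \<open>subgroup\<close> demands.\<close>

lemma submoduleI:
  assumes "H \<subseteq> carrier M" "\<zero>\<^bsub>M\<^esub> \<in> H" "\<And>x y. x \<in> H \<Longrightarrow> y \<in> H \<Longrightarrow> x \<oplus>\<^bsub>M\<^esub> y \<in> H"
    "\<And>a x. a \<in> carrier R \<Longrightarrow> x \<in> H \<Longrightarrow> a \<odot>\<^bsub>M\<^esub> x \<in> H"
  shows "submodule H R M"
proof -
  have inv: "\<ominus>\<^bsub>M\<^esub> x \<in> H" if "x \<in> H" for x
    using that assms(1,4) minus_as_smult[of x] by (metis R.add.inv_closed R.one_closed subsetD)
  show ?thesis
    by (intro submodule.intro subgroup.intro submodule_axioms.intro)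
      (use assms inv in \<open>auto simp: a_inv_def\<close>)
qed

lemma submodule_carrier: "submodule (carrier M) R M"
  by (rule submoduleI) auto

lemma submodule_zero: "submodule {\<zero>\<^bsub>M\<^esub>} R M"
  by (rule submoduleI) auto

lemma submodule_Int: "submodule A R M \<Longrightarrow> submodule B R M \<Longrightarrow> submodule (A \<inter> B) R M"
  by (rule submoduleI) (auto dest: submoduleD)

lemma submodule_add:
  assumes A: "submodule A R M" and B: "submodule B R M"
  shows "submodule (A <+>\<^bsub>M\<^esub> B) R M"
proof (rule submoduleI)
  note [simp] = submoduleD[OF A] submoduleD[OF B]
  show "A <+>\<^bsub>M\<^esub> B \<subseteq> carrier M" by (auto simp: set_add_def')
  show "\<zero>\<^bsub>M\<^esub> \<in> A <+>\<^bsub>M\<^esub> B"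
    unfolding set_add_def' by (simp, rule bexI[of _ "\<zero>\<^bsub>M\<^esub>"], rule bexI[of _ "\<zero>\<^bsub>M\<^esub>"]) auto
  show "x \<oplus>\<^bsub>M\<^esub> y \<in> A <+>\<^bsub>M\<^esub> B" if xy: "x \<in> A <+>\<^bsub>M\<^esub> B" "y \<in> A <+>\<^bsub>M\<^esub> B" for x y
  proof -
    obtain a b a' b' where *: "a \<in> A" "b \<in> B" "x = a \<oplus>\<^bsub>M\<^esub> b" "a' \<in> A" "b' \<in> B" "y = a' \<oplus>\<^bsub>M\<^esub> b'"
      using xy by (auto simp: set_add_def')
    then have "x \<oplus>\<^bsub>M\<^esub> y = (a \<oplus>\<^bsub>M\<^esub> a') \<oplus>\<^bsub>M\<^esub> (b \<oplus>\<^bsub>M\<^esub> b')" by (simp add: M.a_ac)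
    moreover have "a \<oplus>\<^bsub>M\<^esub> a' \<in> A" "b \<oplus>\<^bsub>M\<^esub> b' \<in> B" using * by auto
    ultimately show ?thesis unfolding set_add_def' by blast
  qed
  show "r \<odot>\<^bsub>M\<^esub> x \<in> A <+>\<^bsub>M\<^esub> B" if r: "r \<in> carrier R" "x \<in> A <+>\<^bsub>M\<^esub> B" for r x
  proof -
    obtain a b where *: "a \<in> A" "b \<in> B" "x = a \<oplus>\<^bsub>M\<^esub> b" using r by (auto simp: set_add_def')
    then have "r \<odot>\<^bsub>M\<^esub> x = r \<odot>\<^bsub>M\<^esub> a \<oplus>\<^bsub>M\<^esub> r \<odot>\<^bsub>M\<^esub> b" using r by (simp add: smult_r_distr)
    moreover have "r \<odot>\<^bsub>M\<^esub> a \<in> A" "r \<odot>\<^bsub>M\<^esub> b \<in> B" using * r by auto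
    ultimately show ?thesis unfolding set_add_def' by blast
  qed
qed

lemma submodule_add_upper:
  assumes A: "submodule A R M" and B: "submodule B R M"
  shows "A \<subseteq> A <+>\<^bsub>M\<^esub> B" "B \<subseteq> A <+>\<^bsub>M\<^esub> B"
proof -
  note [simp] = submoduleD[OF A] submoduleD[OF B]
  show "A \<subseteq> A <+>\<^bsub>M\<^esub> B"
  proof
    fix x assume "x \<in> A"
    then have "x = x \<oplus>\<^bsub>M\<^esub> \<zero>\<^bsub>M\<^esub>" by simp
    then show "x \<in> A <+>\<^bsub>M\<^esub> B" unfolding set_add_def' using \<open>x \<in> A\<close> submoduleD(3)[OF B] by blast
  qed
  show "B \<subseteq> A <+>\<^bsub>M\<^esub> B"
  proof
    fix x assume "x \<in> B"
    then have "x = \<zero>\<^bsub>M\<^esub> \<oplus>\<^bsub>M\<^esub> x" by simp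
    then show "x \<in> A <+>\<^bsub>M\<^esub> B" unfolding set_add_def' using \<open>x \<in> B\<close> submoduleD(3)[OF A] by blast
  qed
qed

lemma submodule_add_least:
  "submodule C R M \<Longrightarrow> A \<subseteq> C \<Longrightarrow> B \<subseteq> C \<Longrightarrow> A <+>\<^bsub>M\<^esub> B \<subseteq> C"
  by (auto simp: set_add_def' dest: submoduleD)

lemma submodule_cyclic: "x \<in> carrier M \<Longrightarrow> submodule ((\<lambda>a. a \<odot>\<^bsub>M\<^esub> x) ` carrier R) R M"
proof (rule submoduleI, goal_cases)
  case 2
  then show ?case by (rule_tac image_eqI[of _ _ "\<zero>\<^bsub>R\<^esub>"]) auto
next
  case (3 u v)
  then show ?case using smult_l_distr[symmetric] by auto
next
  case (4 a u)
  then show ?case using smult_assoc[symmetric] by auto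
qed auto

lemma left_module_sub:
  assumes "submodule S R M"
  shows "left_module R (M\<lparr>carrier := S\<rparr>)"
proof -
  note S = submoduleD[OF assms]
  have "abelian_group (M\<lparr>carrier := S\<rparr>)"
  proof (rule abelian_groupI)
    fix x assume "x \<in> carrier (M\<lparr>carrier := S\<rparr>)"
    then show "\<exists>y\<in>carrier (M\<lparr>carrier := S\<rparr>). y \<oplus>\<^bsub>M\<lparr>carrier := S\<rparr>\<^esub> x = \<zero>\<^bsub>M\<lparr>carrier := S\<rparr>\<^esub>"
      using S by (intro bexI[of _ "\<ominus>\<^bsub>M\<^esub> x"]) (auto simp: M.l_neg)
  qed (use S in \<open>auto simp: M.a_ac\<close>)
  then show ?thesis
    using S R.ring_axioms
    by (auto simp: left_module_def left_module_axioms_def smult_l_distr smult_r_distr smult_assoc)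
qed

end

lemma submodule_mono:
  assumes "left_module R M" "submodule S R M" "submodule T R M" "S \<subseteq> T"
  shows "submodule S R (M\<lparr>carrier := T\<rparr>)"
proof -
  interpret T: left_module R "M\<lparr>carrier := T\<rparr>" using assms left_module.left_module_sub by blast
  show ?thesis by (rule T.submoduleI) (use assms(4) submoduleD[OF assms(2)] in auto)
qed

lemma submodule_trans:
  assumes "left_module R M" "submodule T R M" "submodule S R (M\<lparr>carrier := T\<rparr>)"
  shows "submodule S R M"
proof -
  interpret left_module R M by fact
  show ?thesis
    by (rule submoduleI) (use submoduleD[OF assms(3)] submoduleD[OF assms(2)] in auto)
qed

lemma mod_homD:
  assumes "f \<in> mod_hom R A B"
  shows "x \<in> carrier A \<Longrightarrow> f x \<in> carrier B"
    "x \<in> carrier A \<Longrightarrow> y \<in> carrier A \<Longrightarrow> f (x \<oplus>\<^bsub>A\<^esub> y) = f x \<oplus>\<^bsub>B\<^esub> f y"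
    "a \<in> carrier R \<Longrightarrow> x \<in> carrier A \<Longrightarrow> f (a \<odot>\<^bsub>A\<^esub> x) = a \<odot>\<^bsub>B\<^esub> f x"
  using assms by (auto simp: mod_hom_def)

lemma mod_homI:
  assumes "\<And>x. x \<in> carrier A \<Longrightarrow> f x \<in> carrier B"
    "\<And>x y. x \<in> carrier A \<Longrightarrow> y \<in> carrier A \<Longrightarrow> f (x \<oplus>\<^bsub>A\<^esub> y) = f x \<oplus>\<^bsub>B\<^esub> f y"
    "\<And>a x. a \<in> carrier R \<Longrightarrow> x \<in> carrier A \<Longrightarrow> f (a \<odot>\<^bsub>A\<^esub> x) = a \<odot>\<^bsub>B\<^esub> f x"
  shows "f \<in> mod_hom R A B"
  using assms by (auto simp: mod_hom_def)

lemma mod_hom_zero: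
  assumes "left_module R A" "left_module R B" "f \<in> mod_hom R A B"
  shows "f \<zero>\<^bsub>A\<^esub> = \<zero>\<^bsub>B\<^esub>"
proof -
  interpret A: left_module R A by fact
  interpret B: left_module R B by fact
  have "f (\<zero>\<^bsub>R\<^esub> \<odot>\<^bsub>A\<^esub> \<zero>\<^bsub>A\<^esub>) = \<zero>\<^bsub>R\<^esub> \<odot>\<^bsub>B\<^esub> f \<zero>\<^bsub>A\<^esub>" by (intro mod_homD[OF assms(3)]) auto
  then show ?thesis using mod_homD(1)[OF assms(3)] by simp
qed

lemma mod_hom_minus:
  assumes "left_module R A" "left_module R B" "f \<in> mod_hom R A B" "x \<in> carrier A"
  shows "f (\<ominus>\<^bsub>A\<^esub> x) = \<ominus>\<^bsub>B\<^esub> f x"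
proof -
  interpret A: left_module R A by fact
  interpret B: left_module R B by fact
  have "f ((\<ominus>\<^bsub>R\<^esub> \<one>\<^bsub>R\<^esub>) \<odot>\<^bsub>A\<^esub> x) = (\<ominus>\<^bsub>R\<^esub> \<one>\<^bsub>R\<^esub>) \<odot>\<^bsub>B\<^esub> f x"
    by (rule mod_homD(3)[OF assms(3)]) (use assms(4) in auto)
  then show ?thesis using assms(4) mod_homD(1)[OF assms(3)]
    by (simp add: A.minus_as_smult B.minus_as_smult)
qed

lemma mod_hom_diff:
  assumes "left_module R A" "left_module R B" "f \<in> mod_hom R A B" "x \<in> carrier A" "y \<in> carrier A"
  shows "f (x \<ominus>\<^bsub>A\<^esub> y) = f x \<ominus>\<^bsub>B\<^esub> f y"
proof -
  interpret A: left_module R A by fact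
  show ?thesis using assms mod_homD[OF assms(3)] mod_hom_minus[OF assms(1-3)]
    by (simp add: a_minus_def)
qed

lemma mod_hom_comp:
  "f \<in> mod_hom R A B \<Longrightarrow> g \<in> mod_hom R B C \<Longrightarrow> (\<lambda>x. g (f x)) \<in> mod_hom R A C"
  by (auto simp: mod_hom_def Pi_def)

lemma mod_hom_id: "(\<lambda>x. x) \<in> mod_hom R A A"
  by (auto simp: mod_hom_def)

lemma mod_hom_const_zero:
  assumes "left_module R B"
  shows "(\<lambda>x. \<zero>\<^bsub>B\<^esub>) \<in> mod_hom R A B"
proof -
  interpret B: left_module R B by fact
  show ?thesis by (rule mod_homI) auto
qed

lemma mod_hom_cong:
  assumes "left_module R A" "f \<in> mod_hom R A B" "\<And>x. x \<in> carrier A \<Longrightarrow> g x = f x"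
  shows "g \<in> mod_hom R A B"
proof -
  interpret A: left_module R A by fact
  show ?thesis by (rule mod_homI) (use assms(3) mod_homD[OF assms(2)] in auto)
qed

lemma mod_hom_sub: "f \<in> mod_hom R A B \<Longrightarrow> S \<subseteq> carrier A \<Longrightarrow> f \<in> mod_hom R (A\<lparr>carrier := S\<rparr>) B"
  by (auto simp: mod_hom_def subset_iff Pi_iff)

lemma mod_hom_into_sub:
  "f \<in> mod_hom R A B \<Longrightarrow> f ` carrier A \<subseteq> S \<Longrightarrow> f \<in> mod_hom R A (B\<lparr>carrier := S\<rparr>)"
  by (auto simp: mod_hom_def)

lemma mod_hom_from_sub:
  "f \<in> mod_hom R A (B\<lparr>carrier := S\<rparr>) \<Longrightarrow> S \<subseteq> carrier B \<Longrightarrow> f \<in> mod_hom R A B"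
  by (auto simp: mod_hom_def)

lemma mod_hom_subtract:
  assumes "left_module R A" "left_module R B" "f \<in> mod_hom R A B" "g \<in> mod_hom R A B"
  shows "(\<lambda>x. f x \<ominus>\<^bsub>B\<^esub> g x) \<in> mod_hom R A B"
proof -
  interpret A: left_module R A by fact
  interpret B: left_module R B by fact
  note [simp] = mod_homD[OF assms(3)] mod_homD[OF assms(4)]
  show ?thesis
    by (rule mod_homI)
      (auto simp: a_minus_def B.smult_r_distr B.smult_r_minus B.M.minus_add B.M.a_ac)
qed

lemma submodule_image:
  assumes "left_module R A" "left_module R B" "f \<in> mod_hom R A B" "submodule S R A"
  shows "submodule (f ` S) R B"
proof -
  interpret A: left_module R A by fact
  interpret B: left_module R B by fact
  note S = submoduleD[OF assms(4)] and f = mod_homD[OF assms(3)]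
  show ?thesis
  proof (rule B.submoduleI, goal_cases)
    case 1 then show ?case using S f by auto
  next
    case 2 then show ?case using S mod_hom_zero[OF assms(1-3)] by (metis imageI)
  next
    case (3 x y)
    then obtain u v where "u \<in> S" "v \<in> S" "x = f u" "y = f v" by auto
    then show ?case using S f by (intro image_eqI[of _ _ "u \<oplus>\<^bsub>A\<^esub> v"]) auto
  next
    case (4 a x)
    then obtain u where "u \<in> S" "x = f u" by auto
    then show ?case using S f 4 by (intro image_eqI[of _ _ "a \<odot>\<^bsub>A\<^esub> u"]) auto
  qed
qed

lemma submodule_preimage:
  assumes "left_module R A" "left_module R B" "f \<in> mod_hom R A B" "submodule S R B"
  shows "submodule {x \<in> carrier A. f x \<in> S} R A"
proof -
  interpret A: left_module R A by fact
  interpret B: left_module R B by fact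
  show ?thesis
    by (rule A.submoduleI)
      (auto simp: mod_homD[OF assms(3)] submoduleD[OF assms(4)] mod_hom_zero[OF assms(1-3)])
qed

lemma submodule_kernel:
  assumes "left_module R A" "left_module R B" "f \<in> mod_hom R A B"
  shows "submodule {x \<in> carrier A. f x = \<zero>\<^bsub>B\<^esub>} R A"
  using submodule_preimage[OF assms left_module.submodule_zero[OF assms(2)]] by simp

subsection \<open>Direct powers\<close>

text \<open>One construction serves two purposes: free modules on arbitrary sets, and finite powers
  of \<open>M\<close>, which later stand for R^m (x) M. The value zero off \<open>X\<close> makes
  equality of elements plain equality of functions.\<close>

definition direct_power :: "'x set \<Rightarrow> ('r, 'm) module \<Rightarrow> ('r, 'x \<Rightarrow> 'm) module" where
  "direct_power X M =
    \<lparr>carrier = {w. (\<forall>a. w a \<in> carrier M) \<and> (\<forall>a. a \<notin> X \<longrightarrow> w a = \<zero>\<^bsub>M\<^esub>) \<and> finite {a. w a \<noteq> \<zero>\<^bsub>M\<^esub>}},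
     mult = undefined, one = undefined, zero = (\<lambda>a. \<zero>\<^bsub>M\<^esub>),
     add = (\<lambda>v w a. v a \<oplus>\<^bsub>M\<^esub> w a), smult = (\<lambda>r w a. r \<odot>\<^bsub>M\<^esub> w a)\<rparr>"

lemma direct_power_simps [simp]:
  "zero (direct_power X M) = (\<lambda>a. \<zero>\<^bsub>M\<^esub>)"
  "add (direct_power X M) v w = (\<lambda>a. v a \<oplus>\<^bsub>M\<^esub> w a)"
  "smult (direct_power X M) r w = (\<lambda>a. r \<odot>\<^bsub>M\<^esub> w a)"
  by (simp_all add: direct_power_def)

lemma direct_power_carrierD:
  assumes "w \<in> carrier (direct_power X M)"
  shows "w a \<in> carrier M" "a \<notin> X \<Longrightarrow> w a = \<zero>\<^bsub>M\<^esub>" "finite {a. w a \<noteq> \<zero>\<^bsub>M\<^esub>}"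
  using assms by (auto simp: direct_power_def)

lemma direct_power_carrierI:
  assumes "finite X" "\<And>a. a \<in> X \<Longrightarrow> w a \<in> carrier M" "\<And>a. a \<notin> X \<Longrightarrow> w a = \<zero>\<^bsub>M\<^esub>" "left_module R M"
  shows "w \<in> carrier (direct_power X M)"
proof -
  interpret left_module R M by fact
  have "{a. w a \<noteq> \<zero>\<^bsub>M\<^esub>} \<subseteq> X" using assms by auto
  then have "finite {a. w a \<noteq> \<zero>\<^bsub>M\<^esub>}" using assms finite_subset by blast
  then show ?thesis using assms by (auto simp: direct_power_def) (metis M.zero_closed)
qed

lemma left_module_direct_power:
  assumes "left_module R M"
  shows "left_module R (direct_power X M)"
proof -
  interpret left_module R M by fact
  have fin: "finite {a. f (v a) (w a) \<noteq> \<zero>\<^bsub>M\<^esub>}"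
    if "finite {a. v a \<noteq> \<zero>\<^bsub>M\<^esub>}" "finite {a. w a \<noteq> \<zero>\<^bsub>M\<^esub>}" "f \<zero>\<^bsub>M\<^esub> \<zero>\<^bsub>M\<^esub> = \<zero>\<^bsub>M\<^esub>"
    for v w f
    using that(3) by (intro finite_subset[OF _ finite_UnI[OF that(1,2)]]) auto
  have "abelian_group (direct_power X M)"
  proof (rule abelian_groupI)
    fix w assume w: "w \<in> carrier (direct_power X M)"
    have "(\<lambda>a. \<ominus>\<^bsub>M\<^esub> w a) \<in> carrier (direct_power X M)"
      using w fin[of w w "\<lambda>x y. \<ominus>\<^bsub>M\<^esub> x"] by (auto simp: direct_power_def)
    then show "\<exists>y\<in>carrier (direct_power X M). y \<oplus>\<^bsub>direct_power X M\<^esub> w = \<zero>\<^bsub>direct_power X M\<^esub>"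
      using w by (intro bexI[of _ "\<lambda>a. \<ominus>\<^bsub>M\<^esub> w a"]) (auto simp: direct_power_def M.l_neg)
  next
    fix v w assume "v \<in> carrier (direct_power X M)" "w \<in> carrier (direct_power X M)"
    then show "v \<oplus>\<^bsub>direct_power X M\<^esub> w \<in> carrier (direct_power X M)"
      using fin[of v w "\<lambda>x y. x \<oplus>\<^bsub>M\<^esub> y"] by (auto simp: direct_power_def)
  qed (auto simp: direct_power_def M.a_ac)
  moreover have "r \<odot>\<^bsub>direct_power X M\<^esub> w \<in> carrier (direct_power X M)"
    if "r \<in> carrier R" "w \<in> carrier (direct_power X M)" for r w
    using that fin[of w w "\<lambda>x y. r \<odot>\<^bsub>M\<^esub> x"] by (auto simp: direct_power_def)
  ultimately show ?thesis
    unfolding left_module_def left_module_axioms_def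
    using R.ring_axioms
    by (simp add: direct_power_def smult_l_distr smult_r_distr smult_assoc)
qed

lemma direct_power_component: "(\<lambda>w. w a) \<in> mod_hom R (direct_power X M) M"
  by (auto simp: mod_hom_def direct_power_def)

lemma direct_power_map:
  assumes "left_module R A" "left_module R B" "f \<in> mod_hom R A B"
  shows "(\<lambda>w a. f (w a)) \<in> mod_hom R (direct_power X A) (direct_power X B)"
proof (rule mod_homI)
  fix w assume w: "w \<in> carrier (direct_power X A)"
  have "finite {a. f (w a) \<noteq> \<zero>\<^bsub>B\<^esub>}"
    by (rule finite_subset[OF _ direct_power_carrierD(3)[OF w]]) (auto simp: mod_hom_zero[OF assms])
  then show "(\<lambda>a. f (w a)) \<in> carrier (direct_power X B)"
    using direct_power_carrierD[OF w] mod_homD[OF assms(3)] mod_hom_zero[OF assms]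
    by (auto simp: direct_power_def)
qed (auto simp: mod_homD[OF assms(3)] direct_power_def)

subsection \<open>Transport of structure\<close>

text \<open>Projectivity and injectivity are tested on modules with carrier in \<open>'u\<close>
  only. Modules of other types that are small enough are moved there along an injection
  \<open>c\<close>.\<close>

definition transport_module :: "('m \<Rightarrow> 'u) \<Rightarrow> ('r, 'm) module \<Rightarrow> ('r, 'u) module" where
  "transport_module c M = (let i = inv_into (carrier M) c in
    \<lparr>carrier = c ` carrier M, mult = undefined, one = undefined, zero = c \<zero>\<^bsub>M\<^esub>,
     add = (\<lambda>x y. c (i x \<oplus>\<^bsub>M\<^esub> i y)), smult = (\<lambda>a x. c (a \<odot>\<^bsub>M\<^esub> i x))\<rparr>)"

lemma carrier_transport [simp]: "carrier (transport_module c M) = c ` carrier M"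
  by (simp add: transport_module_def Let_def)

lemma transport_module:
  assumes "left_module R M" "inj_on c (carrier M)"
  shows "left_module R (transport_module c M)"
    and "c \<in> mod_hom R M (transport_module c M)"
    and "inv_into (carrier M) c \<in> mod_hom R (transport_module c M) M"
proof -
  interpret left_module R M by fact
  note [simp] = inv_into_f_f[OF assms(2)]
  show "c \<in> mod_hom R M (transport_module c M)"
    "inv_into (carrier M) c \<in> mod_hom R (transport_module c M) M"
    by (auto simp: mod_hom_def transport_module_def Let_def)
  have "abelian_group (transport_module c M)"
  proof (rule abelian_groupI)
    fix x assume "x \<in> carrier (transport_module c M)"
    then obtain y where "y \<in> carrier M" "x = c y" by auto
    then show "\<exists>z\<in>carrier (transport_module c M).
        z \<oplus>\<^bsub>transport_module c M\<^esub> x = \<zero>\<^bsub>transport_module c M\<^esub>"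
      by (intro bexI[of _ "c (\<ominus>\<^bsub>M\<^esub> y)"]) (auto simp: transport_module_def Let_def M.l_neg)
  qed (auto simp: transport_module_def Let_def M.a_ac)
  then show "left_module R (transport_module c M)"
    using R.ring_axioms
    by (auto simp: left_module_def left_module_axioms_def transport_module_def Let_def
        smult_l_distr smult_r_distr smult_assoc)
qed

lemma copy_exists:
  assumes "left_module R (M :: ('r, 'm) module)" "carrier M \<lesssim> (UNIV :: 'u set)"
  obtains M' :: "('r, 'u) module" and c d where "left_module R M'" "c \<in> mod_hom R M M'"
    "d \<in> mod_hom R M' M" "\<And>x. x \<in> carrier M \<Longrightarrow> d (c x) = x" "\<And>y. y \<in> carrier M' \<Longrightarrow> c (d y) = y"
    "carrier M' = c ` carrier M"
proof -
  obtain c :: "'m \<Rightarrow> 'u" where c: "inj_on c (carrier M)" using assms(2) by (auto simp: lepoll_def)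
  show ?thesis
    by (rule that[OF transport_module[OF assms(1) c]]) (auto simp: c f_inv_into_f)
qed

subsection \<open>Extension into injectives and lifting from projectives\<close>

text \<open>The defining property of \<open>I\<close> concerns modules in \<open>'u\<close>. A copy
  of \<open>B\<close> there, with the copy of \<open>S\<close> as source of the inclusion, reduces a
  module \<open>B\<close> of another type to it.\<close>

lemma injective_extend:
  fixes U :: "'u itself" and I :: "('r, 'i) module" and B :: "('r, 'b) module"
  assumes I: "injective_module U R I" and B: "left_module R B"
    and small: "carrier B \<lesssim> (UNIV :: 'u set)"
    and S: "submodule S R B" and f: "f \<in> mod_hom R (B\<lparr>carrier := S\<rparr>) I"
  obtains h where "h \<in> mod_hom R B I" "\<And>x. x \<in> S \<Longrightarrow> h x = f x"
proof -
  obtain B' :: "('r, 'u) module" and c d where B': "left_module R B'" and c: "c \<in> mod_hom R B B'"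
    and d: "d \<in> mod_hom R B' B" and dc: "\<And>x. x \<in> carrier B \<Longrightarrow> d (c x) = x"
    and cd: "\<And>y. y \<in> carrier B' \<Longrightarrow> c (d y) = y"
    using copy_exists[OF B small] by metis
  note SB = submoduleD[OF S]
  have S': "submodule (c ` S) R B'" by (rule submodule_image[OF B B' c S])
  define A where "A = B'\<lparr>carrier := c ` S\<rparr>"
  have A: "left_module R A" unfolding A_def by (rule left_module.left_module_sub[OF B' S'])
  have dA: "d \<in> mod_hom R A (B\<lparr>carrier := S\<rparr>)"
    unfolding A_def
    using SB(2) dc by (intro mod_hom_into_sub mod_hom_sub d submoduleD(1)[OF S']) auto
  have gA: "(\<lambda>x. x) \<in> mod_hom R A B'"
    unfolding A_def by (intro mod_hom_sub mod_hom_id submoduleD(1)[OF S'])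
  obtain h where h: "h \<in> mod_hom R B' I" "\<And>x. x \<in> carrier A \<Longrightarrow> h x = f (d x)"
    using I A B' gA mod_hom_comp[OF dA f] inj_on_id2
    unfolding injective_module_def by (metis (mono_tags, lifting))
  show ?thesis
  proof (rule that[OF mod_hom_comp[OF c h(1)]])
    fix x assume "x \<in> S"
    then show "h (c x) = f x" using h(2)[of "c x"] dc SB(2) by (simp add: A_def)
  qed
qed

text \<open>
  A linear relation that is single-valued at zero is the graph of a homomorphism on its domain.
\<close>

lemma injective_extend_relation:
  fixes U :: "'u itself" and I :: "('r, 'i) module" and B :: "('r, 'b) module"
  assumes I: "injective_module U R I" and B: "left_module R B"
    and small: "carrier B \<lesssim> (UNIV :: 'u set)"
    and G: "\<And>x y. (x, y) \<in> \<Gamma> \<Longrightarrow> x \<in> carrier B \<and> y \<in> carrier I"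
    and G0: "(\<zero>\<^bsub>B\<^esub>, \<zero>\<^bsub>I\<^esub>) \<in> \<Gamma>"
    and Gadd: "\<And>x y x' y'. (x, y) \<in> \<Gamma> \<Longrightarrow> (x', y') \<in> \<Gamma> \<Longrightarrow> (x \<oplus>\<^bsub>B\<^esub> x', y \<oplus>\<^bsub>I\<^esub> y') \<in> \<Gamma>"
    and Gsmult: "\<And>a x y. a \<in> carrier R \<Longrightarrow> (x, y) \<in> \<Gamma> \<Longrightarrow> (a \<odot>\<^bsub>B\<^esub> x, a \<odot>\<^bsub>I\<^esub> y) \<in> \<Gamma>"
    and Gfun: "\<And>y. (\<zero>\<^bsub>B\<^esub>, y) \<in> \<Gamma> \<Longrightarrow> y = \<zero>\<^bsub>I\<^esub>"
  obtains h where "h \<in> mod_hom R B I" "\<And>x y. (x, y) \<in> \<Gamma> \<Longrightarrow> h x = y"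
proof -
  have IM: "left_module R I" using I by (simp add: injective_module_def)
  interpret B: left_module R B by fact
  interpret I: left_module R I by fact
  have uniq: "y = y'" if "(x, y) \<in> \<Gamma>" "(x, y') \<in> \<Gamma>" for x y y'
  proof -
    have "(\<ominus>\<^bsub>B\<^esub> x, \<ominus>\<^bsub>I\<^esub> y') \<in> \<Gamma>"
      using Gsmult[of "\<ominus>\<^bsub>R\<^esub> \<one>\<^bsub>R\<^esub>" x y'] G[OF that(2)] that(2)
      by (simp add: B.minus_as_smult I.minus_as_smult)
    from Gadd[OF that(1) this] have "(\<zero>\<^bsub>B\<^esub>, y \<ominus>\<^bsub>I\<^esub> y') \<in> \<Gamma>"
      using G[OF that(1)] by (simp add: B.M.r_neg a_minus_def)
    then have "y \<ominus>\<^bsub>I\<^esub> y' = \<zero>\<^bsub>I\<^esub>" by (rule Gfun)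
    then show ?thesis using G[OF that(1)] G[OF that(2)] I.diff_eq_zeroD by simp
  qed
  define f where "f x = (THE y. (x, y) \<in> \<Gamma>)" for x
  have f: "f x = y" if "(x, y) \<in> \<Gamma>" for x y unfolding f_def using that uniq by blast
  have S: "submodule (Domain \<Gamma>) R B"
    by (rule B.submoduleI) (use G G0 Gadd Gsmult in blast)+
  have hom: "f \<in> mod_hom R (B\<lparr>carrier := Domain \<Gamma>\<rparr>) I"
    by (rule mod_homI) (use f Gadd Gsmult G in fastforce)+
  obtain h where h: "h \<in> mod_hom R B I" "\<And>x. x \<in> Domain \<Gamma> \<Longrightarrow> h x = f x"
    by (rule injective_extend[OF I B small S hom]) blast
  show ?thesis by (rule that[OF h(1)]) (metis h(2) f DomainI)
qed

text \<open>The pairs \<open>(g x, f x)\<close> form a linear relation, single-valued at zero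
  because \<open>f\<close> kills the kernel of \<open>g\<close>. This does the work of passing to
  the quotient by that kernel.\<close>

lemma injective_factor:
  fixes U :: "'u itself" and I :: "('r, 'i) module" and B :: "('r, 'b) module"
  assumes I: "injective_module U R I" and A: "left_module R A" and B: "left_module R B"
    and small: "carrier B \<lesssim> (UNIV :: 'u set)"
    and g: "g \<in> mod_hom R A B" and f: "f \<in> mod_hom R A I"
    and ker: "\<And>x. x \<in> carrier A \<Longrightarrow> g x = \<zero>\<^bsub>B\<^esub> \<Longrightarrow> f x = \<zero>\<^bsub>I\<^esub>"
  obtains h where "h \<in> mod_hom R B I" "\<And>x. x \<in> carrier A \<Longrightarrow> h (g x) = f x"
proof -
  have IM: "left_module R I" using I by (simp add: injective_module_def)
  interpret A: left_module R A by fact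
  note [simp] = mod_homD[OF g] mod_homD[OF f]
  let ?\<Gamma> = "(\<lambda>x. (g x, f x)) ` carrier A"
  obtain h where "h \<in> mod_hom R B I" "\<And>x y. (x, y) \<in> ?\<Gamma> \<Longrightarrow> h x = y"
  proof (rule injective_extend_relation[OF I B small, of ?\<Gamma>], goal_cases)
    case (2)
    show ?case
      using mod_hom_zero[OF A B g] mod_hom_zero[OF A IM f]
      by (intro image_eqI[of _ _ "\<zero>\<^bsub>A\<^esub>"]) auto
  next
    case (3 x y x' y')
    then obtain u u' where "u \<in> carrier A" "u' \<in> carrier A" "x = g u" "y = f u" "x' = g u'" "y' = f u'"
      by auto
    then show ?case by (intro image_eqI[of _ _ "u \<oplus>\<^bsub>A\<^esub> u'"]) auto
  next
    case (4 a x y)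
    then obtain u where "u \<in> carrier A" "x = g u" "y = f u" by auto
    then show ?case using 4 by (intro image_eqI[of _ _ "a \<odot>\<^bsub>A\<^esub> u"]) auto
  qed (use ker in \<open>auto\<close>)
  then show ?thesis using that by blast
qed

text \<open>The definition lifts along surjections inside \<open>'u\<close>. Replacing
  \<open>B\<close> by the image of \<open>g\<close> produces a surjection, and that image is no
  larger than \<open>A\<close>, so both modules have copies in the universe.\<close>

lemma projective_lift:
  fixes U :: "'u itself" and P :: "('r, 'p) module" and A :: "('r, 'a) module"
  assumes P: "projective_module U R P" and A: "left_module R A" and B: "left_module R B"
    and small: "carrier A \<lesssim> (UNIV :: 'u set)"
    and g: "g \<in> mod_hom R A B" and f: "f \<in> mod_hom R P B"
    and im: "f ` carrier P \<subseteq> g ` carrier A"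
  obtains h where "h \<in> mod_hom R P A" "\<And>x. x \<in> carrier P \<Longrightarrow> g (h x) = f x"
proof -
  interpret A: left_module R A by fact
  define C where "C = B\<lparr>carrier := g ` carrier A\<rparr>"
  have subC: "submodule (g ` carrier A) R B" by (rule submodule_image[OF A B g A.submodule_carrier])
  have C: "left_module R C" unfolding C_def by (rule left_module.left_module_sub[OF B subC])
  have smallC: "carrier C \<lesssim> (UNIV :: 'u set)"
    unfolding C_def using small image_lepoll lepoll_trans by fastforce
  obtain A' :: "('r, 'u) module" and c d where A': "left_module R A'" and c: "c \<in> mod_hom R A A'"
    and d: "d \<in> mod_hom R A' A" and dc: "\<And>x. x \<in> carrier A \<Longrightarrow> d (c x) = x"
    and cd: "\<And>y. y \<in> carrier A' \<Longrightarrow> c (d y) = y" and cA: "carrier A' = c ` carrier A"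
    using copy_exists[OF A small] by metis
  obtain C' :: "('r, 'u) module" and e k where C': "left_module R C'" and e: "e \<in> mod_hom R C C'"
    and k: "k \<in> mod_hom R C' C" and ke: "\<And>x. x \<in> carrier C \<Longrightarrow> k (e x) = x"
    and ek: "\<And>y. y \<in> carrier C' \<Longrightarrow> e (k y) = y" and eC: "carrier C' = e ` carrier C"
    using copy_exists[OF C smallC] by metis
  have gC: "g \<in> mod_hom R A C" and fC: "f \<in> mod_hom R P C"
    unfolding C_def using g f im by (auto intro: mod_hom_into_sub)
  have onto: "(\<lambda>x. e (g (d x))) ` carrier A' = carrier C'"
  proof -
    have "(\<lambda>x. e (g (d x))) ` carrier A' = e ` g ` carrier A"
      unfolding cA by (force simp: dc)
    then show ?thesis by (simp add: eC C_def)
  qed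
  obtain h where h: "h \<in> mod_hom R P A'" "\<And>x. x \<in> carrier P \<Longrightarrow> e (g (d (h x))) = e (f x)"
    using P[unfolded projective_module_def] A' C' onto mod_hom_comp[OF mod_hom_comp[OF d gC] e]
      mod_hom_comp[OF fC e] by (metis (mono_tags, lifting))
  show ?thesis
  proof (rule that[OF mod_hom_comp[OF h(1) d]])
    fix x assume x: "x \<in> carrier P"
    have "g (d (h x)) \<in> carrier C" "f x \<in> carrier C"
      using x mod_homD(1)[OF h(1)] mod_homD(1)[OF d] mod_homD(1)[OF gC] mod_homD(1)[OF fC] by auto
    then show "g (d (h x)) = f x" using h(2)[OF x] ke by metis
  qed
qed

subsection \<open>Cosets and the regular module\<close>

lemma submodule_abelian_subgroup:
  "left_module R M \<Longrightarrow> submodule S R M \<Longrightarrow> abelian_subgroup S M"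
  by (rule abelian_subgroupI3) (auto simp: left_module_def submodule_def intro: additive_subgroup.intro)

context abelian_subgroup
begin

lemma coset_eq_iff:
  assumes "x \<in> carrier G" "y \<in> carrier G"
  shows "H +> x = H +> y \<longleftrightarrow> x \<ominus> y \<in> H"
proof
  assume "H +> x = H +> y"
  then have "x \<in> H +> y" using a_rcos_self[OF assms(1)] by simp
  then obtain h where "h \<in> H" "x = h \<oplus> y" by (auto simp: a_r_coset_def')
  then show "x \<ominus> y \<in> H"
    using assms by (simp add: a_minus_def a_assoc r_neg)
next
  assume "x \<ominus> y \<in> H"
  then have "(x \<ominus> y) \<oplus> y \<in> H +> y" using assms a_subset by (intro a_rcosI) auto
  then have "x \<in> H +> y" using assms by (simp add: a_minus_def a_assoc l_neg)
  then show "H +> x = H +> y" using a_repr_independence[OF _ assms(2) a_subgroup] by simp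
qed

lemma coset_eq_self_iff: "x \<in> carrier G \<Longrightarrow> H +> x = H \<longleftrightarrow> x \<in> H"
  using a_coset_join1[OF _ _ a_subgroup] a_coset_join2[OF _ a_subgroup] by blast

end

text \<open>The union in \<open>quot_map\<close> runs over equal cosets: two representatives of a
  coset of \<open>S\<close> differ by an element of \<open>S\<close>, and their images by an element
  of \<open>T\<close>.\<close>

lemma quot_map_coset:
  fixes M :: "('r, 'm) module" and N :: "('s, 'n) module"
  assumes S: "abelian_subgroup S M" and T: "abelian_subgroup T N"
    and f: "\<And>x. x \<in> carrier M \<Longrightarrow> f x \<in> carrier N"
      "\<And>x y. x \<in> carrier M \<Longrightarrow> y \<in> carrier M \<Longrightarrow> f (x \<oplus>\<^bsub>M\<^esub> y) = f x \<oplus>\<^bsub>N\<^esub> f y"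
    and fS: "\<And>x. x \<in> S \<Longrightarrow> f x \<in> T"
    and x: "x \<in> carrier M"
  shows "quot_map N T f (S +>\<^bsub>M\<^esub> x) = T +>\<^bsub>N\<^esub> f x"
proof -
  interpret S: abelian_subgroup S M by fact
  interpret T: abelian_subgroup T N by fact
  have "T +>\<^bsub>N\<^esub> f y = T +>\<^bsub>N\<^esub> f x" if y: "y \<in> S +>\<^bsub>M\<^esub> x" for y
  proof -
    obtain s where s: "s \<in> S" "y = s \<oplus>\<^bsub>M\<^esub> x" using y by (auto simp: a_r_coset_def')
    have sM: "s \<in> carrier M" using s S.a_subset by auto
    have "f y = f s \<oplus>\<^bsub>N\<^esub> f x" using f(2)[OF sM x] s by simp
    then have "f y \<ominus>\<^bsub>N\<^esub> f x = f s" using f(1)[OF sM] f(1)[OF x] by (simp add: a_minus_def T.a_assoc T.r_neg)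
    then have "f y \<ominus>\<^bsub>N\<^esub> f x \<in> T" using fS[OF s(1)] by simp
    then show ?thesis using T.coset_eq_iff f(1) sM x s by simp
  qed
  moreover have "x \<in> S +>\<^bsub>M\<^esub> x" using S.a_rcos_self x by simp
  ultimately show ?thesis unfolding quot_map_def by blast
qed

lemma regular_module_simps [simp]:
  "carrier (regular_module R) = carrier R" "zero (regular_module R) = \<zero>\<^bsub>R\<^esub>"
  "add (regular_module R) = add R" "smult (regular_module R) = mult R"
  by (simp_all add: regular_module_def)

lemma (in ring) left_module_regular: "left_module R (regular_module R)"
proof -
  have "abelian_group (regular_module R)"
  proof (rule abelian_groupI)
    fix x assume "x \<in> carrier (regular_module R)"
    then show "\<exists>y\<in>carrier (regular_module R). y \<oplus>\<^bsub>regular_module R\<^esub> x = \<zero>\<^bsub>regular_module R\<^esub>"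
      by (intro bexI[of _ "\<ominus> x"]) (auto simp: l_neg)
  qed (auto simp: a_ac)
  then show ?thesis
    unfolding left_module_def left_module_axioms_def
    using ring_axioms by (simp add: l_distr r_distr m_assoc)
qed

lemma a_inv_regular [simp]: "a_inv (regular_module R) = a_inv R"
  by (simp add: fun_eq_iff a_inv_def m_inv_def)

context cring
begin

lemma submodule_regular_iff: "submodule I R (regular_module R) \<longleftrightarrow> ideal I R"
proof
  interpret reg: left_module R "regular_module R" by (rule left_module_regular)
  {
    assume I: "submodule I R (regular_module R)"
    note S = submoduleD[OF I, simplified]
    have "subgroup I (add_monoid R)"
      by (rule subgroup.intro) (use S in \<open>auto simp flip: a_inv_def\<close>)
    then show "ideal I R"
    proof (rule idealI[OF ring_axioms])
      fix a x assume "a \<in> I" "x \<in> carrier R"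
      then show "x \<otimes> a \<in> I" "a \<otimes> x \<in> I" using S(2)[of a] S(5)[of x a] m_comm[of a x] by auto
    qed
  }
  assume "ideal I R"
  then interpret ideal I R .
  show "submodule I R (regular_module R)"
    by (rule reg.submoduleI) (auto simp: I_l_closed)
qed

text \<open>The ideal generated by \<open>m\<close> and \<open>a\<close> is strictly above
  \<open>m\<close>, hence contains 1. This is the field K/m in terms of elements of
  \<open>K\<close>.\<close>

lemma maximalideal_inverse:
  assumes m: "maximalideal m R" and a: "a \<in> carrier R" "a \<notin> m"
  obtains b where "b \<in> carrier R" "\<one> \<ominus> b \<otimes> a \<in> m"
proof -
  interpret m: maximalideal m R by fact
  interpret reg: left_module R "regular_module R" by (rule left_module_regular)
  let ?S = "(\<lambda>b. b \<otimes> a) ` carrier R"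
  have S: "submodule ?S R (regular_module R)" using reg.submodule_cyclic[of a] a by simp
  have m': "submodule m R (regular_module R)" by (simp add: submodule_regular_iff m.ideal_axioms)
  have J: "ideal (m <+>\<^bsub>regular_module R\<^esub> ?S) R"
    using reg.submodule_add[OF m' S] by (simp add: submodule_regular_iff)
  have "m <+>\<^bsub>regular_module R\<^esub> ?S = m \<or> m <+>\<^bsub>regular_module R\<^esub> ?S = carrier R"
    using reg.submodule_add_upper[OF m' S] ideal.Icarr[OF J] by (intro m.I_maximal[OF J]) auto
  moreover have "a \<in> m <+>\<^bsub>regular_module R\<^esub> ?S"
  proof -
    have "a = \<one> \<otimes> a" using a by simp
    then have "a \<in> ?S" by blast
    then show ?thesis using reg.submodule_add_upper(2)[OF m' S] by blast
  qed
  ultimately have "\<one> \<in> m <+>\<^bsub>regular_module R\<^esub> ?S" using a by auto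
  then obtain t b where t: "t \<in> m" "b \<in> carrier R" "\<one> = t \<oplus> b \<otimes> a" by (auto simp: set_add_def')
  have "\<one> \<ominus> b \<otimes> a = t" unfolding t(3) using t(1,2) a m.Icarr by (simp add: a_minus_def a_assoc r_neg)
  then show ?thesis using that t by metis
qed

lemma maximalideal_exists:
  assumes A: "ideal A R" "\<one> \<notin> A"
  obtains m where "maximalideal m R" "A \<subseteq> m"
proof -
  let ?F = "{I. ideal I R \<and> A \<subseteq> I \<and> \<one> \<notin> I}"
  have "\<exists>M\<in>?F. \<forall>X\<in>?F. M \<subseteq> X \<longrightarrow> X = M"
  proof (rule subset_Zorn_nonempty)
    show "?F \<noteq> {}" using A by auto
    fix C assume C: "C \<noteq> {}" "subset.chain ?F C"
    interpret reg: left_module R "regular_module R" by (rule left_module_regular)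
    have sub: "submodule I R (regular_module R)" if "I \<in> C" for I
      using that C by (auto simp: submodule_regular_iff subset_chain_def)
    have join: "\<exists>I\<in>C. x \<in> I \<and> y \<in> I" if xy: "x \<in> \<Union>C" "y \<in> \<Union>C" for x y
    proof -
      obtain I J where "I \<in> C" "J \<in> C" "x \<in> I" "y \<in> J" using xy by blast
      moreover have "I \<subseteq> J \<or> J \<subseteq> I" using C(2) calculation(1,2) unfolding subset_chain_def by blast
      ultimately show ?thesis by blast
    qed
    have "submodule (\<Union>C) R (regular_module R)"
    proof (rule reg.submoduleI)
      fix x y assume "x \<in> \<Union>C" "y \<in> \<Union>C"
      then show "x \<oplus>\<^bsub>regular_module R\<^esub> y \<in> \<Union>C" using join submoduleD(4)[OF sub] by blast
    next
      show "\<zero>\<^bsub>regular_module R\<^esub> \<in> \<Union>C" using C(1) submoduleD(3)[OF sub] by blast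
    qed (use submoduleD(2,5)[OF sub] in blast)+
    then show "\<Union>C \<in> ?F"
      using C by (auto simp: subset_chain_def submodule_regular_iff)
  qed
  then obtain M where M: "M \<in> ?F" "\<And>X. X \<in> ?F \<Longrightarrow> M \<subseteq> X \<Longrightarrow> X = M" by auto
  have "maximalideal M R"
  proof (rule maximalidealI)
    show "ideal M R" using M by auto
    show "carrier R \<noteq> M" using M by auto
    fix J assume J: "ideal J R" "M \<subseteq> J" "J \<subseteq> carrier R"
    show "J = M \<or> J = carrier R"
    proof (cases "\<one> \<in> J")
      case True
      then show ?thesis using ideal.one_imp_carrier[OF J(1)] by simp
    next
      case False
      then show ?thesis using M J by auto
    qed
  qed
  then show ?thesis using that M by auto
qed

end

lemma artinian_minimal_ideal:
  assumes K: "artinian_ring K" and F: "A \<in> F" "\<And>I. I \<in> F \<Longrightarrow> ideal I K"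
  obtains I where "I \<in> F" "\<And>J. J \<in> F \<Longrightarrow> J \<subseteq> I \<Longrightarrow> J = I"
proof (rule ccontr)
  assume no: "\<not> thesis"
  then have "\<forall>I. \<exists>J. I \<in> F \<longrightarrow> J \<in> F \<and> J \<subset> I" using that by blast
  then obtain g where g: "\<And>I. I \<in> F \<Longrightarrow> g I \<in> F \<and> g I \<subset> I" by metis
  define X where "X n = (g ^^ n) A" for n
  have X: "X n \<in> F" for n by (induction n) (auto simp: X_def F g)
  then have lt: "X (Suc n) \<subset> X n" for n using g[of "X n"] by (simp add: X_def)
  have "\<exists>m. \<forall>n\<ge>m. X n = X m"
    using K X lt F(2) unfolding artinian_ring_def by (metis psubset_imp_subset)
  then obtain m where "X (Suc m) = X m" by (metis le_SucI order_refl)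
  then show False using lt[of m] by simp
qed

section \<open>Finite length and Matlis theory over the artinian base ring\<close>

subsection \<open>Modules of finite length\<close>

text \<open>The factor B/A is simple or zero, expressed by submodules of one fixed module. Admitting
  \<open>A = B\<close> makes the notion stable under images, intersections and sums, where a simple
  factor may collapse.\<close>

definition simple_step :: "('k, 'c) ring_scheme \<Rightarrow> ('k, 'm) module \<Rightarrow> 'm set \<Rightarrow> 'm set \<Rightarrow> bool" where
  "simple_step K M A B \<longleftrightarrow> submodule A K M \<and> submodule B K M \<and> A \<subseteq> B \<and>
    (\<forall>C. submodule C K M \<and> A \<subseteq> C \<and> C \<subseteq> B \<longrightarrow> C = A \<or> C = B)"

inductive fin_len :: "('k, 'c) ring_scheme \<Rightarrow> ('k, 'm) module \<Rightarrow> 'm set \<Rightarrow> 'm set \<Rightarrow> bool"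
  for K M where
  refl: "submodule A K M \<Longrightarrow> fin_len K M A A"
| step: "fin_len K M A B \<Longrightarrow> simple_step K M B C \<Longrightarrow> fin_len K M A C"

abbreviation finite_length :: "('k, 'c) ring_scheme \<Rightarrow> ('k, 'm) module \<Rightarrow> bool" where
  "finite_length K M \<equiv> fin_len K M {\<zero>\<^bsub>M\<^esub>} (carrier M)"

lemma fin_len_submodule: "fin_len K M A B \<Longrightarrow> submodule A K M \<and> submodule B K M"
  by (induction rule: fin_len.induct) (auto simp: simple_step_def)

lemma fin_len_trans: "fin_len K M B C \<Longrightarrow> fin_len K M A B \<Longrightarrow> fin_len K M A C"
  by (induction rule: fin_len.induct) (auto intro: fin_len.step)

lemma simple_step_fin_len: "simple_step K M A B \<Longrightarrow> fin_len K M A B"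
  by (meson fin_len.refl fin_len.step simple_step_def)

text \<open>An intermediate submodule of the image is the image of its preimage cut with
  \<open>B\<close>, and that preimage lies between \<open>A\<close> and \<open>B\<close>.\<close>

lemma simple_step_image:
  assumes "left_module K M" "left_module K N" "f \<in> mod_hom K M N" "simple_step K M A B"
  shows "simple_step K N (f ` A) (f ` B)"
proof -
  interpret M: left_module K M by fact
  have A: "submodule A K M" and B: "submodule B K M" and AB: "A \<subseteq> B"
    and s: "\<And>C. submodule C K M \<Longrightarrow> A \<subseteq> C \<Longrightarrow> C \<subseteq> B \<Longrightarrow> C = A \<or> C = B"
    using assms(4) by (auto simp: simple_step_def)
  have "C = f ` A \<or> C = f ` B" if C: "submodule C K N" "f ` A \<subseteq> C" "C \<subseteq> f ` B" for C
  proof -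
    let ?D = "{x \<in> carrier M. f x \<in> C} \<inter> B"
    have "submodule ?D K M"
      by (intro M.submodule_Int submodule_preimage[OF assms(1-3)] C B)
    then have "?D = A \<or> ?D = B" using AB C submoduleD(1)[OF A] by (intro s) auto
    moreover have "f ` ?D = C" using C(3) submoduleD(1)[OF B] by auto
    ultimately show ?thesis by (elim disjE) simp_all
  qed
  then show ?thesis
    using submodule_image[OF assms(1-3)] A B AB by (auto simp: simple_step_def)
qed

lemma fin_len_image:
  assumes "left_module K M" "left_module K N" "f \<in> mod_hom K M N"
  shows "fin_len K M A B \<Longrightarrow> fin_len K N (f ` A) (f ` B)"
  by (induction rule: fin_len.induct)
    (use assms in \<open>auto intro: fin_len.intros submodule_image simple_step_image\<close>)

lemma finite_length_image:
  assumes "left_module K M" "left_module K N" "f \<in> mod_hom K M N" "f ` carrier M = carrier N"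
    "finite_length K M"
  shows "finite_length K N"
  using fin_len_image[OF assms(1-3,5)] assms(4) mod_hom_zero[OF assms(1-3)] by simp

lemma modular_law:
  assumes "left_module K M" "submodule X K M" "submodule S K M" "submodule B K M" "X \<subseteq> S"
  shows "(B <+>\<^bsub>M\<^esub> X) \<inter> S = (B \<inter> S) <+>\<^bsub>M\<^esub> X"
proof
  interpret left_module K M by fact
  note X = submoduleD[OF assms(2)] and S = submoduleD[OF assms(3)] and B = submoduleD[OF assms(4)]
  show "(B <+>\<^bsub>M\<^esub> X) \<inter> S \<subseteq> (B \<inter> S) <+>\<^bsub>M\<^esub> X"
  proof
    fix z assume z: "z \<in> (B <+>\<^bsub>M\<^esub> X) \<inter> S"
    then obtain b x where *: "b \<in> B" "x \<in> X" "z = b \<oplus>\<^bsub>M\<^esub> x" by (auto simp: set_add_def')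
    have "z \<ominus>\<^bsub>M\<^esub> x \<in> S" using z * assms(5) S(7)[of z x] by auto
    moreover have "z \<ominus>\<^bsub>M\<^esub> x = b" using * B(2) X(2) by (simp add: a_minus_def M.a_assoc M.r_neg)
    ultimately show "z \<in> (B \<inter> S) <+>\<^bsub>M\<^esub> X" using * by (auto simp: set_add_def')
  qed
  show "(B \<inter> S) <+>\<^bsub>M\<^esub> X \<subseteq> (B <+>\<^bsub>M\<^esub> X) \<inter> S"
    using assms(5) S by (auto simp: set_add_def')
qed

text \<open>For an intermediate \<open>C\<close> the sum A + C is \<open>A\<close> or
  \<open>B\<close>, and the modular law recovers \<open>C\<close> as the intersection of A + C with
  \<open>S\<close>.\<close>

lemma simple_step_Int:
  assumes "left_module K M" "submodule S K M" "simple_step K M A B"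
  shows "simple_step K M (A \<inter> S) (B \<inter> S)"
proof -
  interpret M: left_module K M by fact
  have A: "submodule A K M" and B: "submodule B K M" and AB: "A \<subseteq> B"
    and s: "\<And>C. submodule C K M \<Longrightarrow> A \<subseteq> C \<Longrightarrow> C \<subseteq> B \<Longrightarrow> C = A \<or> C = B"
    using assms(3) by (auto simp: simple_step_def)
  have "C = A \<inter> S \<or> C = B \<inter> S" if C: "submodule C K M" "A \<inter> S \<subseteq> C" "C \<subseteq> B \<inter> S" for C
  proof -
    have "A <+>\<^bsub>M\<^esub> C = A \<or> A <+>\<^bsub>M\<^esub> C = B"
      using M.submodule_add_upper[OF A C(1)] AB C
      by (intro s M.submodule_add A C M.submodule_add_least B) auto
    moreover have "(A <+>\<^bsub>M\<^esub> C) \<inter> S = (A \<inter> S) <+>\<^bsub>M\<^esub> C"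
      using C by (intro modular_law[OF assms(1) C(1) assms(2) A]) auto
    moreover have "(A \<inter> S) <+>\<^bsub>M\<^esub> C = C"
      using M.submodule_add_least[OF C(1), of "A \<inter> S" C] C
        M.submodule_add_upper[OF M.submodule_Int[OF A assms(2)] C(1)] by auto
    ultimately show ?thesis by auto
  qed
  then show ?thesis
    using A B AB assms(2) M.submodule_Int by (auto simp: simple_step_def)
qed

lemma fin_len_Int:
  assumes "left_module K M" "submodule S K M"
  shows "fin_len K M A B \<Longrightarrow> fin_len K M (A \<inter> S) (B \<inter> S)"
  by (induction rule: fin_len.induct)
    (use assms in \<open>auto intro: fin_len.intros left_module.submodule_Int simple_step_Int\<close>)

lemma simple_step_sub:
  assumes "left_module K M" "submodule S K M" "B \<subseteq> S" "simple_step K M A B"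
  shows "simple_step K (M\<lparr>carrier := S\<rparr>) A B"
  using assms submodule_mono[OF assms(1)] submodule_trans[OF assms(1,2)]
  unfolding simple_step_def by (meson order_trans)

lemma fin_len_sub:
  assumes "left_module K M" "submodule S K M"
  shows "fin_len K M A B \<Longrightarrow> B \<subseteq> S \<Longrightarrow> fin_len K (M\<lparr>carrier := S\<rparr>) A B"
proof (induction rule: fin_len.induct)
  case (refl A)
  then show ?case using assms by (auto intro: fin_len.refl submodule_mono)
next
  case (step A B C)
  then have "B \<subseteq> S" by (auto simp: simple_step_def)
  then show ?case using step simple_step_sub[OF assms] by (auto intro: fin_len.step)
qed

lemma finite_length_sub:
  assumes "left_module K M" "submodule S K M" "finite_length K M"
  shows "finite_length K (M\<lparr>carrier := S\<rparr>)"
proof -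
  have "fin_len K M ({\<zero>\<^bsub>M\<^esub>} \<inter> S) (carrier M \<inter> S)" by (rule fin_len_Int[OF assms])
  moreover have "{\<zero>\<^bsub>M\<^esub>} \<inter> S = {\<zero>\<^bsub>M\<^esub>}" "carrier M \<inter> S = S"
    using submoduleD[OF assms(2)] by auto
  ultimately show ?thesis using fin_len_sub[OF assms(1,2)] by simp
qed

text \<open>A composition series of \<open>M\<close>, inserted in one coordinate at a time, refines
  the filtration of the power by the number of coordinates in use.\<close>

lemma finite_length_direct_power:
  assumes M: "left_module K M" and fl: "finite_length K M"
  shows "finite_length K (direct_power {..<n::nat} M)"
proof -
  interpret left_module K M by fact
  let ?P = "direct_power {..<n} M"
  interpret P: left_module K ?P by (rule left_module_direct_power[OF M])
  \<comment> \<open>Vectors that vanish beyond coordinate \<open>m\<close> and have their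
    \<open>m\<close>-th coordinate in \<open>B\<close>. As \<open>B\<close> runs from zero to
    \<open>M\<close>, these interpolate between the vectors supported on \<open>m\<close>
    coordinates and those supported on \<open>m + 1\<close>.\<close>
  define F where "F m B = {w \<in> carrier ?P. (\<forall>a>m. w a = \<zero>\<^bsub>M\<^esub>) \<and> w m \<in> B}" for m :: nat and B
  have sub: "submodule (F m B) K ?P" if "submodule B K M" for m B
    unfolding F_def
    by (rule P.submoduleI) (use that P.smult_closed P.M.a_closed P.M.zero_closed in \<open>auto dest: submoduleD\<close>)
  have step: "simple_step K ?P (F m A) (F m B)" if s: "simple_step K M A B" and m: "m < n" for m A B
  proof -
    have A: "submodule A K M" and B: "submodule B K M" and AB: "A \<subseteq> B"
      and s: "\<And>C. submodule C K M \<Longrightarrow> A \<subseteq> C \<Longrightarrow> C \<subseteq> B \<Longrightarrow> C = A \<or> C = B"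
      using s by (auto simp: simple_step_def)
    have "C = F m A \<or> C = F m B" if C: "submodule C K ?P" "F m A \<subseteq> C" "C \<subseteq> F m B" for C
    proof -
      let ?D = "(\<lambda>w. w m) ` C"
      have D: "submodule ?D K M"
        by (rule submodule_image[OF P.left_module_axioms M direct_power_component C(1)])
      have AC: "A \<subseteq> ?D"
      proof
        fix a assume a: "a \<in> A"
        let ?w = "\<lambda>i. if i = m then a else \<zero>\<^bsub>M\<^esub>"
        have "?w \<in> carrier ?P"
          using m a submoduleD(2)[OF A] by (intro direct_power_carrierI[OF _ _ _ M]) auto
        then have "?w \<in> F m A" using a by (auto simp: F_def)
        then show "a \<in> ?D" using C(2) by (auto intro!: image_eqI[of _ _ ?w])
      qed
      have "?D \<subseteq> B" using C(3) by (auto simp: F_def)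
      then have "?D = A \<or> ?D = B" using s[OF D AC] by blast
      \<comment> \<open>\<open>C\<close> contains \<open>F m A\<close>, in particular all vectors
        supported below coordinate \<open>m\<close>, so it is determined by the set of its
        \<open>m\<close>-th coordinates.\<close>
      moreover have "C = F m ?D"
      proof
        show "C \<subseteq> F m ?D" using C(3) by (auto simp: F_def)
        show "F m ?D \<subseteq> C"
        proof
          fix w assume w: "w \<in> F m ?D"
          then obtain v where v: "v \<in> C" "w m = v m" by (auto simp: F_def)
          have vP: "v \<in> carrier ?P" "\<And>a. a > m \<Longrightarrow> v a = \<zero>\<^bsub>M\<^esub>" using v C(3) by (auto simp: F_def)
          have wP: "w \<in> carrier ?P" "\<And>a. a > m \<Longrightarrow> w a = \<zero>\<^bsub>M\<^esub>" using w by (auto simp: F_def)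
          have comp: "(w \<ominus>\<^bsub>?P\<^esub> v) a = w a \<ominus>\<^bsub>M\<^esub> v a" for a
            by (rule mod_hom_diff[OF P.left_module_axioms M direct_power_component wP(1) vP(1)])
          have "w \<ominus>\<^bsub>?P\<^esub> v \<in> F m A"
            using wP vP v(2) submoduleD(3)[OF A] direct_power_carrierD(1)[OF vP(1)]
            by (auto simp: F_def comp M.r_neg a_minus_def[of M])
          then have "(w \<ominus>\<^bsub>?P\<^esub> v) \<oplus>\<^bsub>?P\<^esub> v \<in> C" using C(2) v(1) submoduleD(4)[OF C(1)] by blast
          moreover have "(w \<ominus>\<^bsub>?P\<^esub> v) \<oplus>\<^bsub>?P\<^esub> v = w"
            using wP(1) vP(1) by (simp add: a_minus_def P.M.a_assoc P.M.l_neg del: direct_power_simps)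
          ultimately show "w \<in> C" by simp
        qed
      qed
      ultimately show ?thesis by auto
    qed
    moreover have "F m A \<subseteq> F m B" using AB unfolding F_def by blast
    ultimately show ?thesis unfolding simple_step_def using sub[OF A] sub[OF B] by blast
  qed
  have lift: "fin_len K M A B \<Longrightarrow> m < n \<Longrightarrow> fin_len K ?P (F m A) (F m B)" for m A B
    by (induction rule: fin_len.induct) (auto intro: fin_len.intros sub step)
  have mem: "w a \<in> carrier M" if "w \<in> carrier ?P" for w a
    by (rule direct_power_carrierD(1)[OF that])
  have all: "fin_len K ?P {\<zero>\<^bsub>?P\<^esub>} {w \<in> carrier ?P. \<forall>a\<ge>m. w a = \<zero>\<^bsub>M\<^esub>}" if "m \<le> n" for m
    using that
  proof (induction m)
    case 0
    have "{w \<in> carrier ?P. \<forall>a\<ge>0. w a = \<zero>\<^bsub>M\<^esub>} = {\<zero>\<^bsub>?P\<^esub>}" using P.M.zero_closed by auto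
    then show ?case using fin_len.refl[OF P.submodule_zero] by simp
  next
    case (Suc m)
    have "fin_len K ?P (F m {\<zero>\<^bsub>M\<^esub>}) (F m (carrier M))" using Suc by (intro lift[OF fl]) auto
    moreover have "F m {\<zero>\<^bsub>M\<^esub>} = {w \<in> carrier ?P. \<forall>a\<ge>m. w a = \<zero>\<^bsub>M\<^esub>}"
      unfolding F_def by (auto simp: order.order_iff_strict)
    moreover have "F m (carrier M) = {w \<in> carrier ?P. \<forall>a\<ge>Suc m. w a = \<zero>\<^bsub>M\<^esub>}"
      unfolding F_def using mem by (auto simp: Suc_le_eq)
    ultimately show ?case using Suc fin_len_trans by auto
  qed
  have "w a = \<zero>\<^bsub>M\<^esub>" if "w \<in> carrier ?P" "a \<ge> n" for w a
    by (rule direct_power_carrierD(2)[OF that(1)]) (use that in auto)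
  then have "{w \<in> carrier ?P. \<forall>a\<ge>n. w a = \<zero>\<^bsub>M\<^esub>} = carrier ?P" by auto
  then show ?thesis using all[of n] by simp
qed

text \<open>Along a simple step from \<open>B\<close> to \<open>C\<close> the intersections of
  \<open>X n\<close> with \<open>B\<close> are stationary by induction and the sums B + X n take
  only the values \<open>B\<close> and \<open>C\<close>. The modular law recovers \<open>X n\<close>
  from the two.\<close>

lemma fin_len_dcc:
  assumes M: "left_module K M"
  shows "fin_len K M A B \<Longrightarrow> (\<And>n. submodule (X n) K M) \<Longrightarrow> (\<And>n. X (Suc n) \<subseteq> X n) \<Longrightarrow>
    (\<And>n. A \<subseteq> X n) \<Longrightarrow> (\<And>n. X n \<subseteq> B) \<Longrightarrow> \<exists>N. \<forall>n\<ge>N. X n = X (N :: nat)"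
proof (induction arbitrary: X rule: fin_len.induct)
  case (refl A)
  then show ?case by (metis subset_antisym)
next
  case (step A B C)
  interpret left_module K M by fact
  have B: "submodule B K M" and C: "submodule C K M" and BC: "B \<subseteq> C"
    and s: "\<And>D. submodule D K M \<Longrightarrow> B \<subseteq> D \<Longrightarrow> D \<subseteq> C \<Longrightarrow> D = B \<or> D = C"
    using step.hyps(2) by (auto simp: simple_step_def)
  have AB: "A \<subseteq> B" using step.hyps(1) by (induction rule: fin_len.induct) (auto simp: simple_step_def)
  have mono: "X n \<subseteq> X m" if "m \<le> n" for m n using step.prems(2) that by (rule lift_Suc_antimono_le)
  have "\<exists>N. \<forall>n\<ge>N. X n \<inter> B = X N \<inter> B"
    using step.prems AB by (intro step.IH submodule_Int B) blast+
  then obtain N where N: "\<And>n. n \<ge> N \<Longrightarrow> X n \<inter> B = X N \<inter> B" by auto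
  have or: "B <+>\<^bsub>M\<^esub> X n = B \<or> B <+>\<^bsub>M\<^esub> X n = C" for n
    using submodule_add_upper[OF B step.prems(1)] BC step.prems
    by (intro s submodule_add B step.prems submodule_add_least C)
  have "\<exists>L. \<forall>n\<ge>L. B <+>\<^bsub>M\<^esub> X n = B <+>\<^bsub>M\<^esub> X L"
  proof (cases "\<forall>n. B <+>\<^bsub>M\<^esub> X n = C")
    case False
    then obtain L where L: "B <+>\<^bsub>M\<^esub> X L = B" using or by blast
    have "B <+>\<^bsub>M\<^esub> X n = B" if "n \<ge> L" for n
      using mono[OF that] L submodule_add_upper[OF B step.prems(1), of n]
        submodule_add_upper(2)[OF B step.prems(1), of L]
      by (intro antisym submodule_add_least[OF B]) auto
    then show ?thesis using L by metis
  qed auto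
  then obtain L where L: "\<And>n. n \<ge> L \<Longrightarrow> B <+>\<^bsub>M\<^esub> X n = B <+>\<^bsub>M\<^esub> X L" by auto
  have "X n = X (max N L)" if "n \<ge> max N L" for n
  proof -
    let ?k = "max N L"
    have sub: "X n \<subseteq> X ?k" using mono that by blast
    have "X ?k = (B <+>\<^bsub>M\<^esub> X n) \<inter> X ?k"
    proof -
      have "B <+>\<^bsub>M\<^esub> X n = B <+>\<^bsub>M\<^esub> X ?k" using L[of n] L[of ?k] that by simp
      then show ?thesis using submodule_add_upper(2)[OF B step.prems(1)] by auto
    qed
    also have "\<dots> = (B \<inter> X ?k) <+>\<^bsub>M\<^esub> X n" by (rule modular_law[OF M step.prems(1,1) B sub])
    also have "\<dots> \<subseteq> X n"
      using N[of n] N[of ?k] that by (intro submodule_add_least step.prems(1)) auto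
    finally show ?thesis using sub by blast
  qed
  then show ?case by blast
qed

lemma simple_step_generator:
  assumes M: "left_module K M" and s: "simple_step K M A B" and x: "x \<in> B" "x \<notin> A"
  shows "B = A <+>\<^bsub>M\<^esub> (\<lambda>a. a \<odot>\<^bsub>M\<^esub> x) ` carrier K"
proof -
  interpret left_module K M by fact
  have A: "submodule A K M" and B: "submodule B K M" and AB: "A \<subseteq> B"
    and s: "\<And>D. submodule D K M \<Longrightarrow> A \<subseteq> D \<Longrightarrow> D \<subseteq> B \<Longrightarrow> D = A \<or> D = B"
    using s by (auto simp: simple_step_def)
  have xM: "x \<in> carrier M" using x submoduleD(2)[OF B] by simp
  note cyc = submodule_cyclic[OF xM]
  let ?C = "A <+>\<^bsub>M\<^esub> (\<lambda>a. a \<odot>\<^bsub>M\<^esub> x) ` carrier K"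
  have "x = \<one>\<^bsub>K\<^esub> \<odot>\<^bsub>M\<^esub> x" using xM by simp
  then have "x \<in> (\<lambda>a. a \<odot>\<^bsub>M\<^esub> x) ` carrier K" by blast
  then have "x \<in> ?C" using submodule_add_upper(2)[OF A cyc] by blast
  moreover have "?C = A \<or> ?C = B"
    using submodule_add_upper(1)[OF A cyc] AB x submoduleD(5)[OF B]
    by (intro s submodule_add A cyc submodule_add_least B) auto
  ultimately show ?thesis using x by auto
qed

lemma fin_len_generators:
  assumes M: "left_module K M"
  shows "fin_len K M A B \<Longrightarrow> \<exists>F. finite F \<and> F \<subseteq> B \<and>
    (\<forall>S. submodule S K M \<and> A \<subseteq> S \<and> F \<subseteq> S \<longrightarrow> B \<subseteq> S)"
proof (induction rule: fin_len.induct)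
  case (step A B C)
  interpret left_module K M by fact
  obtain F where F: "finite F" "F \<subseteq> B" "\<And>S. submodule S K M \<Longrightarrow> A \<subseteq> S \<Longrightarrow> F \<subseteq> S \<Longrightarrow> B \<subseteq> S"
    using step.IH by auto
  have BC: "B \<subseteq> C" using step.hyps by (auto simp: simple_step_def)
  show ?case
  proof (cases "C = B")
    case False
    then obtain x where x: "x \<in> C" "x \<notin> B" using BC by auto
    have "C \<subseteq> S" if "submodule S K M" "A \<subseteq> S" "insert x F \<subseteq> S" for S
      unfolding simple_step_generator[OF M step.hyps(2) x]
      using F(3)[of S] that submoduleD(5)[OF that(1)] by (intro submodule_add_least) auto
    then show ?thesis using F x BC by (intro exI[of _ "insert x F"]) auto
  next
    case True
    then show ?thesis using F by (intro exI[of _ F]) auto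
  qed
qed auto

lemma times_UNIV_lepoll:
  assumes "infinite (UNIV :: 'u set)" "A \<lesssim> (UNIV :: 'u set)" "B \<lesssim> (UNIV :: 'u set)"
  shows "A \<times> B \<lesssim> (UNIV :: 'u set)"
proof -
  have "(UNIV :: 'u set) \<times> (UNIV :: 'u set) \<approx> (UNIV :: 'u set)"
    using card_of_Times_same_infinite[OF assms(1)] by (simp add: eqpoll_iff_card_of_ordIso)
  moreover have "A \<times> B \<lesssim> (UNIV :: 'u set) \<times> (UNIV :: 'u set)" using assms by (intro times_lepoll_mono)
  ultimately show ?thesis using lepoll_trans2 by blast
qed

text \<open>A proper step adds one cyclic submodule, so the larger module is an image of the smaller
  one times \<open>K\<close>; an infinite universe absorbs the product.\<close>

lemma fin_len_lepoll:
  assumes M: "left_module K M" and inf: "infinite (UNIV :: 'u set)"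
    and K: "carrier K \<lesssim> (UNIV :: 'u set)"
  shows "fin_len K M A B \<Longrightarrow> A \<lesssim> (UNIV :: 'u set) \<Longrightarrow> B \<lesssim> (UNIV :: 'u set)"
proof (induction rule: fin_len.induct)
  case (step A B C)
  show ?case
  proof (cases "C = B")
    case False
    then obtain x where x: "x \<in> C" "x \<notin> B" using step.hyps(2) by (auto simp: simple_step_def)
    have "C = (\<lambda>(b, a). b \<oplus>\<^bsub>M\<^esub> a \<odot>\<^bsub>M\<^esub> x) ` (B \<times> carrier K)"
      unfolding simple_step_generator[OF M step.hyps(2) x] by (force simp: set_add_def')
    then have "C \<lesssim> B \<times> carrier K" by (metis image_lepoll)
    also have "B \<times> carrier K \<lesssim> (UNIV :: 'u set)" using step.IH step.prems K by (intro times_UNIV_lepoll inf)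
    finally show ?thesis .
  qed (use step in auto)
qed

lemma finite_length_lepoll:
  assumes "left_module K M" "infinite (UNIV :: 'u set)" "carrier K \<lesssim> (UNIV :: 'u set)"
    "finite_length K M"
  shows "carrier M \<lesssim> (UNIV :: 'u set)"
  by (rule fin_len_lepoll[OF assms]) (simp add: finite_lepoll_infinite assms(2))

subsection \<open>The minimal injective cogenerator of a commutative artinian ring\<close>

locale artinian_hull =
  fixes U :: "'u itself" and K :: "'k ring" (structure) and E :: "('k, 'e) module"
  assumes universe_infinite: "infinite (UNIV :: 'u set)"
    and K_small: "carrier K \<lesssim> (UNIV :: 'u set)"
    and K_artinian: "artinian_ring K"
    and hull: "injective_hull U K (residue_module K) E"
begin

sublocale K: cring K
  using K_artinian by (simp add: artinian_ring_def)

sublocale reg: left_module K "regular_module K"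
  by (rule K.left_module_regular)

lemma E_injective: "injective_module U K E"
  using hull by (simp add: injective_hull_def)

sublocale E: left_module K E
  using E_injective by (simp add: injective_module_def)

abbreviation "Jac \<equiv> jacobson_radical K"

lemma ideal_Jac: "ideal Jac K"
proof -
  have "submodule Jac K (regular_module K)"
  proof (rule reg.submoduleI)
    fix x y assume "x \<in> Jac" "y \<in> Jac"
    then show "x \<oplus>\<^bsub>regular_module K\<^esub> y \<in> Jac"
      using additive_subgroup.a_closed[OF ideal.axioms(1)] maximalideal.axioms(1)
      by (fastforce simp: jacobson_radical_def)
  next
    fix a x assume "a \<in> carrier K" "x \<in> Jac"
    then show "a \<odot>\<^bsub>regular_module K\<^esub> x \<in> Jac"
      using ideal.I_l_closed[OF maximalideal.axioms(1)]
      by (fastforce simp: jacobson_radical_def)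
  next
    show "\<zero>\<^bsub>regular_module K\<^esub> \<in> Jac"
      using additive_subgroup.zero_closed[OF ideal.axioms(1)] maximalideal.axioms(1)
      by (fastforce simp: jacobson_radical_def)
  qed (auto simp: jacobson_radical_def)
  then show ?thesis by (simp add: K.submodule_regular_iff)
qed

lemma prime_max:
  assumes "maximalideal m K" "a \<in> carrier K" "b \<in> carrier K" "a \<otimes> b \<in> m"
  shows "a \<in> m \<or> b \<in> m"
  using primeideal.I_prime[OF K.maximalideal_prime[OF assms(1)] assms(2-4)] .

text \<open>Repackages the hull as a single map on \<open>K\<close> with kernel \<open>Jac\<close>
  and essential image, so that the arguments below compute with elements of \<open>K\<close> instead
  of cosets.\<close>

lemma residue_embedding:
  obtains j where "j \<in> mod_hom K (regular_module K) E"
    "\<And>x. x \<in> carrier K \<Longrightarrow> j x = \<zero>\<^bsub>E\<^esub> \<longleftrightarrow> x \<in> Jac"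
    "\<And>S. submodule S K E \<Longrightarrow> S \<noteq> {\<zero>\<^bsub>E\<^esub>} \<Longrightarrow> \<exists>x\<in>carrier K. j x \<in> S \<and> j x \<noteq> \<zero>\<^bsub>E\<^esub>"
proof -
  have sub: "submodule Jac K (regular_module K)" by (simp add: K.submodule_regular_iff ideal_Jac)
  note JJ = submodule_abelian_subgroup[OF reg.left_module_axioms sub]
  interpret J: abelian_subgroup Jac "regular_module K" by (rule JJ)
  obtain \<iota> where \<iota>: "\<iota> \<in> mod_hom K (residue_module K) E" "inj_on \<iota> (carrier (residue_module K))"
    and ess: "\<And>S. submodule S K E \<Longrightarrow> S \<inter> \<iota> ` carrier (residue_module K) = {\<zero>\<^bsub>E\<^esub>} \<Longrightarrow> S = {\<zero>\<^bsub>E\<^esub>}"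
    using hull by (auto simp: injective_hull_def)
  let ?q = "\<lambda>x. Jac +>\<^bsub>regular_module K\<^esub> x"
  have car: "carrier (residue_module K) = ?q ` carrier K"
    by (auto simp: residue_module_def quot_module_def A_RCOSETS_def' a_r_coset_def')
  define j where "j x = \<iota> (?q x)" for x
  have q: "?q \<in> mod_hom K (regular_module K) (residue_module K)"
  proof (rule mod_homI, goal_cases)
    case (1 x)
    then show ?case by (simp add: car)
  next
    case (2 x y)
    then show ?case using J.a_rcos_sum[of x y] by (simp add: residue_module_def quot_module_def)
  next
    case (3 a x)
    then have "quot_map (regular_module K) Jac (\<lambda>x. a \<odot>\<^bsub>regular_module K\<^esub> x) (?q x) = ?q (a \<otimes> x)"
      by (subst quot_map_coset[OF JJ JJ])
        (use K.r_distr ideal.I_l_closed[OF ideal_Jac] in auto)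
    then show ?case by (simp add: residue_module_def quot_module_def)
  qed
  have j: "j \<in> mod_hom K (regular_module K) E"
    unfolding j_def by (rule mod_hom_comp[OF q \<iota>(1)])
  have j0: "j \<zero> = \<zero>\<^bsub>E\<^esub>"
    using mod_hom_zero[OF reg.left_module_axioms E.left_module_axioms j] by simp
  show ?thesis
  proof (rule that[OF j])
    fix x assume x: "x \<in> carrier K"
    have "?q x \<in> carrier (residue_module K)" "?q \<zero> \<in> carrier (residue_module K)"
      using x K.zero_closed unfolding car by blast+
    then have "j x = \<zero>\<^bsub>E\<^esub> \<longleftrightarrow> ?q x = ?q \<zero>"
      using inj_on_eq_iff[OF \<iota>(2)] j0 unfolding j_def by metis
    also have "\<dots> \<longleftrightarrow> x \<in> Jac"
      using J.coset_eq_iff[of x \<zero>] x by (simp add: a_minus_def)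
    finally show "j x = \<zero>\<^bsub>E\<^esub> \<longleftrightarrow> x \<in> Jac" .
  next
    fix S assume S: "submodule S K E" "S \<noteq> {\<zero>\<^bsub>E\<^esub>}"
    have "\<zero>\<^bsub>E\<^esub> \<in> S \<inter> \<iota> ` carrier (residue_module K)"
      using submoduleD(3)[OF S(1)] j0 K.zero_closed unfolding car j_def by (metis IntI imageI)
    then obtain z where "z \<in> S \<inter> \<iota> ` carrier (residue_module K)" "z \<noteq> \<zero>\<^bsub>E\<^esub>"
      using ess[OF S(1)] S(2) by blast
    then show "\<exists>x\<in>carrier K. j x \<in> S \<and> j x \<noteq> \<zero>\<^bsub>E\<^esub>" by (auto simp: car j_def)
  qed
qed

text \<open>K/Jac is reduced: for \<open>y\<close> in \<open>m\<close> the square of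
  \<open>y\<close> would lie in \<open>Jac\<close>, and then \<open>y\<close> in every maximal ideal
  by primality.\<close>

lemma residue_annihilated_not_in:
  assumes m: "maximalideal m K" and y: "y \<in> carrier K" "y \<notin> Jac" "\<And>a. a \<in> m \<Longrightarrow> a \<otimes> y \<in> Jac"
  shows "y \<notin> m"
proof
  assume "y \<in> m"
  then have "y \<otimes> y \<in> Jac" by (rule y(3))
  then have "y \<in> m'" if "maximalideal m' K" for m'
    using prime_max[OF that y(1,1)] that by (auto simp: jacobson_radical_def)
  then show False using y by (auto simp: jacobson_radical_def)
qed

text \<open>An ideal \<open>A\<close> minimal among those not contained in \<open>m\<close> lies in
  every other maximal ideal. An element \<open>x\<close> of \<open>A\<close> outside
  \<open>m\<close> is therefore nonzero modulo \<open>Jac\<close>, while m x lies in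
  \<open>Jac\<close>. Minimality takes the place of the Chinese remainder theorem.\<close>

lemma socle_exists:
  assumes m: "maximalideal m K"
  obtains e where "e \<in> carrier E" "e \<noteq> \<zero>\<^bsub>E\<^esub>" "\<And>a. a \<in> m \<Longrightarrow> a \<odot>\<^bsub>E\<^esub> e = \<zero>\<^bsub>E\<^esub>"
proof -
  interpret m: maximalideal m K by fact
  obtain j where j: "j \<in> mod_hom K (regular_module K) E"
    and j0: "\<And>x. x \<in> carrier K \<Longrightarrow> j x = \<zero>\<^bsub>E\<^esub> \<longleftrightarrow> x \<in> Jac" using residue_embedding by metis
  have ne: "\<not> carrier K \<subseteq> m" using m.I_notcarr m.Icarr by blast
  obtain A where A: "ideal A K" "\<not> A \<subseteq> m" "\<And>B. ideal B K \<Longrightarrow> \<not> B \<subseteq> m \<Longrightarrow> B \<subseteq> A \<Longrightarrow> B = A"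
    using artinian_minimal_ideal[OF K_artinian, of "carrier K" "{I. ideal I K \<and> \<not> I \<subseteq> m}"]
      K.oneideal ne by (smt (verit, best) mem_Collect_eq)
  obtain x where x: "x \<in> A" "x \<notin> m" using A by auto
  have xK: "x \<in> carrier K" using ideal.Icarr[OF A(1) x(1)] .
  have An: "A \<subseteq> n" if n: "maximalideal n K" "n \<noteq> m" for n
  proof -
    interpret n: maximalideal n K by fact
    have "\<not> n \<subseteq> m"
      using n.I_maximal[OF m.ideal_axioms] n m.I_notcarr m.Icarr by blast
    then obtain y where y: "y \<in> n" "y \<notin> m" by auto
    have "x \<otimes> y \<in> A \<inter> n" using x y xK n.Icarr n.I_l_closed ideal.I_r_closed[OF A(1)] by auto
    moreover have "x \<otimes> y \<notin> m" using prime_max[OF m] x y xK n.Icarr by blast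
    moreover have "ideal (A \<inter> n) K" by (rule K.i_intersect[OF A(1) n.ideal_axioms])
    ultimately have "A \<inter> n = A" using A(3)[of "A \<inter> n"] by blast
    then show ?thesis by blast
  qed
  have mx: "a \<otimes> x \<in> Jac" if a: "a \<in> m" for a
  proof -
    have "a \<otimes> x \<in> n" if n: "maximalideal n K" for n
    proof (cases "n = m")
      case True
      then show ?thesis using a xK m.I_r_closed by simp
    next
      case False
      then show ?thesis
        using An[OF n] x(1) ideal.I_l_closed[OF maximalideal.axioms(1)[OF n]] m.Icarr[OF a] by blast
    qed
    then show ?thesis using xK m.Icarr[OF a] by (simp add: jacobson_radical_def)
  qed
  show ?thesis
  proof (rule that[of "j x"])
    show "j x \<in> carrier E" using mod_homD(1)[OF j] xK by simp
    show "j x \<noteq> \<zero>\<^bsub>E\<^esub>" using j0[OF xK] x m by (auto simp: jacobson_radical_def)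
    fix a assume a: "a \<in> m"
    have "j (a \<otimes> x) = a \<odot>\<^bsub>E\<^esub> j x" using mod_homD(3)[OF j, of a x] xK m.Icarr[OF a] by simp
    then show "a \<odot>\<^bsub>E\<^esub> j x = \<zero>\<^bsub>E\<^esub>" using j0[of "a \<otimes> x"] mx[OF a] xK m.Icarr[OF a] by simp
  qed
qed

text \<open>The part of \<open>E\<close> killed by \<open>m\<close> is a line over K/m. With e =
  j(y), e' = j(y') and \<open>c\<close> inverse to \<open>y\<close> modulo \<open>m\<close>, the
  element c y fixes e', and regrouping the product gives e' = (c y') e.\<close>

lemma socle_unique:
  assumes m: "maximalideal m K"
    and e: "e \<in> carrier E" "e \<noteq> \<zero>\<^bsub>E\<^esub>" "\<And>a. a \<in> m \<Longrightarrow> a \<odot>\<^bsub>E\<^esub> e = \<zero>\<^bsub>E\<^esub>"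
    and e': "e' \<in> carrier E" "\<And>a. a \<in> m \<Longrightarrow> a \<odot>\<^bsub>E\<^esub> e' = \<zero>\<^bsub>E\<^esub>"
  obtains a where "a \<in> carrier K" "e' = a \<odot>\<^bsub>E\<^esub> e"
proof -
  interpret m: maximalideal m K by fact
  obtain j where j: "j \<in> mod_hom K (regular_module K) E"
    and j0: "\<And>x. x \<in> carrier K \<Longrightarrow> j x = \<zero>\<^bsub>E\<^esub> \<longleftrightarrow> x \<in> Jac"
    and ess: "\<And>S. submodule S K E \<Longrightarrow> S \<noteq> {\<zero>\<^bsub>E\<^esub>} \<Longrightarrow> \<exists>x\<in>carrier K. j x \<in> S \<and> j x \<noteq> \<zero>\<^bsub>E\<^esub>"
    using residue_embedding by metis
  have jm: "j (a \<otimes> x) = a \<odot>\<^bsub>E\<^esub> j x" if "a \<in> carrier K" "x \<in> carrier K" for a x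
    using mod_homD(3)[OF j, of a x] that by simp
  \<comment> \<open>By essentiality some multiple a v is a nonzero value \<open>j x\<close>. As
    \<open>m\<close> kills \<open>v\<close>, the scalar \<open>a\<close> is outside
    \<open>m\<close>, and an inverse of \<open>a\<close> modulo \<open>m\<close> turns
    \<open>v\<close> itself into a value of \<open>j\<close>.\<close>
  have rep: "\<exists>y\<in>carrier K. v = j y \<and> (\<forall>a\<in>m. a \<otimes> y \<in> Jac)"
    if v: "v \<in> carrier E" "v \<noteq> \<zero>\<^bsub>E\<^esub>" "\<And>a. a \<in> m \<Longrightarrow> a \<odot>\<^bsub>E\<^esub> v = \<zero>\<^bsub>E\<^esub>" for v
  proof -
    let ?S = "(\<lambda>a. a \<odot>\<^bsub>E\<^esub> v) ` carrier K"
    have "v = \<one> \<odot>\<^bsub>E\<^esub> v" using v by simp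
    then have "v \<in> ?S" by blast
    then have "?S \<noteq> {\<zero>\<^bsub>E\<^esub>}" using v(2) by auto
    then obtain x where x: "x \<in> carrier K" "j x \<in> ?S" "j x \<noteq> \<zero>\<^bsub>E\<^esub>"
      using ess[OF E.submodule_cyclic[OF v(1)]] by auto
    then obtain a where a: "a \<in> carrier K" "j x = a \<odot>\<^bsub>E\<^esub> v" by auto
    have "a \<notin> m" using v(3) a x by auto
    then obtain b where b: "b \<in> carrier K" "\<one> \<ominus> b \<otimes> a \<in> m"
      using K.maximalideal_inverse[OF m a(1)] by metis
    have "(\<one> \<ominus> b \<otimes> a) \<odot>\<^bsub>E\<^esub> v = \<zero>\<^bsub>E\<^esub>" by (rule v(3)[OF b(2)])
    then have "v = (b \<otimes> a) \<odot>\<^bsub>E\<^esub> v"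
      using E.smult_l_diff[of \<one> "b \<otimes> a" v] E.diff_eq_zeroD[of v "(b \<otimes> a) \<odot>\<^bsub>E\<^esub> v"] a b v(1) by simp
    then have vj: "v = j (b \<otimes> x)" using jm[OF b(1) x(1)] a b(1) v(1) E.smult_assoc by simp
    have "c \<otimes> (b \<otimes> x) \<in> Jac" if c: "c \<in> m" for c
      using jm[of c "b \<otimes> x"] vj v(3)[OF c] m.Icarr[OF c] b x j0[of "c \<otimes> (b \<otimes> x)"] by simp
    then show ?thesis using vj b x by (intro bexI[of _ "b \<otimes> x"]) auto
  qed
  obtain y where y: "y \<in> carrier K" "e = j y" "\<And>a. a \<in> m \<Longrightarrow> a \<otimes> y \<in> Jac" using rep[OF e] by auto
  have "y \<notin> m" using residue_annihilated_not_in[OF m y(1) _ y(3)] j0[OF y(1)] e y(2) by auto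
  then obtain c where c: "c \<in> carrier K" "\<one> \<ominus> c \<otimes> y \<in> m"
    using K.maximalideal_inverse[OF m y(1)] by metis
  show ?thesis
  proof (cases "e' = \<zero>\<^bsub>E\<^esub>")
    case True
    then show ?thesis using that[of \<zero>] e by simp
  next
    case False
    obtain y' where y': "y' \<in> carrier K" "e' = j y'" "\<And>a. a \<in> m \<Longrightarrow> a \<otimes> y' \<in> Jac"
      using rep[OF e'(1) False e'(2)] by auto
    have "(\<one> \<ominus> c \<otimes> y) \<odot>\<^bsub>E\<^esub> e' = \<zero>\<^bsub>E\<^esub>" by (rule e'(2)[OF c(2)])
    then have "e' = (c \<otimes> y) \<odot>\<^bsub>E\<^esub> e'"
      using E.smult_l_diff[of \<one> "c \<otimes> y" e'] E.diff_eq_zeroD[of e' "(c \<otimes> y) \<odot>\<^bsub>E\<^esub> e'"] c y e'(1) by simp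
    also have "\<dots> = j ((c \<otimes> y) \<otimes> y')" using jm[of "c \<otimes> y" y'] c y y' by simp
    also have "(c \<otimes> y) \<otimes> y' = (c \<otimes> y') \<otimes> y" using c y y' by (simp add: K.m_ac)
    also have "j \<dots> = (c \<otimes> y') \<odot>\<^bsub>E\<^esub> e" using jm[of "c \<otimes> y'" y] c y y' by simp
    finally show ?thesis using that[of "c \<otimes> y'"] c y' by simp
  qed
qed

text \<open>The relation sends y + a x to a e, where \<open>e\<close> is a socle element for
  \<open>m\<close>. It is single-valued at zero because every scalar that carries \<open>x\<close>
  into \<open>A\<close> lies in \<open>m\<close>, which kills \<open>e\<close>.\<close>

lemma functional_separates:
  fixes M :: "('k, 'm) module"
  assumes M: "left_module K M" and small: "carrier M \<lesssim> (UNIV :: 'u set)"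
    and A: "submodule A K M" and x: "x \<in> carrier M"
    and m: "maximalideal m K" and mx: "\<And>a. a \<in> carrier K \<Longrightarrow> a \<odot>\<^bsub>M\<^esub> x \<in> A \<Longrightarrow> a \<in> m"
  obtains \<phi> where "\<phi> \<in> mod_hom K M E" "\<And>y. y \<in> A \<Longrightarrow> \<phi> y = \<zero>\<^bsub>E\<^esub>" "\<phi> x \<noteq> \<zero>\<^bsub>E\<^esub>"
    "\<And>a. a \<in> m \<Longrightarrow> a \<odot>\<^bsub>E\<^esub> \<phi> x = \<zero>\<^bsub>E\<^esub>"
proof -
  interpret M: left_module K M by fact
  interpret m: maximalideal m K by fact
  note AD = submoduleD[OF A]
  obtain e where e: "e \<in> carrier E" "e \<noteq> \<zero>\<^bsub>E\<^esub>" "\<And>a. a \<in> m \<Longrightarrow> a \<odot>\<^bsub>E\<^esub> e = \<zero>\<^bsub>E\<^esub>"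
    using socle_exists[OF m] by metis
  let ?\<Gamma> = "{(y \<oplus>\<^bsub>M\<^esub> a \<odot>\<^bsub>M\<^esub> x, a \<odot>\<^bsub>E\<^esub> e) | y a. y \<in> A \<and> a \<in> carrier K}"
  obtain \<phi> where \<phi>: "\<phi> \<in> mod_hom K M E" "\<And>u v. (u, v) \<in> ?\<Gamma> \<Longrightarrow> \<phi> u = v"
  proof (rule injective_extend_relation[OF E_injective M small, of ?\<Gamma>], goal_cases)
    case (1 u v)
    then show ?case using AD x e by auto
  next
    case 2
    have "(\<zero>\<^bsub>M\<^esub> \<oplus>\<^bsub>M\<^esub> \<zero> \<odot>\<^bsub>M\<^esub> x, \<zero> \<odot>\<^bsub>E\<^esub> e) \<in> ?\<Gamma>" using AD by blast
    then show ?case using x e by simp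
  next
    case (3 u v u' v')
    then obtain y a y' a' where *: "y \<in> A" "a \<in> carrier K" "y' \<in> A" "a' \<in> carrier K"
      "u = y \<oplus>\<^bsub>M\<^esub> a \<odot>\<^bsub>M\<^esub> x" "v = a \<odot>\<^bsub>E\<^esub> e" "u' = y' \<oplus>\<^bsub>M\<^esub> a' \<odot>\<^bsub>M\<^esub> x" "v' = a' \<odot>\<^bsub>E\<^esub> e" by auto
    have "u \<oplus>\<^bsub>M\<^esub> u' = (y \<oplus>\<^bsub>M\<^esub> y') \<oplus>\<^bsub>M\<^esub> (a \<oplus> a') \<odot>\<^bsub>M\<^esub> x" "v \<oplus>\<^bsub>E\<^esub> v' = (a \<oplus> a') \<odot>\<^bsub>E\<^esub> e"
      using * AD(2) x e by (simp_all add: M.smult_l_distr E.smult_l_distr M.M.a_ac)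
    moreover have "y \<oplus>\<^bsub>M\<^esub> y' \<in> A" "a \<oplus> a' \<in> carrier K" using * AD by auto
    ultimately show ?case by blast
  next
    case (4 c u v)
    then obtain y a where *: "y \<in> A" "a \<in> carrier K" "u = y \<oplus>\<^bsub>M\<^esub> a \<odot>\<^bsub>M\<^esub> x" "v = a \<odot>\<^bsub>E\<^esub> e" by auto
    have "c \<odot>\<^bsub>M\<^esub> u = c \<odot>\<^bsub>M\<^esub> y \<oplus>\<^bsub>M\<^esub> (c \<otimes> a) \<odot>\<^bsub>M\<^esub> x" "c \<odot>\<^bsub>E\<^esub> v = (c \<otimes> a) \<odot>\<^bsub>E\<^esub> e"
      using * 4 AD(2) x e by (simp_all add: M.smult_r_distr M.smult_assoc E.smult_assoc)
    moreover have "c \<odot>\<^bsub>M\<^esub> y \<in> A" "c \<otimes> a \<in> carrier K" using * 4 AD by auto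
    ultimately show ?case by blast
  next
    case (5 v)
    then obtain y a where *: "y \<in> A" "a \<in> carrier K" "\<zero>\<^bsub>M\<^esub> = y \<oplus>\<^bsub>M\<^esub> a \<odot>\<^bsub>M\<^esub> x" "v = a \<odot>\<^bsub>E\<^esub> e" by auto
    have "a \<odot>\<^bsub>M\<^esub> x = \<ominus>\<^bsub>M\<^esub> y"
      using *(1-3) x AD(2) by (metis M.M.minus_equality M.M.a_comm M.smult_closed)
    then have "a \<odot>\<^bsub>M\<^esub> x \<in> A" using AD * by auto
    then show ?case using mx e * by auto
  qed blast
  show ?thesis
  proof (rule that[OF \<phi>(1)])
    fix y assume y: "y \<in> A"
    have "(y \<oplus>\<^bsub>M\<^esub> \<zero> \<odot>\<^bsub>M\<^esub> x, \<zero> \<odot>\<^bsub>E\<^esub> e) \<in> ?\<Gamma>" using y by blast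
    from \<phi>(2)[OF this] show "\<phi> y = \<zero>\<^bsub>E\<^esub>" using y AD(2) x e by simp
  next
    have "(\<zero>\<^bsub>M\<^esub> \<oplus>\<^bsub>M\<^esub> \<one> \<odot>\<^bsub>M\<^esub> x, \<one> \<odot>\<^bsub>E\<^esub> e) \<in> ?\<Gamma>" using AD by blast
    from \<phi>(2)[OF this] have "\<phi> x = e" using x e by simp
    then show "\<phi> x \<noteq> \<zero>\<^bsub>E\<^esub>" "\<And>a. a \<in> m \<Longrightarrow> a \<odot>\<^bsub>E\<^esub> \<phi> x = \<zero>\<^bsub>E\<^esub>" using e by auto
  qed
qed

lemma conductor_ideal:
  fixes M :: "('k, 'm) module"
  assumes M: "left_module K M" and A: "submodule A K M" and x: "x \<in> carrier M"
  shows "ideal {a \<in> carrier K. a \<odot>\<^bsub>M\<^esub> x \<in> A} K"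
proof -
  interpret M: left_module K M by fact
  have "(\<lambda>a. a \<odot>\<^bsub>M\<^esub> x) \<in> mod_hom K (regular_module K) M"
    by (rule mod_homI) (use x in \<open>auto simp: M.smult_l_distr M.smult_assoc\<close>)
  from submodule_preimage[OF reg.left_module_axioms M this A] show ?thesis
    by (simp add: K.submodule_regular_iff)
qed

text \<open>The scalars that carry \<open>x\<close> into \<open>A\<close> form a proper ideal; any
  maximal ideal above it serves in \<open>functional_separates\<close>. Thus \<open>E\<close> is a
  cogenerator for small modules.\<close>

lemma functional_exists:
  fixes M :: "('k, 'm) module"
  assumes M: "left_module K M" and small: "carrier M \<lesssim> (UNIV :: 'u set)"
    and A: "submodule A K M" and x: "x \<in> carrier M" "x \<notin> A"
  obtains \<phi> where "\<phi> \<in> mod_hom K M E" "\<And>y. y \<in> A \<Longrightarrow> \<phi> y = \<zero>\<^bsub>E\<^esub>" "\<phi> x \<noteq> \<zero>\<^bsub>E\<^esub>"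
proof -
  interpret M: left_module K M by fact
  have "\<one> \<notin> {a \<in> carrier K. a \<odot>\<^bsub>M\<^esub> x \<in> A}" using x by simp
  then obtain m where m: "maximalideal m K" "{a \<in> carrier K. a \<odot>\<^bsub>M\<^esub> x \<in> A} \<subseteq> m"
    using K.maximalideal_exists[OF conductor_ideal[OF M A x(1)]] by metis
  obtain \<phi> where "\<phi> \<in> mod_hom K M E" "\<And>y. y \<in> A \<Longrightarrow> \<phi> y = \<zero>\<^bsub>E\<^esub>" "\<phi> x \<noteq> \<zero>\<^bsub>E\<^esub>"
    using functional_separates[OF M small A x(1) m(1)] m(2) by (metis (mono_tags, lifting) mem_Collect_eq subsetD)
  then show ?thesis using that by blast
qed

text \<open>
  A simple module has at most one homomorphism into \<open>E\<close> up to scalars, since \<open>E\<close> contains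
  each simple module just once.
\<close>

lemma simple_step_functional:
  assumes M: "left_module K M" and s: "simple_step K M A B"
    and \<phi>: "\<phi> \<in> mod_hom K M E" "\<And>y. y \<in> A \<Longrightarrow> \<phi> y = \<zero>\<^bsub>E\<^esub>"
    and \<psi>: "\<psi> \<in> mod_hom K M E" "\<And>y. y \<in> A \<Longrightarrow> \<psi> y = \<zero>\<^bsub>E\<^esub>"
    and b0: "b0 \<in> B" "\<phi> b0 \<noteq> \<zero>\<^bsub>E\<^esub>"
  obtains a where "a \<in> carrier K" "\<And>b. b \<in> B \<Longrightarrow> \<psi> b = a \<odot>\<^bsub>E\<^esub> \<phi> b"
proof -
  interpret M: left_module K M by fact
  have A: "submodule A K M" and B: "submodule B K M" and AB: "A \<subseteq> B"
    and cov: "\<And>D. submodule D K M \<Longrightarrow> A \<subseteq> D \<Longrightarrow> D \<subseteq> B \<Longrightarrow> D = A \<or> D = B"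
    using s by (auto simp: simple_step_def)
  note AD = submoduleD[OF A] and BD = submoduleD[OF B]
  have b0': "b0 \<in> carrier M" "b0 \<notin> A" using b0 \<phi>(2) BD by auto
  have Beq: "B = A <+>\<^bsub>M\<^esub> (\<lambda>a. a \<odot>\<^bsub>M\<^esub> b0) ` carrier K"
    by (rule simple_step_generator[OF M s b0(1) b0'(2)])
  define m where "m = {a \<in> carrier K. a \<odot>\<^bsub>M\<^esub> b0 \<in> A}"
  \<comment> \<open>An ideal \<open>J\<close> strictly above the conductor gives A + J b0 = B by
    simplicity, so b0 = y + i b0 with \<open>y\<close> in \<open>A\<close> and \<open>i\<close> in
    \<open>J\<close>. Hence 1 - i is in the conductor and 1 in \<open>J\<close>.\<close>
  have "maximalideal m K"
  proof (rule maximalidealI)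
    show "ideal m K" unfolding m_def by (rule conductor_ideal[OF M A b0'(1)])
    show "carrier K \<noteq> m" using b0' K.one_closed unfolding m_def by force
    fix J assume J: "ideal J K" "m \<subseteq> J" "J \<subseteq> carrier K"
    show "J = m \<or> J = carrier K"
    proof (cases "J = m")
      case False
      then obtain t where t: "t \<in> J" "t \<notin> m" using J by auto
      have tK: "t \<in> carrier K" using t J by auto
      have hom: "(\<lambda>a. a \<odot>\<^bsub>M\<^esub> b0) \<in> mod_hom K (regular_module K) M"
        by (rule mod_homI) (use b0' in \<open>auto simp: M.smult_l_distr M.smult_assoc\<close>)
      have sub: "submodule ((\<lambda>a. a \<odot>\<^bsub>M\<^esub> b0) ` J) K M"
        using J(1) by (intro submodule_image[OF reg.left_module_axioms M hom]) (simp add: K.submodule_regular_iff)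
      let ?D = "A <+>\<^bsub>M\<^esub> (\<lambda>a. a \<odot>\<^bsub>M\<^esub> b0) ` J"
      have "t \<odot>\<^bsub>M\<^esub> b0 \<in> ?D" using M.submodule_add_upper(2)[OF A sub] t by blast
      moreover have "t \<odot>\<^bsub>M\<^esub> b0 \<notin> A" using t tK by (simp add: m_def)
      ultimately have "?D \<noteq> A" by blast
      moreover have "?D = A \<or> ?D = B"
        using M.submodule_add_upper(1)[OF A sub] AB b0(1) BD(5) J(3)
        by (intro cov M.submodule_add A sub M.submodule_add_least B) auto
      ultimately have "b0 \<in> ?D" using b0(1) by auto
      then obtain y i where yi: "y \<in> A" "i \<in> J" "b0 = y \<oplus>\<^bsub>M\<^esub> i \<odot>\<^bsub>M\<^esub> b0" by (auto simp: set_add_def')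
      have iK: "i \<in> carrier K" using yi J by auto
      have "(\<one> \<ominus> i) \<odot>\<^bsub>M\<^esub> b0 = b0 \<ominus>\<^bsub>M\<^esub> i \<odot>\<^bsub>M\<^esub> b0" using M.smult_l_diff[of \<one> i b0] iK b0' by simp
      also have "\<dots> = (y \<oplus>\<^bsub>M\<^esub> i \<odot>\<^bsub>M\<^esub> b0) \<ominus>\<^bsub>M\<^esub> i \<odot>\<^bsub>M\<^esub> b0" using yi(3) by simp
      also have "\<dots> = y" using yi(1) AD(2) iK b0' by (simp add: a_minus_def M.M.a_assoc M.M.r_neg)
      finally have "\<one> \<ominus> i \<in> m" using yi(1) iK by (simp add: m_def)
      then have "(\<one> \<ominus> i) \<oplus> i \<in> J" using J yi(2) additive_subgroup.a_closed[OF ideal.axioms(1)[OF J(1)]] by blast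
      then have "\<one> \<in> J" using iK by (simp add: a_minus_def K.a_assoc K.l_neg)
      then show ?thesis using ideal.one_imp_carrier[OF J(1)] by simp
    qed simp
  qed
  moreover have "a \<odot>\<^bsub>E\<^esub> \<chi> b0 = \<zero>\<^bsub>E\<^esub>"
    if "a \<in> m" "\<chi> \<in> mod_hom K M E" "\<And>y. y \<in> A \<Longrightarrow> \<chi> y = \<zero>\<^bsub>E\<^esub>" for a \<chi>
    using that mod_homD(3)[OF that(2), of a b0] b0' by (simp add: m_def)
  ultimately obtain a where a: "a \<in> carrier K" "\<psi> b0 = a \<odot>\<^bsub>E\<^esub> \<phi> b0"
    using socle_unique[of m "\<phi> b0" "\<psi> b0"] \<phi> \<psi> b0 mod_homD(1)[OF \<phi>(1) b0'(1)]
      mod_homD(1)[OF \<psi>(1) b0'(1)] by metis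
  have "\<psi> b = a \<odot>\<^bsub>E\<^esub> \<phi> b" if "b \<in> B" for b
  proof -
    have "b \<in> A <+>\<^bsub>M\<^esub> (\<lambda>a. a \<odot>\<^bsub>M\<^esub> b0) ` carrier K" using that Beq by simp
    then obtain y c where yc: "y \<in> A" "c \<in> carrier K" "b = y \<oplus>\<^bsub>M\<^esub> c \<odot>\<^bsub>M\<^esub> b0"
      by (auto simp: set_add_def')
    have "\<chi> b = c \<odot>\<^bsub>E\<^esub> \<chi> b0" if "\<chi> \<in> mod_hom K M E" "\<And>y. y \<in> A \<Longrightarrow> \<chi> y = \<zero>\<^bsub>E\<^esub>" for \<chi>
      using yc AD(2) b0' that mod_homD[OF that(1)] by simp
    then have "\<psi> b = c \<odot>\<^bsub>E\<^esub> \<psi> b0" "\<phi> b = c \<odot>\<^bsub>E\<^esub> \<phi> b0" using \<phi> \<psi> by auto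
    then show ?thesis
      using a yc mod_homD(1)[OF \<phi>(1) b0'(1)] E.smult_assoc[symmetric] K.m_comm by simp
  qed
  then show ?thesis using that a(1) by blast
qed

subsection \<open>Artinian commutative rings have finite length\<close>

text \<open>Let \<open>I\<close> be minimal among the ideals with K/I of finite length. No simple
  step fits below \<open>I\<close>, so m I = I for each maximal ideal \<open>m\<close>. If
  \<open>I\<close> were nonzero, an ideal \<open>J\<close> minimal with J I nonzero would be
  generated by one \<open>x\<close>, and also by some t x with \<open>t\<close> in a maximal ideal
  containing the annihilator of \<open>x\<close>; Nakayama's argument excludes this.\<close>

lemma K_finite_length: "finite_length K (regular_module K)"
proof -
  let ?KK = "regular_module K"
  let ?F = "{I. ideal I K \<and> fin_len K ?KK I (carrier K)}"
  have "carrier K \<in> ?F" using fin_len.refl[OF reg.submodule_carrier] K.oneideal by simp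
  then obtain I where I: "ideal I K" "fin_len K ?KK I (carrier K)"
    and min: "\<And>J. ideal J K \<Longrightarrow> fin_len K ?KK J (carrier K) \<Longrightarrow> J \<subseteq> I \<Longrightarrow> J = I"
    using artinian_minimal_ideal[OF K_artinian, of "carrier K" ?F]
    by (smt (verit, best) mem_Collect_eq)
  have Isub: "submodule I K ?KK" using I by (simp add: K.submodule_regular_iff)
  have KI: "y \<in> carrier K" if "y \<in> I" for y using ideal.Icarr[OF I(1) that] .
  \<comment> \<open>This is m I = I in the form in which it is used: a submodule that contains m I
    contains \<open>I\<close>.\<close>
  have divisible: "x \<in> A"
    if A: "submodule A K ?KK" and m: "maximalideal m K" and mA: "\<And>a y. a \<in> m \<Longrightarrow> y \<in> I \<Longrightarrow> a \<otimes> y \<in> A"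
      and x: "x \<in> I" for A m x
  proof (rule ccontr)
    assume xA: "x \<notin> A"
    interpret m: maximalideal m K by fact
    have am: "a \<in> m" if aK: "a \<in> carrier K" "a \<odot>\<^bsub>?KK\<^esub> x \<in> A" for a
    proof (rule ccontr)
      assume "a \<notin> m"
      then obtain b where b: "b \<in> carrier K" "\<one> \<ominus> b \<otimes> a \<in> m"
        using K.maximalideal_inverse[OF m aK(1)] by metis
      have "(\<one> \<ominus> b \<otimes> a) \<otimes> x \<oplus> b \<otimes> (a \<otimes> x) \<in> A"
        using mA[OF b(2) x] submoduleD(4,5)[OF A] aK b(1) by simp
      moreover have "(\<one> \<ominus> b \<otimes> a) \<otimes> x \<oplus> b \<otimes> (a \<otimes> x) = x"
      proof -
        have "(\<one> \<ominus> b \<otimes> a) \<otimes> x \<oplus> (b \<otimes> a) \<otimes> x = ((\<one> \<ominus> b \<otimes> a) \<oplus> b \<otimes> a) \<otimes> x"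
          using b aK KI[OF x] by (simp add: K.l_distr)
        also have "(\<one> \<ominus> b \<otimes> a) \<oplus> b \<otimes> a = \<one>" using b aK by (simp add: a_minus_def K.a_assoc K.l_neg)
        finally show ?thesis using b aK KI[OF x] by (simp add: K.m_assoc)
      qed
      ultimately show False using xA by simp
    qed
    then obtain \<phi> where \<phi>: "\<phi> \<in> mod_hom K ?KK E" "\<And>y. y \<in> A \<Longrightarrow> \<phi> y = \<zero>\<^bsub>E\<^esub>" "\<phi> x \<noteq> \<zero>\<^bsub>E\<^esub>"
      using functional_separates[OF reg.left_module_axioms _ A _ m am, simplified, OF K_small KI[OF x]]
      by blast
    have ann: "a \<odot>\<^bsub>E\<^esub> \<phi> y = \<zero>\<^bsub>E\<^esub>" if "a \<in> m" "y \<in> I" for a y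
      using mod_homD(3)[OF \<phi>(1), of a y] \<phi>(2)[OF mA[OF that]] m.Icarr that KI by simp
    \<comment> \<open>\<open>\<phi>\<close> maps \<open>I\<close> into the part of \<open>E\<close>
      killed by \<open>m\<close>, which is a line by \<open>socle_unique\<close>. So
      \<open>I'\<close> is one simple step below \<open>I\<close>, against the minimality of
      \<open>I\<close>.\<close>
    define I' where "I' = {y \<in> carrier ?KK. \<phi> y = \<zero>\<^bsub>E\<^esub>} \<inter> I"
    have I': "submodule I' K ?KK"
      unfolding I'_def
      by (intro reg.submodule_Int submodule_kernel[OF reg.left_module_axioms E.left_module_axioms \<phi>(1)] Isub)
    have "simple_step K ?KK I' I"
      unfolding simple_step_def
    proof (intro conjI I' Isub allI impI)
      show "I' \<subseteq> I" by (auto simp: I'_def)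
      fix C assume C: "submodule C K ?KK \<and> I' \<subseteq> C \<and> C \<subseteq> I"
      show "C = I' \<or> C = I"
      proof (cases "C \<subseteq> I'")
        case False
        then obtain y where y: "y \<in> C" "\<phi> y \<noteq> \<zero>\<^bsub>E\<^esub>" "y \<in> I" using C KI by (auto simp: I'_def)
        have "z \<in> C" if z: "z \<in> I" for z
        proof -
          obtain a where a: "a \<in> carrier K" "\<phi> z = a \<odot>\<^bsub>E\<^esub> \<phi> y"
            using socle_unique[OF m _ y(2), of "\<phi> z"] ann y z KI mod_homD(1)[OF \<phi>(1)] by auto
          have "\<phi> (z \<ominus>\<^bsub>?KK\<^esub> a \<odot>\<^bsub>?KK\<^esub> y) = \<phi> z \<ominus>\<^bsub>E\<^esub> a \<odot>\<^bsub>E\<^esub> \<phi> y"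
            using mod_hom_diff[OF reg.left_module_axioms E.left_module_axioms \<phi>(1), of z "a \<odot>\<^bsub>?KK\<^esub> y"]
              mod_homD(3)[OF \<phi>(1) a(1), of y] KI y z a(1) by simp
          also have "\<dots> = \<zero>\<^bsub>E\<^esub>" using a mod_homD(1)[OF \<phi>(1), of y] KI[OF y(3)] by (simp add: a_minus_def E.M.r_neg)
          finally have "z \<ominus>\<^bsub>?KK\<^esub> a \<odot>\<^bsub>?KK\<^esub> y \<in> I'"
            using submoduleD(7)[OF Isub z submoduleD(5)[OF Isub a(1) y(3)]] KI by (auto simp: I'_def)
          then have "(z \<ominus>\<^bsub>?KK\<^esub> a \<odot>\<^bsub>?KK\<^esub> y) \<oplus>\<^bsub>?KK\<^esub> a \<odot>\<^bsub>?KK\<^esub> y \<in> C"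
            using C y(1) a(1) submoduleD(4,5)[of C K ?KK] by blast
          then show "z \<in> C"
            using KI z y(3) a(1) by (simp add: a_minus_def K.a_assoc K.l_neg)
        qed
        then show ?thesis using C by auto
      qed (use C in auto)
    qed
    then have "fin_len K ?KK I' (carrier K)"
      using fin_len_trans[OF I(2) simple_step_fin_len] by blast
    then have "I' = I" using I' by (intro min) (auto simp: K.submodule_regular_iff I'_def)
    then show False using \<phi>(3) x by (auto simp: I'_def)
  qed
  have "I = {\<zero>}"
  proof (rule ccontr)
    assume I0: "I \<noteq> {\<zero>}"
    let ?G = "{J. ideal J K \<and> (\<exists>x\<in>J. \<exists>y\<in>I. x \<otimes> y \<noteq> \<zero>)}"
    have "carrier K \<in> ?G"
    proof -
      obtain y where y: "y \<in> I" "y \<noteq> \<zero>"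
        using I0 additive_subgroup.zero_closed[OF ideal.axioms(1)[OF I(1)]] by blast
      then have "\<one> \<otimes> y \<noteq> \<zero>" using KI by simp
      then show ?thesis using y K.oneideal by blast
    qed
    then obtain J where J: "J \<in> ?G" and Jmin: "\<And>L. L \<in> ?G \<Longrightarrow> L \<subseteq> J \<Longrightarrow> L = J"
      using artinian_minimal_ideal[OF K_artinian, of "carrier K" ?G]
      by (smt (verit, best) mem_Collect_eq)
    then obtain x y where x: "x \<in> J" and y: "y \<in> I" "x \<otimes> y \<noteq> \<zero>" by auto
    have idJ: "ideal J K" using J by simp
    have xK: "x \<in> carrier K" using ideal.Icarr[OF idJ x] .
    \<comment> \<open>By minimality of \<open>J\<close> each of its elements that does not kill
      \<open>I\<close> generates it. This is applied to a multiple of \<open>x\<close> by an element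
      of \<open>m\<close>.\<close>
    have cyc: "(\<lambda>a. a \<otimes> z) ` carrier K = J" if z: "z \<in> J" "\<exists>y\<in>I. z \<otimes> y \<noteq> \<zero>" for z
    proof (rule Jmin)
      have zK: "z \<in> carrier K" using ideal.Icarr[OF idJ z(1)] .
      have "z = \<one> \<otimes> z" using zK by simp
      then have "z \<in> (\<lambda>a. a \<otimes> z) ` carrier K" by blast
      moreover have "ideal ((\<lambda>a. a \<otimes> z) ` carrier K) K"
        using reg.submodule_cyclic[of z] zK by (simp add: K.submodule_regular_iff)
      ultimately show "(\<lambda>a. a \<otimes> z) ` carrier K \<in> ?G" using z(2) by blast
      show "(\<lambda>a. a \<otimes> z) ` carrier K \<subseteq> J" using ideal.I_l_closed[OF idJ z(1)] by auto
    qed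
    have "ideal {a \<in> carrier K. a \<odot>\<^bsub>?KK\<^esub> x \<in> {\<zero>}} K"
      using conductor_ideal[OF reg.left_module_axioms reg.submodule_zero] xK by simp
    moreover have "\<one> \<notin> {a \<in> carrier K. a \<odot>\<^bsub>?KK\<^esub> x \<in> {\<zero>}}" using xK y KI by auto
    ultimately obtain m where m: "maximalideal m K" "{a \<in> carrier K. a \<odot>\<^bsub>?KK\<^esub> x \<in> {\<zero>}} \<subseteq> m"
      using K.maximalideal_exists by metis
    interpret m: maximalideal m K by fact
    \<comment> \<open>Otherwise the annihilator of \<open>x\<close> contains m I, hence all of
      \<open>I\<close> by \<open>divisible\<close>, although \<open>x\<close> does not kill
      \<open>y\<close>.\<close>
    have "\<exists>t\<in>m. \<exists>y\<in>I. t \<otimes> x \<otimes> y \<noteq> \<zero>"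
    proof (rule ccontr)
      assume no: "\<not> ?thesis"
      have "y \<in> {y \<in> carrier ?KK. x \<otimes> y \<in> {\<zero>}}"
      proof (rule divisible[OF _ m(1) _ y(1)])
        have "(\<lambda>y. x \<otimes> y) \<in> mod_hom K ?KK ?KK"
          using xK by (intro mod_homI) (auto simp: K.r_distr K.m_ac)
        from submodule_preimage[OF reg.left_module_axioms reg.left_module_axioms this reg.submodule_zero]
        show "submodule {y \<in> carrier ?KK. x \<otimes> y \<in> {\<zero>}} K ?KK" by simp
        show "a \<otimes> y \<in> {y \<in> carrier ?KK. x \<otimes> y \<in> {\<zero>}}" if "a \<in> m" "y \<in> I" for a y
        proof -
          have "x \<otimes> (a \<otimes> y) = a \<otimes> x \<otimes> y" using xK m.Icarr KI that by (simp add: K.m_ac)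
          then show ?thesis using no that m.Icarr KI by auto
        qed
      qed
      then show False using y by simp
    qed
    then obtain t where t: "t \<in> m" "\<exists>y\<in>I. t \<otimes> x \<otimes> y \<noteq> \<zero>" by auto
    have tK: "t \<in> carrier K" using m.Icarr t by simp
    have "(\<lambda>a. a \<otimes> (t \<otimes> x)) ` carrier K = J"
      using cyc[of "t \<otimes> x"] t(2) ideal.I_l_closed[OF idJ x tK] by simp
    then obtain z where z: "z \<in> carrier K" "x = z \<otimes> (t \<otimes> x)" using x by auto
    have "(\<one> \<ominus> z \<otimes> t) \<otimes> x = x \<ominus> z \<otimes> (t \<otimes> x)"
      using reg.smult_l_diff[of \<one> "z \<otimes> t" x] z(1) tK xK by (simp add: a_minus_def K.m_assoc)
    also have "\<dots> = \<zero>" using z xK by (simp add: a_minus_def K.r_neg)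
    finally have "\<one> \<ominus> z \<otimes> t \<in> m" using m(2) z(1) tK by auto
    then have "(\<one> \<ominus> z \<otimes> t) \<oplus> z \<otimes> t \<in> m" using m.I_l_closed[OF t(1) z(1)] by simp
    then have "\<one> \<in> m" using z(1) tK by (simp add: a_minus_def K.a_assoc K.l_neg)
    then show False using m.one_imp_carrier m.I_notcarr by simp
  qed
  then show ?thesis using I(2) by simp
qed

end

section \<open>Free modules and projective resolutions inside the universe\<close>

subsection \<open>Free modules and projective covers\<close>

lemma mod_hom_finsum:
  assumes A: "left_module R A" and B: "left_module R B" and f: "f \<in> mod_hom R A B"
    and T: "finite T" "x \<in> T \<rightarrow> carrier A"
  shows "f (finsum A x T) = finsum B (\<lambda>i. f (x i)) T"
  using T
proof (induction T rule: finite_induct)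
  case empty
  interpret A: left_module R A by fact
  interpret B: left_module R B by fact
  show ?case using mod_hom_zero[OF A B f] by simp
next
  case (insert a T)
  interpret A: left_module R A by fact
  interpret B: left_module R B by fact
  show ?case
    using insert mod_homD[OF f] by (simp add: Pi_iff A.M.finsum_closed)
qed

definition unit_vector :: "('r, 'c) ring_scheme \<Rightarrow> 'x \<Rightarrow> 'x \<Rightarrow> 'r" where
  "unit_vector R a = (\<lambda>b. if b = a then \<one>\<^bsub>R\<^esub> else \<zero>\<^bsub>R\<^esub>)"

abbreviation free_module :: "'x set \<Rightarrow> ('r, 'c) ring_scheme \<Rightarrow> ('r, 'x \<Rightarrow> 'r) module" where
  "free_module X R \<equiv> direct_power X (regular_module R)"

context ring
begin

lemma left_module_free: "left_module R (free_module X R)"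
  by (rule left_module_direct_power[OF left_module_regular])

lemma unit_vector_closed: "a \<in> X \<Longrightarrow> unit_vector R a \<in> carrier (free_module X R)"
  by (auto simp: direct_power_def unit_vector_def)

text \<open>\<open>T\<close> is any finite set between the support of \<open>w\<close> and
  \<open>X\<close>: the support itself serves for arbitrary \<open>X\<close>, the whole index set
  for finite rank.\<close>

lemma free_module_expand:
  assumes w: "w \<in> carrier (free_module X R)" and T: "finite T" "{a. w a \<noteq> \<zero>} \<subseteq> T" "T \<subseteq> X"
    and B: "left_module R B" and f: "f \<in> mod_hom R (free_module X R) B"
  shows "f w = (\<Oplus>\<^bsub>B\<^esub>a\<in>T. w a \<odot>\<^bsub>B\<^esub> f (unit_vector R a))"
proof -
  let ?F = "free_module X R"
  interpret F: left_module R ?F by (rule left_module_free)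
  have wR: "w a \<in> carrier R" for a using direct_power_carrierD(1)[OF w] by simp
  have u: "unit_vector R a \<in> carrier ?F" if "a \<in> T" for a
    using that T by (intro unit_vector_closed) auto
  let ?t = "\<lambda>a. w a \<odot>\<^bsub>?F\<^esub> unit_vector R a"
  have t: "?t \<in> T \<rightarrow> carrier ?F" using u wR F.smult_closed by blast
  have "finsum ?F ?t T b = w b" for b
  proof -
    interpret reg: left_module R "regular_module R" by (rule left_module_regular)
    have eq: "?t a b = (if b = a then w a else \<zero>)" for a
      using wR by (simp add: unit_vector_def)
    have "finsum ?F ?t T b = finsum (regular_module R) (\<lambda>a. ?t a b) T"
      by (rule mod_hom_finsum[OF left_module_free left_module_regular direct_power_component T(1) t])
    also have "\<dots> = finsum (regular_module R) (\<lambda>a. if b = a then w a else \<zero>) T"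
      using eq by simp
    also have "\<dots> = w b"
    proof (cases "b \<in> T")
      case True
      then show ?thesis using reg.M.finsum_singleton[OF True T(1), of w] wR by (simp cong: if_cong)
    next
      case False
      then have "finsum (regular_module R) (\<lambda>a. if b = a then w a else \<zero>) T
        = finsum (regular_module R) (\<lambda>a. \<zero>) T"
        by (intro reg.M.finsum_cong') auto
      also have "\<dots> = \<zero>" using reg.M.finsum_zero[of T] by simp
      also have "\<dots> = w b" using False T(2) by (metis (mono_tags, lifting) mem_Collect_eq subsetD)
      finally show ?thesis .
    qed
    finally show ?thesis .
  qed
  then have "w = finsum ?F ?t T" by auto
  then have "f w = f (finsum ?F ?t T)" by simp
  also have "\<dots> = finsum B (\<lambda>a. f (?t a)) T"
    by (rule mod_hom_finsum[OF left_module_free B f T(1) t])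
  also have "\<dots> = (\<Oplus>\<^bsub>B\<^esub>a\<in>T. w a \<odot>\<^bsub>B\<^esub> f (unit_vector R a))"
  proof -
    interpret B: left_module R B by fact
    show ?thesis
      using mod_homD(3)[OF f wR u] mod_homD(1)[OF f u] wR by (intro B.M.finsum_cong') auto
  qed
  finally show ?thesis .
qed

lemma free_module_hom:
  assumes A: "left_module R A" and y: "\<And>a. a \<in> X \<Longrightarrow> y a \<in> carrier A"
  obtains h where "h \<in> mod_hom R (free_module X R) A" "\<And>a. a \<in> X \<Longrightarrow> h (unit_vector R a) = y a"
proof -
  let ?F = "free_module X R"
  interpret A: left_module R A by fact
  interpret F: left_module R ?F by (rule left_module_free)
  define z where "z a = (if a \<in> X then y a else \<zero>\<^bsub>A\<^esub>)" for a
  have z: "z a \<in> carrier A" for a using y by (simp add: z_def)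
  define h where "h w = (\<Oplus>\<^bsub>A\<^esub>a\<in>{a. w a \<noteq> \<zero>}. w a \<odot>\<^bsub>A\<^esub> z a)" for w
  have wR: "w a \<in> carrier R" if "w \<in> carrier ?F" for w a using direct_power_carrierD(1)[OF that] by simp
  have fin: "finite {a. w a \<noteq> \<zero>}" if "w \<in> carrier ?F" for w using direct_power_carrierD(3)[OF that] by simp
  \<comment> \<open>The sum defining \<open>h\<close> depends on the support of its argument.
    Enlarging the index set lets two vectors be summed over the same set, which additivity
    requires.\<close>
  have heq: "h w = (\<Oplus>\<^bsub>A\<^esub>a\<in>T. w a \<odot>\<^bsub>A\<^esub> z a)"
    if "w \<in> carrier ?F" "finite T" "{a. w a \<noteq> \<zero>} \<subseteq> T" for w T
    unfolding h_def using that wR[OF that(1)] z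
    by (intro A.M.add.finprod_mono_neutral_cong_left) auto
  show ?thesis
  proof (rule that)
    show "h \<in> mod_hom R ?F A"
    proof (rule mod_homI)
      fix w assume w: "w \<in> carrier ?F"
      show "h w \<in> carrier A" unfolding h_def using wR[OF w] z by (intro A.M.finsum_closed) auto
    next
      fix v w assume v: "v \<in> carrier ?F" and w: "w \<in> carrier ?F"
      let ?T = "{a. v a \<noteq> \<zero>} \<union> {a. w a \<noteq> \<zero>}"
      have vw: "v \<oplus>\<^bsub>?F\<^esub> w \<in> carrier ?F" by (rule F.M.a_closed[OF v w])
      have T: "finite ?T" using fin v w by simp
      have "h (v \<oplus>\<^bsub>?F\<^esub> w) = (\<Oplus>\<^bsub>A\<^esub>a\<in>?T. (v \<oplus>\<^bsub>?F\<^esub> w) a \<odot>\<^bsub>A\<^esub> z a)"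
        by (rule heq[OF vw T]) auto
      also have "\<dots> = (\<Oplus>\<^bsub>A\<^esub>a\<in>?T. v a \<odot>\<^bsub>A\<^esub> z a \<oplus>\<^bsub>A\<^esub> w a \<odot>\<^bsub>A\<^esub> z a)"
        using wR[OF v] wR[OF w] z by (intro A.M.finsum_cong') (auto simp: A.smult_l_distr)
      also have "\<dots> = (\<Oplus>\<^bsub>A\<^esub>a\<in>?T. v a \<odot>\<^bsub>A\<^esub> z a) \<oplus>\<^bsub>A\<^esub> (\<Oplus>\<^bsub>A\<^esub>a\<in>?T. w a \<odot>\<^bsub>A\<^esub> z a)"
        using wR[OF v] wR[OF w] z by (intro A.M.finsum_addf) auto
      also have "\<dots> = h v \<oplus>\<^bsub>A\<^esub> h w" using heq[OF v T] heq[OF w T] by simp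
      finally show "h (v \<oplus>\<^bsub>?F\<^esub> w) = h v \<oplus>\<^bsub>A\<^esub> h w" .
    next
      fix r w assume r: "r \<in> carrier R" and w: "w \<in> carrier ?F"
      have rw: "r \<odot>\<^bsub>?F\<^esub> w \<in> carrier ?F" by (rule F.smult_closed[OF r w])
      have "h (r \<odot>\<^bsub>?F\<^esub> w) = (\<Oplus>\<^bsub>A\<^esub>a\<in>{a. w a \<noteq> \<zero>}. (r \<odot>\<^bsub>?F\<^esub> w) a \<odot>\<^bsub>A\<^esub> z a)"
        using r by (intro heq[OF rw fin[OF w]]) auto
      also have "\<dots> = (\<Oplus>\<^bsub>A\<^esub>a\<in>{a. w a \<noteq> \<zero>}. r \<odot>\<^bsub>A\<^esub> (w a \<odot>\<^bsub>A\<^esub> z a))"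
        using wR[OF w] z r by (intro A.M.finsum_cong') (auto simp: A.smult_assoc)
      also have "\<dots> = r \<odot>\<^bsub>A\<^esub> h w"
      proof -
        have "(\<lambda>x. r \<odot>\<^bsub>A\<^esub> x) \<in> carrier A \<rightarrow> carrier A" using r by auto
        have "(\<Oplus>\<^bsub>A\<^esub>a\<in>T. r \<odot>\<^bsub>A\<^esub> (w a \<odot>\<^bsub>A\<^esub> z a)) = r \<odot>\<^bsub>A\<^esub> (\<Oplus>\<^bsub>A\<^esub>a\<in>T. w a \<odot>\<^bsub>A\<^esub> z a)" if "finite T" for T
          using that wR[OF w] z r
          by (induction T rule: finite_induct)
            (simp_all add: Pi_iff A.smult_r_distr A.M.finsum_closed)
        then show ?thesis unfolding h_def using fin[OF w] by blast
      qed
      finally show "h (r \<odot>\<^bsub>?F\<^esub> w) = r \<odot>\<^bsub>A\<^esub> h w" .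
    qed
    fix a assume a: "a \<in> X"
    have "h (unit_vector R a) = (\<Oplus>\<^bsub>A\<^esub>b\<in>{a}. unit_vector R a b \<odot>\<^bsub>A\<^esub> z b)"
      by (rule heq[OF unit_vector_closed[OF a]]) (auto simp: unit_vector_def)
    then show "h (unit_vector R a) = y a" using z[of a] a by (simp add: unit_vector_def z_def)
  qed
qed

lemma free_module_projective:
  fixes U :: "'u itself"
  shows "projective_module U R (free_module X R)"
  unfolding projective_module_def
proof (intro conjI left_module_free allI impI, elim conjE)
  let ?F = "free_module X R"
  fix A B :: "('a, 'u) module" and g f
  assume A: "left_module R A" and B: "left_module R B" and g: "g \<in> mod_hom R A B" "g ` carrier A = carrier B"
    and f: "f \<in> mod_hom R ?F B"
  have "\<exists>y\<in>carrier A. g y = f (unit_vector R a)" if "a \<in> X" for a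
    using mod_homD(1)[OF f unit_vector_closed[OF that]] g(2) by (metis imageE)
  then obtain y where y: "\<And>a. a \<in> X \<Longrightarrow> y a \<in> carrier A" "\<And>a. a \<in> X \<Longrightarrow> g (y a) = f (unit_vector R a)" by metis
  obtain h where h: "h \<in> mod_hom R ?F A" "\<And>a. a \<in> X \<Longrightarrow> h (unit_vector R a) = y a"
    using free_module_hom[OF A, of X y] y(1) by blast
  have "g (h w) = f w" if w: "w \<in> carrier ?F" for w
  proof -
    interpret B: left_module R B by fact
    let ?T = "{a. w a \<noteq> \<zero>}"
    have T: "finite ?T" "?T \<subseteq> X" using direct_power_carrierD(2,3)[OF w] by auto
    have "g (h w) = (\<Oplus>\<^bsub>B\<^esub>a\<in>?T. w a \<odot>\<^bsub>B\<^esub> g (h (unit_vector R a)))"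
      by (rule free_module_expand[OF w T(1) order_refl T(2) B mod_hom_comp[OF h(1) g(1)]])
    also have "\<dots> = (\<Oplus>\<^bsub>B\<^esub>a\<in>?T. w a \<odot>\<^bsub>B\<^esub> f (unit_vector R a))"
      using T(2) h(2) y direct_power_carrierD(1)[OF w] mod_homD(1)[OF f unit_vector_closed]
      by (intro B.M.finsum_cong') auto
    also have "\<dots> = f w" by (rule free_module_expand[OF w T(1) order_refl T(2) B f, symmetric])
    finally show ?thesis .
  qed
  then show "\<exists>h\<in>mod_hom R ?F A. \<forall>x\<in>carrier ?F. g (h x) = f x" using h(1) by blast
qed

lemma free_module_cover:
  assumes M: "left_module R M" and X: "X \<subseteq> carrier M"
    and gen: "\<And>S. submodule S R M \<Longrightarrow> X \<subseteq> S \<Longrightarrow> carrier M \<subseteq> S"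
  obtains h where "h \<in> mod_hom R (free_module X R) M" "h ` carrier (free_module X R) = carrier M"
proof -
  interpret F: left_module R "free_module X R" by (rule left_module_free)
  obtain h where h: "h \<in> mod_hom R (free_module X R) M" "\<And>a. a \<in> X \<Longrightarrow> h (unit_vector R a) = a"
    using free_module_hom[OF M, of X "\<lambda>a. a"] X by blast
  have "carrier M \<subseteq> h ` carrier (free_module X R)"
  proof (rule gen)
    show "submodule (h ` carrier (free_module X R)) R M"
      by (rule submodule_image[OF left_module_free M h(1) F.submodule_carrier])
    show "X \<subseteq> h ` carrier (free_module X R)"
      using h(2) unit_vector_closed by (metis image_eqI subsetI)
  qed
  then show ?thesis using that h(1) mod_homD(1)[OF h(1)] by blast
qed

end

text \<open>The generators are numbered so that free modules of finite rank all have elements of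
  type \<open>nat \<Rightarrow> 'r\<close>, and a resolution by them is a sequence in one
  type.\<close>

lemma free_module_nat_cover:
  assumes M: "left_module R M" and X: "finite X" "X \<subseteq> carrier M"
    and gen: "\<And>S. submodule S R M \<Longrightarrow> X \<subseteq> S \<Longrightarrow> carrier M \<subseteq> S"
  obtains m :: nat and h where "h \<in> mod_hom R (free_module {..<m} R) M"
    "h ` carrier (free_module {..<m} R) = carrier M"
proof -
  interpret M: left_module R M by fact
  let ?F = "\<lambda>m::nat. free_module {..<m} R"
  obtain m :: nat and e where e: "bij_betw e {..<m} X"
    using X(1) by (metis bij_betw_from_nat_into_finite)
  have eX: "e a \<in> X" if "a < m" for a using e that by (auto dest: bij_betwE)
  obtain h where h: "h \<in> mod_hom R (?F m) M" "\<And>a. a < m \<Longrightarrow> h (unit_vector R a) = e a"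
    using M.R.free_module_hom[OF M, of "{..<m}" e] eX X(2) by auto
  interpret F: left_module R "?F m" by (rule M.R.left_module_free)
  have "carrier M \<subseteq> h ` carrier (?F m)"
  proof (rule gen)
    show "submodule (h ` carrier (?F m)) R M"
      by (rule submodule_image[OF F.left_module_axioms M h(1) F.submodule_carrier])
    show "X \<subseteq> h ` carrier (?F m)"
    proof
      fix x assume "x \<in> X"
      then obtain a where a: "a < m" "x = e a" using e unfolding bij_betw_def by auto
      then show "x \<in> h ` carrier (?F m)"
        using h(2)[OF a(1)] M.R.unit_vector_closed[of a "{..<m}"] by (metis image_eqI lessThan_iff)
    qed
  qed
  then show ?thesis using that h(1) mod_homD(1)[OF h(1)] by blast
qed

text \<open>A finitely supported function is coded by the finite graph of its nonzero part, and an
  infinite type has no more finite subsets than elements.\<close>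

lemma direct_power_lepoll:
  assumes inf: "infinite (UNIV :: 'u set)" and X: "X \<lesssim> (UNIV :: 'u set)"
    and M: "carrier M \<lesssim> (UNIV :: 'u set)"
  shows "carrier (direct_power X M) \<lesssim> (UNIV :: 'u set)"
proof -
  obtain j :: "'a \<times> 'b \<Rightarrow> 'u" where j: "inj_on j (X \<times> carrier M)"
    using times_UNIV_lepoll[OF inf X M] by (auto simp: lepoll_def)
  let ?s = "\<lambda>w. {a. w a \<noteq> \<zero>\<^bsub>M\<^esub>}"
  let ?gr = "\<lambda>w. (\<lambda>a. (a, w a)) ` ?s w"
  have gr: "?gr w \<subseteq> X \<times> carrier M \<and> finite (?gr w)" if "w \<in> carrier (direct_power X M)" for w
    using direct_power_carrierD[OF that] by auto
  have "inj_on (\<lambda>w. j ` ?gr w) (carrier (direct_power X M))"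
  proof (rule inj_onI)
    fix v w assume *: "v \<in> carrier (direct_power X M)" "w \<in> carrier (direct_power X M)" "j ` ?gr v = j ` ?gr w"
    then have eq: "?gr v = ?gr w" using gr by (intro inj_on_image_eq_iff[OF j, THEN iffD1]) auto
    show "v = w"
    proof
      fix a
      have "(a, x) \<in> ?gr v \<longleftrightarrow> (a, x) \<in> ?gr w" for x using eq by simp
      then have eq: "x = v a \<and> v a \<noteq> \<zero>\<^bsub>M\<^esub> \<longleftrightarrow> x = w a \<and> w a \<noteq> \<zero>\<^bsub>M\<^esub>" for x by auto
      show "v a = w a" using eq[of "v a"] eq[of "w a"] by metis
    qed
  qed
  moreover have "(\<lambda>w. j ` ?gr w) ` carrier (direct_power X M) \<subseteq> Fpow (UNIV :: 'u set)"
    using gr by (auto simp: Fpow_def)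
  ultimately have "carrier (direct_power X M) \<lesssim> Fpow (UNIV :: 'u set)" by (auto simp: lepoll_def)
  also have "Fpow (UNIV :: 'u set) \<approx> (UNIV :: 'u set)" by (rule eqpoll_Fpow[OF inf])
  finally show ?thesis .
qed

lemma projective_transport:
  fixes U :: "'u itself" and P :: "('r, 'p) module" and P' :: "('r, 'q) module"
  assumes P: "projective_module U R P" and P': "left_module R P'"
    and c: "c \<in> mod_hom R P P'" and d: "d \<in> mod_hom R P' P" and cd: "\<And>y. y \<in> carrier P' \<Longrightarrow> c (d y) = y"
  shows "projective_module U R P'"
  unfolding projective_module_def
proof (intro conjI P' allI impI, elim conjE)
  fix A B :: "('r, 'u) module" and g f
  assume *: "left_module R A" "left_module R B" "g \<in> mod_hom R A B" "g ` carrier A = carrier B"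
    "f \<in> mod_hom R P' B"
  have "\<exists>h\<in>mod_hom R P A. \<forall>x\<in>carrier P. g (h x) = f (c x)"
    using P[unfolded projective_module_def, THEN conjunct2, THEN spec[of _ A], THEN spec[of _ B],
        THEN spec[of _ g], THEN spec[of _ "\<lambda>x. f (c x)"]] * mod_hom_comp[OF c *(5)] by blast
  then obtain h where h: "h \<in> mod_hom R P A" "\<And>x. x \<in> carrier P \<Longrightarrow> g (h x) = f (c x)"
    by blast
  show "\<exists>h\<in>mod_hom R P' A. \<forall>x\<in>carrier P'. g (h x) = f x"
    by (rule bexI[OF _ mod_hom_comp[OF d h(1)]]) (use h(2) cd mod_homD(1)[OF d] in auto)
qed

text \<open>The free module on all elements of \<open>M\<close> consists of finitely supported
  functions, so it has a copy in the universe.\<close>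

lemma projective_cover:
  fixes M :: "('r, 'u) module" and U :: "'u itself"
  assumes inf: "infinite (UNIV :: 'u set)" and small: "carrier R \<lesssim> (UNIV :: 'u set)"
    and M: "left_module R M"
  obtains F :: "('r, 'u) module" and \<epsilon> where "projective_module U R F" "\<epsilon> \<in> mod_hom R F M"
    "\<epsilon> ` carrier F = carrier M"
proof -
  interpret M: left_module R M by fact
  let ?F = "free_module (carrier M) R"
  have F: "left_module R ?F" by (rule M.R.left_module_free)
  obtain h where h: "h \<in> mod_hom R ?F M" "h ` carrier ?F = carrier M"
    using M.R.free_module_cover[OF M, of "carrier M"] by auto
  obtain F' :: "('r, 'u) module" and c d where F': "left_module R F'" and c: "c \<in> mod_hom R ?F F'"
    and d: "d \<in> mod_hom R F' ?F" and dc: "\<And>x. x \<in> carrier ?F \<Longrightarrow> d (c x) = x"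
    and cd: "\<And>y. y \<in> carrier F' \<Longrightarrow> c (d y) = y" and car: "carrier F' = c ` carrier ?F"
    using copy_exists[OF F direct_power_lepoll[OF inf]] small by (metis subset_UNIV subset_imp_lepoll regular_module_simps(1))
  show ?thesis
  proof (rule that)
    show "projective_module U R F'"
      using projective_transport[OF M.R.free_module_projective[of U "carrier M"] F' c d] cd by blast
    show "(\<lambda>x. h (d x)) \<in> mod_hom R F' M" by (rule mod_hom_comp[OF d h(1)])
    have "(\<lambda>x. h (d x)) ` carrier F' = h ` carrier ?F" unfolding car by (force simp: dc)
    then show "(\<lambda>x. h (d x)) ` carrier F' = carrier M" using h(2) by simp
  qed
qed

subsection \<open>Construction of resolutions\<close>

text \<open>The class \<open>C\<close> is abstract for the sake of two uses: projective modules in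
  the universe, and free modules of finite rank. Each stage carries a module together with the
  submodule that the next map must have as its image: \<open>S0\<close> at the start, a kernel
  afterwards.\<close>

lemma resolution_sequence:
  fixes C :: "('r, 'a) module \<Rightarrow> bool"
  assumes mod: "\<And>F. C F \<Longrightarrow> left_module R F"
    and cover: "\<And>F S. C F \<Longrightarrow> submodule S R F \<Longrightarrow>
      \<exists>F' d. C F' \<and> d \<in> mod_hom R F' F \<and> d ` carrier F' = S"
    and F0: "C F0" "submodule S0 R F0"
  obtains Q d where "Q 0 = F0" "\<And>n. C (Q n)" "\<And>n. d n \<in> mod_hom R (Q (Suc n)) (Q n)"
    "d 0 ` carrier (Q 1) = S0"
    "\<And>n. d (Suc n) ` carrier (Q (Suc (Suc n))) = {x \<in> carrier (Q (Suc n)). d n x = \<zero>\<^bsub>Q n\<^esub>}"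
proof -
  define rel where "rel X Y \<longleftrightarrow> (\<exists>d\<in>mod_hom R (fst Y) (fst X). d ` carrier (fst Y) = snd X \<and>
      snd Y = {x \<in> carrier (fst Y). d x = \<zero>\<^bsub>fst X\<^esub>})" for X Y :: "('r, 'a) module \<times> 'a set"
  have "\<exists>f. \<forall>n. (C (fst (f n)) \<and> submodule (snd (f n)) R (fst (f n)) \<and> (n = 0 \<longrightarrow> f n = (F0, S0)))
      \<and> rel (f n) (f (Suc n))"
  proof (rule dependent_nat_choice)
    fix X :: "('r, 'a) module \<times> 'a set" and n :: nat
    assume X: "C (fst X) \<and> submodule (snd X) R (fst X) \<and> (n = 0 \<longrightarrow> X = (F0, S0))"
    then obtain F' d where F': "C F'" "d \<in> mod_hom R F' (fst X)" "d ` carrier F' = snd X"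
      using cover by blast
    let ?Y = "(F', {x \<in> carrier F'. d x = \<zero>\<^bsub>fst X\<^esub>})"
    have "submodule (snd ?Y) R F'" using submodule_kernel[OF mod[OF F'(1)] mod F'(2)] X by simp
    moreover have "rel X ?Y" unfolding rel_def using F' by auto
    ultimately show "\<exists>Y. (C (fst Y) \<and> submodule (snd Y) R (fst Y) \<and> (Suc n = 0 \<longrightarrow> Y = (F0, S0))) \<and> rel X Y"
      using F'(1) by (intro exI[of _ ?Y]) auto
  qed (use F0 in \<open>auto intro!: exI[of _ "(F0, S0)"]\<close>)
  then obtain f where f: "\<And>n. C (fst (f n))" "f 0 = (F0, S0)" "\<And>n. rel (f n) (f (Suc n))" by auto
  have "\<forall>n. \<exists>d. d \<in> mod_hom R (fst (f (Suc n))) (fst (f n)) \<and> d ` carrier (fst (f (Suc n))) = snd (f n) \<and>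
      snd (f (Suc n)) = {x \<in> carrier (fst (f (Suc n))). d x = \<zero>\<^bsub>fst (f n)\<^esub>}"
    using f(3) unfolding rel_def by blast
  from choice[OF this] obtain d where d: "\<And>n. d n \<in> mod_hom R (fst (f (Suc n))) (fst (f n))"
    "\<And>n. d n ` carrier (fst (f (Suc n))) = snd (f n)"
    "\<And>n. snd (f (Suc n)) = {x \<in> carrier (fst (f (Suc n))). d n x = \<zero>\<^bsub>fst (f n)\<^esub>}"
    by blast
  show ?thesis by (rule that[of "\<lambda>n. fst (f n)" d]) (use f d in auto)
qed

lemma projective_resolution_exists:
  fixes M :: "('r, 'm) module" and U :: "'u itself"
  assumes inf: "infinite (UNIV :: 'u set)" and small: "carrier R \<lesssim> (UNIV :: 'u set)"
    and M: "left_module R M" and Msmall: "carrier M \<lesssim> (UNIV :: 'u set)"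
  shows "\<exists>P \<epsilon>. projective_resolution U R M P \<epsilon>"
proof -
  interpret M: left_module R M by fact
  obtain M' :: "('r, 'u) module" and c e where M': "left_module R M'" and c: "c \<in> mod_hom R M M'"
    and e: "e \<in> mod_hom R M' M" and ec: "\<And>x. x \<in> carrier M \<Longrightarrow> e (c x) = x"
    and car: "carrier M' = c ` carrier M"
    using copy_exists[OF M Msmall] by metis
  obtain F0 :: "('r, 'u) module" and \<epsilon>' where F0: "projective_module U R F0" and \<epsilon>': "\<epsilon>' \<in> mod_hom R F0 M'"
    and onto: "\<epsilon>' ` carrier F0 = carrier M'"
    using projective_cover[OF inf small M', where U=U] by metis
  define \<epsilon> where "\<epsilon> x = e (\<epsilon>' x)" for x
  have \<epsilon>: "\<epsilon> \<in> mod_hom R F0 M" unfolding \<epsilon>_def by (rule mod_hom_comp[OF \<epsilon>' e])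
  have \<epsilon>_onto: "\<epsilon> ` carrier F0 = carrier M"
  proof -
    have "\<epsilon> ` carrier F0 = e ` carrier M'" unfolding onto[symmetric] \<epsilon>_def by auto
    also have "\<dots> = carrier M" unfolding car by (force simp: ec)
    finally show ?thesis .
  qed
  have mod: "left_module R F" if "projective_module U R F" for F :: "('r, 'u) module"
    using that by (simp add: projective_module_def)
  have cover: "\<exists>(F' :: ('r, 'u) module) d. projective_module U R F' \<and> d \<in> mod_hom R F' F \<and> d ` carrier F' = S"
    if F: "projective_module U R F" and S: "submodule S R F" for F :: "('r, 'u) module" and S
  proof -
    obtain F' :: "('r, 'u) module" and d where F': "projective_module U R F'"
      "d \<in> mod_hom R F' (F\<lparr>carrier := S\<rparr>)" "d ` carrier F' = S"
      by (rule projective_cover[OF inf small left_module.left_module_sub[OF mod[OF F] S], where U=U]) auto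
    then show ?thesis using mod_hom_from_sub[OF F'(2) submoduleD(1)[OF S]] by blast
  qed
  obtain Q d where Q: "Q 0 = F0" "\<And>n. projective_module U R (Q n)"
    "\<And>n. d n \<in> mod_hom R (Q (Suc n)) (Q n)"
    "d 0 ` carrier (Q 1) = {x \<in> carrier F0. \<epsilon> x = \<zero>\<^bsub>M\<^esub>}"
    "\<And>n. d (Suc n) ` carrier (Q (Suc (Suc n))) = {x \<in> carrier (Q (Suc n)). d n x = \<zero>\<^bsub>Q n\<^esub>}"
    by (rule resolution_sequence[of "projective_module U R" R, OF mod cover F0
        submodule_kernel[OF mod[OF F0] M \<epsilon>]]) auto
  define Z where "Z = F0\<lparr>carrier := {\<zero>\<^bsub>F0\<^esub>}\<rparr>"
  interpret F0: left_module R F0 by (rule mod[OF F0])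
  have Z: "left_module R Z" unfolding Z_def by (rule F0.left_module_sub[OF F0.submodule_zero])
  interpret Z: left_module R Z by (rule Z)
  have Zc: "carrier Z = {\<zero>\<^bsub>Z\<^esub>}" by (simp add: Z_def)
  have Zproj: "projective_module U R Z"
    unfolding projective_module_def
  proof (intro conjI Z allI impI, elim conjE)
    fix A B :: "('r, 'u) module" and g f
    assume *: "left_module R A" "left_module R B" "g \<in> mod_hom R A B" "f \<in> mod_hom R Z B"
    show "\<exists>h\<in>mod_hom R Z A. \<forall>x\<in>carrier Z. g (h x) = f x"
      by (rule bexI[OF _ mod_hom_const_zero[OF *(1)]])
        (simp add: Zc mod_hom_zero[OF *(1-3)] mod_hom_zero[OF Z *(2,4)])
  qed
  \<comment> \<open>\<open>d n\<close> becomes the differential out of degree n + 1. Out of degrees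
    at most 0 the differential is the zero map into \<open>Z\<close>, which fills all negative
    degrees.\<close>
  define X where "X = \<lparr>cobj = (\<lambda>n. if n < 0 then Z else Q (nat n)),
     cdiff = (\<lambda>n x. if n \<le> 0 then \<zero>\<^bsub>Z\<^esub> else d (nat n - 1) x)\<rparr>"
  have obj: "cobj X (int n) = Q n" for n by (simp add: X_def)
  have neg: "cobj X n = Z" if "n < 0" for n using that by (simp add: X_def)
  have diff: "cdiff X (1 + int n) x = d n x" for n x by (simp add: X_def nat_add_distrib)
  have diff0: "cdiff X n x = \<zero>\<^bsub>Z\<^esub>" if "n \<le> 0" for n x using that by (simp add: X_def)
  have proj: "projective_module U R (cobj X n)" for n using Q(2) Zproj by (simp add: X_def)
  have hom: "cdiff X n \<in> mod_hom R (cobj X n) (cobj X (n - 1))" for n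
  proof (cases "n \<le> 0")
    case True
    then have "cdiff X n = (\<lambda>x. \<zero>\<^bsub>Z\<^esub>)" "cobj X (n - 1) = Z" using diff0 neg by (auto simp: fun_eq_iff)
    then show ?thesis using mod_hom_const_zero[OF Z] by simp
  next
    case False
    then obtain k where k: "n = 1 + int k" using zero_less_imp_eq_int[of n] by (metis add.commute gr0_implies_Suc int_Suc not_less)
    have "cobj X n = Q (Suc k)" using obj[of "Suc k"] k by simp
    moreover have "cdiff X n = d k" using diff k by (simp add: fun_eq_iff)
    ultimately show ?thesis using Q(3)[of k] obj[of k] k by simp
  qed
  have exact: "cycles X (1 + int k) = boundaries X (1 + int k)" for k
  proof -
    have o: "cobj X (1 + int k) = Q (Suc k)" "cobj X (2 + int k) = Q (Suc (Suc k))"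
      using obj[of "Suc k"] obj[of "Suc (Suc k)"] by simp_all
    have "cdiff X (2 + int k) x = d (Suc k) x" for x using diff[of "Suc k"] by simp
    then show ?thesis
      unfolding cycles_def boundaries_def using Q(5)[of k] o obj[of k] diff[of k]
      by (simp add: add.commute)
  qed
  have b0: "boundaries X 0 = {x \<in> carrier F0. \<epsilon> x = \<zero>\<^bsub>M\<^esub>}"
    unfolding boundaries_def using Q(4) obj[of 1] diff[of 0] by simp
  have sq: "cdiff X (n - 1) (cdiff X n x) = \<zero>\<^bsub>cobj X (n - 2)\<^esub>" if x: "x \<in> carrier (cobj X n)" for n x
  proof (cases "n \<le> 1")
    case True
    then show ?thesis using diff0 neg by simp
  next
    case False
    define k where "k = nat (n - 2)"
    have k: "n = 2 + int k" using False by (simp add: k_def)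
    have "cdiff X n x \<in> boundaries X (1 + int k)"
      unfolding boundaries_def using x k by (simp add: add.commute)
    then have "cdiff X n x \<in> cycles X (1 + int k)" using exact by simp
    then show ?thesis using k by (simp add: cycles_def add.commute)
  qed
  have "projective_resolution U R M X \<epsilon>"
    unfolding projective_resolution_def is_complex_def
  proof (intro conjI allI impI ballI)
    show "cycles X n = boundaries X n" if "n > 0" for n
      using exact[of "nat (n - 1)"] that by simp
    show "trivial_module (cobj X n)" if "n < 0" for n using that neg by (simp add: trivial_module_def Zc)
    show "\<epsilon> \<in> mod_hom R (cobj X 0) M" "\<epsilon> ` carrier (cobj X 0) = carrier M"
      "{x \<in> carrier (cobj X 0). \<epsilon> x = \<zero>\<^bsub>M\<^esub>} = boundaries X 0"
      using obj[of 0] Q(1) \<epsilon> \<epsilon>_onto b0 by simp_all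
  qed (use proj mod hom sq in auto)
  then show ?thesis by blast
qed

section \<open>The duality D on modules of finite length over an Artin algebra\<close>

subsection \<open>Opposite algebras and restriction of scalars\<close>

text \<open>\<open>op_ring (op_ring R) = R\<close> is an equality of records, so whatever is proved
  for \<open>R\<close> transfers to the opposite algebra and back by rewriting.\<close>

lemma op_ring_simps [simp]:
  "carrier (op_ring R) = carrier R" "one (op_ring R) = one R" "zero (op_ring R) = zero R"
  "add (op_ring R) = add R" "mult (op_ring R) = (\<lambda>x y. y \<otimes>\<^bsub>R\<^esub> x)" "op_ring (op_ring R) = R"
  by (simp_all add: op_ring_def)

lemma smult_op_ring [simp]: "smult (op_ring (R :: ('k, 'r) module)) = smult R"
  by (simp add: op_ring_def)

lemma (in ring) ring_op: "ring (op_ring R)"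
proof (rule ringI)
  show "abelian_group (op_ring R)"
  proof (rule abelian_groupI)
    fix x assume "x \<in> carrier (op_ring R)"
    then show "\<exists>y\<in>carrier (op_ring R). y \<oplus>\<^bsub>op_ring R\<^esub> x = \<zero>\<^bsub>op_ring R\<^esub>"
      by (intro bexI[of _ "\<ominus> x"]) (auto simp: l_neg)
  qed (auto simp: a_ac)
  show "Group.monoid (op_ring R)" by (rule monoidI) (auto simp: m_assoc)
qed (auto simp: l_distr r_distr)

lemma restrict_scalars_simps [simp]:
  "carrier (restrict_scalars R M) = carrier M" "zero (restrict_scalars R M) = zero M"
  "add (restrict_scalars R M) = add M"
  "smult (restrict_scalars R M) = (\<lambda>a x. (a \<odot>\<^bsub>R\<^esub> \<one>\<^bsub>R\<^esub>) \<odot>\<^bsub>M\<^esub> x)"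
  "restrict_scalars R (M\<lparr>carrier := S\<rparr>) = (restrict_scalars R M)\<lparr>carrier := S\<rparr>"
  "restrict_scalars R (direct_power X M) = direct_power X (restrict_scalars R M)"
  by (simp_all add: restrict_scalars_def direct_power_def)

lemma a_inv_restrict_scalars [simp]: "a_inv (restrict_scalars R M) = a_inv M"
  by (simp add: fun_eq_iff a_inv_def m_inv_def)

text \<open>Only the additive data of the two records have to agree, while the scalars may change.
  This carries submodules across restriction of scalars and to the opposite algebra.\<close>

lemma submodule_cong:
  assumes "submodule S K M" "carrier M' = carrier M" "zero M' = zero M" "add M' = add M"
    "\<And>a x. a \<in> carrier K' \<Longrightarrow> x \<in> S \<Longrightarrow> a \<odot>\<^bsub>M'\<^esub> x \<in> S"
  shows "submodule S K' M'"
proof -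
  have "inv\<^bsub>add_monoid M'\<^esub> x = inv\<^bsub>add_monoid M\<^esub> x" for x
    using assms(2-4) by (simp add: m_inv_def)
  moreover have "subgroup S (add_monoid M)" using assms(1) by (simp add: submodule_def)
  ultimately have "subgroup S (add_monoid M')" using assms(2-4) by (simp add: subgroup_def)
  then show ?thesis using assms(5) by (simp add: submodule_def submodule_axioms_def)
qed

context artin_algebra
begin

lemma scalar_closed [simp]: "a \<in> carrier K \<Longrightarrow> a \<odot>\<^bsub>R\<^esub> \<one>\<^bsub>R\<^esub> \<in> carrier R"
  by (simp add: KR.smult_closed)

lemma scalar_mult: "a \<in> carrier K \<Longrightarrow> x \<in> carrier R \<Longrightarrow> (a \<odot>\<^bsub>R\<^esub> \<one>\<^bsub>R\<^esub>) \<otimes>\<^bsub>R\<^esub> x = a \<odot>\<^bsub>R\<^esub> x"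
  "a \<in> carrier K \<Longrightarrow> x \<in> carrier R \<Longrightarrow> x \<otimes>\<^bsub>R\<^esub> (a \<odot>\<^bsub>R\<^esub> \<one>\<^bsub>R\<^esub>) = a \<odot>\<^bsub>R\<^esub> x"
  using smult_mult_left[of a "\<one>\<^bsub>R\<^esub>" x] smult_mult_right[of a x "\<one>\<^bsub>R\<^esub>"] by auto

lemma artin_algebra_op: "artin_algebra K (op_ring R)"
proof -
  have sub: "submodule S K (op_ring R) \<longleftrightarrow> submodule S K R" for S
  proof
    assume *: "submodule S K (op_ring R)"
    show "submodule S K R"
      by (rule submodule_cong[OF *]) (use submoduleD(5)[OF *] in auto)
  next
    assume *: "submodule S K R"
    show "submodule S K (op_ring R)"
      by (rule submodule_cong[OF *]) (use submoduleD(5)[OF *] in auto)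
  qed
  have "module K (op_ring R)"
    using KR.module_axioms ring.is_abelian_group[OF R.ring_op]
    by (simp add: module_def module_axioms_def)
  moreover have "fin_gen_module K (op_ring R)" using fin_gen by (simp add: fin_gen_module_def sub)
  ultimately show ?thesis
    using R.ring_op artinian smult_mult_left smult_mult_right
    by (simp add: artin_algebra_def artin_algebra_axioms_def)
qed

lemma left_module_restrict:
  assumes "left_module R M"
  shows "left_module K (restrict_scalars R M)"
proof -
  interpret M: left_module R M by fact
  have "abelian_group (restrict_scalars R M)"
  proof (rule abelian_groupI)
    fix x assume "x \<in> carrier (restrict_scalars R M)"
    then show "\<exists>y\<in>carrier (restrict_scalars R M). y \<oplus>\<^bsub>restrict_scalars R M\<^esub> x = \<zero>\<^bsub>restrict_scalars R M\<^esub>"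
      by (intro bexI[of _ "\<ominus>\<^bsub>M\<^esub> x"]) (auto simp: M.M.l_neg)
  qed (auto simp: M.M.a_ac)
  moreover have "((a \<otimes>\<^bsub>K\<^esub> b) \<odot>\<^bsub>R\<^esub> \<one>\<^bsub>R\<^esub>) \<odot>\<^bsub>M\<^esub> x = (a \<odot>\<^bsub>R\<^esub> \<one>\<^bsub>R\<^esub>) \<odot>\<^bsub>M\<^esub> ((b \<odot>\<^bsub>R\<^esub> \<one>\<^bsub>R\<^esub>) \<odot>\<^bsub>M\<^esub> x)"
    if "a \<in> carrier K" "b \<in> carrier K" "x \<in> carrier M" for a b x
    using that by (simp add: M.smult_assoc[symmetric] scalar_mult(1) KR.smult_assoc1)
  moreover have "\<one>\<^bsub>K\<^esub> \<odot>\<^bsub>R\<^esub> \<one>\<^bsub>R\<^esub> = \<one>\<^bsub>R\<^esub>" by (rule KR.smult_one) simp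
  ultimately show ?thesis
    unfolding left_module_def left_module_axioms_def
    using KR.R.ring_axioms by (simp add: KR.smult_l_distr M.smult_l_distr M.smult_r_distr)
qed

lemma submodule_restrict: "submodule S R M \<Longrightarrow> submodule S K (restrict_scalars R M)"
  by (rule submodule_cong[of S R M]) (auto intro: submoduleD(5))

lemma mod_hom_restrict:
  "f \<in> mod_hom R A B \<Longrightarrow> f \<in> mod_hom K (restrict_scalars R A) (restrict_scalars R B)"
  by (auto simp: mod_hom_def)

lemma scalar_commute:
  assumes "left_module R M" "r \<in> carrier R" "a \<in> carrier K" "x \<in> carrier M"
  shows "r \<odot>\<^bsub>M\<^esub> ((a \<odot>\<^bsub>R\<^esub> \<one>\<^bsub>R\<^esub>) \<odot>\<^bsub>M\<^esub> x) = (a \<odot>\<^bsub>R\<^esub> \<one>\<^bsub>R\<^esub>) \<odot>\<^bsub>M\<^esub> (r \<odot>\<^bsub>M\<^esub> x)"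
proof -
  interpret M: left_module R M by fact
  show ?thesis using assms by (simp add: M.smult_assoc[symmetric] scalar_mult)
qed

end

subsection \<open>Finitely generated modules have finite length\<close>

text \<open>Dual to the case of intersections: the intersection of \<open>B\<close> with an
  intermediate \<open>C\<close> is \<open>A\<close> or \<open>B\<close>, and the modular law
  recovers \<open>C\<close> as its sum with \<open>S\<close>.\<close>

lemma simple_step_add:
  assumes M: "left_module K M" and S: "submodule S K M" and s: "simple_step K M A B"
  shows "simple_step K M (S <+>\<^bsub>M\<^esub> A) (S <+>\<^bsub>M\<^esub> B)"
proof -
  interpret M: left_module K M by fact
  have A: "submodule A K M" and B: "submodule B K M" and AB: "A \<subseteq> B"
    and cov: "\<And>D. submodule D K M \<Longrightarrow> A \<subseteq> D \<Longrightarrow> D \<subseteq> B \<Longrightarrow> D = A \<or> D = B"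
    using s by (auto simp: simple_step_def)
  have "C = S <+>\<^bsub>M\<^esub> A \<or> C = S <+>\<^bsub>M\<^esub> B"
    if C: "submodule C K M" "S <+>\<^bsub>M\<^esub> A \<subseteq> C" "C \<subseteq> S <+>\<^bsub>M\<^esub> B" for C
  proof -
    have up: "S \<subseteq> C" "A \<subseteq> C" using M.submodule_add_upper[OF S A] C(2) by auto
    have "B \<inter> C = A \<or> B \<inter> C = B" using up AB by (intro cov M.submodule_Int B C(1)) auto
    moreover have "C = (B \<inter> C) <+>\<^bsub>M\<^esub> S"
      using modular_law[OF M S C(1) B up(1)] C(3) M.set_add_commute[of S B] submoduleD(1)[OF S] submoduleD(1)[OF B]
      by auto
    ultimately show ?thesis
      using M.set_add_commute[of S B] M.set_add_commute[of S A] submoduleD(1)[OF S] submoduleD(1)[OF B]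
        submoduleD(1)[OF A] by auto
  qed
  moreover have "S <+>\<^bsub>M\<^esub> A \<subseteq> S <+>\<^bsub>M\<^esub> B"
    using M.submodule_add_upper[OF S B] AB by (intro M.submodule_add_least M.submodule_add S B) auto
  ultimately show ?thesis
    using M.submodule_add S A B by (auto simp: simple_step_def)
qed

lemma fin_len_add:
  assumes M: "left_module K M" and S: "submodule S K M"
  shows "fin_len K M A B \<Longrightarrow> fin_len K M (S <+>\<^bsub>M\<^esub> A) (S <+>\<^bsub>M\<^esub> B)"
  by (induction rule: fin_len.induct)
    (use assms in \<open>auto intro: fin_len.intros left_module.submodule_add simple_step_add\<close>)

text \<open>Length is measured over \<open>K\<close>, but the span of generators over
  \<open>R\<close> has to be an \<open>R\<close>-submodule. The predicate \<open>P\<close> carries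
  this additional property through the induction on generators.\<close>

lemma fin_len_span:
  assumes M: "left_module K M" and B: "finite B"
    and cyc: "\<And>x. x \<in> B \<Longrightarrow> \<exists>C. P C \<and> x \<in> C \<and> fin_len K M {\<zero>\<^bsub>M\<^esub>} C"
    and zero: "P {\<zero>\<^bsub>M\<^esub>}" and add: "\<And>A C. P A \<Longrightarrow> P C \<Longrightarrow> P (A <+>\<^bsub>M\<^esub> C)"
  shows "\<exists>S. P S \<and> B \<subseteq> S \<and> fin_len K M {\<zero>\<^bsub>M\<^esub>} S"
  using B cyc
proof (induction B rule: finite_induct)
  case empty
  then show ?case using zero fin_len.refl[OF left_module.submodule_zero[OF M]] by auto
next
  case (insert x B)
  interpret M: left_module K M by fact
  obtain S where S: "P S" "B \<subseteq> S" "fin_len K M {\<zero>\<^bsub>M\<^esub>} S" using insert by auto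
  obtain C where C: "P C" "x \<in> C" "fin_len K M {\<zero>\<^bsub>M\<^esub>} C" using insert.prems by auto
  have sub: "submodule S K M" "submodule C K M" using S(3) C(3) fin_len_submodule by auto
  have "S <+>\<^bsub>M\<^esub> {\<zero>\<^bsub>M\<^esub>} = S"
    using M.submodule_add_upper(1)[OF sub(1) M.submodule_zero] submoduleD(3)[OF sub(1)]
      M.submodule_add_least[OF sub(1), of S "{\<zero>\<^bsub>M\<^esub>}"] by auto
  then have "fin_len K M {\<zero>\<^bsub>M\<^esub>} (S <+>\<^bsub>M\<^esub> C)"
    using fin_len_trans[OF fin_len_add[OF M sub(1) C(3)]] S(3) by simp
  moreover have "insert x B \<subseteq> S <+>\<^bsub>M\<^esub> C" using M.submodule_add_upper[OF sub] S C by auto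
  ultimately show ?case using add[OF S(1) C(1)] by blast
qed

locale artin_dual = artinian_hull U K E + AR?: artin_algebra K R
  for U :: "'u itself" and K :: "'k ring" (structure) and E :: "('k, 'e) module"
    and R :: "('k, 'r) module"
begin

abbreviation "dual M \<equiv> dual_module K R E M"
abbreviation "restr M \<equiv> restrict_scalars R M"

lemma op: "artin_dual U K E (op_ring R)"
  by (intro artin_dual.intro artinian_hull_axioms artin_algebra_op)

lemma R_finite_length: "finite_length K (restr (regular_module R))"
proof -
  let ?M = "restr (regular_module R)"
  interpret M: left_module K ?M by (rule left_module_restrict[OF R.left_module_regular])
  obtain B where B: "finite B" "B \<subseteq> carrier R" "\<Inter> {S. submodule S K R \<and> B \<subseteq> S} = carrier R"
    using fin_gen by (auto simp: fin_gen_module_def)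
  have "\<exists>S. True \<and> B \<subseteq> S \<and> fin_len K ?M {\<zero>\<^bsub>?M\<^esub>} S"
  proof (rule fin_len_span[OF M.left_module_axioms B(1)])
    fix x assume "x \<in> B"
    then have x: "x \<in> carrier ?M" using B by auto
    let ?f = "\<lambda>a. a \<odot>\<^bsub>?M\<^esub> x"
    have f: "?f \<in> mod_hom K (regular_module K) ?M"
      using x by (intro mod_homI) (auto simp: M.smult_l_distr[simplified] M.smult_assoc[simplified])
    have "fin_len K ?M {\<zero>\<^bsub>?M\<^esub>} (?f ` carrier K)"
      using fin_len_image[OF reg.left_module_axioms M.left_module_axioms f K_finite_length]
        mod_hom_zero[OF reg.left_module_axioms M.left_module_axioms f] by simp
    moreover have "x \<in> ?f ` carrier K" using M.smult_one[OF x] by (metis K.one_closed imageI)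
    ultimately show "\<exists>C. True \<and> x \<in> C \<and> fin_len K ?M {\<zero>\<^bsub>?M\<^esub>} C"
      by (intro exI[of _ "?f ` carrier K"] conjI TrueI)
  qed auto
  then obtain S where S: "B \<subseteq> S" "fin_len K ?M {\<zero>\<^bsub>?M\<^esub>} S" by auto
  have sub: "submodule S K ?M" using fin_len_submodule[OF S(2)] by simp
  have "submodule S K R"
    by (rule submodule_cong[OF sub])
      (use submoduleD(2,5)[OF sub] scalar_mult(1) in \<open>auto\<close>)
  then have "carrier R \<subseteq> S" using B S by blast
  then have "S = carrier ?M" using submoduleD(1)[OF sub] by auto
  then show ?thesis using S(2) by simp
qed

lemma fin_gen_finite_length:
  assumes M: "left_module R M" and fg: "fin_gen_module R M"
  shows "finite_length K (restr M)"
proof -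
  interpret M: left_module R M by fact
  have KM: "left_module K (restr M)" by (rule left_module_restrict[OF M])
  obtain B where B: "finite B" "B \<subseteq> carrier M" "\<Inter> {S. submodule S R M \<and> B \<subseteq> S} = carrier M"
    using fg by (auto simp: fin_gen_module_def)
  have "\<exists>S. submodule S R M \<and> B \<subseteq> S \<and> fin_len K (restr M) {\<zero>\<^bsub>restr M\<^esub>} S"
  proof (rule fin_len_span[OF KM B(1)])
    fix x assume "x \<in> B"
    then have x: "x \<in> carrier M" using B by auto
    let ?f = "\<lambda>a. a \<odot>\<^bsub>M\<^esub> x"
    have f: "?f \<in> mod_hom R (regular_module R) M"
      using x by (intro mod_homI) (auto simp: M.smult_l_distr M.smult_assoc)
    have "fin_len K (restr M) {\<zero>\<^bsub>restr M\<^esub>} (?f ` carrier R)"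
      using fin_len_image[OF left_module_restrict[OF R.left_module_regular] KM mod_hom_restrict[OF f] R_finite_length]
        x by simp
    moreover have "x \<in> ?f ` carrier R" using M.smult_one[OF x] by (metis R.one_closed imageI)
    moreover have "submodule (?f ` carrier R) R M" by (rule M.submodule_cyclic[OF x])
    ultimately show "\<exists>C. submodule C R M \<and> x \<in> C \<and> fin_len K (restr M) {\<zero>\<^bsub>restr M\<^esub>} C" by blast
  next
    have "A <+>\<^bsub>restr M\<^esub> C = A <+>\<^bsub>M\<^esub> C" for A C by (simp add: set_add_def')
    then show "submodule (A <+>\<^bsub>restr M\<^esub> C) R M" if "submodule A R M" "submodule C R M" for A C
      using M.submodule_add[OF that] by simp
  qed (use M.submodule_zero in simp)
  then obtain S where S: "submodule S R M" "B \<subseteq> S" "fin_len K (restr M) {\<zero>\<^bsub>restr M\<^esub>} S" by auto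
  then have "S = carrier M" using B submoduleD(1)[OF S(1)] by blast
  then show ?thesis using S(3) by simp
qed

lemma finite_length_free: "finite_length K (restr (free_module {..<m::nat} R))"
  using finite_length_direct_power[OF left_module_restrict[OF R.left_module_regular] R_finite_length]
  by simp

text \<open>The source of the size bounds for modules of function type, such as free modules of
  finite rank and duals.\<close>

lemma finite_length_small:
  assumes "left_module R M" "finite_length K (restr M)"
  shows "carrier M \<lesssim> (UNIV :: 'u set)"
  using finite_length_lepoll[OF left_module_restrict[OF assms(1)] universe_infinite K_small assms(2)]
  by simp

lemma finite_length_generators:
  assumes M: "left_module R M" and fl: "finite_length K (restr M)"
  obtains F where "finite F" "F \<subseteq> carrier M" "\<And>S. submodule S R M \<Longrightarrow> F \<subseteq> S \<Longrightarrow> carrier M \<subseteq> S"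
proof -
  obtain F where F: "finite F" "F \<subseteq> carrier M"
    "\<And>S. submodule S K (restr M) \<and> {\<zero>\<^bsub>M\<^esub>} \<subseteq> S \<and> F \<subseteq> S \<Longrightarrow> carrier M \<subseteq> S"
    using fin_len_generators[OF left_module_restrict[OF M] fl] by auto
  have "carrier M \<subseteq> S" if "submodule S R M" "F \<subseteq> S" for S
    by (rule F(3)) (use submodule_restrict[OF that(1)] submoduleD(3)[OF that(1)] that(2) in auto)
  then show ?thesis using that F by blast
qed

lemma finite_length_fin_gen:
  assumes M: "left_module R M" and fl: "finite_length K (restr M)"
  shows "fin_gen_module R M"
proof -
  obtain F where F: "finite F" "F \<subseteq> carrier M" "\<And>S. submodule S R M \<Longrightarrow> F \<subseteq> S \<Longrightarrow> carrier M \<subseteq> S"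
    using finite_length_generators[OF assms] by blast
  have "\<Inter> {S. submodule S R M \<and> F \<subseteq> S} = carrier M"
    using F left_module.submodule_carrier[OF M] by blast
  then show ?thesis using F by (auto simp: fin_gen_module_def)
qed

lemma finite_length_free_cover:
  assumes M: "left_module R M" and fl: "finite_length K (restr M)"
  obtains m :: nat and h where "h \<in> mod_hom R (free_module {..<m} R) M"
    "h ` carrier (free_module {..<m} R) = carrier M"
  using finite_length_generators[OF assms] free_module_nat_cover[OF M] by metis

subsection \<open>The dual module\<close>

lemma dual_carrierD:
  assumes "\<phi> \<in> carrier (dual M)"
  shows "\<phi> \<in> mod_hom K (restr M) E" "\<phi> \<in> extensional (carrier M)"
  using assms by (auto simp: dual_module_def)

lemma dual_ext:
  "\<phi> \<in> carrier (dual M) \<Longrightarrow> \<psi> \<in> carrier (dual M) \<Longrightarrow> (\<And>x. x \<in> carrier M \<Longrightarrow> \<phi> x = \<psi> x) \<Longrightarrow> \<phi> = \<psi>"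
  using dual_carrierD(2) by (metis extensionalityI)

lemma dual_apply:
  assumes "\<phi> \<in> carrier (dual M)"
  shows "x \<in> carrier M \<Longrightarrow> \<phi> x \<in> carrier E"
    "x \<in> carrier M \<Longrightarrow> y \<in> carrier M \<Longrightarrow> \<phi> (x \<oplus>\<^bsub>M\<^esub> y) = \<phi> x \<oplus>\<^bsub>E\<^esub> \<phi> y"
    "a \<in> carrier K \<Longrightarrow> x \<in> carrier M \<Longrightarrow> \<phi> ((a \<odot>\<^bsub>R\<^esub> \<one>\<^bsub>R\<^esub>) \<odot>\<^bsub>M\<^esub> x) = a \<odot>\<^bsub>E\<^esub> \<phi> x"
  using mod_homD[OF dual_carrierD(1)[OF assms]] by auto

lemma dual_simps:
  "x \<in> carrier M \<Longrightarrow> \<zero>\<^bsub>dual M\<^esub> x = \<zero>\<^bsub>E\<^esub>"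
  "x \<in> carrier M \<Longrightarrow> (\<phi> \<oplus>\<^bsub>dual M\<^esub> \<psi>) x = \<phi> x \<oplus>\<^bsub>E\<^esub> \<psi> x"
  "x \<in> carrier M \<Longrightarrow> (r \<odot>\<^bsub>dual M\<^esub> \<phi>) x = \<phi> (r \<odot>\<^bsub>M\<^esub> x)"
  by (simp_all add: dual_module_def)

lemma restrict_in_dual:
  assumes M: "left_module R M" and \<phi>: "\<phi> \<in> mod_hom K (restr M) E"
  shows "restrict \<phi> (carrier M) \<in> carrier (dual M)"
proof -
  have "restrict \<phi> (carrier M) \<in> mod_hom K (restr M) E"
    by (rule mod_hom_cong[OF left_module_restrict[OF M] \<phi>]) simp
  then show ?thesis by (simp add: dual_module_def)
qed

lemma left_module_dual:
  assumes M: "left_module R M"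
  shows "left_module (op_ring R) (dual M)"
proof -
  interpret M: left_module R M by fact
  let ?D = "dual M"
  have dualI: "(\<lambda>x\<in>carrier M. g x) \<in> carrier ?D"
    if "\<And>x. x \<in> carrier M \<Longrightarrow> g x \<in> carrier E"
      "\<And>x y. x \<in> carrier M \<Longrightarrow> y \<in> carrier M \<Longrightarrow> g (x \<oplus>\<^bsub>M\<^esub> y) = g x \<oplus>\<^bsub>E\<^esub> g y"
      "\<And>a x. a \<in> carrier K \<Longrightarrow> x \<in> carrier M \<Longrightarrow> g ((a \<odot>\<^bsub>R\<^esub> \<one>\<^bsub>R\<^esub>) \<odot>\<^bsub>M\<^esub> x) = a \<odot>\<^bsub>E\<^esub> g x" for g
    by (rule restrict_in_dual[OF M]) (use that in \<open>auto intro: mod_homI\<close>)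
  have zero: "\<zero>\<^bsub>?D\<^esub> \<in> carrier ?D"
    using dualI[of "\<lambda>x. \<zero>\<^bsub>E\<^esub>"] by (simp add: dual_module_def)
  have add: "\<phi> \<oplus>\<^bsub>?D\<^esub> \<psi> \<in> carrier ?D" if \<phi>: "\<phi> \<in> carrier ?D" and \<psi>: "\<psi> \<in> carrier ?D" for \<phi> \<psi>
    using dualI[of "\<lambda>x. \<phi> x \<oplus>\<^bsub>E\<^esub> \<psi> x"] dual_apply[OF \<phi>] dual_apply[OF \<psi>]
    by (simp add: dual_module_def E.smult_r_distr E.M.a_ac)
  have smult: "r \<odot>\<^bsub>?D\<^esub> \<phi> \<in> carrier ?D" if \<phi>: "\<phi> \<in> carrier ?D" and r: "r \<in> carrier R" for \<phi> r
    using dualI[of "\<lambda>x. \<phi> (r \<odot>\<^bsub>M\<^esub> x)"] dual_apply[OF \<phi>] r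
    by (simp add: dual_module_def M.smult_r_distr scalar_commute[OF M])
  have ap: "\<phi> x \<in> carrier E" if "\<phi> \<in> carrier ?D" "x \<in> carrier M" for \<phi> x
    by (rule dual_apply(1)[OF that])
  have "abelian_group ?D"
  proof (rule abelian_groupI)
    fix \<phi> assume \<phi>: "\<phi> \<in> carrier ?D"
    let ?\<psi> = "\<lambda>x\<in>carrier M. \<ominus>\<^bsub>E\<^esub> \<phi> x"
    have \<psi>: "?\<psi> \<in> carrier ?D"
      using dual_apply[OF \<phi>] by (intro dualI) (auto simp: E.M.minus_add E.smult_r_minus)
    have "?\<psi> \<oplus>\<^bsub>?D\<^esub> \<phi> = \<zero>\<^bsub>?D\<^esub>"
      by (rule dual_ext[OF add[OF \<psi> \<phi>] zero]) (use dual_apply[OF \<phi>] in \<open>simp add: dual_simps E.M.l_neg\<close>)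
    then show "\<exists>\<psi>\<in>carrier ?D. \<psi> \<oplus>\<^bsub>?D\<^esub> \<phi> = \<zero>\<^bsub>?D\<^esub>" using \<psi> by blast
  qed (use zero add ap in \<open>auto intro!: dual_ext[where M = M] simp: dual_simps E.M.a_ac\<close>)
  moreover have "ring (op_ring R)" by (rule R.ring_op)
  ultimately show ?thesis
    unfolding left_module_def left_module_axioms_def
    using smult add dual_apply(2)[of _ M]
    by (auto intro!: dual_ext[where M = M] simp: dual_simps M.smult_l_distr M.smult_assoc)
qed

lemma restrict_dual_smult:
  assumes "left_module R M" "a \<in> carrier K" "\<phi> \<in> carrier (dual M)" "x \<in> carrier M"
  shows "(a \<odot>\<^bsub>restrict_scalars (op_ring R) (dual M)\<^esub> \<phi>) x = a \<odot>\<^bsub>E\<^esub> \<phi> x"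
  using assms dual_apply(3)[OF assms(3,2,4)] by (simp add: dual_simps)

text \<open>The annihilator of \<open>B\<close> in D(M). Being order-reversing, it turns a
  composition series of \<open>M\<close> into one of D(M).\<close>

definition perp where
  "perp M B = {\<phi> \<in> carrier (dual M). \<forall>b\<in>B. \<phi> b = \<zero>\<^bsub>E\<^esub>}"

lemma perp_submodule:
  assumes M: "left_module R M" and B: "B \<subseteq> carrier M"
  shows "submodule (perp M B) K (restrict_scalars (op_ring R) (dual M))"
proof -
  interpret op: artin_algebra K "op_ring R" by (rule artin_algebra_op)
  let ?D = "restrict_scalars (op_ring R) (dual M)"
  interpret D: left_module K ?D by (rule op.left_module_restrict[OF left_module_dual[OF M]])
  show ?thesis
  proof (rule D.submoduleI)
    show "\<zero>\<^bsub>?D\<^esub> \<in> perp M B"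
      using D.M.zero_closed B by (auto simp: perp_def dual_simps subset_iff)
    show "\<phi> \<oplus>\<^bsub>?D\<^esub> \<psi> \<in> perp M B" if "\<phi> \<in> perp M B" "\<psi> \<in> perp M B" for \<phi> \<psi>
      using that D.M.a_closed[of \<phi> \<psi>] B by (auto simp: perp_def dual_simps subset_iff)
    show "a \<odot>\<^bsub>?D\<^esub> \<phi> \<in> perp M B" if "a \<in> carrier K" "\<phi> \<in> perp M B" for a \<phi>
    proof -
      have "(a \<odot>\<^bsub>?D\<^esub> \<phi>) b = \<zero>\<^bsub>E\<^esub>" if "b \<in> B" for b
        using restrict_dual_smult[OF M \<open>a \<in> carrier K\<close>, of \<phi> b] \<open>\<phi> \<in> perp M B\<close> \<open>a \<in> carrier K\<close> that B
        by (auto simp: perp_def)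
      then show ?thesis using that D.smult_closed[of a \<phi>] by (auto simp: perp_def)
    qed
  qed (auto simp: perp_def)
qed

text \<open>Functionals that kill \<open>A\<close> are proportional on \<open>B\<close> by
  \<open>simple_step_functional\<close>. So one functional in \<open>C\<close> that does not kill
  \<open>B\<close> yields every functional that kills \<open>A\<close>, up to a summand in
  \<open>perp M B\<close>.\<close>

lemma simple_step_perp:
  assumes M: "left_module R M" and s: "simple_step K (restr M) A B"
  shows "simple_step K (restrict_scalars (op_ring R) (dual M)) (perp M B) (perp M A)"
proof -
  interpret op: artin_algebra K "op_ring R" by (rule artin_algebra_op)
  let ?D = "restrict_scalars (op_ring R) (dual M)"
  have KM: "left_module K (restr M)" by (rule left_module_restrict[OF M])
  interpret D: left_module K ?D by (rule op.left_module_restrict[OF left_module_dual[OF M]])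
  have A: "A \<subseteq> carrier M" and B: "B \<subseteq> carrier M" and AB: "A \<subseteq> B"
    using s submoduleD(1) by (auto simp: simple_step_def dest!: submoduleD(1))
  have "C = perp M B \<or> C = perp M A"
    if C: "submodule C K ?D" "perp M B \<subseteq> C" "C \<subseteq> perp M A" for C
  proof (cases "C \<subseteq> perp M B")
    case False
    then obtain \<phi> b0 where \<phi>: "\<phi> \<in> C" "b0 \<in> B" "\<phi> b0 \<noteq> \<zero>\<^bsub>E\<^esub>"
      using C(3) by (auto simp: perp_def)
    have \<phi>A: "\<phi> \<in> carrier (dual M)" "\<And>y. y \<in> A \<Longrightarrow> \<phi> y = \<zero>\<^bsub>E\<^esub>"
      using \<phi>(1) C(3) by (auto simp: perp_def)
    have "\<psi> \<in> C" if "\<psi> \<in> perp M A" for \<psi>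
    proof -
      have \<psi>: "\<psi> \<in> carrier (dual M)" "\<And>y. y \<in> A \<Longrightarrow> \<psi> y = \<zero>\<^bsub>E\<^esub>"
        using that by (auto simp: perp_def)
      obtain a where a: "a \<in> carrier K" "\<And>b. b \<in> B \<Longrightarrow> \<psi> b = a \<odot>\<^bsub>E\<^esub> \<phi> b"
        using simple_step_functional[OF KM s dual_carrierD(1)[OF \<phi>A(1)] \<phi>A(2)
            dual_carrierD(1)[OF \<psi>(1)] \<psi>(2) \<phi>(2,3)] by blast
      let ?\<chi> = "\<psi> \<ominus>\<^bsub>?D\<^esub> a \<odot>\<^bsub>?D\<^esub> \<phi>"
      have a\<phi>: "a \<odot>\<^bsub>?D\<^esub> \<phi> \<in> carrier ?D" using D.smult_closed[OF a(1), of \<phi>] \<phi>A(1) by simp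
      have eq: "?\<chi> \<oplus>\<^bsub>?D\<^esub> a \<odot>\<^bsub>?D\<^esub> \<phi> = \<psi>"
        using a\<phi> \<psi>(1) by (intro D.diff_add_cancel) auto
      have \<chi>: "?\<chi> \<in> carrier ?D" using a\<phi> \<psi>(1) by (intro D.M.minus_closed) auto
      have "?\<chi> b = \<zero>\<^bsub>E\<^esub>" if b: "b \<in> B" for b
      proof -
        have bM: "b \<in> carrier M" using b B by auto
        have "(?\<chi> \<oplus>\<^bsub>dual M\<^esub> a \<odot>\<^bsub>?D\<^esub> \<phi>) b = \<psi> b" using eq by simp
        then have "?\<chi> b \<oplus>\<^bsub>E\<^esub> a \<odot>\<^bsub>E\<^esub> \<phi> b = a \<odot>\<^bsub>E\<^esub> \<phi> b"
          using restrict_dual_smult[OF M a(1) \<phi>A(1) bM] a(2)[OF b] dual_simps(2)[OF bM] by simp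
        moreover have "?\<chi> b \<in> carrier E" using dual_apply(1)[of ?\<chi> M b] \<chi> bM by simp
        moreover have "a \<odot>\<^bsub>E\<^esub> \<phi> b \<in> carrier E" using a(1) dual_apply(1)[OF \<phi>A(1) bM] by simp
        ultimately show ?thesis by (metis E.M.add.r_cancel_one)
      qed
      then have "?\<chi> \<in> C" using C(2) \<chi> by (auto simp: perp_def)
      then have "?\<chi> \<oplus>\<^bsub>?D\<^esub> a \<odot>\<^bsub>?D\<^esub> \<phi> \<in> C"
        by (intro submoduleD(4)[OF C(1)] submoduleD(5)[OF C(1) a(1) \<phi>(1)])
      then show ?thesis using eq by simp
    qed
    then show ?thesis using C(3) by blast
  qed (use C in auto)
  then show ?thesis
    using perp_submodule[OF M A] perp_submodule[OF M B] AB
    by (auto simp: simple_step_def perp_def)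
qed

lemma fin_len_perp:
  assumes M: "left_module R M"
  shows "fin_len K (restr M) A B \<Longrightarrow>
    fin_len K (restrict_scalars (op_ring R) (dual M)) (perp M B) (perp M A)"
proof (induction rule: fin_len.induct)
  case (refl A)
  from submoduleD(1)[OF this] show ?case by (intro fin_len.refl perp_submodule[OF M]) simp
next
  case (step A B C)
  then show ?case using fin_len_trans simple_step_fin_len simple_step_perp[OF M] by blast
qed

lemma perp_zero:
  assumes "left_module R M"
  shows "perp M {\<zero>\<^bsub>M\<^esub>} = carrier (dual M)"
  using mod_hom_zero[OF left_module_restrict[OF assms] E.left_module_axioms] dual_carrierD(1)
  by (fastforce simp: perp_def)

lemma perp_carrier:
  assumes "left_module R M"
  shows "perp M (carrier M) = {\<zero>\<^bsub>dual M\<^esub>}"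
proof -
  interpret D: left_module "op_ring R" "dual M" by (rule left_module_dual[OF assms])
  show ?thesis
    using D.M.zero_closed by (auto simp: perp_def dual_simps intro!: dual_ext)
qed

lemma finite_length_dual:
  assumes M: "left_module R M" and fl: "finite_length K (restr M)"
  shows "finite_length K (restrict_scalars (op_ring R) (dual M))"
  using fin_len_perp[OF M fl] by (simp add: perp_zero[OF M] perp_carrier[OF M])

lemma dual_separates:
  assumes M: "left_module R M" and fl: "finite_length K (restr M)"
    and A: "submodule A K (restr M)" and x: "x \<in> carrier M" "x \<notin> A"
  obtains \<phi> where "\<phi> \<in> carrier (dual M)" "\<And>y. y \<in> A \<Longrightarrow> \<phi> y = \<zero>\<^bsub>E\<^esub>" "\<phi> x \<noteq> \<zero>\<^bsub>E\<^esub>"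
proof -
  obtain \<phi> where "\<phi> \<in> mod_hom K (restr M) E" "\<And>y. y \<in> A \<Longrightarrow> \<phi> y = \<zero>\<^bsub>E\<^esub>" "\<phi> x \<noteq> \<zero>\<^bsub>E\<^esub>"
    using functional_exists[OF left_module_restrict[OF M] _ A, of x] finite_length_small[OF M fl] x by auto
  then show ?thesis
    using that[OF restrict_in_dual[OF M]] submoduleD(2)[OF A] x by simp
qed

text \<open>Induction along a composition series of \<open>M\<close>: a functional
  \<open>\<xi>\<close> that vanishes on the annihilator of the larger term agrees, on the
  annihilator of the smaller one, with a multiple of the evaluation at some \<open>c\<close>.
  Subtracting that evaluation leads to the smaller term. For the whole of \<open>M\<close> the
  annihilator is zero, and the condition on \<open>\<xi>\<close> is automatic.\<close>

lemma double_dual: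
  assumes M: "left_module R M" and fl: "finite_length K (restr M)"
    and \<xi>: "\<xi> \<in> mod_hom K (restrict_scalars (op_ring R) (dual M)) E"
  obtains x where "x \<in> carrier M" "\<And>\<phi>. \<phi> \<in> carrier (dual M) \<Longrightarrow> \<xi> \<phi> = \<phi> x"
proof -
  interpret op: artin_algebra K "op_ring R" by (rule artin_algebra_op)
  let ?D = "restrict_scalars (op_ring R) (dual M)"
  interpret M: left_module R M by fact
  have KM: "left_module K (restr M)" by (rule left_module_restrict[OF M])
  have DM: "left_module K ?D" by (rule op.left_module_restrict[OF left_module_dual[OF M]])
  interpret D: left_module K ?D by (rule DM)
  have "\<xi> \<in> mod_hom K ?D E \<Longrightarrow> (\<And>\<phi>. \<phi> \<in> perp M B \<Longrightarrow> \<xi> \<phi> = \<zero>\<^bsub>E\<^esub>) \<Longrightarrow>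
      \<exists>x\<in>carrier M. \<forall>\<phi>\<in>carrier (dual M). \<xi> \<phi> = \<phi> x"
    if "fin_len K (restr M) {\<zero>\<^bsub>M\<^esub>} B" for B \<xi>
    using that
  proof (induction "{\<zero>\<^bsub>M\<^esub>}" B arbitrary: \<xi> rule: fin_len.induct)
    case refl
    have "\<phi> \<in> perp M {\<zero>\<^bsub>M\<^esub>}" if "\<phi> \<in> carrier (dual M)" for \<phi> using that perp_zero[OF M] by simp
    then have "\<xi> \<phi> = \<phi> \<zero>\<^bsub>M\<^esub>" if "\<phi> \<in> carrier (dual M)" for \<phi>
      using refl(3) that by (auto simp: perp_def)
    then show ?case by blast
  next
    case (step B C)
    have B: "submodule B K (restr M)" and C: "submodule C K (restr M)" and BC: "B \<subseteq> C"
      using step.hyps(3) by (auto simp: simple_step_def)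
    show ?case
    proof (cases "C = B")
      case True
      then show ?thesis using step by blast
    next
      case False
      then obtain c where c: "c \<in> C" "c \<notin> B" using BC by auto
      have cM: "c \<in> carrier M" using submoduleD(2)[OF C c(1)] by simp
      obtain \<phi>0 where \<phi>0: "\<phi>0 \<in> carrier (dual M)" "\<And>y. y \<in> B \<Longrightarrow> \<phi>0 y = \<zero>\<^bsub>E\<^esub>" "\<phi>0 c \<noteq> \<zero>\<^bsub>E\<^esub>"
        using dual_separates[OF M fl B cM c(2)] by blast
      have ev: "(\<lambda>\<phi>. \<phi> x) \<in> mod_hom K ?D E" if "x \<in> carrier M" for x
        using that by (intro mod_homI) (auto simp: dual_apply dual_simps)
      \<comment> \<open>\<open>simple_step_functional\<close> is applied to the dual module: the
        step from \<open>perp M C\<close> to \<open>perp M B\<close> is simple, and the evaluation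
        at \<open>c\<close> is nonzero on it because of \<open>\<phi>0\<close>.\<close>
      obtain a where a: "a \<in> carrier K" "\<And>\<phi>. \<phi> \<in> perp M B \<Longrightarrow> \<xi> \<phi> = a \<odot>\<^bsub>E\<^esub> \<phi> c"
      proof (rule simple_step_functional[OF DM simple_step_perp[OF M step.hyps(3)] ev[OF cM] _ step.prems(1)])
        show "\<phi> c = \<zero>\<^bsub>E\<^esub>" if "\<phi> \<in> perp M C" for \<phi> using that c by (auto simp: perp_def)
        show "\<xi> \<phi> = \<zero>\<^bsub>E\<^esub>" if "\<phi> \<in> perp M C" for \<phi> by (rule step.prems(2)[OF that])
        show "\<phi>0 \<in> perp M B" using \<phi>0 by (auto simp: perp_def)
        show "\<phi>0 c \<noteq> \<zero>\<^bsub>E\<^esub>" by fact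
      qed blast
      let ?c = "(a \<odot>\<^bsub>R\<^esub> \<one>\<^bsub>R\<^esub>) \<odot>\<^bsub>M\<^esub> c"
      have ac: "?c \<in> carrier M" using a(1) cM by simp
      have "\<exists>x\<in>carrier M. \<forall>\<phi>\<in>carrier (dual M). \<xi> \<phi> \<ominus>\<^bsub>E\<^esub> \<phi> ?c = \<phi> x"
      proof (rule step.hyps(2))
        show "(\<lambda>\<phi>. \<xi> \<phi> \<ominus>\<^bsub>E\<^esub> \<phi> ?c) \<in> mod_hom K ?D E"
          by (rule mod_hom_subtract[OF DM E.left_module_axioms step.prems(1) ev[OF ac]])
        fix \<phi> assume \<phi>: "\<phi> \<in> perp M B"
        then have "\<phi> ?c = a \<odot>\<^bsub>E\<^esub> \<phi> c" "\<phi> c \<in> carrier E"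
          using dual_apply[of \<phi> M] a(1) cM by (auto simp: perp_def)
        then show "\<xi> \<phi> \<ominus>\<^bsub>E\<^esub> \<phi> ?c = \<zero>\<^bsub>E\<^esub>" using a \<phi> by (simp add: a_minus_def E.M.r_neg)
      qed
      then obtain x where x: "x \<in> carrier M" "\<And>\<phi>. \<phi> \<in> carrier (dual M) \<Longrightarrow> \<xi> \<phi> \<ominus>\<^bsub>E\<^esub> \<phi> ?c = \<phi> x"
        by auto
      have "\<xi> \<phi> = \<phi> (x \<oplus>\<^bsub>M\<^esub> ?c)" if \<phi>: "\<phi> \<in> carrier (dual M)" for \<phi>
      proof -
        have c: "\<xi> \<phi> \<in> carrier E" "\<phi> ?c \<in> carrier E"
          using mod_homD(1)[OF step.prems(1)] dual_apply(1)[OF \<phi> ac] \<phi> by auto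
        have "\<phi> (x \<oplus>\<^bsub>M\<^esub> ?c) = (\<xi> \<phi> \<ominus>\<^bsub>E\<^esub> \<phi> ?c) \<oplus>\<^bsub>E\<^esub> \<phi> ?c"
          using dual_apply(2)[OF \<phi> x(1) ac] x(2)[OF \<phi>] by simp
        also have "\<dots> = \<xi> \<phi>" using c by (simp add: a_minus_def E.M.a_assoc E.M.l_neg)
        finally show ?thesis by simp
      qed
      then show ?thesis using x(1) ac by blast
    qed
  qed
  from this[OF fl[simplified] \<xi>] have "\<exists>x\<in>carrier M. \<forall>\<phi>\<in>carrier (dual M). \<xi> \<phi> = \<phi> x"
    using perp_carrier[OF M] mod_hom_zero[OF DM E.left_module_axioms \<xi>] by simp
  then show ?thesis using that by blast
qed

definition dual_map where
  "dual_map A f = (\<lambda>\<phi>. \<lambda>x\<in>carrier A. \<phi> (f x))"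

lemma dual_map_apply: "x \<in> carrier A \<Longrightarrow> dual_map A f \<phi> x = \<phi> (f x)"
  by (simp add: dual_map_def)

lemma dual_map_hom:
  assumes A: "left_module R A" and B: "left_module R B" and f: "f \<in> mod_hom R A B"
  shows "dual_map A f \<in> mod_hom (op_ring R) (dual B) (dual A)"
proof -
  interpret A: left_module R A by fact
  interpret DA: left_module "op_ring R" "dual A" by (rule left_module_dual[OF A])
  interpret DB: left_module "op_ring R" "dual B" by (rule left_module_dual[OF B])
  have c: "dual_map A f \<phi> \<in> carrier (dual A)" if "\<phi> \<in> carrier (dual B)" for \<phi>
    unfolding dual_map_def
    by (rule restrict_in_dual[OF A mod_hom_comp[OF mod_hom_restrict[OF f] dual_carrierD(1)[OF that]]])
  show ?thesis
    by (rule mod_homI)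
      (use mod_homD[OF f] DB.M.a_closed DB.smult_closed in
        \<open>auto intro!: dual_ext[where M = A] c DA.M.a_closed DA.smult_closed[simplified] simp: dual_simps dual_map_apply\<close>)
qed

end

section \<open>Functionals on R^m (x) B and injectivity of D(R^m)\<close>

subsection \<open>Functionals on direct powers\<close>

lemma finsum_eq_carrier_add:
  "carrier G = carrier H \<Longrightarrow> zero G = zero H \<Longrightarrow> add G = add H \<Longrightarrow> finsum G f A = finsum H f A"
  by (simp add: finsum_def finprod_def)

lemma carrier_direct_power_restrict [simp]:
  "carrier (direct_power X (restrict_scalars R B)) = carrier (direct_power X B)"
  by (simp add: direct_power_def)

text \<open>When the power of \<open>B\<close> stands for the tensor product of a free module with
  \<open>B\<close>, this is the elementary tensor of \<open>q\<close> and \<open>y\<close>.\<close>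

definition scaled_vector :: "('s, 'b) module \<Rightarrow> ('x \<Rightarrow> 's) \<Rightarrow> 'b \<Rightarrow> 'x \<Rightarrow> 'b" where
  "scaled_vector B q y = (\<lambda>a. q a \<odot>\<^bsub>B\<^esub> y)"

lemma mod_hom_finite_sum:
  assumes A: "left_module R A" and B: "left_module R B" and f: "\<And>i. i \<in> T \<Longrightarrow> f i \<in> mod_hom R A B"
  shows "(\<lambda>x. \<Oplus>\<^bsub>B\<^esub>i\<in>T. f i x) \<in> mod_hom R A B"
proof -
  interpret A: left_module R A by fact
  interpret B: left_module R B by fact
  have cl: "f i x \<in> carrier B" if "i \<in> T" "x \<in> carrier A" for i x using mod_homD(1)[OF f] that by blast
  show ?thesis
  proof (rule mod_homI)
    fix x y assume xy: "x \<in> carrier A" "y \<in> carrier A"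
    have "(\<Oplus>\<^bsub>B\<^esub>i\<in>T. f i (x \<oplus>\<^bsub>A\<^esub> y)) = (\<Oplus>\<^bsub>B\<^esub>i\<in>T. f i x \<oplus>\<^bsub>B\<^esub> f i y)"
      using mod_homD(2)[OF f xy] cl xy by (intro B.M.finsum_cong') auto
    then show "(\<Oplus>\<^bsub>B\<^esub>i\<in>T. f i (x \<oplus>\<^bsub>A\<^esub> y)) = (\<Oplus>\<^bsub>B\<^esub>i\<in>T. f i x) \<oplus>\<^bsub>B\<^esub> (\<Oplus>\<^bsub>B\<^esub>i\<in>T. f i y)"
      using cl xy by (simp add: B.M.finsum_addf Pi_iff)
  next
    fix r x assume r: "r \<in> carrier R" and x: "x \<in> carrier A"
    have "r \<odot>\<^bsub>B\<^esub> (\<Oplus>\<^bsub>B\<^esub>i\<in>T. f i x) = (\<Oplus>\<^bsub>B\<^esub>i\<in>T. r \<odot>\<^bsub>B\<^esub> f i x)"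
    proof (cases "finite T")
      case True
      then show ?thesis using cl[OF _ x]
      proof (induction T rule: finite_induct)
        case (insert j T)
        then show ?case using r by (simp add: Pi_iff B.smult_r_distr B.M.finsum_closed)
      qed (use r in simp)
    qed (use r in \<open>simp add: B.M.finsum_infinite\<close>)
    also have "\<dots> = (\<Oplus>\<^bsub>B\<^esub>i\<in>T. f i (r \<odot>\<^bsub>A\<^esub> x))"
      using mod_homD(3)[OF f r x] cl r x by (intro B.M.finsum_cong') auto
    finally show "(\<Oplus>\<^bsub>B\<^esub>i\<in>T. f i (r \<odot>\<^bsub>A\<^esub> x)) = r \<odot>\<^bsub>B\<^esub> (\<Oplus>\<^bsub>B\<^esub>i\<in>T. f i x)" by simp
  qed (use cl in \<open>auto intro: B.M.finsum_closed\<close>)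
qed

lemma injective_retract:
  fixes U :: "'u itself" and I :: "('r, 'i) module" and I' :: "('r, 'j) module"
  assumes I: "injective_module U R I" and I': "left_module R I'"
    and i: "i \<in> mod_hom R I' I" and r: "r \<in> mod_hom R I I'" and ri: "\<And>x. x \<in> carrier I' \<Longrightarrow> r (i x) = x"
  shows "injective_module U R I'"
  unfolding injective_module_def
proof (intro conjI I' allI impI, elim conjE)
  fix A B :: "('r, 'u) module" and g f
  assume *: "left_module R A" "left_module R B" "g \<in> mod_hom R A B" "inj_on g (carrier A)" "f \<in> mod_hom R A I'"
  have "\<exists>h\<in>mod_hom R B I. \<forall>x\<in>carrier A. h (g x) = i (f x)"
    using I[unfolded injective_module_def, THEN conjunct2, THEN spec[of _ A], THEN spec[of _ B],
        THEN spec[of _ g], THEN spec[of _ "\<lambda>x. i (f x)"]] * mod_hom_comp[OF *(5) i] by blast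
  then obtain h where h: "h \<in> mod_hom R B I" "\<And>x. x \<in> carrier A \<Longrightarrow> h (g x) = i (f x)" by blast
  show "\<exists>h\<in>mod_hom R B I'. \<forall>x\<in>carrier A. h (g x) = f x"
    by (rule bexI[OF _ mod_hom_comp[OF h(1) r]]) (use h(2) ri mod_homD(1)[OF *(5)] in auto)
qed

context artin_dual
begin

sublocale AO: artin_algebra K "op_ring R"
  by (rule artin_algebra_op)

abbreviation "orestr M \<equiv> restrict_scalars (op_ring R) M"
abbreviation "Fr m \<equiv> free_module {..<m::nat} R"
abbreviation "pw m B \<equiv> direct_power {..<m::nat} B"

lemma left_module_Fr: "left_module R (Fr m)"
  by (rule R.left_module_free)

lemma left_module_dual_Fr: "left_module (op_ring R) (dual (Fr m))"
  by (rule left_module_dual[OF left_module_Fr])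

lemma Fr_component: "q \<in> carrier (Fr m) \<Longrightarrow> q a \<in> carrier R" "q \<in> carrier (Fr m) \<Longrightarrow> a \<ge> m \<Longrightarrow> q a = \<zero>\<^bsub>R\<^esub>"
  using direct_power_carrierD(1,2)[where X = "{..<m}" and M = "regular_module R"] by auto

lemma unit_vector_Fr: "a < m \<Longrightarrow> unit_vector R a \<in> carrier (Fr m)"
  by (rule R.unit_vector_closed) simp

lemma Fr_expand:
  assumes "q \<in> carrier (Fr m)" "left_module R B" "f \<in> mod_hom R (Fr m) B"
  shows "f q = (\<Oplus>\<^bsub>B\<^esub>a\<in>{..<m}. q a \<odot>\<^bsub>B\<^esub> f (unit_vector R a))"
proof -
  have "{a. q a \<noteq> \<zero>\<^bsub>R\<^esub>} \<subseteq> {..<m}"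
    using Fr_component(2)[OF assms(1)] by (auto simp: not_less[symmetric])
  then show ?thesis by (rule R.free_module_expand[OF assms(1) finite_lessThan _ order_refl assms(2,3)])
qed

lemma scaled_vector_closed:
  assumes B: "left_module (op_ring R) B" and q: "q \<in> carrier (Fr m)" and y: "y \<in> carrier B"
  shows "scaled_vector B q y \<in> carrier (pw m B)"
proof -
  interpret B: left_module "op_ring R" B by fact
  show ?thesis unfolding scaled_vector_def
    using Fr_component[OF q] y B.smult_closed B.smult_l_null[OF y]
    by (intro direct_power_carrierI[OF _ _ _ B]) auto
qed

lemma scaled_vector_map:
  assumes "f \<in> mod_hom (op_ring R) B C" "q \<in> carrier (Fr m)" "y \<in> carrier B"
  shows "(\<lambda>a. f (scaled_vector B q y a)) = scaled_vector C q (f y)"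
  using mod_homD(3)[OF assms(1) _ assms(3)] Fr_component(1)[OF assms(2)]
  by (auto simp: scaled_vector_def fun_eq_iff)

lemma pw_module:
  assumes "left_module (op_ring R) B"
  shows "left_module K (pw m (orestr B))"
  by (rule left_module_direct_power[OF AO.left_module_restrict[OF assms]])

lemma pw_map:
  assumes "left_module (op_ring R) B" "left_module (op_ring R) C" "f \<in> mod_hom (op_ring R) B C"
  shows "(\<lambda>w a. f (w a)) \<in> mod_hom K (pw m (orestr B)) (pw m (orestr C))"
  by (intro direct_power_map AO.left_module_restrict AO.mod_hom_restrict assms)

text \<open>The vectors \<open>q y\<close> with \<open>q\<close> in \<open>R\<^sup>m\<close> generate \<open>B\<^sup>m\<close>, which stands for \<open>R\<^sup>m \<otimes> B\<close>.\<close>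

lemma pw_generated:
  assumes B: "left_module (op_ring R) B" and w: "w \<in> carrier (pw m B)"
  shows "w = (\<Oplus>\<^bsub>pw m (orestr B)\<^esub>b\<in>{..<m}. scaled_vector B (unit_vector R b) (w b))"
proof -
  interpret B: left_module "op_ring R" B by fact
  interpret KB: left_module K "orestr B" by (rule AO.left_module_restrict[OF B])
  interpret P: left_module K "pw m (orestr B)" by (rule pw_module[OF B])
  let ?t = "\<lambda>b. scaled_vector B (unit_vector R b) (w b)"
  have wB: "w b \<in> carrier B" for b using direct_power_carrierD(1)[OF w] .
  have t: "?t \<in> {..<m} \<rightarrow> carrier (pw m (orestr B))"
    using scaled_vector_closed[OF B unit_vector_Fr wB] by auto
  have "finsum (pw m (orestr B)) ?t {..<m} a = w a" for a
  proof -
    have "finsum (pw m (orestr B)) ?t {..<m} a = finsum (orestr B) (\<lambda>b. ?t b a) {..<m}"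
      by (rule mod_hom_finsum[OF P.left_module_axioms KB.left_module_axioms direct_power_component _ t]) simp
    also have "\<dots> = finsum (orestr B) (\<lambda>b. if a = b then w b else \<zero>\<^bsub>orestr B\<^esub>) {..<m}"
      using wB B.smult_one[OF wB] B.smult_l_null[OF wB]
      by (intro KB.M.finsum_cong') (auto simp: scaled_vector_def unit_vector_def)
    also have "\<dots> = w a"
    proof (cases "a < m")
      case True
      then show ?thesis using KB.M.finsum_singleton[of a "{..<m}" w] wB by auto
    next
      case False
      then have "finsum (orestr B) (\<lambda>b. if a = b then w b else \<zero>\<^bsub>orestr B\<^esub>) {..<m}
          = finsum (orestr B) (\<lambda>b. \<zero>\<^bsub>orestr B\<^esub>) {..<m}"
        by (intro KB.M.finsum_cong') auto
      also have "\<dots> = \<zero>\<^bsub>orestr B\<^esub>" by (rule KB.M.finsum_zero)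
      also have "\<dots> = w a" using direct_power_carrierD(2)[OF w, of a] False by simp
      finally show ?thesis .
    qed
    finally show ?thesis .
  qed
  then show ?thesis by auto
qed

text \<open>The evaluation of \<open>R\<^sup>m \<otimes> D(R\<^sup>m)\<close> in \<open>E\<close>.\<close>

definition pairing :: "nat \<Rightarrow> (nat \<Rightarrow> (nat \<Rightarrow> 'r) \<Rightarrow> 'e) \<Rightarrow> 'e" where
  "pairing m z = (\<Oplus>\<^bsub>E\<^esub>a\<in>{..<m}. z a (unit_vector R a))"

lemma pairing_hom: "pairing m \<in> mod_hom K (pw m (orestr (dual (Fr m)))) E"
  unfolding pairing_def
proof (rule mod_hom_finite_sum[OF pw_module[OF left_module_dual_Fr] E.left_module_axioms])
  fix a assume "a \<in> {..<m}"
  then have "(\<lambda>y. y (unit_vector R a)) \<in> mod_hom K (orestr (dual (Fr m))) E"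
    using unit_vector_Fr[of a m] dual_apply[of _ "Fr m"] left_module.smult_closed[OF left_module_Fr]
    by (intro mod_homI) (auto simp: dual_simps)
  then show "(\<lambda>z. z a (unit_vector R a)) \<in> mod_hom K (pw m (orestr (dual (Fr m)))) E"
    using mod_hom_comp[OF direct_power_component] by fast
qed

lemma pairing_scaled_vector:
  assumes q: "q \<in> carrier (Fr m)" and y: "y \<in> carrier (dual (Fr m))"
  shows "pairing m (scaled_vector (dual (Fr m)) q y) = y q"
proof -
  let ?F = "Fr m"
  interpret F: left_module R ?F by (rule left_module_Fr)
  interpret KF: left_module K "restr ?F" by (rule left_module_restrict[OF left_module_Fr])
  have qR: "q a \<in> carrier R" for a using Fr_component(1)[OF q] .
  have t: "q a \<odot>\<^bsub>?F\<^esub> unit_vector R a \<in> carrier ?F" if "a \<in> {..<m}" for a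
    using unit_vector_Fr[of a m] that qR F.smult_closed by blast
  have "q = (\<Oplus>\<^bsub>?F\<^esub>a\<in>{..<m}. q a \<odot>\<^bsub>?F\<^esub> unit_vector R a)"
    by (rule Fr_expand[OF q left_module_Fr mod_hom_id])
  also have "\<dots> = (\<Oplus>\<^bsub>restr ?F\<^esub>a\<in>{..<m}. q a \<odot>\<^bsub>?F\<^esub> unit_vector R a)"
    by (rule finsum_eq_carrier_add) (simp_all add: direct_power_def)
  finally have "y q = y (\<Oplus>\<^bsub>restr ?F\<^esub>a\<in>{..<m}. q a \<odot>\<^bsub>?F\<^esub> unit_vector R a)" by simp
  also have "\<dots> = (\<Oplus>\<^bsub>E\<^esub>a\<in>{..<m}. y (q a \<odot>\<^bsub>?F\<^esub> unit_vector R a))"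
    by (rule mod_hom_finsum[OF KF.left_module_axioms E.left_module_axioms dual_carrierD(1)[OF y]])
      (use t in \<open>auto simp: direct_power_def\<close>)
  also have "\<dots> = pairing m (scaled_vector (dual ?F) q y)"
    unfolding pairing_def scaled_vector_def
    using t dual_apply(1)[OF y] dual_simps(3)[OF unit_vector_Fr] by (intro E.M.finsum_cong') auto
  finally show ?thesis by simp
qed

text \<open>The adjunction between tensor product and Hom: the homomorphism from \<open>B\<close> to
  D(R^m) that belongs to the functional \<open>\<nu>\<close> on R^m (x) B.\<close>

definition hat where
  "hat m B \<nu> y = (\<lambda>q\<in>carrier (Fr m). \<nu> (scaled_vector B q y))"

lemma hat_apply: "q \<in> carrier (Fr m) \<Longrightarrow> hat m B \<nu> y q = \<nu> (scaled_vector B q y)"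
  by (simp add: hat_def)

lemma hat_hom:
  assumes B: "left_module (op_ring R) B" and \<nu>: "\<nu> \<in> mod_hom K (pw m (orestr B)) E"
  shows "hat m B \<nu> \<in> mod_hom (op_ring R) B (dual (Fr m))"
proof -
  interpret B: left_module "op_ring R" B by fact
  interpret F: left_module R "Fr m" by (rule left_module_Fr)
  interpret D: left_module "op_ring R" "dual (Fr m)" by (rule left_module_dual_Fr)
  have sv: "scaled_vector B q y \<in> carrier (pw m (orestr B))"
    if "q \<in> carrier (Fr m)" "y \<in> carrier B" for q y
    using scaled_vector_closed[OF B that] by simp
  note N = mod_homD[OF \<nu>]
  have cl: "hat m B \<nu> y \<in> carrier (dual (Fr m))" if y: "y \<in> carrier B" for y
    unfolding hat_def
  proof (rule restrict_in_dual[OF left_module_Fr], rule mod_homI)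
    fix q assume q: "q \<in> carrier (restr (Fr m))"
    show "\<nu> (scaled_vector B q y) \<in> carrier E" using N(1)[OF sv[OF _ y]] q by simp
  next
    fix p q assume pq: "p \<in> carrier (restr (Fr m))" "q \<in> carrier (restr (Fr m))"
    then have pqF: "p \<in> carrier (Fr m)" "q \<in> carrier (Fr m)" by (simp_all add: direct_power_def)
    have "scaled_vector B (p \<oplus>\<^bsub>restr (Fr m)\<^esub> q) y
        = scaled_vector B p y \<oplus>\<^bsub>pw m (orestr B)\<^esub> scaled_vector B q y"
      using B.smult_l_distr[OF _ _ y] Fr_component(1)[OF pqF(1)] Fr_component(1)[OF pqF(2)]
      by (auto simp: scaled_vector_def fun_eq_iff)
    then show "\<nu> (scaled_vector B (p \<oplus>\<^bsub>restr (Fr m)\<^esub> q) y) = \<nu> (scaled_vector B p y) \<oplus>\<^bsub>E\<^esub> \<nu> (scaled_vector B q y)"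
      using N(2)[OF sv[OF pqF(1) y] sv[OF pqF(2) y]] by simp
  next
    fix a q assume a: "a \<in> carrier K" and q: "q \<in> carrier (restr (Fr m))"
    then have qF: "q \<in> carrier (Fr m)" by (simp add: direct_power_def)
    have "(q b \<otimes>\<^bsub>op_ring R\<^esub> (a \<odot>\<^bsub>R\<^esub> \<one>\<^bsub>R\<^esub>)) \<odot>\<^bsub>B\<^esub> y = (a \<odot>\<^bsub>R\<^esub> \<one>\<^bsub>R\<^esub>) \<odot>\<^bsub>B\<^esub> (q b \<odot>\<^bsub>B\<^esub> y)" for b
      using B.smult_assoc[of "q b" "a \<odot>\<^bsub>R\<^esub> \<one>\<^bsub>R\<^esub>" y] AO.scalar_commute[OF B, of "q b" a y]
        a y Fr_component(1)[OF qF] by simp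
    then have "scaled_vector B (a \<odot>\<^bsub>restr (Fr m)\<^esub> q) y = a \<odot>\<^bsub>pw m (orestr B)\<^esub> scaled_vector B q y"
      by (auto simp: scaled_vector_def fun_eq_iff)
    then show "\<nu> (scaled_vector B (a \<odot>\<^bsub>restr (Fr m)\<^esub> q) y) = a \<odot>\<^bsub>E\<^esub> \<nu> (scaled_vector B q y)"
      using N(3)[OF a sv[OF qF y]] by simp
  qed
  show ?thesis
  proof (rule mod_homI)
    fix y z assume yz: "y \<in> carrier B" "z \<in> carrier B"
    have "\<nu> (scaled_vector B q (y \<oplus>\<^bsub>B\<^esub> z)) = \<nu> (scaled_vector B q y) \<oplus>\<^bsub>E\<^esub> \<nu> (scaled_vector B q z)"
      if q: "q \<in> carrier (Fr m)" for q
    proof -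
      have "scaled_vector B q (y \<oplus>\<^bsub>B\<^esub> z) = scaled_vector B q y \<oplus>\<^bsub>pw m (orestr B)\<^esub> scaled_vector B q z"
        using B.smult_r_distr[OF _ yz] Fr_component(1)[OF q] by (auto simp: scaled_vector_def fun_eq_iff)
      then show ?thesis using N(2)[OF sv[OF q yz(1)] sv[OF q yz(2)]] by simp
    qed
    then show "hat m B \<nu> (y \<oplus>\<^bsub>B\<^esub> z) = hat m B \<nu> y \<oplus>\<^bsub>dual (Fr m)\<^esub> hat m B \<nu> z"
      using yz by (intro dual_ext[where M = "Fr m"] cl D.M.a_closed) (auto simp: dual_simps hat_apply)
  next
    fix r y assume r: "r \<in> carrier (op_ring R)" and y: "y \<in> carrier B"
    have "scaled_vector B q (r \<odot>\<^bsub>B\<^esub> y) = scaled_vector B (r \<odot>\<^bsub>Fr m\<^esub> q) y" if q: "q \<in> carrier (Fr m)" for q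
      using B.smult_assoc[OF _ r y] Fr_component(1)[OF q] by (auto simp: scaled_vector_def fun_eq_iff)
    then show "hat m B \<nu> (r \<odot>\<^bsub>B\<^esub> y) = r \<odot>\<^bsub>dual (Fr m)\<^esub> hat m B \<nu> y"
      using y r F.smult_closed[of r]
      by (intro dual_ext[where M = "Fr m"] cl D.smult_closed B.smult_closed)
        (auto simp: dual_simps hat_apply simp del: direct_power_simps)
  qed (rule cl)
qed

text \<open>By adjunction a homomorphism into D(R^m) is a functional on R^m (x) A, namely the
  evaluation \<open>pairing\<close> after \<open>f\<close> in each coordinate. Injectivity of
  \<open>E\<close> over \<open>K\<close> extends it along \<open>g\<close>, and \<open>hat\<close>
  turns the extension back into a homomorphism.\<close>

lemma dual_Fr_injective: "injective_module U (op_ring R) (dual (Fr m))"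
  unfolding injective_module_def
proof (intro conjI left_module_dual_Fr allI impI, elim conjE)
  fix A B :: "('r, 'u) module" and g f
  assume A: "left_module (op_ring R) A" and B: "left_module (op_ring R) B"
    and g: "g \<in> mod_hom (op_ring R) A B" "inj_on g (carrier A)"
    and f: "f \<in> mod_hom (op_ring R) A (dual (Fr m))"
  interpret A: left_module "op_ring R" A by fact
  interpret KB: left_module K "orestr B" by (rule AO.left_module_restrict[OF B])
  have small: "carrier (pw m (orestr B)) \<lesssim> (UNIV :: 'u set)"
    by (rule direct_power_lepoll[OF universe_infinite])
      (auto simp: universe_infinite finite_lepoll_infinite subset_imp_lepoll)
  let ?\<mu> = "\<lambda>w. pairing m (\<lambda>a. f (w a))"
  have \<mu>: "?\<mu> \<in> mod_hom K (pw m (orestr A)) E"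
    by (rule mod_hom_comp[OF pw_map[OF A left_module_dual_Fr f] pairing_hom])
  have ker: "?\<mu> w = \<zero>\<^bsub>E\<^esub>"
    if w: "w \<in> carrier (pw m (orestr A))" and z: "(\<lambda>a. g (w a)) = \<zero>\<^bsub>pw m (orestr B)\<^esub>" for w
  proof -
    have "w a \<in> carrier A" for a using direct_power_carrierD(1)[OF w] by simp
    moreover have "g (w a) = g \<zero>\<^bsub>A\<^esub>" for a using z mod_hom_zero[OF A B g(1)] by (simp add: fun_eq_iff)
    ultimately have "w = (\<lambda>a. \<zero>\<^bsub>A\<^esub>)" using g(2) A.M.zero_closed by (auto simp: inj_on_def fun_eq_iff)
    then show ?thesis using mod_hom_zero[OF pw_module[OF A] E.left_module_axioms \<mu>] by simp
  qed
  obtain \<nu> where \<nu>: "\<nu> \<in> mod_hom K (pw m (orestr B)) E"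
    "\<And>w. w \<in> carrier (pw m (orestr A)) \<Longrightarrow> \<nu> (\<lambda>a. g (w a)) = ?\<mu> w"
    using injective_factor[OF E_injective pw_module[OF A] pw_module[OF B] small pw_map[OF A B g(1)] \<mu> ker]
    by blast
  have "hat m B \<nu> (g x) = f x" if x: "x \<in> carrier A" for x
  proof (rule dual_ext[where M = "Fr m"])
    show "hat m B \<nu> (g x) \<in> carrier (dual (Fr m))"
      using mod_homD(1)[OF hat_hom[OF B \<nu>(1)]] mod_homD(1)[OF g(1) x] by simp
    show fx: "f x \<in> carrier (dual (Fr m))" by (rule mod_homD(1)[OF f x])
    fix q assume q: "q \<in> carrier (Fr m)"
    have "hat m B \<nu> (g x) q = \<nu> (\<lambda>a. g (scaled_vector A q x a))"
      using q scaled_vector_map[OF g(1) q x] by (simp add: hat_apply)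
    also have "\<dots> = pairing m (\<lambda>a. f (scaled_vector A q x a))"
      by (rule \<nu>(2)) (simp add: scaled_vector_closed[OF A q x])
    also have "\<dots> = f x q"
      using scaled_vector_map[OF f q x] pairing_scaled_vector[OF q fx] by simp
    finally show "hat m B \<nu> (g x) q = f x q" .
  qed
  then show "\<exists>h\<in>mod_hom (op_ring R) B (dual (Fr m)). \<forall>x\<in>carrier A. h (g x) = f x"
    using hat_hom[OF B \<nu>(1)] by blast
qed

text \<open>\<open>d \<otimes> B\<close> for a homomorphism \<open>d\<close> of free modules.\<close>

definition matrix_map where
  "matrix_map m' B d w = (\<lambda>a. \<Oplus>\<^bsub>orestr B\<^esub>b\<in>{..<m'::nat}. d (unit_vector R b) a \<odot>\<^bsub>B\<^esub> w b)"

lemma matrix_map_hom: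
  assumes B: "left_module (op_ring R) B" and d: "d \<in> mod_hom R (Fr m') (Fr m)"
  shows "matrix_map m' B d \<in> mod_hom K (pw m' (orestr B)) (pw m (orestr B))"
proof -
  interpret B: left_module "op_ring R" B by fact
  interpret KB: left_module K "orestr B" by (rule AO.left_module_restrict[OF B])
  have dF: "d (unit_vector R b) \<in> carrier (Fr m)" if "b < m'" for b
    using mod_homD(1)[OF d unit_vector_Fr[OF that]] .
  have comp: "(\<lambda>w. matrix_map m' B d w a) \<in> mod_hom K (pw m' (orestr B)) (orestr B)" for a
    unfolding matrix_map_def
  proof (rule mod_hom_finite_sum[OF pw_module[OF B] KB.left_module_axioms])
    fix b assume b: "b \<in> {..<m'}"
    then have r: "d (unit_vector R b) a \<in> carrier R" using Fr_component(1)[OF dF] by simp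
    have "(\<lambda>y. d (unit_vector R b) a \<odot>\<^bsub>B\<^esub> y) \<in> mod_hom K (orestr B) (orestr B)"
      using r AO.scalar_commute[OF B] B.smult_r_distr by (intro mod_homI) auto
    then show "(\<lambda>w. d (unit_vector R b) a \<odot>\<^bsub>B\<^esub> w b) \<in> mod_hom K (pw m' (orestr B)) (orestr B)"
      using mod_hom_comp[OF direct_power_component] by fast
  qed
  have off: "matrix_map m' B d w a = \<zero>\<^bsub>orestr B\<^esub>" if w: "w \<in> carrier (pw m' (orestr B))" and a: "a \<notin> {..<m}" for w a
  proof -
    have "matrix_map m' B d w a = (\<Oplus>\<^bsub>orestr B\<^esub>b\<in>{..<m'}. \<zero>\<^bsub>orestr B\<^esub>)"
      unfolding matrix_map_def
      using Fr_component(2)[OF dF] a direct_power_carrierD(1)[OF w] B.smult_l_null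
      by (intro KB.M.finsum_cong') auto
    then show ?thesis by (simp only: KB.M.finsum_zero)
  qed
  show ?thesis
  proof (rule mod_homI)
    fix w assume w: "w \<in> carrier (pw m' (orestr B))"
    show "matrix_map m' B d w \<in> carrier (pw m (orestr B))"
      using mod_homD(1)[OF comp w] off[OF w]
      by (intro direct_power_carrierI[OF _ _ _ KB.left_module_axioms]) auto
  qed (use mod_homD(2,3)[OF comp] in \<open>auto simp: fun_eq_iff\<close>)
qed

lemma matrix_map_scaled_vector:
  assumes B: "left_module (op_ring R) B" and d: "d \<in> mod_hom R (Fr m') (Fr m)"
    and q: "q \<in> carrier (Fr m')" and y: "y \<in> carrier B"
  shows "matrix_map m' B d (scaled_vector B q y) = scaled_vector B (d q) y"
proof
  fix a
  interpret B: left_module "op_ring R" B by fact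
  interpret KB: left_module K "orestr B" by (rule AO.left_module_restrict[OF B])
  have qR: "q b \<in> carrier R" for b using Fr_component(1)[OF q] .
  have dR: "d (unit_vector R b) a \<in> carrier R" if "b < m'" for b
    using Fr_component(1)[OF mod_homD(1)[OF d unit_vector_Fr[OF that]]] .
  have "d q a = (\<Oplus>\<^bsub>regular_module R\<^esub>b\<in>{..<m'}. q b \<odot>\<^bsub>regular_module R\<^esub> d (unit_vector R b) a)"
    by (rule Fr_expand[OF q R.left_module_regular mod_hom_comp[OF d direct_power_component]])
  \<comment> \<open>The sum is reread in the opposite ring, where the factors change places; in this
    order the map taking r to r y is linear.\<close>
  also have "\<dots> = (\<Oplus>\<^bsub>regular_module (op_ring R)\<^esub>b\<in>{..<m'}. d (unit_vector R b) a \<otimes>\<^bsub>op_ring R\<^esub> q b)"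
    by (simp add: finsum_eq_carrier_add[of "regular_module R" "regular_module (op_ring R)"])
  finally have e: "d q a = \<dots>" .
  have hom: "(\<lambda>r. r \<odot>\<^bsub>B\<^esub> y) \<in> mod_hom (op_ring R) (regular_module (op_ring R)) B"
    using y B.smult_l_distr B.smult_assoc by (intro mod_homI) auto
  have "scaled_vector B (d q) y a = (\<Oplus>\<^bsub>B\<^esub>b\<in>{..<m'}. (d (unit_vector R b) a \<otimes>\<^bsub>op_ring R\<^esub> q b) \<odot>\<^bsub>B\<^esub> y)"
    unfolding scaled_vector_def e
    by (rule mod_hom_finsum[OF AO.R.left_module_regular B hom]) (use qR dR in auto)
  also have "\<dots> = (\<Oplus>\<^bsub>orestr B\<^esub>b\<in>{..<m'}. (d (unit_vector R b) a \<otimes>\<^bsub>op_ring R\<^esub> q b) \<odot>\<^bsub>B\<^esub> y)"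
    by (rule finsum_eq_carrier_add) simp_all
  also have "\<dots> = matrix_map m' B d (scaled_vector B q y) a"
    unfolding matrix_map_def scaled_vector_def
    using B.smult_assoc qR dR y B.smult_closed by (intro KB.M.finsum_cong') auto
  finally show "matrix_map m' B d (scaled_vector B q y) a = scaled_vector B (d q) y a" by simp
qed

end

section \<open>Comparison, contraction and truncation of injective coresolutions\<close>

subsection \<open>Injective coresolutions\<close>

text \<open>Resolutions by duals of free modules are not of type \<open>'u\<close>, whereas the
  resolutions behind \<open>inj_dim\<close> and \<open>stable_Tor\<close> are. Allowing any type
  whose modules embed in the universe puts both under one comparison theorem.\<close>

definition inj_coresolution ::
  "'u itself \<Rightarrow> ('r, 'c) ring_scheme \<Rightarrow> ('r, 'm) module \<Rightarrow> (nat \<Rightarrow> ('r, 'i) module) \<Rightarrow>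
    (nat \<Rightarrow> 'i \<Rightarrow> 'i) \<Rightarrow> ('m \<Rightarrow> 'i) \<Rightarrow> bool" where
  "inj_coresolution U R N C d \<eta> \<longleftrightarrow> left_module R N \<and> (\<forall>n. injective_module U R (C n)) \<and>
    (\<forall>n. carrier (C n) \<lesssim> (UNIV :: 'u set)) \<and> (\<forall>n. d n \<in> mod_hom R (C n) (C (Suc n))) \<and>
    \<eta> \<in> mod_hom R N (C 0) \<and> inj_on \<eta> (carrier N) \<and>
    {x \<in> carrier (C 0). d 0 x = \<zero>\<^bsub>C 1\<^esub>} = \<eta> ` carrier N \<and>
    (\<forall>n. {x \<in> carrier (C (Suc n)). d (Suc n) x = \<zero>\<^bsub>C (Suc (Suc n))\<^esub>} = d n ` carrier (C n))"

lemma inj_coresolutionD: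
  fixes U :: "'u itself"
  assumes "inj_coresolution U R N C d \<eta>"
  shows "left_module R N" "injective_module U R (C n)" "left_module R (C n)"
    "carrier (C n) \<lesssim> (UNIV :: 'u set)" "d n \<in> mod_hom R (C n) (C (Suc n))"
    "\<eta> \<in> mod_hom R N (C 0)" "inj_on \<eta> (carrier N)"
    "{x \<in> carrier (C 0). d 0 x = \<zero>\<^bsub>C 1\<^esub>} = \<eta> ` carrier N"
    "{x \<in> carrier (C (Suc n)). d (Suc n) x = \<zero>\<^bsub>C (Suc (Suc n))\<^esub>} = d n ` carrier (C n)"
  using assms by (auto simp: inj_coresolution_def injective_module_def)

lemma inj_coresolution_dd:
  assumes "inj_coresolution U R N C d \<eta>" "x \<in> carrier (C n)"
  shows "d (Suc n) (d n x) = \<zero>\<^bsub>C (Suc (Suc n))\<^esub>"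
  using inj_coresolutionD(9)[OF assms(1), of n] assms(2) by blast

lemma inj_coresolution_d\<eta>:
  assumes "inj_coresolution U R N C d \<eta>" "x \<in> carrier N"
  shows "d 0 (\<eta> x) = \<zero>\<^bsub>C 1\<^esub>"
  using inj_coresolutionD(8)[OF assms(1)] assms(2) by blast

lemma coresolution_comparison:
  assumes C: "inj_coresolution U R N C d \<eta>" and C': "inj_coresolution U R N C' d' \<eta>'"
  obtains f where "\<And>n. f n \<in> mod_hom R (C n) (C' n)"
    "\<And>n x. x \<in> carrier (C n) \<Longrightarrow> f (Suc n) (d n x) = d' n (f n x)"
    "\<And>x. x \<in> carrier N \<Longrightarrow> f 0 (\<eta> x) = \<eta>' x"
proof -
  note CD = inj_coresolutionD[OF C] and CD' = inj_coresolutionD[OF C']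
  have \<eta>0: "\<eta>' x = \<zero>\<^bsub>C' 0\<^esub>" if x: "x \<in> carrier N" "\<eta> x = \<zero>\<^bsub>C 0\<^esub>" for x
  proof -
    interpret N: left_module R N by (rule CD(1))
    have "\<eta> x = \<eta> \<zero>\<^bsub>N\<^esub>" using x mod_hom_zero[OF CD(1,3,6)] by simp
    then have "x = \<zero>\<^bsub>N\<^esub>" using CD(7) x(1) by (auto simp: inj_on_def)
    then show ?thesis using mod_hom_zero[OF CD'(1,3,6)] by simp
  qed
  obtain f0 where f0: "f0 \<in> mod_hom R (C 0) (C' 0)" "\<And>x. x \<in> carrier N \<Longrightarrow> f0 (\<eta> x) = \<eta>' x"
    using injective_factor[OF CD'(2) CD(1,3,4,6) CD'(6) \<eta>0] by blast
  \<comment> \<open>The invariant says that d' after \<open>g\<close> kills the kernel of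
    \<open>d n\<close>, which is what the next application of \<open>injective_factor\<close> asks
    for.\<close>
  define ok where "ok n g \<longleftrightarrow> g \<in> mod_hom R (C n) (C' n) \<and>
      (\<forall>x\<in>carrier (C n). d n x = \<zero>\<^bsub>C (Suc n)\<^esub> \<longrightarrow> d' n (g x) = \<zero>\<^bsub>C' (Suc n)\<^esub>)" for n g
  have "\<exists>f. \<forall>n. (ok n (f n) \<and> (n = 0 \<longrightarrow> f n = f0)) \<and> (\<forall>x\<in>carrier (C n). f (Suc n) (d n x) = d' n (f n x))"
  proof (rule dependent_nat_choice)
    have "ok 0 f0"
      unfolding ok_def
    proof (intro conjI f0(1) ballI impI)
      fix x assume "x \<in> carrier (C 0)" "d 0 x = \<zero>\<^bsub>C (Suc 0)\<^esub>"
      then obtain y where "y \<in> carrier N" "x = \<eta> y" using CD(8) by auto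
      then show "d' 0 (f0 x) = \<zero>\<^bsub>C' (Suc 0)\<^esub>" using f0(2) inj_coresolution_d\<eta>[OF C'] by simp
    qed
    then show "\<exists>g. ok 0 g \<and> (0 = (0::nat) \<longrightarrow> g = f0)" by blast
  next
    fix g n assume g: "ok n g \<and> (n = 0 \<longrightarrow> g = f0)"
    then have gh: "g \<in> mod_hom R (C n) (C' n)" by (simp add: ok_def)
    obtain h where h: "h \<in> mod_hom R (C (Suc n)) (C' (Suc n))"
      "\<And>x. x \<in> carrier (C n) \<Longrightarrow> h (d n x) = d' n (g x)"
      using injective_factor[OF CD'(2)[of "Suc n"] CD(3)[of n] CD(3)[of "Suc n"] CD(4)[of "Suc n"]
          CD(5)[of n] mod_hom_comp[OF gh CD'(5)[of n]]] g
      unfolding ok_def by blast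
    have "ok (Suc n) h"
      unfolding ok_def
    proof (intro conjI h(1) ballI impI)
      fix x assume "x \<in> carrier (C (Suc n))" "d (Suc n) x = \<zero>\<^bsub>C (Suc (Suc n))\<^esub>"
      then obtain y where "y \<in> carrier (C n)" "x = d n y" using CD(9)[of n] by auto
      then show "d' (Suc n) (h x) = \<zero>\<^bsub>C' (Suc (Suc n))\<^esub>"
        using h(2) inj_coresolution_dd[OF C'] mod_homD(1)[OF gh] by simp
    qed
    then show "\<exists>h. (ok (Suc n) h \<and> (Suc n = 0 \<longrightarrow> h = f0)) \<and> (\<forall>x\<in>carrier (C n). h (d n x) = d' n (g x))"
      using h by auto
  qed
  then obtain f where F: "\<And>n. ok n (f n) \<and> (n = 0 \<longrightarrow> f n = f0) \<and> (\<forall>x\<in>carrier (C n). f (Suc n) (d n x) = d' n (f n x))"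
    by auto
  have f: "ok n (f n)" "f 0 = f0" "x \<in> carrier (C n) \<Longrightarrow> f (Suc n) (d n x) = d' n (f n x)" for n x
    using F[of n] F[of 0] by auto
  show ?thesis by (rule that[of f]) (use f f0 ok_def in auto)
qed

text \<open>
  An endomorphism over the identity of \<open>N\<close> is homotopic to the identity; if it vanishes in high
  degrees, the homotopy contracts the coresolution there.
\<close>

lemma coresolution_contraction:
  assumes C: "inj_coresolution U R N C d \<eta>"
    and h: "\<And>n. h n \<in> mod_hom R (C n) (C n)"
    and hd: "\<And>n x. x \<in> carrier (C n) \<Longrightarrow> h (Suc n) (d n x) = d n (h n x)"
    and h\<eta>: "\<And>x. x \<in> carrier N \<Longrightarrow> h 0 (\<eta> x) = \<eta> x"
  obtains s where "\<And>n. s n \<in> mod_hom R (C (Suc n)) (C n)"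
    "\<And>n x. x \<in> carrier (C (Suc n)) \<Longrightarrow> h (Suc n) x = \<zero>\<^bsub>C (Suc n)\<^esub> \<Longrightarrow>
      d n (s n x) \<oplus>\<^bsub>C (Suc n)\<^esub> s (Suc n) (d (Suc n) x) = x"
proof -
  note CD = inj_coresolutionD[OF C]
  interpret C: left_module R "C n" for n by (rule CD(3))
  define k where "k n x = x \<ominus>\<^bsub>C n\<^esub> h n x" for n x
  have k: "k n \<in> mod_hom R (C n) (C n)" for n
    unfolding k_def by (rule mod_hom_subtract[OF CD(3,3) mod_hom_id h])
  have kd: "k (Suc n) (d n x) = d n (k n x)" if "x \<in> carrier (C n)" for n x
    unfolding k_def using mod_hom_diff[OF CD(3,3,5) that mod_homD(1)[OF h that]] hd[OF that] by simp
  note kc = mod_homD(1)[OF k] and dc = mod_homD(1)[OF CD(5)]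
  have k\<eta>: "k 0 x = \<zero>\<^bsub>C 0\<^esub>" if x: "x \<in> carrier (C 0)" "d 0 x = \<zero>\<^bsub>C (Suc 0)\<^esub>" for x
  proof -
    obtain y where "y \<in> carrier N" "x = \<eta> y" using CD(8) x by auto
    then show ?thesis using h\<eta> x(1) by (simp add: k_def C.diff_self)
  qed
  \<comment> \<open>The homotopy sought is between zero and \<open>k\<close>, the difference of the
    identity and \<open>h\<close>. The invariant makes k - d s vanish on the image of
    \<open>d n\<close>, that is, on the kernel of the next differential, so that it factors through
    that differential.\<close>
  define ok where "ok n s \<longleftrightarrow> s \<in> mod_hom R (C (Suc n)) (C n) \<and>
      (\<forall>y\<in>carrier (C n). d n (s (d n y)) = d n (k n y))" for n s
  have "\<exists>s. \<forall>n. ok n (s n) \<and>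
      (\<forall>x\<in>carrier (C (Suc n)). s (Suc n) (d (Suc n) x) = k (Suc n) x \<ominus>\<^bsub>C (Suc n)\<^esub> d n (s n x))"
  proof (rule dependent_nat_choice)
    obtain s where "s \<in> mod_hom R (C (Suc 0)) (C 0)" "\<And>x. x \<in> carrier (C 0) \<Longrightarrow> s (d 0 x) = k 0 x"
      using injective_factor[OF CD(2,3,3,4,5) k k\<eta>] by blast
    then show "\<exists>s. ok 0 s" unfolding ok_def by auto
  next
    fix s n assume s: "ok n s"
    then have sh: "s \<in> mod_hom R (C (Suc n)) (C n)" by (simp add: ok_def)
    have ds: "(\<lambda>x. d n (s x)) \<in> mod_hom R (C (Suc n)) (C (Suc n))" by (rule mod_hom_comp[OF sh CD(5)])
    let ?g = "\<lambda>x. k (Suc n) x \<ominus>\<^bsub>C (Suc n)\<^esub> d n (s x)"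
    have g: "?g \<in> mod_hom R (C (Suc n)) (C (Suc n))" by (rule mod_hom_subtract[OF CD(3,3) k ds])
    have ker: "?g x = \<zero>\<^bsub>C (Suc n)\<^esub>"
      if x: "x \<in> carrier (C (Suc n))" "d (Suc n) x = \<zero>\<^bsub>C (Suc (Suc n))\<^esub>" for x
    proof -
      obtain y where y: "y \<in> carrier (C n)" "x = d n y" using CD(9)[of n] x by auto
      then have "d n (s x) = k (Suc n) x" using s kd by (simp add: ok_def)
      then show ?thesis using C.diff_self kc x by simp
    qed
    obtain s' where s': "s' \<in> mod_hom R (C (Suc (Suc n))) (C (Suc n))"
      "\<And>x. x \<in> carrier (C (Suc n)) \<Longrightarrow> s' (d (Suc n) x) = ?g x"
      using injective_factor[OF CD(2,3,3,4,5) g ker] by blast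
    have "d (Suc n) (s' (d (Suc n) y)) = d (Suc n) (k (Suc n) y)" if y: "y \<in> carrier (C (Suc n))" for y
    proof -
      have dsy: "d n (s y) \<in> carrier (C (Suc n))" by (rule mod_homD(1)[OF ds y])
      have "d (Suc n) (s' (d (Suc n) y)) = d (Suc n) (k (Suc n) y) \<ominus>\<^bsub>C (Suc (Suc n))\<^esub> d (Suc n) (d n (s y))"
        using s'(2)[OF y] mod_hom_diff[OF CD(3,3,5) kc[OF y] dsy] by simp
      then show ?thesis
        using inj_coresolution_dd[OF C mod_homD(1)[OF sh y]] dc[OF kc[OF y]] by (simp add: a_minus_def)
    qed
    then show "\<exists>s'. ok (Suc n) s' \<and> (\<forall>x\<in>carrier (C (Suc n)). s' (d (Suc n) x) = ?g x)"
      using s' unfolding ok_def by blast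
  qed
  then obtain s where s: "\<And>n. ok n (s n)"
    "\<And>n x. x \<in> carrier (C (Suc n)) \<Longrightarrow> s (Suc n) (d (Suc n) x) = k (Suc n) x \<ominus>\<^bsub>C (Suc n)\<^esub> d n (s n x)"
    by auto
  show ?thesis
  proof (rule that[of s])
    show sh: "s n \<in> mod_hom R (C (Suc n)) (C n)" for n using s(1) by (simp add: ok_def)
    fix n x assume x: "x \<in> carrier (C (Suc n))" "h (Suc n) x = \<zero>\<^bsub>C (Suc n)\<^esub>"
    have kx: "k (Suc n) x = x" using x by (simp add: k_def a_minus_def)
    have "d n (s n x) \<in> carrier (C (Suc n))" using dc mod_homD(1)[OF sh x(1)] by blast
    then show "d n (s n x) \<oplus>\<^bsub>C (Suc n)\<^esub> s (Suc n) (d (Suc n) x) = x"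
      using s(2)[OF x(1)] kx x(1) C.diff_add_cancel[of x "Suc n" "d n (s n x)"] C.M.a_comm
      by (metis C.M.minus_closed)
  qed
qed

lemma injective_zero:
  fixes U :: "'u itself" and I :: "('r, 'i) module"
  assumes I: "left_module R I" "carrier I = {\<zero>\<^bsub>I\<^esub>}"
  shows "injective_module U R I"
  unfolding injective_module_def
proof (intro conjI I(1) allI impI, elim conjE)
  fix A B :: "('r, 'u) module" and g f
  assume *: "left_module R A" "left_module R B" "g \<in> mod_hom R A B" "f \<in> mod_hom R A I"
  show "\<exists>h\<in>mod_hom R B I. \<forall>x\<in>carrier A. h (g x) = f x"
    by (rule bexI[OF _ mod_hom_const_zero[OF I(1)]]) (use mod_homD(1)[OF *(4)] I(2) in auto)
qed

text \<open>On the cocycles of degree m + 1 the contraction reads d(s0 x) = x. They are thus a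
  retract of \<open>C m\<close>, hence injective, and can serve as the last term.\<close>

lemma coresolution_truncate:
  fixes U :: "'u itself" and C :: "nat \<Rightarrow> ('r, 'i) module"
  assumes C: "inj_coresolution U R N C d \<eta>"
    and s: "s0 \<in> mod_hom R (C (Suc m)) (C m)" "s1 \<in> mod_hom R (C (Suc (Suc m))) (C (Suc m))"
    and contr: "\<And>x. x \<in> carrier (C (Suc m)) \<Longrightarrow> d m (s0 x) \<oplus>\<^bsub>C (Suc m)\<^esub> s1 (d (Suc m) x) = x"
  obtains C' :: "nat \<Rightarrow> ('r, 'i) module" and d' where "inj_coresolution U R N C' d' \<eta>"
    "\<And>n. n > Suc m \<Longrightarrow> carrier (C' n) = {\<zero>\<^bsub>C' n\<^esub>}"
proof -
  note CD = inj_coresolutionD[OF C]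
  interpret C: left_module R "C n" for n by (rule CD(3))
  let ?Z = "{x \<in> carrier (C (Suc m)). d (Suc m) x = \<zero>\<^bsub>C (Suc (Suc m))\<^esub>}"
  have Zsub: "submodule ?Z R (C (Suc m))" by (rule submodule_kernel[OF CD(3,3,5)])
  have Zim: "?Z = d m ` carrier (C m)" by (rule CD(9))
  define Z where "Z = (C (Suc m))\<lparr>carrier := ?Z\<rparr>"
  define Z0 where "Z0 = (C (Suc m))\<lparr>carrier := {\<zero>\<^bsub>C (Suc m)\<^esub>}\<rparr>"
  have Z: "left_module R Z" unfolding Z_def by (rule C.left_module_sub[OF Zsub])
  have Z0: "left_module R Z0" unfolding Z0_def by (rule C.left_module_sub[OF C.submodule_zero])
  have Zc: "carrier Z0 = {\<zero>\<^bsub>Z0\<^esub>}" by (simp add: Z0_def)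
  have dZ: "d m \<in> mod_hom R (C m) Z" unfolding Z_def by (rule mod_hom_into_sub[OF CD(5)]) (simp add: Zim)
  have sZ: "s0 \<in> mod_hom R Z (C m)" unfolding Z_def by (rule mod_hom_sub[OF s(1)]) auto
  have "d m (s0 x) = x" if "x \<in> carrier Z" for x
  proof -
    have x: "x \<in> carrier (C (Suc m))" "d (Suc m) x = \<zero>\<^bsub>C (Suc (Suc m))\<^esub>" using that by (auto simp: Z_def)
    have "d m (s0 x) \<in> carrier (C (Suc m))" using mod_homD(1)[OF CD(5) mod_homD(1)[OF s(1) x(1)]] .
    then show ?thesis using contr[OF x(1)] x(2) mod_hom_zero[OF CD(3,3) s(2)] by simp
  qed
  then have Zinj: "injective_module U R Z" by (rule injective_retract[OF CD(2) Z sZ dZ])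
  have Oinj: "injective_module U R Z0" by (rule injective_zero[OF Z0 Zc])
  have Osub: "carrier Z0 \<subseteq> carrier (C (Suc m))" "carrier Z \<subseteq> carrier (C (Suc m))" by (auto simp: Z0_def Z_def)
  have small: "carrier Z0 \<lesssim> (UNIV :: 'u set)" "carrier Z \<lesssim> (UNIV :: 'u set)"
    using Osub CD(4) lepoll_trans subset_imp_lepoll by blast+
  define C' where "C' n = (if n \<le> m then C n else if n = Suc m then Z else Z0)" for n
  define d' where "d' n = (if n \<le> m then d n else (\<lambda>x. \<zero>\<^bsub>Z0\<^esub>))" for n
  have hom: "d' n \<in> mod_hom R (C' n) (C' (Suc n))" for n
    using CD(5)[of n] dZ mod_hom_const_zero[OF Z0] by (cases "n = m") (auto simp: C'_def d'_def)
  have zz: "\<zero>\<^bsub>Z\<^esub> = \<zero>\<^bsub>C (Suc m)\<^esub>" by (simp add: Z_def)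
  have "inj_coresolution U R N C' d' \<eta>"
    unfolding inj_coresolution_def
  proof (intro conjI allI CD(1,7) hom)
    show "injective_module U R (C' n)" for n using CD(2) Zinj Oinj by (simp add: C'_def)
    show "carrier (C' n) \<lesssim> (UNIV :: 'u set)" for n using CD(4) small by (simp add: C'_def)
    show "\<eta> \<in> mod_hom R N (C' 0)" using CD(6) by (simp add: C'_def)
    show "{x \<in> carrier (C' 0). d' 0 x = \<zero>\<^bsub>C' 1\<^esub>} = \<eta> ` carrier N"
      using CD(8) zz by (cases "m = 0") (simp_all add: C'_def d'_def)
    fix n
    consider "Suc n \<le> m" | "n = m" | "n > m" by linarith
    then show "{x \<in> carrier (C' (Suc n)). d' (Suc n) x = \<zero>\<^bsub>C' (Suc (Suc n))\<^esub>} = d' n ` carrier (C' n)"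
    proof cases
      case 1
      then show ?thesis using CD(9)[of n] zz by (cases "Suc n = m") (simp_all add: C'_def d'_def)
    next
      case 2
      then have "{x \<in> carrier (C' (Suc n)). d' (Suc n) x = \<zero>\<^bsub>C' (Suc (Suc n))\<^esub>} = carrier Z"
        by (simp add: C'_def d'_def)
      also have "\<dots> = ?Z" by (simp add: Z_def)
      also have "\<dots> = d' n ` carrier (C' n)" using 2 Zim by (simp add: C'_def d'_def)
      finally show ?thesis .
    next
      case 3
      have "carrier (C' n) \<noteq> {}"
        using abelian_groupE(2)[OF left_module.axioms(2)[OF Z]] 3 Zc
        by (cases "n = Suc m") (auto simp: C'_def)
      then show ?thesis using 3 Zc by (auto simp: C'_def d'_def)
    qed
  qed
  then show ?thesis using that[of C' d'] Zc by (simp add: C'_def)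
qed

text \<open>Returns from a coresolution of any type to the homologically indexed complexes over
  \<open>'u\<close> in which \<open>inj_dim\<close> and the chosen resolutions are phrased.\<close>

lemma coresolution_copy:
  fixes U :: "'u itself" and C :: "nat \<Rightarrow> ('r, 'i) module"
  assumes C: "inj_coresolution U R N C d \<eta>"
  obtains I \<eta>' where "injective_resolution U R N (I :: ('r, 'u) cplx) \<eta>'"
    "\<And>n. carrier (C n) = {\<zero>\<^bsub>C n\<^esub>} \<Longrightarrow> trivial_module (cobj I (- int n))"
proof -
  note CD = inj_coresolutionD[OF C]
  have "\<forall>n. \<exists>M c e. left_module R (M :: ('r, 'u) module) \<and> c \<in> mod_hom R (C n) M \<and> e \<in> mod_hom R M (C n) \<and>
      (\<forall>x\<in>carrier (C n). e (c x) = x) \<and> (\<forall>y\<in>carrier M. c (e y) = y) \<and> carrier M = c ` carrier (C n)"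
    using copy_exists[OF CD(3,4)] by (metis (no_types, lifting))
  then obtain M :: "nat \<Rightarrow> ('r, 'u) module" and c e where M: "\<And>n. left_module R (M n)"
    and c: "\<And>n. c n \<in> mod_hom R (C n) (M n)" and e: "\<And>n. e n \<in> mod_hom R (M n) (C n)"
    and ec: "\<And>n x. x \<in> carrier (C n) \<Longrightarrow> e n (c n x) = x"
    and ce: "\<And>n y. y \<in> carrier (M n) \<Longrightarrow> c n (e n y) = y" and car: "\<And>n. carrier (M n) = c n ` carrier (C n)"
    by metis
  have Minj: "injective_module U R (M n)" for n
    by (rule injective_retract[OF CD(2) M e c ce])
  define \<delta> where "\<delta> n x = c (Suc n) (d n (e n x))" for n x
  have \<delta>: "\<delta> n \<in> mod_hom R (M n) (M (Suc n))" for n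
    unfolding \<delta>_def by (rule mod_hom_comp[OF mod_hom_comp[OF e CD(5)] c])
  note c0 = mod_hom_zero[OF CD(3) M c] and e0 = mod_hom_zero[OF M CD(3) e]
  note cc = mod_homD(1)[OF c] and ecl = mod_homD(1)[OF e] and dc = mod_homD(1)[OF CD(5)]
  have \<delta>c: "\<delta> n (c n x) = c (Suc n) (d n x)" if "x \<in> carrier (C n)" for n x
    using ec that by (simp add: \<delta>_def)
  have c_zero_iff: "c n x = \<zero>\<^bsub>M n\<^esub> \<longleftrightarrow> x = \<zero>\<^bsub>C n\<^esub>" if "x \<in> carrier (C n)" for n x
    using ec[OF that] e0[of n] c0[of n] by metis
  have ker: "{x \<in> carrier (M n). \<delta> n x = \<zero>\<^bsub>M (Suc n)\<^esub>} = c n ` {x \<in> carrier (C n). d n x = \<zero>\<^bsub>C (Suc n)\<^esub>}" for n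
    using \<delta>c c_zero_iff dc unfolding car by fastforce
  have im: "\<delta> n ` carrier (M n) = c (Suc n) ` (d n ` carrier (C n))" for n
    unfolding car using \<delta>c by (force simp: image_image)
  define Z0 where "Z0 = (M 0)\<lparr>carrier := {\<zero>\<^bsub>M 0\<^esub>}\<rparr>"
  have Z0: "left_module R Z0"
    unfolding Z0_def by (rule left_module.left_module_sub[OF M left_module.submodule_zero[OF M]])
  have Zc: "carrier Z0 = {\<zero>\<^bsub>Z0\<^esub>}" and Z00: "\<zero>\<^bsub>Z0\<^esub> = \<zero>\<^bsub>M 0\<^esub>" by (simp_all add: Z0_def)
  \<comment> \<open>Degree n becomes degree -n. \<open>Z0\<close> shares its zero element with
    \<open>M 0\<close>, so the same constant is a zero map between positive degrees and from degree
    1 to degree 0.\<close>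
  define I where "I = \<lparr>cobj = (\<lambda>n. if n > 0 then Z0 else M (nat (- n))),
     cdiff = (\<lambda>n x. if n > 0 then \<zero>\<^bsub>Z0\<^esub> else \<delta> (nat (- n)) x)\<rparr>"
  have obj: "cobj I (- int n) = M n" "cobj I (- int n - 1) = M (Suc n)" "cobj I (- int n - 2) = M (Suc (Suc n))" for n
  proof -
    have "nat (1 + int n) = Suc n" "nat (2 + int n) = Suc (Suc n)" by simp_all
    then show "cobj I (- int n) = M n" "cobj I (- int n - 1) = M (Suc n)" "cobj I (- int n - 2) = M (Suc (Suc n))"
      by (simp_all add: I_def add.commute)
  qed
  have diff: "cdiff I (- int n) = \<delta> n" "cdiff I (- int n - 1) = \<delta> (Suc n)" for n
  proof -
    have "nat (1 + int n) = Suc n" by simp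
    then show "cdiff I (- int n) = \<delta> n" "cdiff I (- int n - 1) = \<delta> (Suc n)"
      by (simp_all add: I_def fun_eq_iff add.commute)
  qed
  have pos: "cobj I n = Z0" "cdiff I n = (\<lambda>x. \<zero>\<^bsub>Z0\<^esub>)" if "n > 0" for n using that by (simp_all add: I_def)
  have neg: "\<exists>k. n = - int k" if "\<not> n > 0" for n
    using that by (intro exI[of _ "nat (- n)"]) simp
  have mod: "left_module R (cobj I n)" for n using Z0 M by (simp add: I_def)
  have zero_pred: "\<zero>\<^bsub>cobj I (n - 1)\<^esub> = \<zero>\<^bsub>Z0\<^esub>" if "n > 0" for n
  proof (cases "n = 1")
    case True
    then show ?thesis using obj(1)[of 0] Z00 by simp
  next
    case False
    then show ?thesis using that pos(1)[of "n - 1"] by simp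
  qed
  have \<delta>\<delta>: "\<delta> (Suc n) (\<delta> n x) = \<zero>\<^bsub>M (Suc (Suc n))\<^esub>" if "x \<in> carrier (M n)" for n x
    using that inj_coresolution_dd[OF C ecl] ec[OF dc[OF ecl]] c0 by (simp add: \<delta>_def)
  have hom: "cdiff I n \<in> mod_hom R (cobj I n) (cobj I (n - 1))" for n
  proof (cases "n > 0")
    case True
    then show ?thesis using mod_hom_const_zero[OF mod] zero_pred[OF True] pos(2)[OF True] by metis
  next
    case False
    then obtain k where "n = - int k" using neg by blast
    then show ?thesis using \<delta> obj diff by simp
  qed
  have sq: "cdiff I (n - 1) (cdiff I n x) = \<zero>\<^bsub>cobj I (n - 2)\<^esub>" if x: "x \<in> carrier (cobj I n)" for n x
  proof (cases "n > 0")
    case True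
    have "cdiff I n x = \<zero>\<^bsub>cobj I (n - 1)\<^esub>" using pos(2)[OF True] zero_pred[OF True] by simp
    then show ?thesis using mod_hom_zero[OF mod mod hom, of "n - 1"] by (simp add: diff_diff_eq)
  next
    case False
    then obtain k where "n = - int k" using neg by blast
    then show ?thesis using \<delta>\<delta> obj diff x by simp
  qed
  have "injective_resolution U R N I (\<lambda>x. c 0 (\<eta> x))"
    unfolding injective_resolution_def is_complex_def
  proof (intro conjI allI impI ballI mod hom)
    show "cdiff I (n - 1) (cdiff I n x) = \<zero>\<^bsub>cobj I (n - 2)\<^esub>" if "x \<in> carrier (cobj I n)" for n x
      by (rule sq[OF that])
    show "injective_module U R (cobj I n)" for n
      using injective_zero[OF Z0 Zc, of U] Minj by (simp add: I_def)
    show "trivial_module (cobj I n)" if "n > 0" for n using pos[OF that] Zc by (simp add: trivial_module_def)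
    show "(\<lambda>x. c 0 (\<eta> x)) \<in> mod_hom R N (cobj I 0)" using mod_hom_comp[OF CD(6) c] obj(1)[of 0] by simp
    show "inj_on (\<lambda>x. c 0 (\<eta> x)) (carrier N)"
      using CD(7) ec mod_homD(1)[OF CD(6)] by (auto simp: inj_on_def) metis
    show "(\<lambda>x. c 0 (\<eta> x)) ` carrier N = cycles I 0"
      using ker[of 0] CD(8) obj(1)[of 0] obj(2)[of 0] diff(1)[of 0] by (simp add: cycles_def image_image)
    show "cycles I n = boundaries I n" if "n < 0" for n
    proof -
      define k where "k = nat (- n - 1)"
      have k: "n = - int k - 1" using that by (simp add: k_def)
      have e: "- 2 - int k = - int k - 2" by simp
      have "cobj I (- 2 - int k) = M (Suc (Suc k))" unfolding e by (rule obj(3))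
      then have "cycles I n = \<delta> k ` carrier (M k)"
        unfolding cycles_def k using obj[of k] diff(2)[of k] ker[of "Suc k"] CD(9)[of k] im[of k] by simp
      then show ?thesis unfolding boundaries_def k using obj(1)[of k] diff(1)[of k] by simp
    qed
  qed
  moreover have "trivial_module (cobj I (- int n))" if "carrier (C n) = {\<zero>\<^bsub>C n\<^esub>}" for n
    using that obj(1) car[of n] c0 by (simp add: trivial_module_def)
  ultimately show ?thesis using that by blast
qed

lemma injective_resolution_coresolution:
  fixes U :: "'u itself"
  assumes N: "left_module R N" and I: "injective_resolution U R N I \<eta>"
  shows "inj_coresolution U R N (\<lambda>n. cobj I (- int n)) (\<lambda>n. cdiff I (- int n)) \<eta>"
proof -
  have e: "- int (Suc n) = - int n - 1" for n by simp
  have cyc: "{x \<in> carrier (cobj I (- int n)). cdiff I (- int n) x = \<zero>\<^bsub>cobj I (- int (Suc n))\<^esub>} = cycles I (- int n)" for n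
    unfolding cycles_def e ..
  have b: "boundaries I (- int (Suc n)) = cdiff I (- int n) ` carrier (cobj I (- int n))" for n
    unfolding boundaries_def by simp
  have hom: "cdiff I (- int n) \<in> mod_hom R (cobj I (- int n)) (cobj I (- int (Suc n)))" for n
    using I unfolding injective_resolution_def is_complex_def e by blast
  show ?thesis
    unfolding inj_coresolution_def
  proof (intro conjI allI N hom)
    show "{x \<in> carrier (cobj I (- int 0)). cdiff I (- int 0) x = \<zero>\<^bsub>cobj I (- int 1)\<^esub>} = \<eta> ` carrier N"
      using cyc[of 0] I by (simp add: injective_resolution_def)
    show "{x \<in> carrier (cobj I (- int (Suc n))). cdiff I (- int (Suc n)) x = \<zero>\<^bsub>cobj I (- int (Suc (Suc n)))\<^esub>}
        = cdiff I (- int n) ` carrier (cobj I (- int n))" for n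
      unfolding cyc b[symmetric] using I by (simp add: injective_resolution_def)
  qed (use I in \<open>auto simp: injective_resolution_def subset_imp_lepoll\<close>)
qed

lemma inj_dim_finite_iff:
  fixes U :: "'u itself"
  shows "inj_dim U R N < \<infinity> \<longleftrightarrow> (\<exists>(I :: ('r, 'u) cplx) \<eta> d. injective_resolution U R N I \<eta> \<and>
      (\<forall>n < - int d. trivial_module (cobj I n)))"
proof -
  let ?D = "{d. \<exists>(I :: ('r, 'u) cplx) \<eta>. injective_resolution U R N I \<eta> \<and> (\<forall>n < - int d. trivial_module (cobj I n))}"
  have "inj_dim U R N < \<infinity> \<longleftrightarrow> (\<exists>x\<in>enat ` ?D. x < \<infinity>)" unfolding inj_dim_def by (rule Inf_less_iff)
  also have "\<dots> \<longleftrightarrow> ?D \<noteq> {}" by auto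
  finally show ?thesis by blast
qed

text \<open>Where \<open>h\<close> vanishes, the homotopy from \<open>h\<close> to the identity is a
  contraction. This splits the cocycles in degree L + 1, and the coresolution can be cut
  there.\<close>

lemma inj_dim_finiteI:
  assumes C: "inj_coresolution U R N C d \<eta>"
    and h: "\<And>n. h n \<in> mod_hom R (C n) (C n)"
    and hd: "\<And>n x. x \<in> carrier (C n) \<Longrightarrow> h (Suc n) (d n x) = d n (h n x)"
    and h\<eta>: "\<And>x. x \<in> carrier N \<Longrightarrow> h 0 (\<eta> x) = \<eta> x"
    and h0: "\<And>x. x \<in> carrier (C (Suc L)) \<Longrightarrow> h (Suc L) x = \<zero>\<^bsub>C (Suc L)\<^esub>"
  shows "inj_dim U R N < \<infinity>"
proof -
  obtain s where s: "\<And>n. s n \<in> mod_hom R (C (Suc n)) (C n)"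
    "\<And>n x. x \<in> carrier (C (Suc n)) \<Longrightarrow> h (Suc n) x = \<zero>\<^bsub>C (Suc n)\<^esub> \<Longrightarrow>
      d n (s n x) \<oplus>\<^bsub>C (Suc n)\<^esub> s (Suc n) (d (Suc n) x) = x"
    using coresolution_contraction[OF C h hd h\<eta>] by blast
  obtain C' d' where C': "inj_coresolution U R N C' d' \<eta>" "\<And>n. n > Suc L \<Longrightarrow> carrier (C' n) = {\<zero>\<^bsub>C' n\<^esub>}"
    using coresolution_truncate[OF C s(1) s(1) s(2)[OF _ h0]] by blast
  obtain I \<eta>' where I: "injective_resolution U R N I \<eta>'"
    "\<And>n. carrier (C' n) = {\<zero>\<^bsub>C' n\<^esub>} \<Longrightarrow> trivial_module (cobj I (- int n))"
    using coresolution_copy[OF C'(1)] by blast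
  have "trivial_module (cobj I n)" if "n < - int (Suc L)" for n
    using I(2)[OF C'(2), of "nat (- n)"] that by simp
  then show ?thesis unfolding inj_dim_finite_iff using I(1) by blast
qed

text \<open>Comparison with a bounded resolution and back is an endomorphism over the identity of
  \<open>N\<close> that factors through zero above degree \<open>L\<close>. Hence an arbitrary
  coresolution of \<open>N\<close> contracts in those degrees.\<close>

lemma inj_dim_finiteD:
  fixes U :: "'u itself"
  assumes N: "left_module R N" and fin: "inj_dim U R N < \<infinity>" and C: "inj_coresolution U R N C d \<eta>"
  obtains s L where "\<And>n. s n \<in> mod_hom R (C (Suc n)) (C n)"
    "\<And>n x. n \<ge> L \<Longrightarrow> x \<in> carrier (C (Suc n)) \<Longrightarrow> d n (s n x) \<oplus>\<^bsub>C (Suc n)\<^esub> s (Suc n) (d (Suc n) x) = x"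
proof -
  obtain I :: "('a, 'u) cplx" and \<eta>' L where I: "injective_resolution U R N I \<eta>'"
    "\<And>n. n < - int L \<Longrightarrow> trivial_module (cobj I n)"
    using fin unfolding inj_dim_finite_iff by blast
  let ?I = "\<lambda>n. cobj I (- int n)" and ?d = "\<lambda>n. cdiff I (- int n)"
  note B = injective_resolution_coresolution[OF N I(1)]
  obtain f where f: "\<And>n. f n \<in> mod_hom R (C n) (?I n)"
    "\<And>n x. x \<in> carrier (C n) \<Longrightarrow> f (Suc n) (d n x) = ?d n (f n x)" "\<And>x. x \<in> carrier N \<Longrightarrow> f 0 (\<eta> x) = \<eta>' x"
    using coresolution_comparison[OF C B] by blast
  obtain g where g: "\<And>n. g n \<in> mod_hom R (?I n) (C n)"
    "\<And>n x. x \<in> carrier (?I n) \<Longrightarrow> g (Suc n) (?d n x) = d n (g n x)" "\<And>x. x \<in> carrier N \<Longrightarrow> g 0 (\<eta>' x) = \<eta> x"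
    using coresolution_comparison[OF B C] by blast
  obtain s where s: "\<And>n. s n \<in> mod_hom R (C (Suc n)) (C n)"
    "\<And>n x. x \<in> carrier (C (Suc n)) \<Longrightarrow> g (Suc n) (f (Suc n) x) = \<zero>\<^bsub>C (Suc n)\<^esub> \<Longrightarrow>
      d n (s n x) \<oplus>\<^bsub>C (Suc n)\<^esub> s (Suc n) (d (Suc n) x) = x"
  proof (rule coresolution_contraction[OF C, of "\<lambda>n x. g n (f n x)"])
    show "(\<lambda>x. g n (f n x)) \<in> mod_hom R (C n) (C n)" for n by (rule mod_hom_comp[OF f(1) g(1)])
  qed (use f g mod_homD(1)[OF f(1)] in auto)
  have "g (Suc n) (f (Suc n) x) = \<zero>\<^bsub>C (Suc n)\<^esub>" if "n \<ge> L" "x \<in> carrier (C (Suc n))" for n x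
  proof -
    have "trivial_module (?I (Suc n))" using I(2) that(1) by simp
    then have "f (Suc n) x = \<zero>\<^bsub>?I (Suc n)\<^esub>"
      using mod_homD(1)[OF f(1) that(2)] unfolding trivial_module_def by blast
    then show ?thesis
      using mod_hom_zero[OF inj_coresolutionD(3)[OF B] inj_coresolutionD(3)[OF C] g(1), of "Suc n"] by simp
  qed
  then show ?thesis using that[of s L] s by blast
qed

section \<open>Quotients and tensor products as abelian groups\<close>

subsection \<open>Additive maps and quotients of abelian groups\<close>

text \<open>Triviality of a homology module is a statement about abelian groups, so tensor products
  are studied through additive maps. This also covers \<open>pre_tensor\<close>, which is not a
  module.\<close>

definition add_hom :: "('a, 'c) ring_scheme \<Rightarrow> ('b, 'd) ring_scheme \<Rightarrow> ('a \<Rightarrow> 'b) set" where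
  "add_hom G H = {f \<in> carrier G \<rightarrow> carrier H.
    \<forall>x\<in>carrier G. \<forall>y\<in>carrier G. f (x \<oplus>\<^bsub>G\<^esub> y) = f x \<oplus>\<^bsub>H\<^esub> f y}"

lemma add_homD:
  assumes "f \<in> add_hom G H"
  shows "x \<in> carrier G \<Longrightarrow> f x \<in> carrier H"
    "x \<in> carrier G \<Longrightarrow> y \<in> carrier G \<Longrightarrow> f (x \<oplus>\<^bsub>G\<^esub> y) = f x \<oplus>\<^bsub>H\<^esub> f y"
  using assms by (auto simp: add_hom_def)

lemma add_homI:
  assumes "\<And>x. x \<in> carrier G \<Longrightarrow> f x \<in> carrier H"
    "\<And>x y. x \<in> carrier G \<Longrightarrow> y \<in> carrier G \<Longrightarrow> f (x \<oplus>\<^bsub>G\<^esub> y) = f x \<oplus>\<^bsub>H\<^esub> f y"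
  shows "f \<in> add_hom G H"
  using assms by (auto simp: add_hom_def)

lemma add_hom_comp: "f \<in> add_hom G H \<Longrightarrow> g \<in> add_hom H L \<Longrightarrow> (\<lambda>x. g (f x)) \<in> add_hom G L"
  by (auto simp: add_hom_def Pi_def)

lemma mod_hom_add_hom: "f \<in> mod_hom R A B \<Longrightarrow> f \<in> add_hom A B"
  by (auto simp: mod_hom_def add_hom_def)

lemma (in abelian_group) add_cancel_self: "x \<oplus> y = x \<Longrightarrow> x \<in> carrier G \<Longrightarrow> y \<in> carrier G \<Longrightarrow> y = \<zero>"
  using add.l_cancel_one by blast

lemma add_hom_zero:
  assumes "abelian_group G" "abelian_group H" "f \<in> add_hom G H"
  shows "f \<zero>\<^bsub>G\<^esub> = \<zero>\<^bsub>H\<^esub>"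
proof -
  interpret G: abelian_group G by fact
  interpret H: abelian_group H by fact
  have "f \<zero>\<^bsub>G\<^esub> \<oplus>\<^bsub>H\<^esub> f \<zero>\<^bsub>G\<^esub> = f \<zero>\<^bsub>G\<^esub>"
    using add_homD(2)[OF assms(3), of "\<zero>\<^bsub>G\<^esub>" "\<zero>\<^bsub>G\<^esub>"] by simp
  then show ?thesis using H.add_cancel_self add_homD(1)[OF assms(3)] by simp
qed

lemma add_hom_minus:
  assumes "abelian_group G" "abelian_group H" "f \<in> add_hom G H" "x \<in> carrier G"
  shows "f (\<ominus>\<^bsub>G\<^esub> x) = \<ominus>\<^bsub>H\<^esub> f x"
proof -
  interpret G: abelian_group G by fact
  interpret H: abelian_group H by fact
  have "f (\<ominus>\<^bsub>G\<^esub> x) \<oplus>\<^bsub>H\<^esub> f x = \<zero>\<^bsub>H\<^esub>"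
    using add_homD(2)[OF assms(3), of "\<ominus>\<^bsub>G\<^esub> x" x] assms(4) add_hom_zero[OF assms(1-3)] by (simp add: G.l_neg)
  then show ?thesis using H.minus_equality add_homD(1)[OF assms(3)] assms(4) by simp
qed

lemma add_hom_diff:
  assumes "abelian_group G" "abelian_group H" "f \<in> add_hom G H" "x \<in> carrier G" "y \<in> carrier G"
  shows "f (x \<ominus>\<^bsub>G\<^esub> y) = f x \<ominus>\<^bsub>H\<^esub> f y"
proof -
  interpret G: abelian_group G by fact
  show ?thesis
    using add_homD(2)[OF assms(3,4), of "\<ominus>\<^bsub>G\<^esub> y"] add_hom_minus[OF assms(1-3,5)] assms(5)
    by (simp add: a_minus_def)
qed

lemma add_hom_finsum:
  assumes G: "abelian_group G" and H: "abelian_group H" and f: "f \<in> add_hom G H"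
    and T: "finite T" "x \<in> T \<rightarrow> carrier G"
  shows "f (finsum G x T) = finsum H (\<lambda>i. f (x i)) T"
  using T
proof (induction T rule: finite_induct)
  case empty
  interpret G: abelian_group G by fact
  interpret H: abelian_group H by fact
  show ?case using add_hom_zero[OF G H f] by simp
next
  case (insert a T)
  interpret G: abelian_group G by fact
  interpret H: abelian_group H by fact
  show ?case using insert add_homD[OF f] by (simp add: Pi_iff G.finsum_closed)
qed

lemma quot_module_carrier: "carrier (quot_module M S) = {S +>\<^bsub>M\<^esub> x | x. x \<in> carrier M}"
  by (auto simp: quot_module_def A_RCOSETS_def')

lemma quot_module_add:
  assumes "abelian_subgroup S M" "x \<in> carrier M" "y \<in> carrier M"
  shows "(S +>\<^bsub>M\<^esub> x) \<oplus>\<^bsub>quot_module M S\<^esub> (S +>\<^bsub>M\<^esub> y) = S +>\<^bsub>M\<^esub> (x \<oplus>\<^bsub>M\<^esub> y)"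
  using abelian_subgroup.a_rcos_sum[OF assms] by (simp add: quot_module_def)

lemma quot_module_zero:
  assumes "abelian_subgroup S M"
  shows "\<zero>\<^bsub>quot_module M S\<^esub> = S +>\<^bsub>M\<^esub> \<zero>\<^bsub>M\<^esub>"
proof -
  interpret abelian_subgroup S M by fact
  show ?thesis using a_coset_add_zero[OF a_subset] by (simp add: quot_module_def)
qed

lemma quot_module_abelian_group:
  assumes S: "abelian_subgroup S M"
  shows "abelian_group (quot_module M S)"
proof -
  interpret abelian_subgroup S M by fact
  note q = quot_module_add[OF S] quot_module_zero[OF S]
  show ?thesis
  proof (rule abelian_groupI)
    fix C assume "C \<in> carrier (quot_module M S)"
    then obtain x where "x \<in> carrier M" "C = S +>\<^bsub>M\<^esub> x" by (auto simp: quot_module_carrier)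
    moreover have "S +>\<^bsub>M\<^esub> (\<ominus>\<^bsub>M\<^esub> x) \<in> carrier (quot_module M S)" if "x \<in> carrier M" for x
      unfolding quot_module_carrier using that by blast
    ultimately show "\<exists>D\<in>carrier (quot_module M S). D \<oplus>\<^bsub>quot_module M S\<^esub> C = \<zero>\<^bsub>quot_module M S\<^esub>"
      by (intro bexI[of _ "S +>\<^bsub>M\<^esub> (\<ominus>\<^bsub>M\<^esub> x)"]) (auto simp: q l_neg)
  next
    fix C D assume "C \<in> carrier (quot_module M S)" "D \<in> carrier (quot_module M S)"
    then obtain x y where xy: "x \<in> carrier M" "y \<in> carrier M" "C = S +>\<^bsub>M\<^esub> x" "D = S +>\<^bsub>M\<^esub> y"
      by (auto simp: quot_module_carrier)
    then have "C \<oplus>\<^bsub>quot_module M S\<^esub> D = S +>\<^bsub>M\<^esub> (x \<oplus>\<^bsub>M\<^esub> y)" using q(1) by simp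
    then show "C \<oplus>\<^bsub>quot_module M S\<^esub> D \<in> carrier (quot_module M S)"
      unfolding quot_module_carrier using a_closed[OF xy(1,2)] by blast
  next
    show "\<zero>\<^bsub>quot_module M S\<^esub> \<in> carrier (quot_module M S)"
      unfolding quot_module_carrier q(2) using zero_closed a_subset by blast
  qed (auto simp: quot_module_carrier q a_ac)
qed

lemma quot_proj_add_hom:
  assumes S: "abelian_subgroup S M"
  shows "(\<lambda>x. S +>\<^bsub>M\<^esub> x) \<in> add_hom M (quot_module M S)"
  by (rule add_homI) (auto simp: quot_module_add[OF S] quot_module_carrier)

subsection \<open>Tensor products of modules\<close>

lemma keys_add_subset: "Poly_Mapping.keys a \<subseteq> S \<Longrightarrow> Poly_Mapping.keys b \<subseteq> S \<Longrightarrow> Poly_Mapping.keys (a + b) \<subseteq> S"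
  using keys_add[of a b] by blast

lemma keys_diff_subset:
  fixes a b :: "'a \<Rightarrow>\<^sub>0 int"
  shows "Poly_Mapping.keys a \<subseteq> S \<Longrightarrow> Poly_Mapping.keys b \<subseteq> S \<Longrightarrow> Poly_Mapping.keys (a - b) \<subseteq> S"
  using keys_diff[of a b] by blast

lemma pre_tensor_simps [simp]:
  "carrier (pre_tensor R X Y) = {c. Poly_Mapping.keys c \<subseteq> carrier X \<times> carrier Y}"
  "zero (pre_tensor R X Y) = 0" "add (pre_tensor R X Y) = (+)"
  by (simp_all add: pre_tensor_def free_Abelian_group_def)

lemma pre_tensor_abelian_group: "abelian_group (pre_tensor R X Y)"
proof (rule abelian_groupI)
  fix c assume "c \<in> carrier (pre_tensor R X Y)"
  then show "\<exists>y\<in>carrier (pre_tensor R X Y). y \<oplus>\<^bsub>pre_tensor R X Y\<^esub> c = \<zero>\<^bsub>pre_tensor R X Y\<^esub>"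
    by (intro bexI[of _ "- c"]) auto
qed (simp_all add: add_ac keys_add_subset)

lemma pre_tensor_minus:
  assumes "c \<in> carrier (pre_tensor R X Y)"
  shows "\<ominus>\<^bsub>pre_tensor R X Y\<^esub> c = - c"
proof -
  interpret abelian_group "pre_tensor R X Y" by (rule pre_tensor_abelian_group)
  show ?thesis using minus_equality[of "- c" c] assms by simp
qed

text \<open>The generating set receives a name so that statements about \<open>tensor_rels\<close>
  can be proved by induction on \<open>generate\<close>.\<close>

definition tensor_rel_generators where
  "tensor_rel_generators R X Y =
    {frag_of (x \<oplus>\<^bsub>X\<^esub> x', y) - frag_of (x, y) - frag_of (x', y) | x x' y.
        x \<in> carrier X \<and> x' \<in> carrier X \<and> y \<in> carrier Y} \<union>
     {frag_of (x, y \<oplus>\<^bsub>Y\<^esub> y') - frag_of (x, y) - frag_of (x, y') | x y y'.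
        x \<in> carrier X \<and> y \<in> carrier Y \<and> y' \<in> carrier Y} \<union>
     {frag_of (r \<odot>\<^bsub>X\<^esub> x, y) - frag_of (x, r \<odot>\<^bsub>Y\<^esub> y) | r x y.
        r \<in> carrier R \<and> x \<in> carrier X \<and> y \<in> carrier Y}"

lemma tensor_rels_generate:
  "tensor_rels R X Y = generate (free_Abelian_group (carrier X \<times> carrier Y)) (tensor_rel_generators R X Y)"
  by (simp add: tensor_rels_def tensor_rel_generators_def)

lemma tensor_rel_generators_closed:
  fixes R :: "('k, 'r) module"
  assumes X: "left_module (op_ring R) X" and Y: "left_module R Y"
  shows "tensor_rel_generators R X Y \<subseteq> carrier (free_Abelian_group (carrier X \<times> carrier Y))"
proof -
  interpret X: left_module "op_ring R" X by fact
  interpret Y: left_module R Y by fact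
  show ?thesis
  proof
    fix c assume "c \<in> tensor_rel_generators R X Y"
    then show "c \<in> carrier (free_Abelian_group (carrier X \<times> carrier Y))"
      unfolding tensor_rel_generators_def
      by (elim UnE CollectE exE conjE) (simp_all add: keys_diff_subset X.smult_closed[simplified])
  qed
qed

lemma tensor_rels_subgroup:
  fixes R :: "('k, 'r) module"
  assumes X: "left_module (op_ring R) X" and Y: "left_module R Y"
  shows "abelian_subgroup (tensor_rels R X Y) (pre_tensor R X Y)"
proof (rule abelian_subgroupI3[OF _ pre_tensor_abelian_group], rule additive_subgroup.intro)
  let ?G = "free_Abelian_group (carrier X \<times> carrier Y)"
  interpret H: subgroup "tensor_rels R X Y" ?G
    unfolding tensor_rels_generate
    by (rule group.generate_is_subgroup[OF group_free_Abelian_group tensor_rel_generators_closed[OF X Y]])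
  have keys: "Poly_Mapping.keys c \<subseteq> carrier X \<times> carrier Y" if "c \<in> tensor_rels R X Y" for c
    using subsetD[OF H.subset that] by simp
  show "subgroup (tensor_rels R X Y) (add_monoid (pre_tensor R X Y))"
  proof (rule subgroup.intro)
    show "tensor_rels R X Y \<subseteq> carrier (add_monoid (pre_tensor R X Y))" using keys by (simp add: subset_iff)
    fix c assume c: "c \<in> tensor_rels R X Y"
    have "- c \<in> tensor_rels R X Y" using H.m_inv_closed[OF c] keys[OF c] by simp
    then show "inv\<^bsub>add_monoid (pre_tensor R X Y)\<^esub> c \<in> tensor_rels R X Y"
      using pre_tensor_minus[of c R X Y] keys[OF c] by (simp add: a_inv_def)
  qed (use H.m_closed H.one_closed in auto)
qed

definition ten where
  "ten R X Y x y = tensor_rels R X Y +>\<^bsub>pre_tensor R X Y\<^esub> frag_of (x, y)"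

context
  fixes R :: "('k, 'r) module" and X :: "('r, 'x) module" and Y :: "('r, 'y) module"
  assumes X: "left_module (op_ring R) X" and Y: "left_module R Y"
begin

interpretation X: left_module "op_ring R" X by (rule X)
interpretation Y: left_module R Y by (rule Y)

lemma tensor_abelian_group: "abelian_group (tensor_module R X Y)"
  unfolding tensor_module_def by (rule quot_module_abelian_group[OF tensor_rels_subgroup[OF X Y]])

lemma ten_closed: "x \<in> carrier X \<Longrightarrow> y \<in> carrier Y \<Longrightarrow> ten R X Y x y \<in> carrier (tensor_module R X Y)"
  unfolding ten_def tensor_module_def quot_module_carrier by auto

lemma tensor_coset_relation:
  assumes "a - b \<in> tensor_rels R X Y" "a \<in> carrier (pre_tensor R X Y)" "b \<in> carrier (pre_tensor R X Y)"
  shows "tensor_rels R X Y +>\<^bsub>pre_tensor R X Y\<^esub> a = tensor_rels R X Y +>\<^bsub>pre_tensor R X Y\<^esub> b"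
proof -
  interpret T: abelian_subgroup "tensor_rels R X Y" "pre_tensor R X Y" by (rule tensor_rels_subgroup[OF X Y])
  have "a \<ominus>\<^bsub>pre_tensor R X Y\<^esub> b = a - b" unfolding a_minus_def pre_tensor_minus[OF assms(3)] by simp
  then show ?thesis using T.coset_eq_iff[OF assms(2,3)] assms(1) by simp
qed

lemma ten_relations:
  shows ten_add_left: "x \<in> carrier X \<Longrightarrow> x' \<in> carrier X \<Longrightarrow> y \<in> carrier Y \<Longrightarrow>
      ten R X Y (x \<oplus>\<^bsub>X\<^esub> x') y = ten R X Y x y \<oplus>\<^bsub>tensor_module R X Y\<^esub> ten R X Y x' y"
    and ten_add_right: "x \<in> carrier X \<Longrightarrow> y \<in> carrier Y \<Longrightarrow> y' \<in> carrier Y \<Longrightarrow>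
      ten R X Y x (y \<oplus>\<^bsub>Y\<^esub> y') = ten R X Y x y \<oplus>\<^bsub>tensor_module R X Y\<^esub> ten R X Y x y'"
    and ten_balanced: "r \<in> carrier R \<Longrightarrow> x \<in> carrier X \<Longrightarrow> y \<in> carrier Y \<Longrightarrow>
      ten R X Y (r \<odot>\<^bsub>X\<^esub> x) y = ten R X Y x (r \<odot>\<^bsub>Y\<^esub> y)"
proof -
  note T = tensor_rels_subgroup[OF X Y]
  have gen: "g \<in> tensor_rels R X Y" if "g \<in> tensor_rel_generators R X Y" for g
    unfolding tensor_rels_generate using that by (rule generate.incl)
  have sum: "tensor_rels R X Y +>\<^bsub>pre_tensor R X Y\<^esub> (frag_of p + frag_of q)
      = (tensor_rels R X Y +>\<^bsub>pre_tensor R X Y\<^esub> frag_of p) \<oplus>\<^bsub>tensor_module R X Y\<^esub>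
        (tensor_rels R X Y +>\<^bsub>pre_tensor R X Y\<^esub> frag_of q)"
    if "p \<in> carrier X \<times> carrier Y" "q \<in> carrier X \<times> carrier Y" for p q
    using quot_module_add[OF T, of "frag_of p" "frag_of q"] that by (simp add: tensor_module_def)
  {
    assume *: "x \<in> carrier X" "x' \<in> carrier X" "y \<in> carrier Y"
    then have "frag_of (x \<oplus>\<^bsub>X\<^esub> x', y) - frag_of (x, y) - frag_of (x', y) \<in> tensor_rel_generators R X Y"
      unfolding tensor_rel_generators_def by blast
    then have "frag_of (x \<oplus>\<^bsub>X\<^esub> x', y) - (frag_of (x, y) + frag_of (x', y)) \<in> tensor_rels R X Y"
      using gen by (simp add: diff_diff_eq)
    from tensor_coset_relation[OF this] show "ten R X Y (x \<oplus>\<^bsub>X\<^esub> x') y = ten R X Y x y \<oplus>\<^bsub>tensor_module R X Y\<^esub> ten R X Y x' y"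
      unfolding ten_def using * sum[of "(x, y)" "(x', y)"] by (simp add: keys_add_subset)
  }
  {
    assume *: "x \<in> carrier X" "y \<in> carrier Y" "y' \<in> carrier Y"
    then have "frag_of (x, y \<oplus>\<^bsub>Y\<^esub> y') - frag_of (x, y) - frag_of (x, y') \<in> tensor_rel_generators R X Y"
      unfolding tensor_rel_generators_def by blast
    then have "frag_of (x, y \<oplus>\<^bsub>Y\<^esub> y') - (frag_of (x, y) + frag_of (x, y')) \<in> tensor_rels R X Y"
      using gen by (simp add: diff_diff_eq)
    from tensor_coset_relation[OF this] show "ten R X Y x (y \<oplus>\<^bsub>Y\<^esub> y') = ten R X Y x y \<oplus>\<^bsub>tensor_module R X Y\<^esub> ten R X Y x y'"
      unfolding ten_def using * sum[of "(x, y)" "(x, y')"] by (simp add: keys_add_subset)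
  }
  {
    assume *: "r \<in> carrier R" "x \<in> carrier X" "y \<in> carrier Y"
    then have "frag_of (r \<odot>\<^bsub>X\<^esub> x, y) - frag_of (x, r \<odot>\<^bsub>Y\<^esub> y) \<in> tensor_rel_generators R X Y"
      unfolding tensor_rel_generators_def by blast
    then show "ten R X Y (r \<odot>\<^bsub>X\<^esub> x) y = ten R X Y x (r \<odot>\<^bsub>Y\<^esub> y)"
      unfolding ten_def using * X.smult_closed[of r x] gen by (intro tensor_coset_relation) simp_all
  }
qed

lemma tensor_hom_ext:
  assumes A: "abelian_group A" and f: "f \<in> add_hom (tensor_module R X Y) A" and g: "g \<in> add_hom (tensor_module R X Y) A"
    and eq: "\<And>x y. x \<in> carrier X \<Longrightarrow> y \<in> carrier Y \<Longrightarrow> f (ten R X Y x y) = g (ten R X Y x y)"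
    and t: "t \<in> carrier (tensor_module R X Y)"
  shows "f t = g t"
proof -
  let ?T = "tensor_module R X Y" and ?P = "pre_tensor R X Y"
  let ?q = "\<lambda>c. tensor_rels R X Y +>\<^bsub>?P\<^esub> c"
  note T = tensor_rels_subgroup[OF X Y]
  have q: "?q \<in> add_hom ?P ?T" unfolding tensor_module_def by (rule quot_proj_add_hom[OF T])
  have "f (?q c) = g (?q c)" if "Poly_Mapping.keys c \<subseteq> carrier X \<times> carrier Y" for c
  proof (rule free_Abelian_group_induct[OF that, where P = "\<lambda>c. f (?q c) = g (?q c)"], goal_cases)
    case 1
    have "?q 0 = \<zero>\<^bsub>?T\<^esub>" using quot_module_zero[OF T] by (simp add: tensor_module_def)
    then show ?case using add_hom_zero[OF tensor_abelian_group A f] add_hom_zero[OF tensor_abelian_group A g] by simp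
  next
    case (2 a b)
    have "?q (a - b) = ?q a \<ominus>\<^bsub>?T\<^esub> ?q b"
      using add_hom_diff[OF pre_tensor_abelian_group tensor_abelian_group q, of a b] 2(1,2)
      by (simp add: a_minus_def pre_tensor_minus)
    moreover have "?q a \<in> carrier ?T" "?q b \<in> carrier ?T" using add_homD(1)[OF q] 2 by auto
    ultimately show ?case
      using add_hom_diff[OF tensor_abelian_group A f] add_hom_diff[OF tensor_abelian_group A g] 2 by simp
  next
    case (3 p)
    then show ?case using eq[of "fst p" "snd p"] by (auto simp: ten_def)
  qed
  then show ?thesis using t unfolding tensor_module_def quot_module_carrier by auto
qed

lemma tensor_functional:
  assumes A: "abelian_group A" and \<beta>: "\<And>x y. x \<in> carrier X \<Longrightarrow> y \<in> carrier Y \<Longrightarrow> \<beta> x y \<in> carrier A"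
    "\<And>x x' y. x \<in> carrier X \<Longrightarrow> x' \<in> carrier X \<Longrightarrow> y \<in> carrier Y \<Longrightarrow> \<beta> (x \<oplus>\<^bsub>X\<^esub> x') y = \<beta> x y \<oplus>\<^bsub>A\<^esub> \<beta> x' y"
    "\<And>x y y'. x \<in> carrier X \<Longrightarrow> y \<in> carrier Y \<Longrightarrow> y' \<in> carrier Y \<Longrightarrow> \<beta> x (y \<oplus>\<^bsub>Y\<^esub> y') = \<beta> x y \<oplus>\<^bsub>A\<^esub> \<beta> x y'"
    "\<And>r x y. r \<in> carrier R \<Longrightarrow> x \<in> carrier X \<Longrightarrow> y \<in> carrier Y \<Longrightarrow> \<beta> (r \<odot>\<^bsub>X\<^esub> x) y = \<beta> x (r \<odot>\<^bsub>Y\<^esub> y)"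
  obtains \<Theta> where "\<Theta> \<in> add_hom (tensor_module R X Y) A"
    "\<And>x y. x \<in> carrier X \<Longrightarrow> y \<in> carrier Y \<Longrightarrow> \<Theta> (ten R X Y x y) = \<beta> x y"
proof -
  interpret A: abelian_group A by fact
  let ?S = "carrier X \<times> carrier Y" and ?P = "pre_tensor R X Y"
  note T = tensor_rels_subgroup[OF X Y]
  interpret T: abelian_subgroup "tensor_rels R X Y" ?P by (rule T)
  obtain h where h: "h \<in> hom (free_Abelian_group ?S) (add_monoid A)"
    "\<And>p. p \<in> ?S \<Longrightarrow> h (frag_of p) = \<beta> (fst p) (snd p)"
    using comm_group.free_Abelian_group_universal[OF A.a_comm_group, of "\<lambda>p. \<beta> (fst p) (snd p)" ?S] \<beta>(1)
    by (auto simp: image_subset_iff)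
  have hP: "h \<in> add_hom ?P A" using h(1) by (auto simp: add_hom_def hom_def)
  have hd: "h (a - b) = h a \<ominus>\<^bsub>A\<^esub> h b"
    if "Poly_Mapping.keys a \<subseteq> ?S" "Poly_Mapping.keys b \<subseteq> ?S" for a b
    using add_hom_diff[OF pre_tensor_abelian_group A hP, of a b] that by (simp add: a_minus_def pre_tensor_minus)
  note k = keys_diff_subset
  have h0: "h c = \<zero>\<^bsub>A\<^esub>" if "c \<in> tensor_rel_generators R X Y" for c
    using that unfolding tensor_rel_generators_def
  proof (elim UnE CollectE exE conjE, goal_cases)
    case (1 x x' y)
    then show ?case
      using \<beta>(1,2) by (simp add: hd h(2) k a_minus_def A.minus_add A.a_ac A.r_neg A.r_neg1 A.r_neg2)
  next
    case (2 x y y')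
    then show ?case
      using \<beta>(1,3) by (simp add: hd h(2) k a_minus_def A.minus_add A.a_ac A.r_neg A.r_neg1 A.r_neg2)
  next
    case (3 r x y)
    then show ?case using \<beta>(1,4) X.smult_closed[of r x] by (simp add: hd h(2) a_minus_def A.r_neg)
  qed
  have h_rel: "h c = \<zero>\<^bsub>A\<^esub>" if "c \<in> tensor_rels R X Y" for c
    using that unfolding tensor_rels_generate
  proof (induction c rule: generate.induct)
    case one
    show ?case using add_hom_zero[OF pre_tensor_abelian_group A hP] by simp
  next
    case (incl c)
    then show ?case by (rule h0)
  next
    case (inv c)
    then have "Poly_Mapping.keys c \<subseteq> ?S" using subsetD[OF tensor_rel_generators_closed[OF X Y]] by simp
    then have "h (0 - c) = h 0 \<ominus>\<^bsub>A\<^esub> h c" by (intro hd) auto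
    then show ?case
      using \<open>Poly_Mapping.keys c \<subseteq> ?S\<close> h0[OF inv] add_hom_zero[OF pre_tensor_abelian_group A hP]
      by (simp add: a_minus_def)
  next
    case (eng a b)
    then have "a \<in> carrier ?P" "b \<in> carrier ?P" using T.a_subset unfolding tensor_rels_generate by blast+
    then show ?case using add_homD(2)[OF hP, of a b] eng.IH by simp
  qed
  \<comment> \<open>A representative is chosen in each coset. The choice is harmless, since two
    representatives differ by a relation, which \<open>h\<close> kills.\<close>
  define \<Theta> where "\<Theta> C = h (SOME c. c \<in> carrier ?P \<and> C = tensor_rels R X Y +>\<^bsub>?P\<^esub> c)" for C
  have \<Theta>: "\<Theta> (tensor_rels R X Y +>\<^bsub>?P\<^esub> c) = h c" if c: "c \<in> carrier ?P" for c
  proof -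
    let ?c = "SOME c'. c' \<in> carrier ?P \<and> tensor_rels R X Y +>\<^bsub>?P\<^esub> c = tensor_rels R X Y +>\<^bsub>?P\<^esub> c'"
    have c': "?c \<in> carrier ?P \<and> tensor_rels R X Y +>\<^bsub>?P\<^esub> c = tensor_rels R X Y +>\<^bsub>?P\<^esub> ?c"
      by (rule someI[of _ c]) (use c in simp)
    then have "?c \<ominus>\<^bsub>?P\<^esub> c \<in> tensor_rels R X Y" using T.coset_eq_iff[of ?c c] c by simp
    then have "h (?c \<ominus>\<^bsub>?P\<^esub> c) = \<zero>\<^bsub>A\<^esub>" by (rule h_rel)
    then have "h ?c \<ominus>\<^bsub>A\<^esub> h c = \<zero>\<^bsub>A\<^esub>"
      using add_hom_diff[OF pre_tensor_abelian_group A hP _ c] c' by simp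
    then have "h ?c = h c"
      using A.minus_equality[of "h ?c" "\<ominus>\<^bsub>A\<^esub> h c"] add_homD(1)[OF hP] c c' by (simp add: a_minus_def)
    then show ?thesis by (simp add: \<Theta>_def)
  qed
  show ?thesis
  proof (rule that)
    show "\<Theta> \<in> add_hom (tensor_module R X Y) A"
    proof (rule add_homI)
      fix C assume "C \<in> carrier (tensor_module R X Y)"
      then show "\<Theta> C \<in> carrier A"
        using \<Theta> add_homD(1)[OF hP] unfolding tensor_module_def quot_module_carrier by auto
    next
      fix C D assume "C \<in> carrier (tensor_module R X Y)" "D \<in> carrier (tensor_module R X Y)"
      then obtain c d where *: "c \<in> carrier ?P" "d \<in> carrier ?P"
        "C = tensor_rels R X Y +>\<^bsub>?P\<^esub> c" "D = tensor_rels R X Y +>\<^bsub>?P\<^esub> d"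
        unfolding tensor_module_def quot_module_carrier by auto
      show "\<Theta> (C \<oplus>\<^bsub>tensor_module R X Y\<^esub> D) = \<Theta> C \<oplus>\<^bsub>A\<^esub> \<Theta> D"
        unfolding tensor_module_def *(3,4) quot_module_add[OF T *(1,2)]
        using \<Theta>[OF *(1)] \<Theta>[OF *(2)] \<Theta>[OF T.a_closed[OF *(1,2)]] add_homD(2)[OF hP *(1,2)] by simp
    qed
    show "\<Theta> (ten R X Y x y) = \<beta> x y" if "x \<in> carrier X" "y \<in> carrier Y" for x y
      using \<Theta>[of "frag_of (x, y)"] h(2)[of "(x, y)"] that by (simp add: ten_def)
  qed
qed

lemma ten_zero_left: "y \<in> carrier Y \<Longrightarrow> ten R X Y \<zero>\<^bsub>X\<^esub> y = \<zero>\<^bsub>tensor_module R X Y\<^esub>"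
  by (rule add_hom_zero[OF X.M.abelian_group_axioms tensor_abelian_group add_homI])
    (simp_all add: ten_closed ten_add_left)

lemma tensor_trivial:
  assumes "carrier X = {\<zero>\<^bsub>X\<^esub>}" "t \<in> carrier (tensor_module R X Y)"
  shows "t = \<zero>\<^bsub>tensor_module R X Y\<^esub>"
proof (rule tensor_hom_ext[OF tensor_abelian_group _ _ _ assms(2), of "\<lambda>t. t" "\<lambda>t. \<zero>\<^bsub>tensor_module R X Y\<^esub>"])
  interpret T: abelian_group "tensor_module R X Y" by (rule tensor_abelian_group)
  show "(\<lambda>t. t) \<in> add_hom (tensor_module R X Y) (tensor_module R X Y)"
    "(\<lambda>t. \<zero>\<^bsub>tensor_module R X Y\<^esub>) \<in> add_hom (tensor_module R X Y) (tensor_module R X Y)"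
    by (auto intro!: add_homI)
qed (use assms(1) ten_zero_left in auto)

end

text \<open>The map on free groups carries each relation generator to a relation generator of the
  same kind, hence relations to relations, and so descends to the cosets.\<close>

lemma tensor_map_add_hom:
  fixes R :: "('k, 'r) module"
  assumes X: "left_module (op_ring R) X" and Y: "left_module R Y"
    and X': "left_module (op_ring R) X'" and Y': "left_module R Y'"
    and f: "f \<in> mod_hom (op_ring R) X X'" and g: "g \<in> mod_hom R Y Y'"
  shows "tensor_map R X' Y' f g \<in> add_hom (tensor_module R X Y) (tensor_module R X' Y')"
    and "x \<in> carrier X \<Longrightarrow> y \<in> carrier Y \<Longrightarrow>
      tensor_map R X' Y' f g (ten R X Y x y) = ten R X' Y' (f x) (g y)"
proof -
  let ?P = "pre_tensor R X Y" and ?P' = "pre_tensor R X' Y'"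
  let ?\<phi> = "frag_extend (\<lambda>(x, y). frag_of (f x, g y))"
  note T = tensor_rels_subgroup[OF X Y] and T' = tensor_rels_subgroup[OF X' Y']
  interpret X: left_module "op_ring R" X by fact
  interpret Y: left_module R Y by fact
  interpret T': abelian_subgroup "tensor_rels R X' Y'" ?P' by (rule T')
  have closed: "?\<phi> c \<in> carrier ?P'" if "c \<in> carrier ?P" for c
  proof -
    have "Poly_Mapping.keys (?\<phi> c) \<subseteq> (\<Union>p\<in>Poly_Mapping.keys c. Poly_Mapping.keys ((\<lambda>(x, y). frag_of (f x, g y)) p))"
      by (rule keys_frag_extend)
    also have "\<dots> \<subseteq> carrier X' \<times> carrier Y'"
      using that mod_homD(1)[OF f] mod_homD(1)[OF g] by auto
    finally show ?thesis by simp
  qed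
  have gens: "?\<phi> c \<in> tensor_rel_generators R X' Y'" if "c \<in> tensor_rel_generators R X Y" for c
    using that
    unfolding tensor_rel_generators_def[of R X Y]
  proof (elim UnE CollectE exE conjE, goal_cases)
    case (1 x x' y)
    then have "?\<phi> c = frag_of (f x \<oplus>\<^bsub>X'\<^esub> f x', g y) - frag_of (f x, g y) - frag_of (f x', g y)"
      using mod_homD(2)[OF f, of x x'] by (simp add: frag_extend_diff)
    then show ?case
      unfolding tensor_rel_generators_def using 1 mod_homD(1)[OF f] mod_homD(1)[OF g] by blast
  next
    case (2 x y y')
    then have "?\<phi> c = frag_of (f x, g y \<oplus>\<^bsub>Y'\<^esub> g y') - frag_of (f x, g y) - frag_of (f x, g y')"
      using mod_homD(2)[OF g, of y y'] by (simp add: frag_extend_diff)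
    then show ?case
      unfolding tensor_rel_generators_def using 2 mod_homD(1)[OF f] mod_homD(1)[OF g] by blast
  next
    case (3 r x y)
    then have "?\<phi> c = frag_of (r \<odot>\<^bsub>X'\<^esub> f x, g y) - frag_of (f x, r \<odot>\<^bsub>Y'\<^esub> g y)"
      using mod_homD(3)[OF f, of r x] mod_homD(3)[OF g, of r y] by (simp add: frag_extend_diff)
    then show ?case
      unfolding tensor_rel_generators_def using 3 mod_homD(1)[OF f] mod_homD(1)[OF g] by blast
  qed
  have rels: "?\<phi> c \<in> tensor_rels R X' Y'" if "c \<in> tensor_rels R X Y" for c
    using that unfolding tensor_rels_generate[of R X Y]
  proof (induction c rule: generate.induct)
    case one
    have "\<zero>\<^bsub>?P'\<^esub> \<in> tensor_rels R X' Y'"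
      by (rule additive_subgroup.zero_closed[OF T'.is_additive_subgroup])
    then show ?case by (simp only: pre_tensor_simps one_free_Abelian_group frag_extend_0)
  next
    case (incl c)
    then show ?case using gens unfolding tensor_rels_generate by (blast intro: generate.incl)
  next
    case (inv c)
    then have c: "Poly_Mapping.keys c \<subseteq> carrier X \<times> carrier Y"
      using subsetD[OF tensor_rel_generators_closed[OF X Y]] by simp
    have "?\<phi> c \<in> tensor_rels R X' Y'"
      using gens[OF inv] unfolding tensor_rels_generate by (rule generate.incl)
    then have "\<ominus>\<^bsub>?P'\<^esub> ?\<phi> c \<in> tensor_rels R X' Y'" by (rule additive_subgroup.a_inv_closed[OF T'.is_additive_subgroup])
    then show ?case using c closed[of c] by (simp add: pre_tensor_minus frag_extend_minus)
  next
    case (eng a b)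
    then show ?case using additive_subgroup.a_closed[OF T'.is_additive_subgroup eng.IH] by (simp add: frag_extend_add)
  qed
  have coset: "tensor_map R X' Y' f g (tensor_rels R X Y +>\<^bsub>?P\<^esub> c) = tensor_rels R X' Y' +>\<^bsub>?P'\<^esub> ?\<phi> c"
    if "c \<in> carrier ?P" for c
    unfolding tensor_map_def
    by (rule quot_map_coset[OF T T' closed _ rels that]) (auto simp: frag_extend_add)
  show "tensor_map R X' Y' f g (ten R X Y x y) = ten R X' Y' (f x) (g y)" if "x \<in> carrier X" "y \<in> carrier Y"
    using coset[of "frag_of (x, y)"] that by (simp add: ten_def)
  interpret P: abelian_group ?P by (rule pre_tensor_abelian_group)
  show "tensor_map R X' Y' f g \<in> add_hom (tensor_module R X Y) (tensor_module R X' Y')"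
  proof (rule add_homI)
    fix C assume "C \<in> carrier (tensor_module R X Y)"
    then obtain c where "c \<in> carrier ?P" "C = tensor_rels R X Y +>\<^bsub>?P\<^esub> c"
      unfolding tensor_module_def quot_module_carrier by blast
    then show "tensor_map R X' Y' f g C \<in> carrier (tensor_module R X' Y')"
      using coset closed unfolding tensor_module_def quot_module_carrier by blast
  next
    fix C D assume "C \<in> carrier (tensor_module R X Y)" "D \<in> carrier (tensor_module R X Y)"
    then obtain c d where *: "c \<in> carrier ?P" "d \<in> carrier ?P"
      "C = tensor_rels R X Y +>\<^bsub>?P\<^esub> c" "D = tensor_rels R X Y +>\<^bsub>?P\<^esub> d"
      unfolding tensor_module_def quot_module_carrier by blast
    have "tensor_map R X' Y' f g (tensor_rels R X Y +>\<^bsub>?P\<^esub> (c \<oplus>\<^bsub>?P\<^esub> d))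
        = tensor_rels R X' Y' +>\<^bsub>?P'\<^esub> (?\<phi> c \<oplus>\<^bsub>?P'\<^esub> ?\<phi> d)"
      using coset[OF P.a_closed[OF *(1,2)]] by (simp add: frag_extend_add)
    then show "tensor_map R X' Y' f g (C \<oplus>\<^bsub>tensor_module R X Y\<^esub> D)
        = tensor_map R X' Y' f g C \<oplus>\<^bsub>tensor_module R X' Y'\<^esub> tensor_map R X' Y' f g D"
      unfolding tensor_module_def *(3,4) quot_module_add[OF T *(1,2)] coset[OF *(1)] coset[OF *(2)]
        quot_module_add[OF T' closed[OF *(1)] closed[OF *(2)]] .
  qed
qed

section \<open>Vanishing criteria for the homology of the stable tensor product\<close>

subsection \<open>Homology of a quotient complex\<close>

lemma image_eq_singleton_iff: "A \<noteq> {} \<Longrightarrow> {g z | z. z \<in> A} = {b} \<longleftrightarrow> (\<forall>z\<in>A. g z = b)"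
  by (intro iffI ballI equalityI subsetI) (blast | force)+

text \<open>Elements of this homology are cosets whose elements are again cosets. The criterion
  brings everything down to representatives in \<open>X\<close>.\<close>

lemma homology_quot_trivial_iff:
  fixes X :: "('k, 'm) cplx" and n :: int
  assumes S: "\<And>n. abelian_subgroup (S n) (cobj X n)"
    and d: "\<And>n. cdiff X n \<in> add_hom (cobj X n) (cobj X (n - 1))"
    and dS: "\<And>n x. x \<in> S n \<Longrightarrow> cdiff X n x \<in> S (n - 1)"
  shows "trivial_module (homology_module (quot_complex X S) n) \<longleftrightarrow>
    (\<forall>t\<in>carrier (cobj X n). cdiff X n t \<in> S (n - 1) \<longrightarrow>
      (\<exists>u\<in>carrier (cobj X (n + 1)). t \<ominus>\<^bsub>cobj X n\<^esub> cdiff X (n + 1) u \<in> S n))"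
proof -
  interpret S: abelian_subgroup "S m" "cobj X m" for m by (rule S)
  let ?G = "\<lambda>n. cobj X n" and ?c = "\<lambda>n x. S n +>\<^bsub>cobj X n\<^esub> x"
  let ?Q = "quot_module (?G n) (S n)"
  interpret Q: abelian_group ?Q by (rule quot_module_abelian_group[OF S])
  have dq: "quot_map (?G (m - 1)) (S (m - 1)) (cdiff X m) (?c m x) = ?c (m - 1) (cdiff X m x)"
    if "x \<in> carrier (?G m)" for m x
    by (rule quot_map_coset[OF S S add_homD[OF d] dS that])
  have Z: "cycles (quot_complex X S) n = {?c n t | t. t \<in> carrier (?G n) \<and> cdiff X n t \<in> S (n - 1)}"
  proof -
    have z: "\<zero>\<^bsub>quot_module (?G (n - 1)) (S (n - 1))\<^esub> = S (n - 1)" by (simp add: quot_module_def)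
    have "quot_map (?G (n - 1)) (S (n - 1)) (cdiff X n) (?c n t) = S (n - 1) \<longleftrightarrow> cdiff X n t \<in> S (n - 1)"
      if "t \<in> carrier (?G n)" for t
      using dq[OF that] S.coset_eq_self_iff[OF add_homD(1)[OF d that]] by simp
    then have "{C \<in> {?c n t |t. t \<in> carrier (?G n)}. quot_map (?G (n - 1)) (S (n - 1)) (cdiff X n) C = S (n - 1)}
        = {?c n t | t. t \<in> carrier (?G n) \<and> cdiff X n t \<in> S (n - 1)}" by blast
    then show ?thesis
      unfolding cycles_def quot_complex_def by (simp add: quot_module_carrier z)
  qed
  have d': "cdiff X (n + 1) \<in> add_hom (?G (n + 1)) (?G n)" using d[of "n + 1"] by simp
  note d'c = add_homD(1)[OF d']
  define B where "B = boundaries (quot_complex X S) n"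
  have B: "B = {?c n (cdiff X (n + 1) u) | u. u \<in> carrier (?G (n + 1))}"
    unfolding B_def boundaries_def quot_complex_def
    using dq[of _ "n + 1"] by (auto simp: quot_module_carrier)
  have BQ: "b \<in> carrier ?Q" if "b \<in> B" for b using that d'c by (auto simp: B quot_module_carrier)
  have Bz: "\<zero>\<^bsub>?Q\<^esub> \<in> B"
    using add_hom_zero[OF S.abelian_group_axioms S.abelian_group_axioms d']
    unfolding B quot_module_zero[OF S] by (auto intro!: exI[of _ "\<zero>\<^bsub>?G (n + 1)\<^esub>"])
  have B_diff: "a \<ominus>\<^bsub>?Q\<^esub> b \<in> B" if ab: "a \<in> B" "b \<in> B" for a b
  proof -
    obtain u v where u: "u \<in> carrier (?G (n + 1))" "a = ?c n (cdiff X (n + 1) u)"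
      and v: "v \<in> carrier (?G (n + 1))" "b = ?c n (cdiff X (n + 1) v)" using ab unfolding B by auto
    have "?c n (cdiff X (n + 1) (u \<ominus>\<^bsub>?G (n + 1)\<^esub> v))
        = ?c n (cdiff X (n + 1) u) \<ominus>\<^bsub>?Q\<^esub> ?c n (cdiff X (n + 1) v)"
      using add_hom_diff[OF S.abelian_group_axioms Q.abelian_group_axioms
          add_hom_comp[OF d' quot_proj_add_hom[OF S]] u(1) v(1)] .
    then show ?thesis unfolding B u(2) v(2) using S.minus_closed[OF u(1) v(1)] by auto
  qed
  have B_add: "a \<oplus>\<^bsub>?Q\<^esub> b \<in> B" if "a \<in> B" "b \<in> B" for a b
  proof -
    have "a \<ominus>\<^bsub>?Q\<^esub> (\<zero>\<^bsub>?Q\<^esub> \<ominus>\<^bsub>?Q\<^esub> b) \<in> B" using that Bz by (intro B_diff)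
    then show ?thesis using BQ that by (simp add: a_minus_def)
  qed
  have mem: "?c n t \<in> B \<longleftrightarrow> (\<exists>u\<in>carrier (?G (n + 1)). t \<ominus>\<^bsub>?G n\<^esub> cdiff X (n + 1) u \<in> S n)"
    if "t \<in> carrier (?G n)" for t
    unfolding B using S.coset_eq_iff[OF that d'c] by auto
  let ?z = "\<lambda>z. {b \<oplus>\<^bsub>?Q\<^esub> z | b. b \<in> B}"
  have car: "carrier (homology_module (quot_complex X S) n) = {?z z | z. z \<in> cycles (quot_complex X S) n}"
    unfolding homology_module_def quot_module_carrier B_def[symmetric]
    by (auto simp: quot_complex_def a_r_coset_def')
  have zero: "\<zero>\<^bsub>homology_module (quot_complex X S) n\<^esub> = B"
    by (simp add: homology_module_def quot_module_def B_def)
  have iff: "?z z = B \<longleftrightarrow> z \<in> B" if z: "z \<in> cycles (quot_complex X S) n" for z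
  proof
    have zQ: "z \<in> carrier ?Q" using z unfolding Z by (auto simp: quot_module_carrier)
    assume "?z z = B"
    moreover have "\<zero>\<^bsub>?Q\<^esub> \<oplus>\<^bsub>?Q\<^esub> z \<in> ?z z" using Bz by blast
    ultimately show "z \<in> B" using zQ by simp
  next
    assume zB: "z \<in> B"
    show "?z z = B"
    proof
      show "?z z \<subseteq> B" using B_add zB by blast
      show "B \<subseteq> ?z z"
      proof
        fix b assume b: "b \<in> B"
        have "b = (b \<ominus>\<^bsub>?Q\<^esub> z) \<oplus>\<^bsub>?Q\<^esub> z"
          using BQ[OF b] BQ[OF zB] by (simp add: a_minus_def Q.a_assoc Q.l_neg)
        then show "b \<in> ?z z" using B_diff[OF b zB] by blast
      qed
    qed
  qed
  have ne: "cycles (quot_complex X S) n \<noteq> {}"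
  proof -
    have "\<zero>\<^bsub>?G n\<^esub> \<in> carrier (?G n) \<and> cdiff X n \<zero>\<^bsub>?G n\<^esub> \<in> S (n - 1)"
      using add_hom_zero[OF S.abelian_group_axioms S.abelian_group_axioms d, of n]
        additive_subgroup.zero_closed[OF S.is_additive_subgroup, of "n - 1"] by simp
    then show ?thesis unfolding Z by blast
  qed
  have "trivial_module (homology_module (quot_complex X S) n) \<longleftrightarrow>
      (\<forall>z\<in>cycles (quot_complex X S) n. ?z z = B)"
    unfolding trivial_module_def car zero by (rule image_eq_singleton_iff[OF ne])
  also have "\<dots> \<longleftrightarrow> (\<forall>z\<in>cycles (quot_complex X S) n. z \<in> B)" using iff by simp
  also have "\<dots> \<longleftrightarrow> (\<forall>t\<in>carrier (?G n). cdiff X n t \<in> S (n - 1) \<longrightarrow> ?c n t \<in> B)"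
    unfolding Z by blast
  also have "\<dots> \<longleftrightarrow> (\<forall>t\<in>carrier (?G n). cdiff X n t \<in> S (n - 1) \<longrightarrow>
      (\<exists>u\<in>carrier (?G (n + 1)). t \<ominus>\<^bsub>?G n\<^esub> cdiff X (n + 1) u \<in> S n))"
    using mem by simp
  finally show ?thesis .
qed

lemma prod_module_simps [simp]:
  "carrier (prod_module M) = {t. \<forall>i. t i \<in> carrier (M i)}" "zero (prod_module M) = (\<lambda>i. \<zero>\<^bsub>M i\<^esub>)"
  "add (prod_module M) s t = (\<lambda>i. s i \<oplus>\<^bsub>M i\<^esub> t i)"
  by (simp_all add: prod_module_def)

context
  fixes M :: "int \<Rightarrow> ('k, 'm) module"
  assumes M: "\<And>i. abelian_group (M i)"
begin

interpretation M: abelian_group "M i" for i by (rule M)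

lemma prod_module_abelian_group: "abelian_group (prod_module M)"
proof (rule abelian_groupI)
  fix t assume "t \<in> carrier (prod_module M)"
  then show "\<exists>s\<in>carrier (prod_module M). s \<oplus>\<^bsub>prod_module M\<^esub> t = \<zero>\<^bsub>prod_module M\<^esub>"
    by (intro bexI[of _ "\<lambda>i. \<ominus>\<^bsub>M i\<^esub> t i"]) (auto simp: M.l_neg)
qed (auto simp: M.a_ac)

lemma prod_module_minus:
  assumes "t \<in> carrier (prod_module M)"
  shows "(\<ominus>\<^bsub>prod_module M\<^esub> t) i = \<ominus>\<^bsub>M i\<^esub> t i"
proof -
  interpret P: abelian_group "prod_module M" by (rule prod_module_abelian_group)
  have "\<ominus>\<^bsub>prod_module M\<^esub> t = (\<lambda>i. \<ominus>\<^bsub>M i\<^esub> t i)"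
    by (rule P.minus_equality) (use assms in \<open>auto simp: M.l_neg\<close>)
  then show ?thesis by simp
qed

lemma prod_module_diff:
  "s \<in> carrier (prod_module M) \<Longrightarrow> t \<in> carrier (prod_module M) \<Longrightarrow>
    (s \<ominus>\<^bsub>prod_module M\<^esub> t) i = s i \<ominus>\<^bsub>M i\<^esub> t i"
  by (simp add: a_minus_def prod_module_minus del: prod_module_simps(1))

lemma coprod_subgroup: "abelian_subgroup (coprod_submodule M) (prod_module M)"
proof (rule abelian_subgroupI3[OF _ prod_module_abelian_group], rule additive_subgroup.intro, rule subgroup.intro)
  show "coprod_submodule M \<subseteq> carrier (add_monoid (prod_module M))" by (auto simp: coprod_submodule_def)
  show "\<one>\<^bsub>add_monoid (prod_module M)\<^esub> \<in> coprod_submodule M" by (simp add: coprod_submodule_def)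
  fix s t assume s: "s \<in> coprod_submodule M" and t: "t \<in> coprod_submodule M"
  have "finite ({i. s i \<noteq> \<zero>\<^bsub>M i\<^esub>} \<union> {i. t i \<noteq> \<zero>\<^bsub>M i\<^esub>})" using s t by (simp add: coprod_submodule_def)
  then have "finite {i. s i \<oplus>\<^bsub>M i\<^esub> t i \<noteq> \<zero>\<^bsub>M i\<^esub>}" by (rule finite_subset[rotated]) auto
  then show "s \<otimes>\<^bsub>add_monoid (prod_module M)\<^esub> t \<in> coprod_submodule M"
    using s t by (simp add: coprod_submodule_def)
  have sP: "s \<in> carrier (prod_module M)" using s by (simp add: coprod_submodule_def)
  have eq: "(\<ominus>\<^bsub>prod_module M\<^esub> s) = (\<lambda>i. \<ominus>\<^bsub>M i\<^esub> s i)" using prod_module_minus[OF sP] by auto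
  have "finite {i. \<ominus>\<^bsub>M i\<^esub> s i \<noteq> \<zero>\<^bsub>M i\<^esub>}"
    by (rule finite_subset[of _ "{i. s i \<noteq> \<zero>\<^bsub>M i\<^esub>}"]) (use s in \<open>auto simp: coprod_submodule_def\<close>)
  then have "\<ominus>\<^bsub>prod_module M\<^esub> s \<in> coprod_submodule M" using s by (simp add: coprod_submodule_def eq)
  then show "inv\<^bsub>add_monoid (prod_module M)\<^esub> s \<in> coprod_submodule M" by (simp add: a_inv_def)
qed

end

subsection \<open>The stable tensor product\<close>

locale two_complexes =
  fixes R :: "('k, 'r) module" and P :: "('r, 'u) cplx" and I :: "('r, 'v) cplx"
  assumes P: "is_complex (op_ring R) P" and I: "is_complex R I"
begin

lemma P_facts: "left_module (op_ring R) (cobj P i)" "cdiff P (i + 1) \<in> mod_hom (op_ring R) (cobj P (i + 1)) (cobj P i)"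
  using P unfolding is_complex_def by (blast, metis add_diff_cancel_right')

lemma I_facts: "left_module R (cobj I j)" "cdiff I (j + 1) \<in> mod_hom R (cobj I (j + 1)) (cobj I j)"
  "x \<in> carrier (cobj I (j + 1 + 1)) \<Longrightarrow> cdiff I (j + 1) (cdiff I (j + 1 + 1) x) = \<zero>\<^bsub>cobj I j\<^esub>"
proof -
  show "left_module R (cobj I j)" using I unfolding is_complex_def by blast
  have "cdiff I (j + 1) \<in> mod_hom R (cobj I (j + 1)) (cobj I (j + 1 - 1))" using I unfolding is_complex_def by blast
  then show "cdiff I (j + 1) \<in> mod_hom R (cobj I (j + 1)) (cobj I j)" by simp
  have "\<forall>x\<in>carrier (cobj I (j + 2)). cdiff I (j + 2 - 1) (cdiff I (j + 2) x) = \<zero>\<^bsub>cobj I (j + 2 - 2)\<^esub>"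
    using I unfolding is_complex_def by blast
  then show "x \<in> carrier (cobj I (j + 1 + 1)) \<Longrightarrow> cdiff I (j + 1) (cdiff I (j + 1 + 1) x) = \<zero>\<^bsub>cobj I j\<^esub>"
    by (simp add: add.commute)
qed

abbreviation "T i j \<equiv> tensor_module R (cobj P i) (cobj I j)"
abbreviation "tn i j \<equiv> ten R (cobj P i) (cobj I j)"

text \<open>\<open>dP i j\<close> and \<open>dI i j\<close> are the maps into \<open>T i j\<close> from \<open>T (i + 1) j\<close> and \<open>T i (j + 1)\<close>.\<close>

definition "dP i j = tensor_map R (cobj P i) (cobj I j) (cdiff P (i + 1)) (\<lambda>y. y)"
definition "dI i j = tensor_map R (cobj P i) (cobj I j) (\<lambda>x. x) (cdiff I (j + 1))"

lemma T_abelian: "abelian_group (T i j)"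
  by (rule tensor_abelian_group[OF P_facts(1) I_facts(1)])

sublocale T: abelian_group "T i j" for i j
  by (rule T_abelian)

lemma dP_hom: "dP i j \<in> add_hom (T (i + 1) j) (T i j)"
  and dP_ten: "x \<in> carrier (cobj P (i + 1)) \<Longrightarrow> y \<in> carrier (cobj I j) \<Longrightarrow>
    dP i j (tn (i + 1) j x y) = tn i j (cdiff P (i + 1) x) y"
  unfolding dP_def
  using tensor_map_add_hom[OF P_facts(1) I_facts(1) P_facts(1) I_facts(1) P_facts(2) mod_hom_id] by blast+

lemma dI_hom: "dI i j \<in> add_hom (T i (j + 1)) (T i j)"
  and dI_ten: "x \<in> carrier (cobj P i) \<Longrightarrow> y \<in> carrier (cobj I (j + 1)) \<Longrightarrow>
    dI i j (tn i (j + 1) x y) = tn i j x (cdiff I (j + 1) y)"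
  unfolding dI_def
  using tensor_map_add_hom[OF P_facts(1) I_facts(1) P_facts(1) I_facts(1) mod_hom_id I_facts(2)] by blast+

lemma dI_dP:
  assumes "t \<in> carrier (T (i + 1) (j + 1))"
  shows "dI i j (dP i (j + 1) t) = dP i j (dI (i + 1) j t)"
  by (rule tensor_hom_ext[OF P_facts(1) I_facts(1) T_abelian add_hom_comp[OF dP_hom dI_hom]
        add_hom_comp[OF dI_hom dP_hom] _ assms])
    (simp add: dP_ten dI_ten mod_homD(1)[OF P_facts(2)] mod_homD(1)[OF I_facts(2)])

lemma ten_zero_right: "x \<in> carrier (cobj P i) \<Longrightarrow> tn i j x \<zero>\<^bsub>cobj I j\<^esub> = \<zero>\<^bsub>T i j\<^esub>"
proof (rule add_hom_zero[of "cobj I j"])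
  show "abelian_group (cobj I j)" using I_facts(1) left_module.axioms(2) by blast
  assume "x \<in> carrier (cobj P i)"
  then show "tn i j x \<in> add_hom (cobj I j) (T i j)"
    by (intro add_homI) (simp_all add: ten_closed[OF P_facts(1) I_facts(1)] ten_add_right[OF P_facts(1) I_facts(1)])
qed (rule T_abelian)

lemma zero_add_hom: "(\<lambda>t. \<zero>\<^bsub>T i' j'\<^esub>) \<in> add_hom (T i j) (T i' j')"
  by (rule add_homI) auto

lemma dI_dI:
  assumes "t \<in> carrier (T i (j + 1 + 1))"
  shows "dI i j (dI i (j + 1) t) = \<zero>\<^bsub>T i j\<^esub>"
proof (rule tensor_hom_ext[OF P_facts(1) I_facts(1) T_abelian add_hom_comp[OF dI_hom dI_hom] zero_add_hom _ assms])
  fix x y assume x: "x \<in> carrier (cobj P i)" and y: "y \<in> carrier (cobj I (j + 1 + 1))"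
  have "dI i j (dI i (j + 1) (tn i (j + 1 + 1) x y)) = tn i j x (cdiff I (j + 1) (cdiff I (j + 1 + 1) y))"
    by (simp only: dI_ten[OF x y] dI_ten[OF x mod_homD(1)[OF I_facts(2) y]])
  also have "\<dots> = \<zero>\<^bsub>T i j\<^esub>" by (simp only: I_facts(3)[OF y] ten_zero_right[OF x])
  finally show "dI i j (dI i (j + 1) (tn i (j + 1 + 1) x y)) = \<zero>\<^bsub>T i j\<^esub>" .
qed

definition signed :: "int \<Rightarrow> int \<Rightarrow> (('u \<times> 'v) \<Rightarrow>\<^sub>0 int) set \<Rightarrow> (('u \<times> 'v) \<Rightarrow>\<^sub>0 int) set" where
  "signed i j v = (if even i then v else \<ominus>\<^bsub>T i j\<^esub> v)"

lemma signed_closed: "v \<in> carrier (T i j) \<Longrightarrow> signed i j v \<in> carrier (T i j)"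
  by (simp add: signed_def)

lemma diff_eq: "cdiff (unbounded_tensor R P I) n t i =
    dP i (n - 1 - i) (t (i + 1)) \<oplus>\<^bsub>T i (n - 1 - i)\<^esub> signed i (n - 1 - i) (dI i (n - 1 - i) (t i))"
proof -
  have "n - 1 - i + 1 = n - i" by simp
  then show ?thesis by (simp add: unbounded_tensor_def dP_def dI_def signed_def Let_def)
qed

lemma obj_eq: "cobj (unbounded_tensor R P I) n = prod_module (\<lambda>i. T i (n - i))"
  by (simp add: unbounded_tensor_def)

lemma dP_mem: "t \<in> carrier (T (i + 1) (n - (i + 1))) \<Longrightarrow> dP i (n - 1 - i) t \<in> carrier (T i (n - 1 - i))"
  using add_homD(1)[OF dP_hom, of t i "n - 1 - i"] by (simp add: algebra_simps)

lemma dI_mem: "t \<in> carrier (T i (n - i)) \<Longrightarrow> dI i (n - 1 - i) t \<in> carrier (T i (n - 1 - i))"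
  using add_homD(1)[OF dI_hom, of t i "n - 1 - i"] by (simp add: algebra_simps)

lemma diff_mem:
  assumes "\<And>i. t i \<in> carrier (T i (n - i))"
  shows "cdiff (unbounded_tensor R P I) n t i \<in> carrier (T i (n - 1 - i))"
  unfolding diff_eq using dP_mem[OF assms] dI_mem[OF assms] by (simp add: signed_closed)

text \<open>To be zero modulo the coproduct is to have finitely many nonzero components. So a stable
  cycle is a family whose boundary vanishes at almost all indices, and it bounds if it equals a
  boundary at almost all indices.\<close>

lemma stable_trivial_iff:
  "trivial_module (homology_module (stable_tensor R P I) n) \<longleftrightarrow>
    (\<forall>t. (\<forall>i. t i \<in> carrier (T i (n - i))) \<and>
        finite {i. cdiff (unbounded_tensor R P I) n t i \<noteq> \<zero>\<^bsub>T i (n - 1 - i)\<^esub>} \<longrightarrow>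
      (\<exists>u. (\<forall>i. u i \<in> carrier (T i (n + 1 - i))) \<and>
        finite {i. t i \<ominus>\<^bsub>T i (n - i)\<^esub> cdiff (unbounded_tensor R P I) (n + 1) u i \<noteq> \<zero>\<^bsub>T i (n - i)\<^esub>}))"
proof -
  let ?X = "unbounded_tensor R P I" and ?S = "\<lambda>n. coprod_submodule (\<lambda>i. T i (n - i))"
  have mem: "cdiff ?X n t i \<in> carrier (T i (n - 1 - i))" if "t \<in> carrier (cobj ?X n)" for n t i
    by (rule diff_mem) (use that in \<open>simp add: obj_eq\<close>)
  have hom: "cdiff ?X n \<in> add_hom (cobj ?X n) (cobj ?X (n - 1))" for n
  proof (rule add_homI)
    fix t assume "t \<in> carrier (cobj ?X n)"
    then show "cdiff ?X n t \<in> carrier (cobj ?X (n - 1))" using mem by (simp add: obj_eq)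
  next
    fix s t assume "s \<in> carrier (cobj ?X n)" "t \<in> carrier (cobj ?X n)"
    then have st: "s i \<in> carrier (T i (n - i))" "t i \<in> carrier (T i (n - i))" for i by (simp_all add: obj_eq)
    have "cdiff ?X n (\<lambda>i. s i \<oplus>\<^bsub>T i (n - i)\<^esub> t i) i =
        cdiff ?X n s i \<oplus>\<^bsub>T i (n - 1 - i)\<^esub> cdiff ?X n t i" for i
    proof -
      have e: "n - (i + 1) = n - 1 - i" "n - 1 - i + 1 = n - i" by simp_all
      have a: "dP i (n - 1 - i) (s (i + 1) \<oplus>\<^bsub>T (i + 1) (n - (i + 1))\<^esub> t (i + 1)) =
          dP i (n - 1 - i) (s (i + 1)) \<oplus>\<^bsub>T i (n - 1 - i)\<^esub> dP i (n - 1 - i) (t (i + 1))"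
        using add_homD(2)[OF dP_hom, of "s (i + 1)" i "n - 1 - i" "t (i + 1)"] st[of "i + 1"] unfolding e by simp
      have b: "dI i (n - 1 - i) (s i \<oplus>\<^bsub>T i (n - i)\<^esub> t i) =
          dI i (n - 1 - i) (s i) \<oplus>\<^bsub>T i (n - 1 - i)\<^esub> dI i (n - 1 - i) (t i)"
        using add_homD(2)[OF dI_hom, of "s i" i "n - 1 - i" "t i"] st[of i] unfolding e by simp
      have c: "dP i (n - 1 - i) (s (i + 1)) \<in> carrier (T i (n - 1 - i))"
        "dP i (n - 1 - i) (t (i + 1)) \<in> carrier (T i (n - 1 - i))"
        "dI i (n - 1 - i) (s i) \<in> carrier (T i (n - 1 - i))"
        "dI i (n - 1 - i) (t i) \<in> carrier (T i (n - 1 - i))"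
        using dP_mem st dI_mem by blast+
      show ?thesis unfolding diff_eq a b signed_def using c by (simp add: T.minus_add T.a_ac)
    qed
    then show "cdiff ?X n (s \<oplus>\<^bsub>cobj ?X n\<^esub> t) = cdiff ?X n s \<oplus>\<^bsub>cobj ?X (n - 1)\<^esub> cdiff ?X n t"
      by (auto simp: obj_eq)
  qed
  have sub: "abelian_subgroup (?S n) (cobj ?X n)" for n
    unfolding obj_eq by (rule coprod_subgroup[OF T_abelian])
  have preserved: "cdiff ?X n t \<in> ?S (n - 1)" if t: "t \<in> ?S n" for n t
  proof -
    have tX: "t \<in> carrier (cobj ?X n)" and fin: "finite {i. t i \<noteq> \<zero>\<^bsub>T i (n - i)\<^esub>}"
      using t by (auto simp: coprod_submodule_def obj_eq)
    \<comment> \<open>Component \<open>i\<close> of the boundary involves only the components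
      \<open>i\<close> and \<open>i + 1\<close> of \<open>t\<close>.\<close>
    have fin': "finite ((\<lambda>i. i - 1) ` {i. t i \<noteq> \<zero>\<^bsub>T i (n - i)\<^esub>} \<union> {i. t i \<noteq> \<zero>\<^bsub>T i (n - i)\<^esub>})" using fin by simp
    have "i \<in> (\<lambda>i. i - 1) ` {i. t i \<noteq> \<zero>\<^bsub>T i (n - i)\<^esub>} \<union> {i. t i \<noteq> \<zero>\<^bsub>T i (n - i)\<^esub>}"
      if nz: "cdiff ?X n t i \<noteq> \<zero>\<^bsub>T i (n - 1 - i)\<^esub>" for i
    proof (rule ccontr)
      assume "i \<notin> (\<lambda>i. i - 1) ` {i. t i \<noteq> \<zero>\<^bsub>T i (n - i)\<^esub>} \<union> {i. t i \<noteq> \<zero>\<^bsub>T i (n - i)\<^esub>}"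
      then have z: "t i = \<zero>\<^bsub>T i (n - i)\<^esub>" "t (i + 1) = \<zero>\<^bsub>T (i + 1) (n - (i + 1))\<^esub>"
        by (auto simp: image_iff)
      have e: "n - (i + 1) = n - 1 - i" "n - 1 - i + 1 = n - i" by simp_all
      have "dP i (n - 1 - i) (t (i + 1)) = \<zero>\<^bsub>T i (n - 1 - i)\<^esub>"
        using add_hom_zero[OF T_abelian T_abelian dP_hom, of i "n - 1 - i"] z(2) unfolding e by simp
      moreover have "dI i (n - 1 - i) (t i) = \<zero>\<^bsub>T i (n - 1 - i)\<^esub>"
        using add_hom_zero[OF T_abelian T_abelian dI_hom, of i "n - 1 - i"] z(1) unfolding e by simp
      ultimately show False using nz unfolding diff_eq signed_def by (cases "even i") simp_all
    qed
    then have "finite {i. cdiff ?X n t i \<noteq> \<zero>\<^bsub>T i (n - 1 - i)\<^esub>}"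
      by (intro finite_subset[OF _ fin'] subsetI) simp
    then show ?thesis using mem[OF tX] by (simp add: coprod_submodule_def)
  qed
  have "trivial_module (homology_module (stable_tensor R P I) n) \<longleftrightarrow>
    (\<forall>t\<in>carrier (cobj ?X n). cdiff ?X n t \<in> ?S (n - 1) \<longrightarrow>
      (\<exists>u\<in>carrier (cobj ?X (n + 1)). t \<ominus>\<^bsub>cobj ?X n\<^esub> cdiff ?X (n + 1) u \<in> ?S n))"
    unfolding stable_tensor_def by (rule homology_quot_trivial_iff[OF sub hom preserved])
  also have "\<dots> \<longleftrightarrow> (\<forall>t. (\<forall>i. t i \<in> carrier (T i (n - i))) \<and>
        finite {i. cdiff ?X n t i \<noteq> \<zero>\<^bsub>T i (n - 1 - i)\<^esub>} \<longrightarrow>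
      (\<exists>u. (\<forall>i. u i \<in> carrier (T i (n + 1 - i))) \<and>
        finite {i. t i \<ominus>\<^bsub>T i (n - i)\<^esub> cdiff ?X (n + 1) u i \<noteq> \<zero>\<^bsub>T i (n - i)\<^esub>}))"
  proof -
    have 1: "cdiff ?X n t \<in> ?S (n - 1) \<longleftrightarrow> finite {i. cdiff ?X n t i \<noteq> \<zero>\<^bsub>T i (n - 1 - i)\<^esub>}"
      if "\<forall>i. t i \<in> carrier (T i (n - i))" for t
      using mem[of t n] that by (simp add: coprod_submodule_def obj_eq)
    have 2: "t \<ominus>\<^bsub>cobj ?X n\<^esub> cdiff ?X (n + 1) u \<in> ?S n \<longleftrightarrow>
        finite {i. t i \<ominus>\<^bsub>T i (n - i)\<^esub> cdiff ?X (n + 1) u i \<noteq> \<zero>\<^bsub>T i (n - i)\<^esub>}"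
      if t: "\<forall>i. t i \<in> carrier (T i (n - i))" and u: "\<forall>i. u i \<in> carrier (T i (n + 1 - i))" for t u
    proof -
      have "u \<in> carrier (cobj ?X (n + 1))" using u by (simp add: obj_eq)
      from mem[OF this] have du: "cdiff ?X (n + 1) u i \<in> carrier (T i (n - i))" for i by simp
      have "(t \<ominus>\<^bsub>cobj ?X n\<^esub> cdiff ?X (n + 1) u) i = t i \<ominus>\<^bsub>T i (n - i)\<^esub> cdiff ?X (n + 1) u i" for i
        unfolding obj_eq by (rule prod_module_diff[OF T_abelian]) (use t du in auto)
      then show ?thesis using t du by (simp add: coprod_submodule_def)
    qed
    show ?thesis
    proof -
      have "(\<exists>u\<in>carrier (cobj ?X (n + 1)). t \<ominus>\<^bsub>cobj ?X n\<^esub> cdiff ?X (n + 1) u \<in> ?S n) \<longleftrightarrow>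
          (\<exists>u. (\<forall>i. u i \<in> carrier (T i (n + 1 - i))) \<and>
            finite {i. t i \<ominus>\<^bsub>T i (n - i)\<^esub> cdiff ?X (n + 1) u i \<noteq> \<zero>\<^bsub>T i (n - i)\<^esub>})"
        if "\<forall>i. t i \<in> carrier (T i (n - i))" for t
        using 2[OF that] by (auto simp: obj_eq)
      then show ?thesis using 1 by (auto simp: obj_eq)
    qed
  qed
  finally show ?thesis .
qed

end

context two_complexes
begin

lemma signed_hom:
  assumes "f \<in> add_hom (T i' j') (T i'' j'')" "v \<in> carrier (T i' j')"
  shows "f (if b then v else \<ominus>\<^bsub>T i' j'\<^esub> v) = (if b then f v else \<ominus>\<^bsub>T i'' j''\<^esub> f v)"
  using add_hom_minus[OF T_abelian T_abelian assms] by simp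

lemma add_hom_diff_zero: "v \<in> carrier (T i j) \<Longrightarrow> w \<in> carrier (T i j) \<Longrightarrow> v \<ominus>\<^bsub>T i j\<^esub> w = \<zero>\<^bsub>T i j\<^esub> \<Longrightarrow> v = w"
  using abelian_group.minus_equality[OF T_abelian[of i j], of v "\<ominus>\<^bsub>T i j\<^esub> w"] by (simp add: a_minus_def)

text \<open>
  The sign \<open>(-1)\<^sup>i\<close> in the differential is absorbed by signs of period four on the components.
\<close>

lemma stable_trivial_functional:
  fixes n L :: int
  assumes triv: "trivial_module (homology_module (stable_tensor R P I) n)"
    and t: "\<And>i. t i \<in> carrier (T i (n - i))"
    and zero: "\<And>i. i < L \<Longrightarrow> t i = \<zero>\<^bsub>T i (n - i)\<^esub>"
    and cyc: "\<And>i. i \<ge> L \<Longrightarrow> dP i (n - 1 - i) (t (i + 1)) = dI i (n - 1 - i) (t i)"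
    and A: "abelian_group A"
    and \<Theta>: "\<And>i. i \<ge> L \<Longrightarrow> \<Theta> i \<in> add_hom (T i (n - 1 - i)) A"
    and \<Theta>d: "\<And>i v. i \<ge> L \<Longrightarrow> v \<in> carrier (T (i + 1) (n - 1 - i)) \<Longrightarrow>
      \<Theta> i (dP i (n - 1 - i) v) = \<Theta> (i + 1) (dI (i + 1) (n - 1 - (i + 1)) v)"
  obtains M where "\<And>i. i \<ge> M \<Longrightarrow> \<Theta> i (dI i (n - 1 - i) (t i)) = \<zero>\<^bsub>A\<^esub>"
proof -
  interpret A: abelian_group A by fact
  \<comment> \<open>The pattern + - - + from i = 0 on: passing from \<open>i\<close> to
    \<open>i + 1\<close> changes the sign exactly when \<open>i\<close> is even. This turns the
    relation \<open>cyc\<close>, where both terms have the same sign, into the vanishing of the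
    signed differential.\<close>
  define \<sigma> :: "int \<Rightarrow> bool" where "\<sigma> i = even ((i + 1) div 2)" for i
  have \<sigma>: "\<sigma> (i + 1) \<longleftrightarrow> (if even i then \<not> \<sigma> i else \<sigma> i)" for i
  proof (cases "even i")
    case True
    then obtain k where "i = 2 * k" by (rule evenE)
    moreover have "(2 * k + 1 + 1) div 2 = k + 1" "(2 * k + 1) div 2 = k" by simp_all
    ultimately show ?thesis by (simp only: \<sigma>_def True if_True) simp
  next
    case False
    then obtain k where "i = 2 * k + 1" by (rule oddE)
    moreover have "(2 * k + 1 + 1 + 1) div 2 = k + 1" "(2 * k + 1 + 1) div 2 = k + 1" by simp_all
    ultimately show ?thesis by (simp only: \<sigma>_def False if_False) simp
  qed
  define t' where "t' i = (if \<sigma> i then t i else \<ominus>\<^bsub>T i (n - i)\<^esub> t i)" for i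
  have t': "t' i \<in> carrier (T i (n - i))" for i using t[of i] by (simp add: t'_def)
  have dIt': "dI i (n - 1 - i) (t' i) =
      (if \<sigma> i then dI i (n - 1 - i) (t i) else \<ominus>\<^bsub>T i (n - 1 - i)\<^esub> dI i (n - 1 - i) (t i))" for i
  proof -
    have e: "n - i = n - 1 - i + 1" by simp
    show ?thesis unfolding t'_def e by (rule signed_hom[OF dI_hom t[of i, unfolded e]])
  qed
  have dPt': "dP i (n - 1 - i) (t' (i + 1)) =
      (if \<sigma> (i + 1) then dP i (n - 1 - i) (t (i + 1)) else \<ominus>\<^bsub>T i (n - 1 - i)\<^esub> dP i (n - 1 - i) (t (i + 1)))" for i
  proof -
    have e: "n - (i + 1) = n - 1 - i" by simp
    show ?thesis unfolding t'_def e by (rule signed_hom[OF dP_hom t[of "i + 1", unfolded e]])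
  qed
  \<comment> \<open>At index \<open>L - 1\<close> the boundary of the truncated family keeps the
    contribution of \<open>t L\<close>. A single component is zero in the stable complex.\<close>
  have van: "cdiff (unbounded_tensor R P I) n t' i = \<zero>\<^bsub>T i (n - 1 - i)\<^esub>" if i: "i \<noteq> L - 1" for i
  proof (cases "i \<ge> L")
    case True
    have "dI i (n - 1 - i) (t i) \<in> carrier (T i (n - 1 - i))" by (rule dI_mem[OF t])
    then show ?thesis
      unfolding diff_eq dPt' dIt' signed_def cyc[OF True] \<sigma>
      by (cases "even i"; cases "\<sigma> i") (simp_all add: T.l_neg T.r_neg)
  next
    case False
    then have "t i = \<zero>\<^bsub>T i (n - i)\<^esub>" "t (i + 1) = \<zero>\<^bsub>T (i + 1) (n - (i + 1))\<^esub>" using zero i by auto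
    moreover have e: "n - (i + 1) = n - 1 - i" "n - i = n - 1 - i + 1" by simp_all
    ultimately have "dI i (n - 1 - i) (t i) = \<zero>\<^bsub>T i (n - 1 - i)\<^esub>" "dP i (n - 1 - i) (t (i + 1)) = \<zero>\<^bsub>T i (n - 1 - i)\<^esub>"
      using add_hom_zero[OF T_abelian T_abelian dI_hom, of i "n - 1 - i"]
        add_hom_zero[OF T_abelian T_abelian dP_hom, of i "n - 1 - i"] unfolding e by simp_all
    moreover have "\<ominus>\<^bsub>T i (n - 1 - i)\<^esub> \<zero>\<^bsub>T i (n - 1 - i)\<^esub> = \<zero>\<^bsub>T i (n - 1 - i)\<^esub>"
      and "\<zero>\<^bsub>T i (n - 1 - i)\<^esub> \<oplus>\<^bsub>T i (n - 1 - i)\<^esub> \<zero>\<^bsub>T i (n - 1 - i)\<^esub> = \<zero>\<^bsub>T i (n - 1 - i)\<^esub>"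
      by (rule abelian_group.minus_equality[OF T_abelian]) simp_all
    ultimately show ?thesis
      unfolding diff_eq dPt' dIt' signed_def by (simp only: if_cancel)
  qed
  have "finite {i. cdiff (unbounded_tensor R P I) n t' i \<noteq> \<zero>\<^bsub>T i (n - 1 - i)\<^esub>}"
    by (rule finite_subset[of _ "{L - 1}"]) (use van in auto)
  then obtain u where u: "\<And>i. u i \<in> carrier (T i (n + 1 - i))"
    and fin: "finite {i. t' i \<ominus>\<^bsub>T i (n - i)\<^esub> cdiff (unbounded_tensor R P I) (n + 1) u i \<noteq> \<zero>\<^bsub>T i (n - i)\<^esub>}"
    using triv[unfolded stable_trivial_iff, THEN spec[of _ t']] t' by blast
  obtain M0 where M0: "\<And>i. i \<ge> M0 \<Longrightarrow> t' i \<ominus>\<^bsub>T i (n - i)\<^esub> cdiff (unbounded_tensor R P I) (n + 1) u i = \<zero>\<^bsub>T i (n - i)\<^esub>"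
  proof -
    obtain M where "\<And>i. i \<in> {i. t' i \<ominus>\<^bsub>T i (n - i)\<^esub> cdiff (unbounded_tensor R P I) (n + 1) u i \<noteq> \<zero>\<^bsub>T i (n - i)\<^esub>} \<Longrightarrow> i \<le> M"
      using bdd_above_finite[OF fin] unfolding bdd_above_def by blast
    then show ?thesis using that[of "M + 1"] by force
  qed
  \<comment> \<open>Far out \<open>t'\<close> equals the boundary of \<open>u\<close> on the nose.
    Applying dI leaves dI dP u = dP dI u; \<open>\<Theta>d\<close> moves the functional from place
    \<open>i\<close> to \<open>i + 1\<close>, where it meets dI dI u = 0.\<close>
  have "\<Theta> i (dI i (n - 1 - i) (t i)) = \<zero>\<^bsub>A\<^esub>" if i: "i \<ge> max M0 L" for i
  proof -
    define j where "j = n - 1 - i"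
    have e: "n - i = j + 1" "n + 1 - i = j + 1 + 1" "n + 1 - (i + 1) = j + 1" "n + 1 - 1 - i = j + 1"
      "n - 1 - (i + 1) = j - 1" "j - 1 + 1 = j" by (simp_all add: j_def)
    have ui: "u i \<in> carrier (T i (j + 1 + 1))" and ui': "u (i + 1) \<in> carrier (T (i + 1) (j + 1))"
      using u[of i] u[of "i + 1"] unfolding e by simp_all
    have "cdiff (unbounded_tensor R P I) (n + 1) u i \<in> carrier (T i (n + 1 - 1 - i))" by (rule diff_mem[OF u])
    then have "t' i = cdiff (unbounded_tensor R P I) (n + 1) u i"
      using M0[of i] i t'[of i] add_hom_diff_zero[of "t' i" i "n - i"] unfolding e by simp
    then have t'_eq: "t' i = dP i (j + 1) (u (i + 1)) \<oplus>\<^bsub>T i (j + 1)\<^esub> signed i (j + 1) (dI i (j + 1) (u i))"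
      unfolding diff_eq e .
    let ?a = "dP i (j + 1) (u (i + 1))" and ?b = "dI i (j + 1) (u i)"
    have a: "?a \<in> carrier (T i (j + 1))" and b: "?b \<in> carrier (T i (j + 1))"
      using add_homD(1)[OF dP_hom ui'] add_homD(1)[OF dI_hom ui] by auto
    have "dI i j (signed i (j + 1) ?b) = \<zero>\<^bsub>T i j\<^esub>"
      unfolding signed_def using signed_hom[OF dI_hom b, of "even i"] dI_dI[OF ui] by simp
    then have "dI i j (t' i) = dI i j ?a"
      unfolding t'_eq using add_homD(2)[OF dI_hom a signed_closed[OF b]] add_homD(1)[OF dI_hom a] by simp
    also have "\<dots> = dP i j (dI (i + 1) j (u (i + 1)))" by (rule dI_dP[OF ui'])
    finally have eq: "dI i j (t' i) = dP i j (dI (i + 1) j (u (i + 1)))" .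
    have v: "dI (i + 1) j (u (i + 1)) \<in> carrier (T (i + 1) j)" by (rule add_homD(1)[OF dI_hom ui'])
    have iL: "i \<ge> L" using i by simp
    have "\<Theta> i (dI i j (t' i)) = \<Theta> (i + 1) (dI (i + 1) (j - 1) (dI (i + 1) j (u (i + 1))))"
      unfolding eq using \<Theta>d[OF iL, of "dI (i + 1) j (u (i + 1))"] v unfolding j_def[symmetric] e by simp
    also have "dI (i + 1) (j - 1) (dI (i + 1) j (u (i + 1))) = \<zero>\<^bsub>T (i + 1) (j - 1)\<^esub>"
      using dI_dI[of "u (i + 1)" "i + 1" "j - 1"] ui' unfolding e by simp
    also have "\<Theta> (i + 1) \<zero>\<^bsub>T (i + 1) (j - 1)\<^esub> = \<zero>\<^bsub>A\<^esub>"
      using add_hom_zero[OF T_abelian A \<Theta>[of "i + 1"]] iL unfolding e by simp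
    finally have z: "\<Theta> i (dI i j (t' i)) = \<zero>\<^bsub>A\<^esub>" .
    have c: "dI i j (t i) \<in> carrier (T i j)" using dI_mem[OF t, of i] unfolding j_def .
    have \<Theta>i: "\<Theta> i \<in> add_hom (T i j) A" using \<Theta>[OF iL] unfolding j_def .
    show ?thesis
    proof (cases "\<sigma> i")
      case True
      then show ?thesis using z by (simp add: t'_def j_def)
    next
      case False
      then have "dI i j (t' i) = \<ominus>\<^bsub>T i j\<^esub> dI i j (t i)" using dIt'[of i] unfolding j_def[symmetric] by simp
      then have "\<ominus>\<^bsub>A\<^esub> \<Theta> i (dI i j (t i)) = \<zero>\<^bsub>A\<^esub>" using z add_hom_minus[OF T_abelian A \<Theta>i c] by simp
      then have "\<Theta> i (dI i j (t i)) = \<zero>\<^bsub>A\<^esub>"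
        using A.minus_minus[of "\<Theta> i (dI i j (t i))"] add_homD(1)[OF \<Theta>i c] by simp
      then show ?thesis by (simp add: j_def)
    qed
  qed
  then show ?thesis using that by blast
qed

lemma succ_eqs: "int i + 1 = int (Suc i)" "- int (Suc j) + 1 = - int j"
  by simp_all

lemma nat_dP_hom: "dP (int i) j \<in> add_hom (T (int (Suc i)) j) (T (int i) j)"
  and nat_dP_ten: "x \<in> carrier (cobj P (int (Suc i))) \<Longrightarrow> y \<in> carrier (cobj I j) \<Longrightarrow>
    dP (int i) j (tn (int (Suc i)) j x y) = tn (int i) j (cdiff P (int (Suc i)) x) y"
  and nat_dI_hom: "dI i (- int (Suc l)) \<in> add_hom (T i (- int l)) (T i (- int (Suc l)))"
  and nat_dI_ten: "x' \<in> carrier (cobj P i') \<Longrightarrow> y' \<in> carrier (cobj I (- int l)) \<Longrightarrow>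
    dI i' (- int (Suc l)) (tn i' (- int l) x' y') = tn i' (- int (Suc l)) x' (cdiff I (- int l) y')"
  using dP_hom[of "int i" j] dP_ten[of x "int i" y j] dI_hom[of i "- int (Suc l)"] dI_ten[of x' i' y' "- int (Suc l)"]
  unfolding succ_eqs by blast+

text \<open>The preceding criterion reindexed by natural numbers, the form in which comparison maps
  and chains are produced; \<open>t i\<close> sits in degree i + 1 of \<open>P\<close>, so the
  family starts at index 1.\<close>

lemma stable_trivial_functional_nat:
  assumes triv: "trivial_module (homology_module (stable_tensor R P I) (- int k + 1))"
    and t: "\<And>i. t i \<in> carrier (T (int (Suc i)) (- int (i + k)))"
    and cyc: "\<And>i. dP (int (Suc i)) (- int (Suc (i + k))) (t (Suc i)) = dI (int (Suc i)) (- int (Suc (i + k))) (t i)"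
    and A: "abelian_group A"
    and \<Theta>: "\<And>i. \<Theta> i \<in> add_hom (T (int i) (- int (i + k))) A"
    and \<Theta>d: "\<And>i v. v \<in> carrier (T (int (Suc i)) (- int (i + k))) \<Longrightarrow>
      \<Theta> i (dP (int i) (- int (i + k)) v) = \<Theta> (Suc i) (dI (int (Suc i)) (- int (Suc (i + k))) v)"
  shows "\<exists>i. \<Theta> (Suc i) (dI (int (Suc i)) (- int (Suc (i + k))) (t i)) = \<zero>\<^bsub>A\<^esub>"
proof -
  \<comment> \<open>The total degree of \<open>t i\<close>: the degrees i + 1 and -(i + k) add up to
    1 - k.\<close>
  define n where "n = - int k + 1"
  have e: "n - int (Suc i) = - int (i + k)" "n - 1 - int (Suc i) = - int (Suc (i + k))" for i
    by (simp_all add: n_def)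
  define t' where "t' i = (if i \<ge> 1 then t (nat i - 1) else \<zero>\<^bsub>T i (n - i)\<^esub>)" for i
  have t'_Suc: "t' (int (Suc i)) = t i" for i
  proof -
    have "int (Suc i) \<ge> 1" "nat (int (Suc i)) - 1 = i" by (simp, simp only: nat_int diff_Suc_1)
    then show ?thesis unfolding t'_def by (simp only: if_True)
  qed
  have pos: "\<exists>l. i = int (Suc l)" if "i \<ge> 1" for i :: int
    using that by (intro exI[of _ "nat i - 1"]) simp
  have "\<exists>M. \<forall>i\<ge>M. \<Theta> (nat i) (dI i (n - 1 - i) (t' i)) = \<zero>\<^bsub>A\<^esub>"
  proof (rule stable_trivial_functional[of n t' 1 A "\<lambda>i. \<Theta> (nat i)"])
    show "trivial_module (homology_module (stable_tensor R P I) n)" using triv unfolding n_def .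
    show "t' i \<in> carrier (T i (n - i))" for i
    proof (cases "i \<ge> 1")
      case True
      with pos obtain l where l: "i = int (Suc l)" by blast
      show ?thesis unfolding l t'_Suc e by (rule t)
    qed (simp add: t'_def)
    show "t' i = \<zero>\<^bsub>T i (n - i)\<^esub>" if "i < 1" for i using that by (simp add: t'_def)
    show "dP i (n - 1 - i) (t' (i + 1)) = dI i (n - 1 - i) (t' i)" if "1 \<le> i" for i
    proof -
      from pos that obtain l where l: "i = int (Suc l)" by blast
      show ?thesis unfolding l succ_eqs t'_Suc e by (rule cyc)
    qed
    show "\<Theta> (nat i) \<in> add_hom (T i (n - 1 - i)) A" if "1 \<le> i" for i
    proof -
      from pos that obtain l where l: "i = int (Suc l)" by blast
      show ?thesis unfolding l e nat_int using \<Theta>[of "Suc l"] by (simp only: add_Suc)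
    qed
    show "\<Theta> (nat i) (dP i (n - 1 - i) v) = \<Theta> (nat (i + 1)) (dI (i + 1) (n - 1 - (i + 1)) v)"
      if "1 \<le> i" "v \<in> carrier (T (i + 1) (n - 1 - i))" for i v
    proof -
      from pos that(1) obtain l where l: "i = int (Suc l)" by blast
      show ?thesis
        using \<Theta>d[of v "Suc l"] that(2) unfolding l succ_eqs e nat_int by (simp only: add_Suc)
    qed
  qed (rule A, blast)
  then obtain M where M: "\<And>i. i \<ge> M \<Longrightarrow> \<Theta> (nat i) (dI i (n - 1 - i) (t' i)) = \<zero>\<^bsub>A\<^esub>" by blast
  have "\<Theta> (Suc (nat M)) (dI (int (Suc (nat M))) (- int (Suc (nat M + k))) (t (nat M))) = \<zero>\<^bsub>A\<^esub>"
    using M[of "int (Suc (nat M))"] unfolding nat_int t'_Suc e by simp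
  then show ?thesis by blast
qed

text \<open>1 (x) S contracts the columns of the double complex in those degrees of \<open>I\<close>
  that are below \<open>l\<close>. In a fixed total degree these belong to all large
  \<open>i\<close>; for negative \<open>i\<close> the factor of \<open>P\<close> is zero, and only
  finitely many indices remain.\<close>

lemma contraction_stable_trivial:
  fixes n l :: int
  assumes Pneg: "\<And>i. i < 0 \<Longrightarrow> trivial_module (cobj P i)"
    and S: "\<And>m. m < l \<Longrightarrow> S m \<in> mod_hom R (cobj I m) (cobj I (m + 1))"
    and contr: "\<And>m x. m + 1 < l \<Longrightarrow> x \<in> carrier (cobj I (m + 1)) \<Longrightarrow>
      cdiff I (m + 1 + 1) (S (m + 1) x) \<oplus>\<^bsub>cobj I (m + 1)\<^esub> S m (cdiff I (m + 1) x) = x"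
  shows "trivial_module (homology_module (stable_tensor R P I) n)"
  unfolding stable_trivial_iff
proof (intro allI impI, elim conjE)
  fix t
  assume t: "\<forall>i. t i \<in> carrier (T i (n - i))"
    and fin: "finite {i. cdiff (unbounded_tensor R P I) n t i \<noteq> \<zero>\<^bsub>T i (n - 1 - i)\<^esub>}"
  define \<sigma> where "\<sigma> i j = tensor_map R (cobj P i) (cobj I (j + 1)) (\<lambda>x. x) (S j)" for i j
  have \<sigma>_hom: "\<sigma> i j \<in> add_hom (T i j) (T i (j + 1))"
    and \<sigma>_ten: "x \<in> carrier (cobj P i) \<Longrightarrow> y \<in> carrier (cobj I j) \<Longrightarrow> \<sigma> i j (tn i j x y) = tn i (j + 1) x (S j y)"
    if "j < l" for i j x y
    unfolding \<sigma>_def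
    using tensor_map_add_hom[OF P_facts(1) I_facts(1) P_facts(1) I_facts(1) mod_hom_id S[OF that]] by blast+
  have \<sigma>_dP: "dP i (j + 1) (\<sigma> (i + 1) j v) = \<sigma> i j (dP i j v)" if j: "j < l" and v: "v \<in> carrier (T (i + 1) j)" for i j v
    by (rule tensor_hom_ext[OF P_facts(1) I_facts(1) T_abelian add_hom_comp[OF \<sigma>_hom[OF j] dP_hom]
          add_hom_comp[OF dP_hom \<sigma>_hom[OF j]] _ v])
      (simp add: dP_ten \<sigma>_ten[OF j] mod_homD(1)[OF P_facts(2)] mod_homD(1)[OF S[OF j]])
  have homotopy: "\<sigma> i j (dI i j v) \<oplus>\<^bsub>T i (j + 1)\<^esub> dI i (j + 1) (\<sigma> i (j + 1) v) = v"
    if j: "j + 1 < l" and v: "v \<in> carrier (T i (j + 1))" for i j v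
  proof -
    have j': "j < l" using j by simp
    have h1: "(\<lambda>v. \<sigma> i j (dI i j v)) \<in> add_hom (T i (j + 1)) (T i (j + 1))"
      by (rule add_hom_comp[OF dI_hom \<sigma>_hom[OF j']])
    have h2: "(\<lambda>v. dI i (j + 1) (\<sigma> i (j + 1) v)) \<in> add_hom (T i (j + 1)) (T i (j + 1))"
      by (rule add_hom_comp[OF \<sigma>_hom[OF j] dI_hom])
    have sum: "(\<lambda>v. \<sigma> i j (dI i j v) \<oplus>\<^bsub>T i (j + 1)\<^esub> dI i (j + 1) (\<sigma> i (j + 1) v)) \<in> add_hom (T i (j + 1)) (T i (j + 1))"
      by (rule add_homI) (simp_all add: add_homD[OF h1] add_homD[OF h2] T.a_ac)
    show ?thesis
    proof (rule tensor_hom_ext[OF P_facts(1) I_facts(1) T_abelian sum _ _ v, of "\<lambda>v. v"])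
      show "(\<lambda>v. v) \<in> add_hom (T i (j + 1)) (T i (j + 1))" by (rule add_homI) auto
      fix x y assume x: "x \<in> carrier (cobj P i)" and y: "y \<in> carrier (cobj I (j + 1))"
      note dy = mod_homD(1)[OF I_facts(2) y] and sy = mod_homD(1)[OF S[OF j] y]
      have "\<sigma> i j (dI i j (tn i (j + 1) x y)) = tn i (j + 1) x (S j (cdiff I (j + 1) y))"
        using dI_ten[OF x y] \<sigma>_ten[OF j' x dy] by simp
      moreover have "dI i (j + 1) (\<sigma> i (j + 1) (tn i (j + 1) x y)) = tn i (j + 1) x (cdiff I (j + 1 + 1) (S (j + 1) y))"
        using \<sigma>_ten[OF j x y] dI_ten[OF x sy] by simp
      moreover have "tn i (j + 1) x (cdiff I (j + 1 + 1) (S (j + 1) y)) \<oplus>\<^bsub>T i (j + 1)\<^esub> tn i (j + 1) x (S j (cdiff I (j + 1) y))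
          = tn i (j + 1) x y"
        using ten_add_right[OF P_facts(1) I_facts(1) x mod_homD(1)[OF I_facts(2) sy] mod_homD(1)[OF S[OF j'] dy]]
          contr[OF j y] by simp
      ultimately show "\<sigma> i j (dI i j (tn i (j + 1) x y)) \<oplus>\<^bsub>T i (j + 1)\<^esub> dI i (j + 1) (\<sigma> i (j + 1) (tn i (j + 1) x y))
          = tn i (j + 1) x y"
        using T.a_comm ten_closed[OF P_facts(1) I_facts(1) x] mod_homD(1)[OF I_facts(2) sy]
          mod_homD(1)[OF S[OF j'] dy] by simp
    qed
  qed
  obtain M0 where M0: "\<And>i. i \<ge> M0 \<Longrightarrow> cdiff (unbounded_tensor R P I) n t i = \<zero>\<^bsub>T i (n - 1 - i)\<^esub>"
  proof -
    obtain M where "\<And>i. i \<in> {i. cdiff (unbounded_tensor R P I) n t i \<noteq> \<zero>\<^bsub>T i (n - 1 - i)\<^esub>} \<Longrightarrow> i \<le> M"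
      using bdd_above_finite[OF fin] unfolding bdd_above_def by blast
    then show ?thesis using that[of "M + 1"] by force
  qed
  \<comment> \<open>The sign (-1)^i of \<open>signed\<close> cancels the one in the differential.
    For the neighbouring term, the sign at i + 1 cancels the one that comes from the cycle condition
    on \<open>t\<close>.\<close>
  define u where "u i = (if n - i < l then signed i (n - i + 1) (\<sigma> i (n - i) (t i)) else \<zero>\<^bsub>T i (n - i + 1)\<^esub>)" for i
  have ue: "n - i + 1 = n + 1 - i" for i by simp
  have u: "u i \<in> carrier (T i (n + 1 - i))" for i
    using add_homD(1)[OF \<sigma>_hom, of "n - i" "t i" i] t[rule_format, of i] unfolding ue[symmetric] u_def
    by (auto intro: signed_closed)
  \<comment> \<open>Beyond \<open>M0\<close> the boundary of \<open>t\<close> vanishes, and beyond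
    \<open>n - l\<close> the degree n - i of \<open>I\<close> is below \<open>l\<close>.\<close>
  have "t i \<ominus>\<^bsub>T i (n - i)\<^esub> cdiff (unbounded_tensor R P I) (n + 1) u i = \<zero>\<^bsub>T i (n - i)\<^esub>"
    if i: "i \<notin> {0..max M0 (n - l)}" for i
  proof (cases "i < 0")
    case True
    have ti: "t i \<in> carrier (T i (n - i))" using t by simp
    have "cdiff (unbounded_tensor R P I) (n + 1) u i \<in> carrier (T i (n + 1 - 1 - i))" by (rule diff_mem[OF u])
    then have "t i \<ominus>\<^bsub>T i (n - i)\<^esub> cdiff (unbounded_tensor R P I) (n + 1) u i \<in> carrier (T i (n - i))"
      using ti by simp
    then show ?thesis
      using tensor_trivial[OF P_facts(1) I_facts(1)] Pneg[OF True] unfolding trivial_module_def by blast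
  next
    case False
    then have iM: "i \<ge> M0" and il: "n - i < l" "n - (i + 1) < l" using i by auto
    define j where "j = n - 1 - i"
    have e: "n - i = j + 1" "n - (i + 1) = j" "n + 1 - 1 - i = j + 1" by (simp_all add: j_def)
    have j: "j + 1 < l" "j < l" using il unfolding e by simp_all
    have ti: "t i \<in> carrier (T i (j + 1))" and ti': "t (i + 1) \<in> carrier (T (i + 1) j)"
      using t[rule_format, of i] t[rule_format, of "i + 1"] unfolding e by simp_all
    have ui: "u i = signed i (j + 1 + 1) (\<sigma> i (j + 1) (t i))" using il(1) unfolding u_def e by simp
    have ui': "u (i + 1) = signed (i + 1) (j + 1) (\<sigma> (i + 1) j (t (i + 1)))" using il(2) unfolding u_def e by simp
    let ?a = "\<sigma> i j (dI i j (t i))" and ?b = "dI i (j + 1) (\<sigma> i (j + 1) (t i))"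
    have dt: "dI i j (t i) \<in> carrier (T i j)" and dt': "dP i j (t (i + 1)) \<in> carrier (T i j)"
      using add_homD(1)[OF dI_hom ti] add_homD(1)[OF dP_hom ti'] by auto
    have a: "?a \<in> carrier (T i (j + 1))" by (rule add_homD(1)[OF \<sigma>_hom[OF j(2)] dt])
    have b: "?b \<in> carrier (T i (j + 1))"
      by (rule add_homD(1)[OF dI_hom add_homD(1)[OF \<sigma>_hom[OF j(1)] ti]])
    have "dP i j (t (i + 1)) \<oplus>\<^bsub>T i j\<^esub> signed i j (dI i j (t i)) = \<zero>\<^bsub>T i j\<^esub>"
      using M0[OF iM] unfolding diff_eq j_def .
    then have "dP i j (t (i + 1)) = \<ominus>\<^bsub>T i j\<^esub> signed i j (dI i j (t i))"
      using abelian_group.minus_equality[OF T_abelian[of i j], of "dP i j (t (i + 1))" "signed i j (dI i j (t i))"] dt' signed_closed[OF dt] by simp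
    then have dPt: "dP i j (t (i + 1)) = (if even (i + 1) then dI i j (t i) else \<ominus>\<^bsub>T i j\<^esub> dI i j (t i))"
      using dt unfolding signed_def by (cases "even i") simp_all
    have "dP i (j + 1) (u (i + 1))
        = (if even (i + 1) then dP i (j + 1) (\<sigma> (i + 1) j (t (i + 1))) else \<ominus>\<^bsub>T i (j + 1)\<^esub> dP i (j + 1) (\<sigma> (i + 1) j (t (i + 1))))"
      unfolding ui' signed_def by (rule signed_hom[OF dP_hom add_homD(1)[OF \<sigma>_hom[OF j(2)] ti']])
    also have "dP i (j + 1) (\<sigma> (i + 1) j (t (i + 1))) = \<sigma> i j (dP i j (t (i + 1)))" by (rule \<sigma>_dP[OF j(2) ti'])
    also have "\<dots> = (if even (i + 1) then ?a else \<ominus>\<^bsub>T i (j + 1)\<^esub> ?a)"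
      unfolding dPt by (rule signed_hom[OF \<sigma>_hom[OF j(2)] dt])
    finally have A: "dP i (j + 1) (u (i + 1)) = ?a" using a by (cases "even (i + 1)") simp_all
    have "dI i (j + 1) (u i) = (if even i then ?b else \<ominus>\<^bsub>T i (j + 1)\<^esub> ?b)"
      unfolding ui signed_def by (rule signed_hom[OF dI_hom add_homD(1)[OF \<sigma>_hom[OF j(1)] ti]])
    then have B: "signed i (j + 1) (dI i (j + 1) (u i)) = ?b" using b by (cases "even i") (simp_all add: signed_def)
    have "cdiff (unbounded_tensor R P I) (n + 1) u i = t i"
      unfolding diff_eq e A B by (rule homotopy[OF j(1) ti])
    then show ?thesis using ti unfolding e by (simp add: a_minus_def T.r_neg)
  qed
  then have "{i. t i \<ominus>\<^bsub>T i (n - i)\<^esub> cdiff (unbounded_tensor R P I) (n + 1) u i \<noteq> \<zero>\<^bsub>T i (n - i)\<^esub>} \<subseteq> {0..max M0 (n - l)}"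
    by blast
  then have "finite {i. t i \<ominus>\<^bsub>T i (n - i)\<^esub> cdiff (unbounded_tensor R P I) (n + 1) u i \<noteq> \<zero>\<^bsub>T i (n - i)\<^esub>}"
    by (rule finite_subset) simp
  then show "\<exists>u. (\<forall>i. u i \<in> carrier (T i (n + 1 - i))) \<and>
      finite {i. t i \<ominus>\<^bsub>T i (n - i)\<^esub> cdiff (unbounded_tensor R P I) (n + 1) u i \<noteq> \<zero>\<^bsub>T i (n - i)\<^esub>}"
    using u by blast
qed

end

section \<open>The free resolution of D(N) and the injective resolution dual to it\<close>

subsection \<open>Projective resolutions\<close>

text \<open>As with \<open>inj_coresolution\<close>, the type of the terms is left open, so that
  resolutions by free modules of finite rank can be compared with the chosen ones in
  \<open>'u\<close>.\<close>

definition proj_resolution_seq ::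
  "'u itself \<Rightarrow> ('r, 'c) ring_scheme \<Rightarrow> ('r, 'm) module \<Rightarrow> (nat \<Rightarrow> ('r, 'p) module) \<Rightarrow>
    (nat \<Rightarrow> 'p \<Rightarrow> 'p) \<Rightarrow> ('p \<Rightarrow> 'm) \<Rightarrow> bool" where
  "proj_resolution_seq U R M F d \<epsilon> \<longleftrightarrow> left_module R M \<and> (\<forall>n. projective_module U R (F n)) \<and>
    (\<forall>n. carrier (F n) \<lesssim> (UNIV :: 'u set)) \<and> (\<forall>n. d n \<in> mod_hom R (F (Suc n)) (F n)) \<and>
    \<epsilon> \<in> mod_hom R (F 0) M \<and> \<epsilon> ` carrier (F 0) = carrier M \<and>
    d 0 ` carrier (F 1) = {x \<in> carrier (F 0). \<epsilon> x = \<zero>\<^bsub>M\<^esub>} \<and>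
    (\<forall>n. d (Suc n) ` carrier (F (Suc (Suc n))) = {x \<in> carrier (F (Suc n)). d n x = \<zero>\<^bsub>F n\<^esub>})"

lemma proj_resolution_seqD:
  fixes U :: "'u itself"
  assumes "proj_resolution_seq U R M F d \<epsilon>"
  shows "left_module R M" "projective_module U R (F n)" "left_module R (F n)"
    "carrier (F n) \<lesssim> (UNIV :: 'u set)" "d n \<in> mod_hom R (F (Suc n)) (F n)"
    "\<epsilon> \<in> mod_hom R (F 0) M" "\<epsilon> ` carrier (F 0) = carrier M"
    "d 0 ` carrier (F 1) = {x \<in> carrier (F 0). \<epsilon> x = \<zero>\<^bsub>M\<^esub>}"
    "d (Suc n) ` carrier (F (Suc (Suc n))) = {x \<in> carrier (F (Suc n)). d n x = \<zero>\<^bsub>F n\<^esub>}"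
  using assms by (auto simp: proj_resolution_seq_def projective_module_def)

lemma projective_resolution_seq:
  fixes U :: "'u itself"
  assumes M: "left_module R M" and P: "projective_resolution U R M P \<epsilon>"
  shows "proj_resolution_seq U R M (\<lambda>n. cobj P (int n)) (\<lambda>n. cdiff P (int (Suc n))) \<epsilon>"
proof -
  have e: "int (Suc n) - 1 = int n" "int (Suc n) + 1 = int (Suc (Suc n))" for n by simp_all
  have b: "boundaries P (int n) = cdiff P (int (Suc n)) ` carrier (cobj P (int (Suc n)))" for n
    unfolding boundaries_def by (simp add: add.commute)
  have cyc: "cycles P (int (Suc n)) = {x \<in> carrier (cobj P (int (Suc n))). cdiff P (int (Suc n)) x = \<zero>\<^bsub>cobj P (int n)\<^esub>}" for n
    unfolding cycles_def e ..
  have hom: "cdiff P (int (Suc n)) \<in> mod_hom R (cobj P (int (Suc n))) (cobj P (int n))" for n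
    using P unfolding projective_resolution_def is_complex_def by (metis e(1))
  show ?thesis
    unfolding proj_resolution_seq_def
  proof (intro conjI allI M hom)
    show "cdiff P (int (Suc 0)) ` carrier (cobj P (int 1)) = {x \<in> carrier (cobj P (int 0)). \<epsilon> x = \<zero>\<^bsub>M\<^esub>}"
      using b[of 0] P by (simp add: projective_resolution_def)
    show "cdiff P (int (Suc (Suc n))) ` carrier (cobj P (int (Suc (Suc n)))) =
        {x \<in> carrier (cobj P (int (Suc n))). cdiff P (int (Suc n)) x = \<zero>\<^bsub>cobj P (int n)\<^esub>}" for n
      unfolding cyc[symmetric] b[symmetric] using P by (simp add: projective_resolution_def)
  qed (use P in \<open>auto simp: projective_resolution_def subset_imp_lepoll\<close>)
qed

lemma projective_comparison:
  assumes F: "proj_resolution_seq U R M F d \<epsilon>" and F': "proj_resolution_seq U R M F' d' \<epsilon>'"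
  obtains f where "\<And>n. f n \<in> mod_hom R (F n) (F' n)"
    "\<And>n x. x \<in> carrier (F (Suc n)) \<Longrightarrow> d' n (f (Suc n) x) = f n (d n x)"
    "\<And>x. x \<in> carrier (F 0) \<Longrightarrow> \<epsilon>' (f 0 x) = \<epsilon> x"
proof -
  note FD = proj_resolution_seqD[OF F] and FD' = proj_resolution_seqD[OF F']
  have "\<epsilon> ` carrier (F 0) \<subseteq> \<epsilon>' ` carrier (F' 0)" using FD(7) FD'(7) by simp
  from projective_lift[OF FD(2) FD'(3) FD'(1) FD'(4) FD'(6) FD(6) this]
  obtain f0 where f0: "f0 \<in> mod_hom R (F 0) (F' 0)" "\<And>x. x \<in> carrier (F 0) \<Longrightarrow> \<epsilon>' (f0 x) = \<epsilon> x" by blast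
  \<comment> \<open>The invariant says that \<open>g\<close> carries boundaries to boundaries, the
    image condition under which \<open>projective_lift\<close> supplies the next map.\<close>
  define ok where "ok n g \<longleftrightarrow> g \<in> mod_hom R (F n) (F' n) \<and>
      (\<forall>x\<in>carrier (F (Suc n)). g (d n x) \<in> d' n ` carrier (F' (Suc n)))" for n g
  have "\<exists>f. \<forall>n. (ok n (f n) \<and> (n = 0 \<longrightarrow> f n = f0)) \<and> (\<forall>x\<in>carrier (F (Suc n)). d' n (f (Suc n) x) = f n (d n x))"
  proof (rule dependent_nat_choice)
    have "f0 (d 0 x) \<in> d' 0 ` carrier (F' (Suc 0))" if x: "x \<in> carrier (F (Suc 0))" for x
    proof -
      have "d 0 x \<in> {x \<in> carrier (F 0). \<epsilon> x = \<zero>\<^bsub>M\<^esub>}" unfolding FD(8)[symmetric] using x by simp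
      then have "f0 (d 0 x) \<in> {x \<in> carrier (F' 0). \<epsilon>' x = \<zero>\<^bsub>M\<^esub>}" using f0(2) mod_homD(1)[OF f0(1)] by simp
      then show ?thesis unfolding FD'(8)[symmetric] by simp
    qed
    then show "\<exists>f. ok 0 f \<and> (0 = 0 \<longrightarrow> f = f0)" using f0(1) unfolding ok_def by blast
  next
    fix g n assume "ok n g \<and> (n = 0 \<longrightarrow> g = f0)"
    then have g: "g \<in> mod_hom R (F n) (F' n)"
      and gd: "(\<lambda>x. g (d n x)) ` carrier (F (Suc n)) \<subseteq> d' n ` carrier (F' (Suc n))"
      unfolding ok_def by auto
    from projective_lift[OF FD(2) FD'(3) FD'(3) FD'(4) FD'(5) mod_hom_comp[OF FD(5) g] gd]
    obtain h where h: "h \<in> mod_hom R (F (Suc n)) (F' (Suc n))"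
      "\<And>x. x \<in> carrier (F (Suc n)) \<Longrightarrow> d' n (h x) = g (d n x)" by blast
    have "h (d (Suc n) x) \<in> d' (Suc n) ` carrier (F' (Suc (Suc n)))" if x: "x \<in> carrier (F (Suc (Suc n)))" for x
    proof -
      have "d (Suc n) x \<in> {x \<in> carrier (F (Suc n)). d n x = \<zero>\<^bsub>F n\<^esub>}" unfolding FD(9)[symmetric] using x by simp
      then have dx: "d (Suc n) x \<in> carrier (F (Suc n))" "d n (d (Suc n) x) = \<zero>\<^bsub>F n\<^esub>" by auto
      have "d' n (h (d (Suc n) x)) = \<zero>\<^bsub>F' n\<^esub>"
        using h(2)[OF dx(1)] dx(2) mod_hom_zero[OF FD(3) FD'(3) g] by simp
      then have "h (d (Suc n) x) \<in> {x \<in> carrier (F' (Suc n)). d' n x = \<zero>\<^bsub>F' n\<^esub>}"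
        using mod_homD(1)[OF h(1) dx(1)] by simp
      then show ?thesis unfolding FD'(9)[symmetric] .
    qed
    then show "\<exists>h. (ok (Suc n) h \<and> (Suc n = 0 \<longrightarrow> h = f0)) \<and> (\<forall>x\<in>carrier (F (Suc n)). d' n (h x) = g (d n x))"
      using h unfolding ok_def by (intro exI[of _ h]) auto
  qed
  then obtain f where f: "\<And>n. ok n (f n)" "f 0 = f0"
    "\<And>n x. x \<in> carrier (F (Suc n)) \<Longrightarrow> d' n (f (Suc n) x) = f n (d n x)" by blast
  show ?thesis
    by (rule that[of f]) (use f f0 in \<open>auto simp: ok_def\<close>)
qed

subsection \<open>The injective resolution dual to a free resolution\<close>

context artin_dual
begin

text \<open>A submodule of R^m inherits finite length over \<open>K\<close>, so each kernel is again
  covered by a free module of finite rank.\<close>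

lemma free_resolution_exists:
  assumes X: "left_module R X" and fl: "finite_length K (restr X)"
  obtains m \<Delta> \<epsilon> where "\<epsilon> \<in> mod_hom R (Fr (m 0)) X" "\<epsilon> ` carrier (Fr (m 0)) = carrier X"
    "\<And>j. \<Delta> j \<in> mod_hom R (Fr (m (Suc j))) (Fr (m j))"
    "\<Delta> 0 ` carrier (Fr (m 1)) = {q \<in> carrier (Fr (m 0)). \<epsilon> q = \<zero>\<^bsub>X\<^esub>}"
    "\<And>j. \<Delta> (Suc j) ` carrier (Fr (m (Suc (Suc j)))) = {q \<in> carrier (Fr (m (Suc j))). \<Delta> j q = \<zero>\<^bsub>Fr (m j)\<^esub>}"
proof -
  obtain m0 :: nat and \<epsilon> where \<epsilon>: "\<epsilon> \<in> mod_hom R (Fr m0) X" "\<epsilon> ` carrier (Fr m0) = carrier X"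
    by (rule finite_length_free_cover[OF X fl])
  have "\<exists>F' d. (\<exists>m. F' = Fr m) \<and> d \<in> mod_hom R F' F \<and> d ` carrier F' = S"
    if F: "\<exists>m. F = Fr m" and S: "submodule S R F" for F S
  proof -
    obtain m where m: "F = Fr m" using F by blast
    interpret F: left_module R F unfolding m by (rule left_module_Fr)
    have "finite_length K ((restr F)\<lparr>carrier := S\<rparr>)"
      by (rule finite_length_sub[OF left_module_restrict[OF F.left_module_axioms] submodule_restrict[OF S]])
        (use finite_length_free[of m] in \<open>simp only: m\<close>)
    then have fl': "finite_length K (restr (F\<lparr>carrier := S\<rparr>))" by simp
    obtain m' :: nat and d where d: "d \<in> mod_hom R (Fr m') (F\<lparr>carrier := S\<rparr>)"
      "d ` carrier (Fr m') = carrier (F\<lparr>carrier := S\<rparr>)"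
      by (rule finite_length_free_cover[OF F.left_module_sub[OF S] fl'])
    have "d ` carrier (Fr m') = S" using d(2) by simp
    then show ?thesis using mod_hom_from_sub[OF d(1) submoduleD(1)[OF S]] by blast
  qed
  then obtain Q \<Delta> where Q: "Q 0 = Fr m0" "\<And>n. \<exists>m. Q n = Fr m" "\<And>n. \<Delta> n \<in> mod_hom R (Q (Suc n)) (Q n)"
    "\<Delta> 0 ` carrier (Q 1) = {q \<in> carrier (Fr m0). \<epsilon> q = \<zero>\<^bsub>X\<^esub>}"
    "\<And>n. \<Delta> (Suc n) ` carrier (Q (Suc (Suc n))) = {x \<in> carrier (Q (Suc n)). \<Delta> n x = \<zero>\<^bsub>Q n\<^esub>}"
    using resolution_sequence[where C = "\<lambda>F. \<exists>m. F = Fr m" and R = R and ?F0.0 = "Fr m0",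
        OF _ _ _ submodule_kernel[OF left_module_Fr X \<epsilon>(1)]] left_module_Fr by blast
  \<comment> \<open>Over the zero ring \<open>Fr k\<close> does not determine \<open>k\<close>, so
    the rank in degree 0 is pinned explicitly.\<close>
  have "\<forall>n. \<exists>k. Q n = Fr k \<and> (n = 0 \<longrightarrow> k = m0)" using Q(1,2) by metis
  then obtain m where m: "\<And>n. Q n = Fr (m n)" "m 0 = m0" by metis
  show ?thesis
    by (rule that[of \<epsilon> m \<Delta>]) (use Q \<epsilon> in \<open>simp_all only: m\<close>)
qed

end

text \<open>
  The locale is used with the opposite algebra in the place of \<open>R\<close>: here \<open>N\<close> is a right module,
  and the free modules resolving its dual are left modules.
\<close>

locale dual_resolution = artin_dual U K E R
  for U :: "'u itself" and K :: "'k ring" (structure) and E :: "('k, 'e) module" and R :: "('k, 'r) module" +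
  fixes N :: "('r, 'n) module" and m :: "nat \<Rightarrow> nat" and \<Delta> :: "nat \<Rightarrow> (nat \<Rightarrow> 'r) \<Rightarrow> nat \<Rightarrow> 'r"
    and \<epsilon> :: "(nat \<Rightarrow> 'r) \<Rightarrow> 'n \<Rightarrow> 'e"
  assumes N: "left_module (op_ring R) N" and N_length: "finite_length K (orestr N)"
    and \<Delta>: "\<Delta> j \<in> mod_hom R (Fr (m (Suc j))) (Fr (m j))"
    and \<Delta>_exact: "\<Delta> (Suc j) ` carrier (Fr (m (Suc (Suc j)))) = {q \<in> carrier (Fr (m (Suc j))). \<Delta> j q = \<zero>\<^bsub>Fr (m j)\<^esub>}"
    and \<epsilon>: "\<epsilon> \<in> mod_hom R (Fr (m 0)) (dual_module K (op_ring R) E N)"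
      "\<epsilon> ` carrier (Fr (m 0)) = carrier (dual_module K (op_ring R) E N)"
    and \<epsilon>_exact: "\<Delta> 0 ` carrier (Fr (m 1)) = {q \<in> carrier (Fr (m 0)). \<epsilon> q = \<zero>\<^bsub>dual_module K (op_ring R) E N\<^esub>}"
begin

abbreviation "Q j \<equiv> Fr (m j)"
abbreviation "DN \<equiv> dual_module K (op_ring R) E N"
abbreviation "J j \<equiv> dual (Q j)"
definition d :: "nat \<Rightarrow> ((nat \<Rightarrow> 'r) \<Rightarrow> 'e) \<Rightarrow> (nat \<Rightarrow> 'r) \<Rightarrow> 'e" where "d j = dual_map (Q (Suc j)) (\<Delta> j)"
text \<open>The natural map from \<open>N\<close> to its double dual, followed by the dual of the
  cover \<open>\<epsilon>\<close> of D(N).\<close>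

definition \<eta> :: "'n \<Rightarrow> (nat \<Rightarrow> 'r) \<Rightarrow> 'e" where "\<eta> x = (\<lambda>q\<in>carrier (Q 0). \<epsilon> q x)"

lemma DN: "left_module R DN" and DN_length: "finite_length K (restr DN)"
  using artin_dual.left_module_dual[OF op N] artin_dual.finite_length_dual[OF op N N_length] by simp_all

lemma DN_apply: "\<phi> \<in> carrier DN \<Longrightarrow> x \<in> carrier N \<Longrightarrow> \<phi> x \<in> carrier E"
  "\<phi> \<in> carrier DN \<Longrightarrow> x \<in> carrier N \<Longrightarrow> y \<in> carrier N \<Longrightarrow> \<phi> (x \<oplus>\<^bsub>N\<^esub> y) = \<phi> x \<oplus>\<^bsub>E\<^esub> \<phi> y"
  by (fact artin_dual.dual_apply(1,2)[OF op])+

lemma d: "d j \<in> mod_hom (op_ring R) (J j) (J (Suc j))"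
  unfolding d_def by (rule dual_map_hom[OF left_module_Fr left_module_Fr \<Delta>])

lemma d_apply: "q \<in> carrier (Q (Suc j)) \<Longrightarrow> d j y q = y (\<Delta> j q)"
  unfolding d_def by (rule dual_map_apply)

lemma \<eta>_apply: "q \<in> carrier (Q 0) \<Longrightarrow> \<eta> x q = \<epsilon> q x"
  by (simp add: \<eta>_def)

lemma J_small: "carrier (J j) \<lesssim> (UNIV :: 'u set)"
  by (rule artin_dual.finite_length_small[OF op left_module_dual_Fr finite_length_dual[OF left_module_Fr finite_length_free]])

lemma J_eval_zero: "y \<in> carrier (J j) \<Longrightarrow> y \<zero>\<^bsub>Q j\<^esub> = \<zero>\<^bsub>E\<^esub>"
  using mod_hom_zero[OF left_module_restrict[OF left_module_Fr] E.left_module_axioms dual_carrierD(1)] by fastforce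

lemma \<eta>_closed:
  assumes x: "x \<in> carrier N"
  shows "\<eta> x \<in> carrier (J 0)"
  unfolding \<eta>_def
proof (rule restrict_in_dual[OF left_module_Fr], rule mod_homI)
  fix q assume q: "q \<in> carrier (restr (Q 0))"
  then show "\<epsilon> q x \<in> carrier E" using DN_apply(1)[OF mod_homD(1)[OF \<epsilon>(1)] x] by simp
next
  fix p q assume "p \<in> carrier (restr (Q 0))" "q \<in> carrier (restr (Q 0))"
  then have "p \<in> carrier (Q 0)" "q \<in> carrier (Q 0)" by (simp_all only: restrict_scalars_simps carrier_direct_power_restrict)
  from mod_homD(2)[OF \<epsilon>(1) this] show "\<epsilon> (p \<oplus>\<^bsub>restr (Q 0)\<^esub> q) x = \<epsilon> p x \<oplus>\<^bsub>E\<^esub> \<epsilon> q x"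
    using artin_dual.dual_simps(2)[OF op x] by simp
next
  fix a q assume a: "a \<in> carrier K" and "q \<in> carrier (restr (Q 0))"
  then have q: "q \<in> carrier (Q 0)" by (simp only: restrict_scalars_simps carrier_direct_power_restrict)
  have "\<epsilon> (a \<odot>\<^bsub>restr (Q 0)\<^esub> q) = a \<odot>\<^bsub>restr DN\<^esub> \<epsilon> q"
    using mod_homD(3)[OF mod_hom_restrict[OF \<epsilon>(1)] a] q by (simp only: restrict_scalars_simps carrier_direct_power_restrict)
  then show "\<epsilon> (a \<odot>\<^bsub>restr (Q 0)\<^esub> q) x = a \<odot>\<^bsub>E\<^esub> \<epsilon> q x"
    using artin_dual.restrict_dual_smult[OF op N a mod_homD(1)[OF \<epsilon>(1) q] x] by simp
qed

lemma \<eta>: "\<eta> \<in> mod_hom (op_ring R) N (J 0)"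
proof -
  interpret N: left_module "op_ring R" N by (rule N)
  interpret J0: left_module "op_ring R" "J 0" by (rule left_module_dual_Fr)
  interpret Q0: left_module R "Q 0" by (rule left_module_Fr)
  show ?thesis
  proof (rule mod_homI)
    fix x y assume xy: "x \<in> carrier N" "y \<in> carrier N"
    show "\<eta> (x \<oplus>\<^bsub>N\<^esub> y) = \<eta> x \<oplus>\<^bsub>J 0\<^esub> \<eta> y"
    proof (rule dual_ext[where M = "Q 0"])
      fix q assume q: "q \<in> carrier (Q 0)"
      show "\<eta> (x \<oplus>\<^bsub>N\<^esub> y) q = (\<eta> x \<oplus>\<^bsub>J 0\<^esub> \<eta> y) q"
        using DN_apply(2)[OF mod_homD(1)[OF \<epsilon>(1) q] xy] dual_simps(2)[OF q] \<eta>_apply[OF q] by simp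
    qed (intro \<eta>_closed N.M.a_closed J0.M.a_closed xy)+
  next
    fix r x assume r: "r \<in> carrier (op_ring R)" and x: "x \<in> carrier N"
    show "\<eta> (r \<odot>\<^bsub>N\<^esub> x) = r \<odot>\<^bsub>J 0\<^esub> \<eta> x"
    proof (rule dual_ext[where M = "Q 0"])
      fix q assume q: "q \<in> carrier (Q 0)"
      have rR: "r \<in> carrier R" using r by simp
      have "(r \<odot>\<^bsub>J 0\<^esub> \<eta> x) q = \<epsilon> (r \<odot>\<^bsub>Q 0\<^esub> q) x"
        using dual_simps(3)[OF q] \<eta>_apply[OF Q0.smult_closed[OF rR q]] by simp
      also have "\<dots> = \<epsilon> q (r \<odot>\<^bsub>N\<^esub> x)"
        using mod_homD(3)[OF \<epsilon>(1) rR q] artin_dual.dual_simps(3)[OF op x] by simp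
      finally show "\<eta> (r \<odot>\<^bsub>N\<^esub> x) q = (r \<odot>\<^bsub>J 0\<^esub> \<eta> x) q" using \<eta>_apply[OF q] by simp
    qed (intro \<eta>_closed N.smult_closed J0.smult_closed r x)+
  qed (rule \<eta>_closed)
qed

text \<open>Functionals separate the points of \<open>N\<close>, and each functional is a value of
  \<open>\<epsilon>\<close>.\<close>

lemma \<eta>_inj: "inj_on \<eta> (carrier N)"
proof (rule inj_onI)
  fix x y assume x: "x \<in> carrier N" and y: "y \<in> carrier N" and eq: "\<eta> x = \<eta> y"
  interpret N: left_module "op_ring R" N by (rule N)
  interpret KN: left_module K "orestr N" by (rule AO.left_module_restrict[OF N])
  show "x = y"
  proof (rule ccontr)
    assume "x \<noteq> y"
    then have "x \<ominus>\<^bsub>N\<^esub> y \<notin> {\<zero>\<^bsub>orestr N\<^esub>}" using N.diff_eq_zeroD x y by auto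
    moreover have "x \<ominus>\<^bsub>N\<^esub> y \<in> carrier N" using x y by simp
    ultimately obtain \<phi> where \<phi>: "\<phi> \<in> carrier DN" "\<phi> (x \<ominus>\<^bsub>N\<^esub> y) \<noteq> \<zero>\<^bsub>E\<^esub>"
      using artin_dual.dual_separates[OF op N N_length KN.submodule_zero] by metis
    obtain q where q: "q \<in> carrier (Q 0)" "\<phi> = \<epsilon> q" using \<epsilon>(2) \<phi>(1) by blast
    have "\<phi> x = \<phi> y" using eq \<eta>_apply[OF q(1)] q(2) by metis
    moreover have "\<phi> (x \<ominus>\<^bsub>N\<^esub> y) = \<phi> x \<ominus>\<^bsub>E\<^esub> \<phi> y"
      using mod_hom_diff[OF KN.left_module_axioms E.left_module_axioms artin_dual.dual_carrierD(1)[OF op \<phi>(1)]] x y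
      by (simp add: a_minus_def)
    ultimately show False using \<phi>(2) DN_apply(1)[OF \<phi>(1) y] E.diff_self by simp
  qed
qed

lemma \<Delta>_\<Delta>: "q \<in> carrier (Q (Suc (Suc j))) \<Longrightarrow> \<Delta> j (\<Delta> (Suc j) q) = \<zero>\<^bsub>Q j\<^esub>"
  using \<Delta>_exact[of j] by blast

text \<open>A cocycle kills the image of \<open>\<Delta> 0\<close>, which is the kernel of
  \<open>\<epsilon>\<close>, and so comes from a functional on D(N). By reflexivity that functional
  is the evaluation at an element of \<open>N\<close>.\<close>

lemma d_kernel_zero: "{y \<in> carrier (J 0). d 0 y = \<zero>\<^bsub>J 1\<^esub>} = \<eta> ` carrier N"
proof (intro equalityI subsetI)
  fix y assume "y \<in> {y \<in> carrier (J 0). d 0 y = \<zero>\<^bsub>J 1\<^esub>}"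
  then have y: "y \<in> carrier (J 0)" and dy: "d 0 y = \<zero>\<^bsub>J 1\<^esub>" by auto
  have ker: "y q = \<zero>\<^bsub>E\<^esub>" if "q \<in> carrier (restr (Q 0))" "\<epsilon> q = \<zero>\<^bsub>restr DN\<^esub>" for q
  proof -
    have "q \<in> \<Delta> 0 ` carrier (Q 1)" unfolding \<epsilon>_exact using that by simp
    then obtain p where p: "p \<in> carrier (Q (Suc 0))" "q = \<Delta> 0 p" by auto
    then have "y q = d 0 y p" using d_apply by metis
    then show ?thesis using dy dual_simps(1)[OF p(1)] by simp
  qed
  have small: "carrier (restr DN) \<lesssim> (UNIV :: 'u set)" using finite_length_small[OF DN DN_length] by simp
  obtain \<xi> where \<xi>: "\<xi> \<in> mod_hom K (restr DN) E" "\<And>q. q \<in> carrier (restr (Q 0)) \<Longrightarrow> \<xi> (\<epsilon> q) = y q"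
    using injective_factor[OF E_injective left_module_restrict[OF left_module_Fr] left_module_restrict[OF DN] small
        mod_hom_restrict[OF \<epsilon>(1)] dual_carrierD(1)[OF y] ker] by blast
  have \<xi>': "\<xi> \<in> mod_hom K (restrict_scalars (op_ring (op_ring R)) DN) E" using \<xi>(1) by simp
  obtain x where x: "x \<in> carrier N" "\<And>\<phi>. \<phi> \<in> carrier DN \<Longrightarrow> \<xi> \<phi> = \<phi> x"
    using artin_dual.double_dual[OF op N N_length \<xi>'] by blast
  have "\<eta> x = y"
  proof (rule dual_ext[where M = "Q 0"])
    fix q assume q: "q \<in> carrier (Q 0)"
    then show "\<eta> x q = y q"
      using \<eta>_apply[OF q] x(2)[OF mod_homD(1)[OF \<epsilon>(1) q]] \<xi>(2)[of q] by simp
  qed (intro \<eta>_closed x(1) y)+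
  then show "y \<in> \<eta> ` carrier N" using x(1) by blast
next
  fix y assume "y \<in> \<eta> ` carrier N"
  then obtain x where x: "x \<in> carrier N" "y = \<eta> x" by blast
  interpret J1: left_module "op_ring R" "J (Suc 0)" by (rule left_module_dual_Fr)
  have "d 0 (\<eta> x) = \<zero>\<^bsub>J (Suc 0)\<^esub>"
  proof (rule dual_ext[where M = "Q (Suc 0)"])
    fix q assume q: "q \<in> carrier (Q (Suc 0))"
    then have "\<Delta> 0 q \<in> {q \<in> carrier (Q 0). \<epsilon> q = \<zero>\<^bsub>DN\<^esub>}" unfolding \<epsilon>_exact[symmetric] by simp
    then show "d 0 (\<eta> x) q = \<zero>\<^bsub>J (Suc 0)\<^esub> q"
      using d_apply[OF q] \<eta>_apply dual_simps(1)[OF q] artin_dual.dual_simps(1)[OF op x(1)] by simp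
  qed (use mod_homD(1)[OF d \<eta>_closed[OF x(1)]] in \<open>auto intro: J1.M.zero_closed\<close>)
  then show "y \<in> {y \<in> carrier (J 0). d 0 y = \<zero>\<^bsub>J 1\<^esub>}" using x \<eta>_closed by simp
qed

text \<open>A cocycle kills the image of \<open>\<Delta> (Suc n)\<close>, which is the kernel of
  \<open>\<Delta> n\<close>. Injectivity of \<open>E\<close> factors it through
  \<open>\<Delta> n\<close>.\<close>

lemma d_exact: "{y \<in> carrier (J (Suc n)). d (Suc n) y = \<zero>\<^bsub>J (Suc (Suc n))\<^esub>} = d n ` carrier (J n)"
proof (intro equalityI subsetI)
  fix y assume "y \<in> {y \<in> carrier (J (Suc n)). d (Suc n) y = \<zero>\<^bsub>J (Suc (Suc n))\<^esub>}"
  then have y: "y \<in> carrier (J (Suc n))" and dy: "d (Suc n) y = \<zero>\<^bsub>J (Suc (Suc n))\<^esub>" by auto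
  have ker: "y q = \<zero>\<^bsub>E\<^esub>" if "q \<in> carrier (restr (Q (Suc n)))" "\<Delta> n q = \<zero>\<^bsub>restr (Q n)\<^esub>" for q
  proof -
    have "q \<in> \<Delta> (Suc n) ` carrier (Q (Suc (Suc n)))" unfolding \<Delta>_exact using that by simp
    then obtain p where p: "p \<in> carrier (Q (Suc (Suc n)))" "q = \<Delta> (Suc n) p" by auto
    then have "y q = d (Suc n) y p" using d_apply by metis
    then show ?thesis using dy dual_simps(1)[OF p(1)] by simp
  qed
  have small: "carrier (restr (Q n)) \<lesssim> (UNIV :: 'u set)"
    using finite_length_small[OF left_module_Fr finite_length_free] by simp
  obtain \<xi> where \<xi>: "\<xi> \<in> mod_hom K (restr (Q n)) E" "\<And>q. q \<in> carrier (restr (Q (Suc n))) \<Longrightarrow> \<xi> (\<Delta> n q) = y q"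
    using injective_factor[OF E_injective left_module_restrict[OF left_module_Fr] left_module_restrict[OF left_module_Fr]
        small mod_hom_restrict[OF \<Delta>] dual_carrierD(1)[OF y] ker] by blast
  note x = restrict_in_dual[OF left_module_Fr \<xi>(1)]
  have "d n (restrict \<xi> (carrier (Q n))) = y"
  proof (rule dual_ext[where M = "Q (Suc n)", OF mod_homD(1)[OF d x] y])
    fix q assume q: "q \<in> carrier (Q (Suc n))"
    then show "d n (restrict \<xi> (carrier (Q n))) q = y q"
      using d_apply[OF q] mod_homD(1)[OF \<Delta> q] \<xi>(2)[of q] by simp
  qed
  then show "y \<in> d n ` carrier (J n)" using x by blast
next
  fix y assume "y \<in> d n ` carrier (J n)"
  then obtain x where x: "x \<in> carrier (J n)" "y = d n x" by blast
  interpret J2: left_module "op_ring R" "J (Suc (Suc n))" by (rule left_module_dual_Fr)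
  have "d (Suc n) (d n x) = \<zero>\<^bsub>J (Suc (Suc n))\<^esub>"
  proof (rule dual_ext[where M = "Q (Suc (Suc n))", OF mod_homD(1)[OF d mod_homD(1)[OF d x(1)]] J2.M.zero_closed])
    fix q assume q: "q \<in> carrier (Q (Suc (Suc n)))"
    show "d (Suc n) (d n x) q = \<zero>\<^bsub>J (Suc (Suc n))\<^esub> q"
      using d_apply[OF q] d_apply[OF mod_homD(1)[OF \<Delta> q]] \<Delta>_\<Delta>[OF q] J_eval_zero[OF x(1)] dual_simps(1)[OF q] by simp
  qed
  then show "y \<in> {y \<in> carrier (J (Suc n)). d (Suc n) y = \<zero>\<^bsub>J (Suc (Suc n))\<^esub>}"
    using x mod_homD(1)[OF d x(1)] by simp
qed

lemma dual_coresolution: "inj_coresolution U (op_ring R) N J d \<eta>"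
  unfolding inj_coresolution_def
  by (intro conjI allI N dual_Fr_injective J_small d \<eta> \<eta>_inj d_kernel_zero d_exact)

end

section \<open>The alternative between a bounded endomorphism and an infinite chain\<close>

subsection \<open>Finite injective dimension or an infinite sequence of vectors\<close>

context dual_resolution
begin

text \<open>\<open>V j\<close> stands for Q_{j+1} (x) J^j, \<open>T j\<close> for Q_j (x) J^j, and
  \<open>\<delta> j\<close> for the map \<Delta> (x) 1 between them.\<close>

abbreviation "V j \<equiv> pw (m (Suc j)) (orestr (J j))"
abbreviation "T j \<equiv> pw (m j) (orestr (J j))"
abbreviation "\<delta> j \<equiv> matrix_map (m (Suc j)) (J j) (\<Delta> j)"

lemma J: "left_module (op_ring R) (J j)"
  by (rule left_module_dual_Fr)

lemma V: "left_module K (V j)" and T: "left_module K (T j)"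
  by (rule pw_module[OF J])+

lemma \<delta>: "\<delta> j \<in> mod_hom K (V j) (T j)"
  by (rule matrix_map_hom[OF J \<Delta>])

lemma dV: "(\<lambda>w b. d j (w b)) \<in> mod_hom K (V j) (T (Suc j))"
  and dT: "(\<lambda>w b. d j (w b)) \<in> mod_hom K (T j) (pw (m j) (orestr (J (Suc j))))"
  by (rule pw_map[OF J J d])+

lemma T_small: "carrier (T j) \<lesssim> (UNIV :: 'u set)"
  by (rule direct_power_lepoll[OF universe_infinite])
    (use J_small in \<open>auto simp: universe_infinite finite_lepoll_infinite subset_imp_lepoll\<close>)

lemma V_finite_length: "finite_length K (V j)"
  by (rule finite_length_direct_power[OF AO.left_module_restrict[OF J]
        finite_length_dual[OF left_module_Fr finite_length_free]])

text \<open>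
  \<open>chains r j\<close> is the set of those \<open>w\<close> that start a sequence \<open>w = w\<^sub>j, \<dots>, w\<^sub>j\<^sub>+\<^sub>r\<close> with
  \<open>(\<Delta> \<otimes> 1) w\<^sub>i\<^sub>+\<^sub>1 = (1 \<otimes> d) w\<^sub>i\<close>.
\<close>

primrec chains :: "nat \<Rightarrow> nat \<Rightarrow> (nat \<Rightarrow> (nat \<Rightarrow> 'r) \<Rightarrow> 'e) set" where
  "chains 0 j = carrier (V j)"
| "chains (Suc r) j = {w \<in> carrier (V j). (\<lambda>b. d j (w b)) \<in> \<delta> (Suc j) ` chains r (Suc j)}"

lemma chains_submodule: "submodule (chains r j) K (V j)"
proof (induction r arbitrary: j)
  case 0
  interpret V: left_module K "V j" by (rule V)
  show ?case unfolding chains.simps by (rule V.submodule_carrier)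
next
  case (Suc r)
  show ?case
    unfolding chains.simps by (rule submodule_preimage[OF V T dV submodule_image[OF V T \<delta> Suc]])
qed

lemma chains_decreasing: "chains (Suc r) j \<subseteq> chains r j"
proof (induction r arbitrary: j)
  case (Suc r)
  show ?case using Suc[of "Suc j"] by auto
qed auto

lemma chains_stable: "\<exists>s. \<forall>r\<ge>s. chains r j = chains s j"
  using fin_len_dcc[OF V V_finite_length, where X = "\<lambda>r. chains r j"] chains_submodule chains_decreasing
    submoduleD(1,3)[OF chains_submodule] by blast

lemma dual_cocycle_apply:
  assumes "y \<in> carrier (J j)" "d j y = \<zero>\<^bsub>J (Suc j)\<^esub>" "q \<in> carrier (Q (Suc j))"
  shows "y (\<Delta> j q) = \<zero>\<^bsub>E\<^esub>"
  using d_apply[OF assms(3), of y] assms(2) dual_simps(1)[OF assms(3)] by simp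

text \<open>Prolonging a functional on \<open>T j\<close> to the next place meets an obstruction on
  those elements of \<open>V j\<close> that 1 (x) d carries into the subspace where the next
  functional has to vanish. Unwound over the remaining steps, these elements are the chains of
  length n - j, so vanishing on their images is imposed from the outset. At place n all of
  \<open>V n\<close> counts, which permits continuation by zero.\<close>

lemma bounded_endomorphism:
  assumes zero: "\<And>w. w \<in> chains n 0 \<Longrightarrow> (\<lambda>b. d 0 (\<delta> 0 w b)) = (\<lambda>b. \<zero>\<^bsub>J 1\<^esub>) \<Longrightarrow> pairing (m 0) (\<delta> 0 w) = \<zero>\<^bsub>E\<^esub>"
  shows "inj_dim U (op_ring R) N < \<infinity>"
proof -
  interpret T: left_module K "T j" for j by (rule T)
  interpret V: left_module K "V j" for j by (rule V)
  interpret W: left_module K "pw (m 0) (orestr (J 1))" by (rule pw_module[OF J])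
  note C = chains_submodule
  have Cc: "u \<in> chains r j \<Longrightarrow> u \<in> carrier (V j)" for u r j using submoduleD(2)[OF C] .
  \<comment> \<open>The side condition is just what makes the next prolongation single-valued. As
    \<open>chains 0 n\<close> is the whole of \<open>V n\<close>, at place n it says that
    \<open>\<nu>\<close> vanishes on the image of \<open>\<delta> n\<close>.\<close>
  define ok where "ok j \<nu> \<longleftrightarrow> \<nu> \<in> mod_hom K (T j) E \<and> (\<forall>u\<in>chains (n - j) j. \<nu> (\<delta> j u) = \<zero>\<^bsub>E\<^esub>)" for j \<nu>
  \<comment> \<open>Two prescriptions at place 0: evaluation on cocycles, which makes the
    endomorphism the identity on \<open>N\<close>, and zero on the images of chains of length
    \<open>n\<close>. On their overlap they agree by the hypothesis \<open>zero\<close>.\<close>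
  define \<Gamma>0 where "\<Gamma>0 = {(z \<oplus>\<^bsub>T 0\<^esub> \<delta> 0 u, pairing (m 0) z) | z u.
      z \<in> {z \<in> carrier (T 0). (\<lambda>b. d 0 (z b)) = \<zero>\<^bsub>pw (m 0) (orestr (J 1))\<^esub>} \<and> u \<in> chains n 0}"
  have ker: "submodule {z \<in> carrier (T 0). (\<lambda>b. d 0 (z b)) = \<zero>\<^bsub>pw (m 0) (orestr (J 1))\<^esub>} K (T 0)" (is "submodule ?Z K _")
    using submodule_kernel[OF T W.left_module_axioms, of "\<lambda>w b. d 0 (w b)"] dT[of 0] by simp
  have \<Gamma>0I: "(z \<oplus>\<^bsub>T 0\<^esub> \<delta> 0 u, pairing (m 0) z) \<in> \<Gamma>0" if "z \<in> ?Z" "u \<in> chains n 0" for z u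
    unfolding \<Gamma>0_def using that by blast
  have pz: "pairing (m 0) \<zero>\<^bsub>T 0\<^esub> = \<zero>\<^bsub>E\<^esub>" by (rule mod_hom_zero[OF T E.left_module_axioms pairing_hom])
  obtain \<nu>0 where \<nu>0: "\<nu>0 \<in> mod_hom K (T 0) E" "\<And>x y. (x, y) \<in> \<Gamma>0 \<Longrightarrow> \<nu>0 x = y"
  proof (rule injective_extend_relation[OF E_injective T T_small, of \<Gamma>0])
    fix x y assume "(x, y) \<in> \<Gamma>0"
    then obtain z u where *: "z \<in> ?Z" "u \<in> chains n 0" "x = z \<oplus>\<^bsub>T 0\<^esub> \<delta> 0 u" "y = pairing (m 0) z"
      unfolding \<Gamma>0_def by blast
    then show "x \<in> carrier (T 0) \<and> y \<in> carrier E"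
      using mod_homD(1)[OF pairing_hom, of z "m 0"] T.M.a_closed[of z 0 "\<delta> 0 u"] mod_homD(1)[OF \<delta> Cc[OF *(2)]] by blast
  next
    have "\<zero>\<^bsub>T 0\<^esub> \<oplus>\<^bsub>T 0\<^esub> \<delta> 0 \<zero>\<^bsub>V 0\<^esub> = \<zero>\<^bsub>T 0\<^esub>"
      unfolding mod_hom_zero[OF V T \<delta>] using T.M.l_zero[OF T.M.zero_closed] .
    then show "(\<zero>\<^bsub>T 0\<^esub>, \<zero>\<^bsub>E\<^esub>) \<in> \<Gamma>0"
      using \<Gamma>0I[OF submoduleD(3)[OF ker] submoduleD(3)[OF C]] by (simp only: pz)
  next
    fix x y x' y' assume "(x, y) \<in> \<Gamma>0" "(x', y') \<in> \<Gamma>0"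
    then obtain z u z' u' where *: "z \<in> ?Z" "u \<in> chains n 0" "x = z \<oplus>\<^bsub>T 0\<^esub> \<delta> 0 u" "y = pairing (m 0) z"
      "z' \<in> ?Z" "u' \<in> chains n 0" "x' = z' \<oplus>\<^bsub>T 0\<^esub> \<delta> 0 u'" "y' = pairing (m 0) z'"
      unfolding \<Gamma>0_def by blast
    have c: "z \<in> carrier (T 0)" "z' \<in> carrier (T 0)" "\<delta> 0 u \<in> carrier (T 0)" "\<delta> 0 u' \<in> carrier (T 0)"
      using * mod_homD(1)[OF \<delta> Cc] by auto
    have "x \<oplus>\<^bsub>T 0\<^esub> x' = (z \<oplus>\<^bsub>T 0\<^esub> z') \<oplus>\<^bsub>T 0\<^esub> \<delta> 0 (u \<oplus>\<^bsub>V 0\<^esub> u')"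
      unfolding *(3,7) mod_homD(2)[OF \<delta> Cc[OF *(2)] Cc[OF *(6)]]
      using c by (simp only: T.M.a_ac T.M.a_closed)
    moreover have "y \<oplus>\<^bsub>E\<^esub> y' = pairing (m 0) (z \<oplus>\<^bsub>T 0\<^esub> z')"
      unfolding *(4,8) mod_homD(2)[OF pairing_hom c(1,2)] ..
    ultimately show "(x \<oplus>\<^bsub>T 0\<^esub> x', y \<oplus>\<^bsub>E\<^esub> y') \<in> \<Gamma>0"
      unfolding \<Gamma>0_def using submoduleD(4)[OF ker *(1,5)] submoduleD(4)[OF C *(2,6)] by blast
  next
    fix a x y assume a: "a \<in> carrier K" and "(x, y) \<in> \<Gamma>0"
    then obtain z u where *: "z \<in> ?Z" "u \<in> chains n 0" "x = z \<oplus>\<^bsub>T 0\<^esub> \<delta> 0 u" "y = pairing (m 0) z"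
      unfolding \<Gamma>0_def by blast
    have c: "z \<in> carrier (T 0)" "\<delta> 0 u \<in> carrier (T 0)" using * mod_homD(1)[OF \<delta> Cc] by auto
    have "a \<odot>\<^bsub>T 0\<^esub> x = a \<odot>\<^bsub>T 0\<^esub> z \<oplus>\<^bsub>T 0\<^esub> \<delta> 0 (a \<odot>\<^bsub>V 0\<^esub> u)"
      unfolding *(3) mod_homD(3)[OF \<delta> a Cc[OF *(2)]] by (rule T.smult_r_distr[OF a c])
    moreover have "a \<odot>\<^bsub>E\<^esub> y = pairing (m 0) (a \<odot>\<^bsub>T 0\<^esub> z)"
      unfolding *(4) mod_homD(3)[OF pairing_hom a c(1)] ..
    ultimately show "(a \<odot>\<^bsub>T 0\<^esub> x, a \<odot>\<^bsub>E\<^esub> y) \<in> \<Gamma>0"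
      unfolding \<Gamma>0_def using submoduleD(5)[OF ker a *(1)] submoduleD(5)[OF C a *(2)] by blast
  next
    fix y assume "(\<zero>\<^bsub>T 0\<^esub>, y) \<in> \<Gamma>0"
    then obtain z u where *: "z \<in> ?Z" "u \<in> chains n 0" "\<zero>\<^bsub>T 0\<^esub> = z \<oplus>\<^bsub>T 0\<^esub> \<delta> 0 u" "y = pairing (m 0) z"
      unfolding \<Gamma>0_def by blast
    have c: "z \<in> carrier (T 0)" "\<delta> 0 u \<in> carrier (T 0)" using * mod_homD(1)[OF \<delta> Cc] by auto
    define v where "v = \<ominus>\<^bsub>V 0\<^esub> u"
    have v: "v \<in> chains n 0" unfolding v_def by (rule submoduleD(6)[OF C *(2)])
    have "\<delta> 0 v = \<ominus>\<^bsub>T 0\<^esub> \<delta> 0 u" unfolding v_def by (rule mod_hom_minus[OF V T \<delta> Cc[OF *(2)]])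
    also have "\<dots> = z" by (rule T.M.minus_equality[OF *(3)[symmetric] c(2,1)])
    finally have z: "z = \<delta> 0 v" by simp
    then have "(\<lambda>b. d 0 (\<delta> 0 v b)) = (\<lambda>b. \<zero>\<^bsub>J 1\<^esub>)" using *(1) by simp
    then show "y = \<zero>\<^bsub>E\<^esub>" unfolding *(4) z by (rule zero[OF v])
  qed blast
  have "\<exists>\<nu>. \<forall>j. (ok j (\<nu> j) \<and> (j = 0 \<longrightarrow> \<nu> j = \<nu>0)) \<and> (\<forall>w\<in>carrier (V j). \<nu> (Suc j) (\<lambda>b. d j (w b)) = \<nu> j (\<delta> j w))"
  proof (rule dependent_nat_choice)
    have "\<nu>0 (\<delta> 0 u) = \<zero>\<^bsub>E\<^esub>" if u: "u \<in> chains n 0" for u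
    proof (rule \<nu>0(2))
      have "\<delta> 0 u \<in> carrier (T 0)" using mod_homD(1)[OF \<delta> Cc[OF u]] .
      then have "\<zero>\<^bsub>T 0\<^esub> \<oplus>\<^bsub>T 0\<^esub> \<delta> 0 u = \<delta> 0 u" by (rule T.M.l_zero)
      then show "(\<delta> 0 u, \<zero>\<^bsub>E\<^esub>) \<in> \<Gamma>0"
        using \<Gamma>0I[OF submoduleD(3)[OF ker] u] by (simp only: pz)
    qed
    then show "\<exists>\<nu>. ok 0 \<nu> \<and> (0 = 0 \<longrightarrow> \<nu> = \<nu>0)" using \<nu>0(1) unfolding ok_def by auto
  next
    fix \<nu> j assume "ok j \<nu> \<and> (j = 0 \<longrightarrow> \<nu> = \<nu>0)"
    then have \<nu>: "\<nu> \<in> mod_hom K (T j) E" and van: "\<And>u. u \<in> chains (n - j) j \<Longrightarrow> \<nu> (\<delta> j u) = \<zero>\<^bsub>E\<^esub>"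
      unfolding ok_def by auto
    let ?r = "n - Suc j" and ?d = "\<lambda>w b. d j (w b)" and ?\<delta> = "\<delta> (Suc j)"
    note \<nu>\<delta> = mod_hom_comp[OF \<delta> \<nu>]
    \<comment> \<open>The next functional is prescribed on the image of 1 (x) d by commutation and
      is zero on images of shorter chains. If d w + \<delta> u = 0, then \<open>w\<close> starts a
      chain one step longer than that of \<open>u\<close>, and there the old functional
      vanishes.\<close>
    define \<Gamma> where "\<Gamma> = {(?d w \<oplus>\<^bsub>T (Suc j)\<^esub> ?\<delta> u, \<nu> (\<delta> j w)) | w u. w \<in> carrier (V j) \<and> u \<in> chains ?r (Suc j)}"
    have dc: "?d w \<in> carrier (T (Suc j))" if "w \<in> carrier (V j)" for w by (rule mod_homD(1)[OF dV that])
    have \<delta>c: "?\<delta> u \<in> carrier (T (Suc j))" if "u \<in> chains ?r (Suc j)" for u by (rule mod_homD(1)[OF \<delta> Cc[OF that]])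
    have d0: "?d \<zero>\<^bsub>V j\<^esub> = \<zero>\<^bsub>T (Suc j)\<^esub>" by (rule mod_hom_zero[OF V T dV])
    have \<nu>z: "\<nu> (\<delta> j \<zero>\<^bsub>V j\<^esub>) = \<zero>\<^bsub>E\<^esub>" by (rule mod_hom_zero[OF V E.left_module_axioms \<nu>\<delta>])
    have \<delta>0: "?\<delta> \<zero>\<^bsub>V (Suc j)\<^esub> = \<zero>\<^bsub>T (Suc j)\<^esub>" by (rule mod_hom_zero[OF V T \<delta>])
    obtain \<mu> where \<mu>: "\<mu> \<in> mod_hom K (T (Suc j)) E" "\<And>x y. (x, y) \<in> \<Gamma> \<Longrightarrow> \<mu> x = y"
    proof (rule injective_extend_relation[OF E_injective T T_small, of \<Gamma> "Suc j"])
      fix x y assume "(x, y) \<in> \<Gamma>"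
      then obtain w u where *: "w \<in> carrier (V j)" "u \<in> chains ?r (Suc j)" "x = ?d w \<oplus>\<^bsub>T (Suc j)\<^esub> ?\<delta> u" "y = \<nu> (\<delta> j w)"
        unfolding \<Gamma>_def by blast
      show "x \<in> carrier (T (Suc j)) \<and> y \<in> carrier E"
        unfolding *(3,4) using T.M.a_closed[OF dc[OF *(1)] \<delta>c[OF *(2)]] mod_homD(1)[OF \<nu>\<delta> *(1)] ..
    next
      have "\<zero>\<^bsub>T (Suc j)\<^esub> = ?d \<zero>\<^bsub>V j\<^esub> \<oplus>\<^bsub>T (Suc j)\<^esub> ?\<delta> \<zero>\<^bsub>V (Suc j)\<^esub>"
        unfolding d0 \<delta>0 using T.M.l_zero[OF T.M.zero_closed, symmetric] .
      then show "(\<zero>\<^bsub>T (Suc j)\<^esub>, \<zero>\<^bsub>E\<^esub>) \<in> \<Gamma>"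
        unfolding \<Gamma>_def using \<nu>z[symmetric] V.M.zero_closed submoduleD(3)[OF C] by blast
    next
      fix x y x' y' assume "(x, y) \<in> \<Gamma>" "(x', y') \<in> \<Gamma>"
      then obtain w u w' u' where *: "w \<in> carrier (V j)" "u \<in> chains ?r (Suc j)" "x = ?d w \<oplus>\<^bsub>T (Suc j)\<^esub> ?\<delta> u" "y = \<nu> (\<delta> j w)"
        "w' \<in> carrier (V j)" "u' \<in> chains ?r (Suc j)" "x' = ?d w' \<oplus>\<^bsub>T (Suc j)\<^esub> ?\<delta> u'" "y' = \<nu> (\<delta> j w')"
        unfolding \<Gamma>_def by blast
      have "x \<oplus>\<^bsub>T (Suc j)\<^esub> x' = ?d (w \<oplus>\<^bsub>V j\<^esub> w') \<oplus>\<^bsub>T (Suc j)\<^esub> ?\<delta> (u \<oplus>\<^bsub>V (Suc j)\<^esub> u')"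
        unfolding *(3,7) mod_homD(2)[OF \<delta> Cc[OF *(2)] Cc[OF *(6)]] mod_homD(2)[OF dV *(1,5)]
        using dc[OF *(1)] dc[OF *(5)] \<delta>c[OF *(2)] \<delta>c[OF *(6)] by (simp only: T.M.a_ac T.M.a_closed)
      moreover have "y \<oplus>\<^bsub>E\<^esub> y' = \<nu> (\<delta> j (w \<oplus>\<^bsub>V j\<^esub> w'))"
        unfolding *(4,8) mod_homD(2)[OF \<nu>\<delta> *(1,5)] ..
      ultimately show "(x \<oplus>\<^bsub>T (Suc j)\<^esub> x', y \<oplus>\<^bsub>E\<^esub> y') \<in> \<Gamma>"
        unfolding \<Gamma>_def using V.M.a_closed[OF *(1,5)] submoduleD(4)[OF C *(2,6)] by blast
    next
      fix a x y assume a: "a \<in> carrier K" and "(x, y) \<in> \<Gamma>"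
      then obtain w u where *: "w \<in> carrier (V j)" "u \<in> chains ?r (Suc j)" "x = ?d w \<oplus>\<^bsub>T (Suc j)\<^esub> ?\<delta> u" "y = \<nu> (\<delta> j w)"
        unfolding \<Gamma>_def by blast
      have "a \<odot>\<^bsub>T (Suc j)\<^esub> x = ?d (a \<odot>\<^bsub>V j\<^esub> w) \<oplus>\<^bsub>T (Suc j)\<^esub> ?\<delta> (a \<odot>\<^bsub>V (Suc j)\<^esub> u)"
        unfolding *(3) mod_homD(3)[OF \<delta> a Cc[OF *(2)]] mod_homD(3)[OF dV a *(1)]
        by (rule T.smult_r_distr[OF a dc[OF *(1)] \<delta>c[OF *(2)]])
      moreover have "a \<odot>\<^bsub>E\<^esub> y = \<nu> (\<delta> j (a \<odot>\<^bsub>V j\<^esub> w))"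
        unfolding *(4) mod_homD(3)[OF \<nu>\<delta> a *(1)] ..
      ultimately show "(a \<odot>\<^bsub>T (Suc j)\<^esub> x, a \<odot>\<^bsub>E\<^esub> y) \<in> \<Gamma>"
        unfolding \<Gamma>_def using V.smult_closed[OF a *(1)] submoduleD(5)[OF C a *(2)] by blast
    next
      fix y assume "(\<zero>\<^bsub>T (Suc j)\<^esub>, y) \<in> \<Gamma>"
      then obtain w u where *: "w \<in> carrier (V j)" "u \<in> chains ?r (Suc j)"
        "\<zero>\<^bsub>T (Suc j)\<^esub> = ?d w \<oplus>\<^bsub>T (Suc j)\<^esub> ?\<delta> u" "y = \<nu> (\<delta> j w)"
        unfolding \<Gamma>_def by blast
      have "?\<delta> (\<ominus>\<^bsub>V (Suc j)\<^esub> u) = \<ominus>\<^bsub>T (Suc j)\<^esub> ?\<delta> u" by (rule mod_hom_minus[OF V T \<delta> Cc[OF *(2)]])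
      also have "\<dots> = ?d w" by (rule T.M.minus_equality[OF *(3)[symmetric] \<delta>c[OF *(2)] dc[OF *(1)]])
      finally have "?d w \<in> ?\<delta> ` chains ?r (Suc j)"
        using submoduleD(6)[OF C *(2)] by (metis image_eqI)
      then have "w \<in> chains (Suc ?r) j" using *(1) by simp
      \<comment> \<open>For \<open>j < n\<close> the lengths match exactly; from
        \<open>j = n\<close> on the truncated difference is 0 and \<open>chains 0 j\<close> is all
        of \<open>V j\<close>.\<close>
      then have "w \<in> chains (n - j) j" using *(1) by (cases "j < n") (simp_all add: Suc_diff_Suc del: chains.simps(2))
      then show "y = \<zero>\<^bsub>E\<^esub>" unfolding *(4) by (rule van)
    qed blast
    have "\<mu> (?d w) = \<nu> (\<delta> j w)" if w: "w \<in> carrier (V j)" for w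
    proof (rule \<mu>(2))
      have "?d w = ?d w \<oplus>\<^bsub>T (Suc j)\<^esub> ?\<delta> \<zero>\<^bsub>V (Suc j)\<^esub>"
        unfolding \<delta>0 using T.M.r_zero[OF dc[OF w], symmetric] .
      then show "(?d w, \<nu> (\<delta> j w)) \<in> \<Gamma>" unfolding \<Gamma>_def using w submoduleD(3)[OF C] by blast
    qed
    moreover have "\<mu> (?\<delta> u) = \<zero>\<^bsub>E\<^esub>" if u: "u \<in> chains ?r (Suc j)" for u
    proof (rule \<mu>(2))
      have "?\<delta> u = ?d \<zero>\<^bsub>V j\<^esub> \<oplus>\<^bsub>T (Suc j)\<^esub> ?\<delta> u"
        unfolding d0 using T.M.l_zero[OF \<delta>c[OF u], symmetric] .
      then show "(?\<delta> u, \<zero>\<^bsub>E\<^esub>) \<in> \<Gamma>" unfolding \<Gamma>_def using u V.M.zero_closed \<nu>z[symmetric] by blast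
    qed
    ultimately show "\<exists>\<mu>. (ok (Suc j) \<mu> \<and> (Suc j = 0 \<longrightarrow> \<mu> = \<nu>0)) \<and> (\<forall>w\<in>carrier (V j). \<mu> (?d w) = \<nu> (\<delta> j w))"
      using \<mu>(1) unfolding ok_def by (intro exI[of _ \<mu>]) simp
  qed
  then obtain \<nu> where \<nu>: "\<And>j. ok j (\<nu> j)" "\<nu> 0 = \<nu>0"
    "\<And>j w. w \<in> carrier (V j) \<Longrightarrow> \<nu> (Suc j) (\<lambda>b. d j (w b)) = \<nu> j (\<delta> j w)" by blast
  have \<nu>_hom: "\<nu> j \<in> mod_hom K (T j) E" for j using \<nu>(1) unfolding ok_def by blast
  have \<nu>_n: "\<nu> n (\<delta> n w) = \<zero>\<^bsub>E\<^esub>" if "w \<in> carrier (V n)" for w using \<nu>(1)[of n] that unfolding ok_def by simp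
  \<comment> \<open>By adjunction each functional on Q_j (x) J^j is an endomorphism of J^j. Zero
    above degree \<open>n\<close> is compatible because \<open>\<nu> n\<close> vanishes on the image
    of \<open>\<delta> n\<close>.\<close>
  define h where "h j = (if j \<le> n then hat (m j) (J j) (\<nu> j) else (\<lambda>y. \<zero>\<^bsub>J j\<^esub>))" for j
  have h: "h j \<in> mod_hom (op_ring R) (J j) (J j)" for j
    unfolding h_def using hat_hom[OF J \<nu>_hom] mod_hom_const_zero[OF J] by (cases "j \<le> n") auto
  have sv: "scaled_vector (J j) q y \<in> carrier (V j)" if "q \<in> carrier (Q (Suc j))" "y \<in> carrier (J j)" for j q y
    using scaled_vector_closed[OF J that] by simp
  \<comment> \<open>Under the adjunction, applying \<open>d\<close> after the endomorphism
    corresponds to composing the functional with \<open>\<delta> j\<close>, and applying it before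
    corresponds to 1 (x) d. The recursion for \<open>\<nu>\<close> thus becomes commutation with
    \<open>d\<close>.\<close>
  have key: "d j (hat (m j) (J j) (\<nu> j) y) q = \<nu> j (\<delta> j (scaled_vector (J j) q y))"
    if q: "q \<in> carrier (Q (Suc j))" and y: "y \<in> carrier (J j)" for j q y
    using d_apply[OF q] hat_apply[OF mod_homD(1)[OF \<Delta> q]] matrix_map_scaled_vector[OF J \<Delta> q y] by simp
  have comm: "h (Suc j) (d j y) = d j (h j y)" if y: "y \<in> carrier (J j)" for j y
  proof (rule dual_ext[where M = "Q (Suc j)", OF mod_homD(1)[OF h mod_homD(1)[OF d y]] mod_homD(1)[OF d mod_homD(1)[OF h y]]])
    fix q assume q: "q \<in> carrier (Q (Suc j))"
    consider "j < n" | "j = n" | "j > n" by linarith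
    then show "h (Suc j) (d j y) q = d j (h j y) q"
    proof cases
      case 1
      have "hat (m (Suc j)) (J (Suc j)) (\<nu> (Suc j)) (d j y) q = \<nu> (Suc j) (\<lambda>b. d j (scaled_vector (J j) q y b))"
        using hat_apply[OF q] scaled_vector_map[OF d q y] by simp
      then show ?thesis using 1 key[OF q y] \<nu>(3)[OF sv[OF q y]] unfolding h_def by simp
    next
      case 2
      then show ?thesis using key[OF q y] \<nu>_n sv[OF q y] dual_simps(1)[OF q] unfolding h_def by simp
    next
      case 3
      then show ?thesis unfolding h_def using mod_hom_zero[OF J J d] by simp
    qed
  qed
  have h\<eta>: "h 0 (\<eta> x) = \<eta> x" if x: "x \<in> carrier N" for x
  proof (rule dual_ext[where M = "Q 0", OF mod_homD(1)[OF h \<eta>_closed[OF x]] \<eta>_closed[OF x]])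
    fix q assume q: "q \<in> carrier (Q 0)"
    let ?z = "scaled_vector (J 0) q (\<eta> x)"
    have z: "?z \<in> carrier (T 0)" using scaled_vector_closed[OF J q \<eta>_closed[OF x]] by simp
    have "(\<lambda>b. d 0 (?z b)) = scaled_vector (J (Suc 0)) q (d 0 (\<eta> x))" by (rule scaled_vector_map[OF d q \<eta>_closed[OF x]])
    also have "d 0 (\<eta> x) = \<zero>\<^bsub>J (Suc 0)\<^esub>" using inj_coresolution_d\<eta>[OF dual_coresolution x] by simp
    also have "scaled_vector (J (Suc 0)) q \<zero>\<^bsub>J (Suc 0)\<^esub> = (\<lambda>b. \<zero>\<^bsub>J (Suc 0)\<^esub>)"
      unfolding scaled_vector_def using left_module.smult_r_null[OF J] Fr_component(1)[OF q] by simp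
    finally have "(\<lambda>b. d 0 (?z b)) = \<zero>\<^bsub>pw (m 0) (orestr (J 1))\<^esub>" by simp
    then have zZ: "?z \<in> ?Z" using z by blast
    have "?z \<oplus>\<^bsub>T 0\<^esub> \<delta> 0 \<zero>\<^bsub>V 0\<^esub> = ?z"
      unfolding mod_hom_zero[OF V T \<delta>] by (rule T.M.r_zero[OF z])
    then have "(?z, pairing (m 0) ?z) \<in> \<Gamma>0" using \<Gamma>0I[OF zZ submoduleD(3)[OF C]] by (simp only:)
    then have "\<nu> 0 ?z = pairing (m 0) ?z" unfolding \<nu>(2) by (rule \<nu>0(2))
    then show "h 0 (\<eta> x) q = \<eta> x q"
      unfolding h_def using hat_apply[OF q, of "J 0" "\<nu> 0" "\<eta> x"] pairing_scaled_vector[OF q \<eta>_closed[OF x]] by simp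
  qed
  show ?thesis
  proof (rule inj_dim_finiteI[OF dual_coresolution, of h n])
    show "h (Suc n) y = \<zero>\<^bsub>J (Suc n)\<^esub>" for y unfolding h_def by simp
  qed (fact h comm h\<eta>)+
qed

text \<open>Finite chains of every length need not fit together. Inside the stationary values of
  \<open>chains\<close> each element has a successor that is stationary again, so the choice can go
  on forever.\<close>

lemma infinite_chain:
  assumes "\<not> inj_dim U (op_ring R) N < \<infinity>"
  obtains w where "\<And>j. w j \<in> carrier (V j)" "\<And>j. (\<lambda>b. d j (w j b)) = \<delta> (Suc j) (w (Suc j))"
    "(\<lambda>b. d 0 (\<delta> 0 (w 0) b)) = (\<lambda>b. \<zero>\<^bsub>J 1\<^esub>)" "pairing (m 0) (\<delta> 0 (w 0)) \<noteq> \<zero>\<^bsub>E\<^esub>"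
proof -
  have "\<forall>j. \<exists>s. \<forall>r\<ge>s. chains r j = chains s j" using chains_stable by blast
  then obtain s where s: "\<And>j r. r \<ge> s j \<Longrightarrow> chains r j = chains (s j) j" by metis
  obtain w0 where w0: "w0 \<in> chains (s 0) 0" "(\<lambda>b. d 0 (\<delta> 0 w0 b)) = (\<lambda>b. \<zero>\<^bsub>J 1\<^esub>)"
    "pairing (m 0) (\<delta> 0 w0) \<noteq> \<zero>\<^bsub>E\<^esub>"
    using bounded_endomorphism[of "s 0"] assms by blast
  have "\<exists>w. \<forall>j. (w j \<in> chains (s j) j \<and> (j = 0 \<longrightarrow> w j = w0)) \<and> (\<lambda>b. d j (w j b)) = \<delta> (Suc j) (w (Suc j))"
  proof (rule dependent_nat_choice)
    show "\<exists>w. w \<in> chains (s 0) 0 \<and> (0 = 0 \<longrightarrow> w = w0)" using w0(1) by blast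
  next
    fix w j assume "w \<in> chains (s j) j \<and> (j = 0 \<longrightarrow> w = w0)"
    then have w: "w \<in> chains (s j) j" by blast
    \<comment> \<open>A stationary element starts chains of every length. Asking for one whose
      remainder has length at least \<open>s (Suc j)\<close> puts the successor into the stationary
      set of the next place.\<close>
    have "chains (Suc (max (s j) (s (Suc j)))) j = chains (s j) j" by (rule s) simp
    then have "(\<lambda>b. d j (w b)) \<in> \<delta> (Suc j) ` chains (max (s j) (s (Suc j))) (Suc j)" using w by auto
    also have "chains (max (s j) (s (Suc j))) (Suc j) = chains (s (Suc j)) (Suc j)" by (rule s) simp
    finally show "\<exists>w'. (w' \<in> chains (s (Suc j)) (Suc j) \<and> (Suc j = 0 \<longrightarrow> w' = w0)) \<and> (\<lambda>b. d j (w b)) = \<delta> (Suc j) w'"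
      by blast
  qed
  then obtain w where "\<And>j. w j \<in> chains (s j) j" "w 0 = w0" "\<And>j. (\<lambda>b. d j (w j b)) = \<delta> (Suc j) (w (Suc j))" by blast
  then show ?thesis using that[of w] w0(2,3) submoduleD(2)[OF chains_submodule] by blast
qed

end

section \<open>Detecting a nonzero stable class by functionals\<close>

subsection \<open>Nontrivial stable homology\<close>

context artin_dual
begin

text \<open>Only an additive target is involved, since two kinds occur: tensor products of the terms
  of the given resolutions, and \<open>E\<close> itself.\<close>

definition balanced ::
  "nat \<Rightarrow> ('r, 'b) module \<Rightarrow> ('a, 'c) ring_scheme \<Rightarrow> ((nat \<Rightarrow> 'r) \<Rightarrow> 'b \<Rightarrow> 'a) \<Rightarrow> bool" where
  "balanced m B A \<beta> \<longleftrightarrow>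
    (\<forall>q\<in>carrier (Fr m). \<forall>y\<in>carrier B. \<beta> q y \<in> carrier A) \<and>
    (\<forall>q\<in>carrier (Fr m). \<forall>q'\<in>carrier (Fr m). \<forall>y\<in>carrier B. \<beta> (q \<oplus>\<^bsub>Fr m\<^esub> q') y = \<beta> q y \<oplus>\<^bsub>A\<^esub> \<beta> q' y) \<and>
    (\<forall>q\<in>carrier (Fr m). \<forall>y\<in>carrier B. \<forall>y'\<in>carrier B. \<beta> q (y \<oplus>\<^bsub>B\<^esub> y') = \<beta> q y \<oplus>\<^bsub>A\<^esub> \<beta> q y') \<and>
    (\<forall>r\<in>carrier R. \<forall>q\<in>carrier (Fr m). \<forall>y\<in>carrier B. \<beta> (r \<odot>\<^bsub>Fr m\<^esub> q) y = \<beta> q (r \<odot>\<^bsub>B\<^esub> y))"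

lemma balancedD:
  assumes "balanced m B A \<beta>"
  shows "q \<in> carrier (Fr m) \<Longrightarrow> y \<in> carrier B \<Longrightarrow> \<beta> q y \<in> carrier A"
    "q \<in> carrier (Fr m) \<Longrightarrow> q' \<in> carrier (Fr m) \<Longrightarrow> y \<in> carrier B \<Longrightarrow> \<beta> (q \<oplus>\<^bsub>Fr m\<^esub> q') y = \<beta> q y \<oplus>\<^bsub>A\<^esub> \<beta> q' y"
    "q \<in> carrier (Fr m) \<Longrightarrow> y \<in> carrier B \<Longrightarrow> y' \<in> carrier B \<Longrightarrow> \<beta> q (y \<oplus>\<^bsub>B\<^esub> y') = \<beta> q y \<oplus>\<^bsub>A\<^esub> \<beta> q y'"
    "r \<in> carrier R \<Longrightarrow> q \<in> carrier (Fr m) \<Longrightarrow> y \<in> carrier B \<Longrightarrow> \<beta> (r \<odot>\<^bsub>Fr m\<^esub> q) y = \<beta> q (r \<odot>\<^bsub>B\<^esub> y)"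
  using assms unfolding balanced_def by blast+

lemma balanced_dual:
  assumes h: "h \<in> mod_hom (op_ring R) B (dual (Fr m))"
  shows "balanced m B E (\<lambda>q y. h y q)"
  unfolding balanced_def
proof (intro conjI ballI)
  fix q y assume q: "q \<in> carrier (Fr m)" and y: "y \<in> carrier B"
  show "h y q \<in> carrier E" by (rule dual_apply(1)[OF mod_homD(1)[OF h y] q])
  { fix q' assume "q' \<in> carrier (Fr m)"
    then show "h y (q \<oplus>\<^bsub>Fr m\<^esub> q') = h y q \<oplus>\<^bsub>E\<^esub> h y q'" by (rule dual_apply(2)[OF mod_homD(1)[OF h y] q]) }
  { fix y' assume "y' \<in> carrier B"
    then show "h (y \<oplus>\<^bsub>B\<^esub> y') q = h y q \<oplus>\<^bsub>E\<^esub> h y' q"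
      using mod_homD(2)[OF h y] dual_simps(2)[OF q] by simp }
next
  fix r q y assume r: "r \<in> carrier R" and q: "q \<in> carrier (Fr m)" and y: "y \<in> carrier B"
  show "h y (r \<odot>\<^bsub>Fr m\<^esub> q) = h (r \<odot>\<^bsub>B\<^esub> y) q"
    using mod_homD(3)[OF h _ y, of r] r dual_simps(3)[OF q] by simp
qed

text \<open>The homomorphism that a balanced map induces on \<open>B\<^sup>m\<close>, regarded as \<open>R\<^sup>m \<otimes> B\<close>.\<close>

definition pw_sum where
  "pw_sum A \<beta> m w = (\<Oplus>\<^bsub>A\<^esub>b\<in>{..<m::nat}. \<beta> (unit_vector R b) (w b))"

lemma pw_sum_hom:
  assumes A: "abelian_group A" and \<beta>: "balanced m B A \<beta>"
  shows "pw_sum A \<beta> m \<in> add_hom (pw m (orestr B)) A"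
proof -
  interpret A: abelian_group A by fact
  note \<beta>D = balancedD[OF \<beta>]
  have cl: "\<beta> (unit_vector R b) (w b) \<in> carrier A" if "w \<in> carrier (pw m (orestr B))" "b \<in> {..<m}" for w b
    using \<beta>D(1)[OF unit_vector_Fr] direct_power_carrierD(1)[OF that(1)] that(2) by simp
  show ?thesis
  proof (rule add_homI)
    fix w assume "w \<in> carrier (pw m (orestr B))"
    then show "pw_sum A \<beta> m w \<in> carrier A"
      unfolding pw_sum_def using cl by (intro A.finsum_closed) auto
  next
    fix v w assume v: "v \<in> carrier (pw m (orestr B))" and w: "w \<in> carrier (pw m (orestr B))"
    have "pw_sum A \<beta> m (v \<oplus>\<^bsub>pw m (orestr B)\<^esub> w)
        = (\<Oplus>\<^bsub>A\<^esub>b\<in>{..<m}. \<beta> (unit_vector R b) (v b) \<oplus>\<^bsub>A\<^esub> \<beta> (unit_vector R b) (w b))"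
      unfolding pw_sum_def
      using \<beta>D(3)[OF unit_vector_Fr] direct_power_carrierD(1)[OF v] direct_power_carrierD(1)[OF w] cl[OF v] cl[OF w]
      by (intro A.finsum_cong') auto
    also have "\<dots> = pw_sum A \<beta> m v \<oplus>\<^bsub>A\<^esub> pw_sum A \<beta> m w"
      unfolding pw_sum_def using cl[OF v] cl[OF w] by (intro A.finsum_addf) auto
    finally show "pw_sum A \<beta> m (v \<oplus>\<^bsub>pw m (orestr B)\<^esub> w) = pw_sum A \<beta> m v \<oplus>\<^bsub>A\<^esub> pw_sum A \<beta> m w" .
  qed
qed

lemma pw_sum_scaled_vector:
  assumes A: "abelian_group A" and \<beta>: "balanced m B A \<beta>" and q: "q \<in> carrier (Fr m)" and y: "y \<in> carrier B"
  shows "pw_sum A \<beta> m (scaled_vector B q y) = \<beta> q y"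
proof -
  interpret A: abelian_group A by fact
  interpret F: left_module R "Fr m" by (rule left_module_Fr)
  note \<beta>D = balancedD[OF \<beta>]
  have qR: "q a \<in> carrier R" for a using Fr_component(1)[OF q] .
  have t: "q a \<odot>\<^bsub>Fr m\<^esub> unit_vector R a \<in> carrier (Fr m)" if "a \<in> {..<m}" for a
    using unit_vector_Fr[of a m] that qR F.smult_closed by blast
  have hom: "(\<lambda>q. \<beta> q y) \<in> add_hom (Fr m) A"
    by (rule add_homI) (fact \<beta>D(1)[OF _ y], fact \<beta>D(2)[OF _ _ y])
  have "q = (\<Oplus>\<^bsub>Fr m\<^esub>a\<in>{..<m}. q a \<odot>\<^bsub>Fr m\<^esub> unit_vector R a)"
    by (rule Fr_expand[OF q left_module_Fr mod_hom_id])
  then have "\<beta> q y = \<beta> (\<Oplus>\<^bsub>Fr m\<^esub>a\<in>{..<m}. q a \<odot>\<^bsub>Fr m\<^esub> unit_vector R a) y" by simp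
  also have "\<dots> = (\<Oplus>\<^bsub>A\<^esub>a\<in>{..<m}. \<beta> (q a \<odot>\<^bsub>Fr m\<^esub> unit_vector R a) y)"
    by (rule add_hom_finsum[OF F.M.abelian_group_axioms A hom]) (use t in auto)
  also have "\<dots> = pw_sum A \<beta> m (scaled_vector B q y)"
    unfolding pw_sum_def scaled_vector_def
    using \<beta>D(4)[OF qR unit_vector_Fr y] \<beta>D(1)[OF t y] by (intro A.finsum_cong') auto
  finally show ?thesis by simp
qed

lemma pw_add_hom_ext:
  assumes A: "abelian_group A" and B: "left_module (op_ring R) B"
    and \<mu>: "\<mu> \<in> add_hom (pw m (orestr B)) A" and \<nu>: "\<nu> \<in> add_hom (pw m (orestr B)) A"
    and eq: "\<And>q y. q \<in> carrier (Fr m) \<Longrightarrow> y \<in> carrier B \<Longrightarrow> \<mu> (scaled_vector B q y) = \<nu> (scaled_vector B q y)"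
    and w: "w \<in> carrier (pw m (orestr B))"
  shows "\<mu> w = \<nu> w"
proof -
  interpret A: abelian_group A by fact
  interpret P: left_module K "pw m (orestr B)" by (rule pw_module[OF B])
  let ?t = "\<lambda>b. scaled_vector B (unit_vector R b) (w b)"
  have wB: "w b \<in> carrier B" for b using direct_power_carrierD(1)[OF w] by simp
  have t: "?t \<in> {..<m} \<rightarrow> carrier (pw m (orestr B))"
    using scaled_vector_closed[OF B unit_vector_Fr wB] by auto
  have "w \<in> carrier (pw m B)" using w by simp
  from pw_generated[OF B this]
  have "\<chi> w = finsum A (\<lambda>b. \<chi> (?t b)) {..<m}" if "\<chi> \<in> add_hom (pw m (orestr B)) A" for \<chi>
    using add_hom_finsum[OF P.M.abelian_group_axioms A that _ t] by simp
  moreover have "finsum A (\<lambda>b. \<mu> (?t b)) {..<m} = finsum A (\<lambda>b. \<nu> (?t b)) {..<m}"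
    using eq[OF unit_vector_Fr wB] add_homD(1)[OF \<nu>] t by (intro A.finsum_cong') auto
  ultimately show ?thesis using \<mu> \<nu> by simp
qed

end

context dual_resolution
begin

text \<open>A cocycle kills the image of \<open>\<Delta> k\<close>, that is, the kernel of
  \<open>e\<close>, and hence factors through \<open>e\<close>. This absorbs the failure of
  composites of comparison maps to be the identity: they are the identity only after
  \<open>e\<close>.\<close>

lemma cocycle_comparison:
  assumes e: "e \<in> mod_hom R (Q k) M" and M: "left_module R M"
    and ker: "\<Delta> k ` carrier (Q (Suc k)) = {q \<in> carrier (Q k). e q = \<zero>\<^bsub>M\<^esub>}"
    and y: "y \<in> carrier (J k)" "d k y = \<zero>\<^bsub>J (Suc k)\<^esub>"
    and p: "p \<in> carrier (Q k)" and q: "q \<in> carrier (Q k)" and eq: "e p = e q"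
  shows "y p = y q"
proof -
  interpret Q: left_module R "Q k" by (rule left_module_Fr)
  interpret M: left_module R M by (rule M)
  have "e (p \<ominus>\<^bsub>Q k\<^esub> q) = \<zero>\<^bsub>M\<^esub>"
    using mod_hom_diff[OF left_module_Fr M e p q] eq M.diff_self[OF mod_homD(1)[OF e q]] by simp
  then have "p \<ominus>\<^bsub>Q k\<^esub> q \<in> \<Delta> k ` carrier (Q (Suc k))" unfolding ker using Q.M.minus_closed[OF p q] by simp
  then have z: "y (p \<ominus>\<^bsub>Q k\<^esub> q) = \<zero>\<^bsub>E\<^esub>" using dual_cocycle_apply[OF y] by auto
  have "y p = y ((p \<ominus>\<^bsub>Q k\<^esub> q) \<oplus>\<^bsub>Q k\<^esub> q)" using Q.diff_add_cancel[OF p q] by (simp only:)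
  also have "\<dots> = y q"
    using dual_apply(2)[OF y(1) Q.M.minus_closed[OF p q] q] z dual_apply(1)[OF y(1) q] by (simp del: direct_power_simps)
  finally show ?thesis .
qed

lemma stable_tensor_nontrivial:
  assumes inf: "\<not> inj_dim U (op_ring R) N < \<infinity>"
    and M: "left_module R M" and e: "e \<in> mod_hom R (Q k) M" "e ` carrier (Q k) = carrier M"
    and ker: "\<Delta> k ` carrier (Q (Suc k)) = {q \<in> carrier (Q k). e q = \<zero>\<^bsub>M\<^esub>}"
    and P: "projective_resolution U R M P \<epsilon>P" and I: "injective_resolution U (op_ring R) N I \<eta>I"
  shows "\<not> trivial_module (homology_module (stable_tensor (op_ring R) P I) (- int k + 1))"
proof
  assume triv: "trivial_module (homology_module (stable_tensor (op_ring R) P I) (- int k + 1))"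
  interpret TC: two_complexes "op_ring R" P I
    using P I by unfold_locales (simp_all add: projective_resolution_def injective_resolution_def)
  have EA: "abelian_group E" by (rule left_module.axioms(2)[OF E.left_module_axioms])
  \<comment> \<open>Cut off below degree \<open>k\<close>, the free resolution resolves
    \<open>M\<close>, with \<open>e\<close> as augmentation. From here on the free side is shifted
    by \<open>k\<close>.\<close>
  have QF: "proj_resolution_seq U R M (\<lambda>i. Q (i + k)) (\<lambda>i. \<Delta> (i + k)) e"
    unfolding proj_resolution_seq_def
    using M e ker \<Delta> \<Delta>_exact
    by (simp add: R.free_module_projective finite_length_small[OF left_module_Fr finite_length_free]
        del: direct_power_simps)
  note PF = projective_resolution_seq[OF M P]
  obtain f where f: "\<And>i. f i \<in> mod_hom R (Q (i + k)) (cobj P (int i))"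
    "\<And>i q. q \<in> carrier (Q (Suc i + k)) \<Longrightarrow> cdiff P (int (Suc i)) (f (Suc i) q) = f i (\<Delta> (i + k) q)"
    "\<And>q. q \<in> carrier (Q (0 + k)) \<Longrightarrow> \<epsilon>P (f 0 q) = e q"
    using projective_comparison[OF QF PF] by blast
  obtain g where g: "\<And>i. g i \<in> mod_hom R (cobj P (int i)) (Q (i + k))"
    "\<And>i p. p \<in> carrier (cobj P (int (Suc i))) \<Longrightarrow> \<Delta> (i + k) (g (Suc i) p) = g i (cdiff P (int (Suc i)) p)"
    "\<And>p. p \<in> carrier (cobj P (int 0)) \<Longrightarrow> e (g 0 p) = \<epsilon>P p"
    using projective_comparison[OF PF QF] by blast
  note IC = injective_resolution_coresolution[OF N I]
  obtain a where a: "\<And>j. a j \<in> mod_hom (op_ring R) (J j) (cobj I (- int j))"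
    "\<And>j y. y \<in> carrier (J j) \<Longrightarrow> a (Suc j) (d j y) = cdiff I (- int j) (a j y)"
    "\<And>x. x \<in> carrier N \<Longrightarrow> a 0 (\<eta> x) = \<eta>I x"
    using coresolution_comparison[OF dual_coresolution IC] by blast
  obtain b where b: "\<And>j. b j \<in> mod_hom (op_ring R) (cobj I (- int j)) (J j)"
    "\<And>j y. y \<in> carrier (cobj I (- int j)) \<Longrightarrow> b (Suc j) (cdiff I (- int j) y) = d j (b j y)"
    "\<And>x. x \<in> carrier N \<Longrightarrow> b 0 (\<eta>I x) = \<eta> x"
    using coresolution_comparison[OF IC dual_coresolution] by blast
  \<comment> \<open>The way back and forth on the injective side. It need not be the identity, but
    it is an endomorphism of the coresolution that fixes the image of \<open>N\<close>.\<close>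
  define c where "c j y = b j (a j y)" for j y
  have c: "c j \<in> mod_hom (op_ring R) (J j) (J j)" for j
    unfolding c_def by (rule mod_hom_comp[OF a(1) b(1)])
  have cd: "c (Suc j) (d j y) = d j (c j y)" if "y \<in> carrier (J j)" for j y
    unfolding c_def a(2)[OF that] by (rule b(2)[OF mod_homD(1)[OF a(1) that]])
  have c\<eta>: "c 0 (\<eta> x) = \<eta> x" if "x \<in> carrier N" for x
    unfolding c_def a(3)[OF that] by (rule b(3)[OF that])
  obtain w where w: "\<And>j. w j \<in> carrier (V j)" "\<And>j. (\<lambda>b. d j (w j b)) = \<delta> (Suc j) (w (Suc j))"
    and w0: "(\<lambda>b. d 0 (\<delta> 0 (w 0) b)) = (\<lambda>b. \<zero>\<^bsub>J 1\<^esub>)" "pairing (m 0) (\<delta> 0 (w 0)) \<noteq> \<zero>\<^bsub>E\<^esub>"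
    using infinite_chain[OF inf] by blast
  \<comment> \<open>The map f (x) a, with the power of \<open>J j\<close> in the role of Q_{i+k} (x)
    J^j.\<close>
  define \<tau> where "\<tau> i j = pw_sum (TC.T (int i) (- int j)) (\<lambda>q y. TC.tn (int i) (- int j) (f i q) (a j y)) (m (i + k))" for i j
  have bal: "balanced (m (i + k)) (J j) (TC.T (int i) (- int j)) (\<lambda>q y. TC.tn (int i) (- int j) (f i q) (a j y))" for i j
    unfolding balanced_def
    using ten_closed[OF TC.P_facts(1) TC.I_facts(1)] ten_add_left[OF TC.P_facts(1) TC.I_facts(1)]
      ten_add_right[OF TC.P_facts(1) TC.I_facts(1)] ten_balanced[OF TC.P_facts(1) TC.I_facts(1)]
      mod_homD[OF f(1)[of i]] mod_homD[OF a(1)[of j]]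
    by (simp del: direct_power_simps)
  have \<tau>_hom: "\<tau> i j \<in> add_hom (pw (m (i + k)) (orestr (J j))) (TC.T (int i) (- int j))" for i j
    unfolding \<tau>_def by (rule pw_sum_hom[OF TC.T_abelian bal])
  have \<tau>_sv: "\<tau> i j (scaled_vector (J j) q y) = TC.tn (int i) (- int j) (f i q) (a j y)"
    if "q \<in> carrier (Q (i + k))" "y \<in> carrier (J j)" for i j q y
    unfolding \<tau>_def by (rule pw_sum_scaled_vector[OF TC.T_abelian bal that])
  have dmap: "(\<lambda>w b. d j (w b)) \<in> add_hom (pw n (orestr (J j))) (pw n (orestr (J (Suc j))))" for n j
    by (rule mod_hom_add_hom[OF pw_map[OF J J d]])
  have \<delta>map: "matrix_map (m (Suc l)) (J j) (\<Delta> l) \<in> add_hom (pw (m (Suc l)) (orestr (J j))) (pw (m l) (orestr (J j)))" for l j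
    by (rule mod_hom_add_hom[OF matrix_map_hom[OF J \<Delta>]])
  have dI\<tau>: "TC.dI (int i) (- int (Suc j)) (\<tau> i j v) = \<tau> i (Suc j) (\<lambda>b. d j (v b))"
    if v: "v \<in> carrier (pw (m (i + k)) (orestr (J j)))" for i j v
  proof (rule pw_add_hom_ext[OF TC.T_abelian J add_hom_comp[OF \<tau>_hom TC.nat_dI_hom] add_hom_comp[OF dmap \<tau>_hom] _ v])
    fix q y assume q: "q \<in> carrier (Q (i + k))" and y: "y \<in> carrier (J j)"
    show "TC.dI (int i) (- int (Suc j)) (\<tau> i j (scaled_vector (J j) q y)) = \<tau> i (Suc j) (\<lambda>b. d j (scaled_vector (J j) q y b))"
      unfolding \<tau>_sv[OF q y] scaled_vector_map[OF d q y] \<tau>_sv[OF q mod_homD(1)[OF d y]] a(2)[OF y]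
      by (rule TC.nat_dI_ten[OF mod_homD(1)[OF f(1) q] mod_homD(1)[OF a(1) y]])
  qed
  have dP\<tau>: "TC.dP (int i) (- int j) (\<tau> (Suc i) j v) = \<tau> i j (matrix_map (m (Suc (i + k))) (J j) (\<Delta> (i + k)) v)"
    if v: "v \<in> carrier (pw (m (Suc (i + k))) (orestr (J j)))" for i j v
  proof (rule pw_add_hom_ext[OF TC.T_abelian J add_hom_comp[OF \<tau>_hom[of "Suc i", unfolded add_Suc] TC.nat_dP_hom]
        add_hom_comp[OF \<delta>map \<tau>_hom] _ v])
    fix q y assume q: "q \<in> carrier (Q (Suc (i + k)))" and y: "y \<in> carrier (J j)"
    have q': "q \<in> carrier (Q (Suc i + k))" using q by (simp only: add_Suc)
    show "TC.dP (int i) (- int j) (\<tau> (Suc i) j (scaled_vector (J j) q y))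
        = \<tau> i j (matrix_map (m (Suc (i + k))) (J j) (\<Delta> (i + k)) (scaled_vector (J j) q y))"
      unfolding \<tau>_sv[OF q' y] matrix_map_scaled_vector[OF J \<Delta> q y] \<tau>_sv[OF mod_homD(1)[OF \<Delta> q] y] f(2)[OF q', symmetric]
      by (rule TC.nat_dP_ten[OF mod_homD(1)[OF f(1) q'] mod_homD(1)[OF a(1) y]])
  qed
  \<comment> \<open>On elementary tensors \<open>\<Theta>\<close> is evaluation after g (x) b. Both
    comparison maps commute with the differentials and \<open>d\<close> is dual to
    \<open>\<Delta>\<close>, whence the compatibility \<open>\<Theta>d\<close> below.\<close>
  have "\<exists>\<Theta>. \<Theta> \<in> add_hom (TC.T (int i) (- int (i + k))) E \<and>
      (\<forall>x\<in>carrier (cobj P (int i)). \<forall>y\<in>carrier (cobj I (- int (i + k))).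
        \<Theta> (TC.tn (int i) (- int (i + k)) x y) = b (i + k) y (g i x))" for i
  proof -
    note B = balancedD[OF balanced_dual[OF b(1)[of "i + k"]]] and G = mod_homD[OF g(1)[of i]]
    obtain \<Theta> where "\<Theta> \<in> add_hom (TC.T (int i) (- int (i + k))) E"
      "\<And>x y. x \<in> carrier (cobj P (int i)) \<Longrightarrow> y \<in> carrier (cobj I (- int (i + k))) \<Longrightarrow>
        \<Theta> (TC.tn (int i) (- int (i + k)) x y) = b (i + k) y (g i x)"
    proof (rule tensor_functional[OF TC.P_facts(1) TC.I_facts(1) EA, of "int i" "- int (i + k)" "\<lambda>x y. b (i + k) y (g i x)"])
      fix x y assume x: "x \<in> carrier (cobj P (int i))" and y: "y \<in> carrier (cobj I (- int (i + k)))"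
      show "b (i + k) y (g i x) \<in> carrier E" by (rule B(1)[OF G(1)[OF x] y])
      { fix x' assume x': "x' \<in> carrier (cobj P (int i))"
        show "b (i + k) y (g i (x \<oplus>\<^bsub>cobj P (int i)\<^esub> x')) = b (i + k) y (g i x) \<oplus>\<^bsub>E\<^esub> b (i + k) y (g i x')"
          unfolding G(2)[OF x x'] by (rule B(2)[OF G(1)[OF x] G(1)[OF x'] y]) }
      { fix y' assume "y' \<in> carrier (cobj I (- int (i + k)))"
        then show "b (i + k) (y \<oplus>\<^bsub>cobj I (- int (i + k))\<^esub> y') (g i x) = b (i + k) y (g i x) \<oplus>\<^bsub>E\<^esub> b (i + k) y' (g i x)"
          by (rule B(3)[OF G(1)[OF x] y]) }
      { fix r assume "r \<in> carrier (op_ring R)"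
        then have r: "r \<in> carrier R" by simp
        show "b (i + k) y (g i (r \<odot>\<^bsub>cobj P (int i)\<^esub> x)) = b (i + k) (r \<odot>\<^bsub>cobj I (- int (i + k))\<^esub> y) (g i x)"
          unfolding G(3)[OF r x] by (rule B(4)[OF r G(1)[OF x] y]) }
    qed blast
    then show ?thesis by blast
  qed
  then obtain \<Theta> where \<Theta>: "\<And>i. \<Theta> i \<in> add_hom (TC.T (int i) (- int (i + k))) E"
    and \<Theta>_ten: "\<And>i x y. x \<in> carrier (cobj P (int i)) \<Longrightarrow> y \<in> carrier (cobj I (- int (i + k))) \<Longrightarrow>
        \<Theta> i (TC.tn (int i) (- int (i + k)) x y) = b (i + k) y (g i x)"
    by metis
  have \<Theta>': "\<Theta> (Suc i) \<in> add_hom (TC.T (int (Suc i)) (- int (Suc (i + k)))) E" for i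
    using \<Theta>[of "Suc i"] by (simp only: add_Suc)
  have \<Theta>d: "\<Theta> i (TC.dP (int i) (- int (i + k)) v) = \<Theta> (Suc i) (TC.dI (int (Suc i)) (- int (Suc (i + k))) v)"
    if v: "v \<in> carrier (TC.T (int (Suc i)) (- int (i + k)))" for i v
  proof (rule tensor_hom_ext[OF TC.P_facts(1) TC.I_facts(1) EA add_hom_comp[OF TC.nat_dP_hom \<Theta>]
        add_hom_comp[OF TC.nat_dI_hom \<Theta>'] _ v])
    fix x y assume x: "x \<in> carrier (cobj P (int (Suc i)))" and y: "y \<in> carrier (cobj I (- int (i + k)))"
    have dx: "cdiff P (int (Suc i)) x \<in> carrier (cobj P (int i))"
      using mod_homD(1)[OF proj_resolution_seqD(5)[OF PF] x] .
    have dy: "cdiff I (- int (i + k)) y \<in> carrier (cobj I (- int (Suc (i + k))))"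
      using mod_homD(1)[OF inj_coresolutionD(5)[OF IC] y] .
    have gx: "g (Suc i) x \<in> carrier (Q (Suc (i + k)))" using mod_homD(1)[OF g(1) x] by (simp only: add_Suc)
    have "\<Theta> (Suc i) (TC.tn (int (Suc i)) (- int (Suc (i + k))) x (cdiff I (- int (i + k)) y))
        = b (Suc (i + k)) (cdiff I (- int (i + k)) y) (g (Suc i) x)"
      using \<Theta>_ten[OF x, of "cdiff I (- int (i + k)) y"] dy by (simp only: add_Suc)
    also have "\<dots> = b (i + k) y (g i (cdiff P (int (Suc i)) x))"
      unfolding b(2)[OF y] d_apply[OF gx] g(2)[OF x] ..
    also have "\<dots> = \<Theta> i (TC.tn (int i) (- int (i + k)) (cdiff P (int (Suc i)) x) y)"
      by (rule \<Theta>_ten[OF dx y, symmetric])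
    finally show "\<Theta> i (TC.dP (int i) (- int (i + k)) (TC.tn (int (Suc i)) (- int (i + k)) x y))
        = \<Theta> (Suc i) (TC.dI (int (Suc i)) (- int (Suc (i + k))) (TC.tn (int (Suc i)) (- int (i + k)) x y))"
      unfolding TC.nat_dP_ten[OF x y] TC.nat_dI_ten[OF x y] by (rule sym)
  qed
  \<comment> \<open>The tail of the chain from place \<open>k\<close> on: \<open>w (i + k)\<close>
    lies in Q_{i+k+1} (x) J^{i+k}, so its image has degree i + 1 in \<open>P\<close>.\<close>
  define t where "t i = \<tau> (Suc i) (i + k) (w (i + k))" for i
  have wp: "w (i + k) \<in> carrier (pw (m (Suc i + k)) (orestr (J (i + k))))" for i
    using w(1)[of "i + k"] by (simp only: add_Suc)
  have t: "t i \<in> carrier (TC.T (int (Suc i)) (- int (i + k)))" for i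
    unfolding t_def by (rule add_homD(1)[OF \<tau>_hom wp])
  have dIt: "TC.dI (int (Suc i)) (- int (Suc (i + k))) (t i) = \<tau> (Suc i) (Suc (i + k)) (\<delta> (Suc (i + k)) (w (Suc (i + k))))" for i
    unfolding t_def dI\<tau>[OF wp] w(2) ..
  define \<Psi> where "\<Psi> i = \<Theta> i (\<tau> i (i + k) (\<delta> (i + k) (w (i + k))))" for i
  have \<Psi>_Suc: "\<Psi> (Suc i) = \<Theta> (Suc i) (TC.dI (int (Suc i)) (- int (Suc (i + k))) (t i))" for i
    unfolding \<Psi>_def dIt add_Suc ..
  have dPt: "TC.dP (int i) (- int (i + k)) (t i) = \<tau> i (i + k) (\<delta> (i + k) (w (i + k)))" for i
    unfolding t_def by (rule dP\<tau>[OF w(1)])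
  \<comment> \<open>\<open>t i\<close> links two consecutive places: its image under dP gives the
    value at \<open>i\<close>, its image under dI the value at \<open>i + 1\<close>, and
    \<open>\<Theta>d\<close> identifies the two.\<close>
  have \<Psi>_const: "\<Psi> i = \<Psi> 0" for i
  proof (induction i)
    case (Suc i)
    have "\<Psi> (Suc i) = \<Theta> i (TC.dP (int i) (- int (i + k)) (t i))"
      unfolding \<Psi>_Suc by (rule \<Theta>d[OF t, symmetric])
    also have "\<dots> = \<Psi> i" unfolding dPt \<Psi>_def ..
    finally show ?case using Suc by simp
  qed simp
  have "TC.dP (int (Suc i)) (- int (Suc (i + k))) (t (Suc i)) = TC.dI (int (Suc i)) (- int (Suc (i + k))) (t i)" for i
    using dPt[of "Suc i"] unfolding dIt by (simp only: add_Suc)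
  from TC.stable_trivial_functional_nat[OF triv t this EA \<Theta> \<Theta>d]
  obtain i where "\<Theta> (Suc i) (TC.dI (int (Suc i)) (- int (Suc (i + k))) (t i)) = \<zero>\<^bsub>E\<^esub>" by blast
  then have \<Psi>0: "\<Psi> 0 = \<zero>\<^bsub>E\<^esub>" using \<Psi>_Suc[of i] \<Psi>_const[of "Suc i"] by simp
  \<comment> \<open>Evaluation after 1 (x) c, now on Q_j (x) J^j for all places \<open>j\<close>. It
    connects place \<open>k\<close>, where the class on \<open>M\<close> is read off, with place 0,
    where the chain is known to have a nonzero value.\<close>
  define \<Lambda> where "\<Lambda> j = pw_sum E (\<lambda>q y. c j y q) (m j)" for j
  have \<Lambda>_hom: "\<Lambda> j \<in> add_hom (T j) E" for j
    unfolding \<Lambda>_def by (rule pw_sum_hom[OF EA balanced_dual[OF c]])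
  have \<Lambda>_sv: "\<Lambda> j (scaled_vector (J j) q y) = c j y q" if "q \<in> carrier (Q j)" "y \<in> carrier (J j)" for j q y
    unfolding \<Lambda>_def by (rule pw_sum_scaled_vector[OF EA balanced_dual[OF c] that])
  have \<Lambda>_Suc: "\<Lambda> (Suc j) (\<lambda>b. d j (v b)) = \<Lambda> j (\<delta> j v)" if v: "v \<in> carrier (V j)" for j v
  proof (rule pw_add_hom_ext[OF EA J add_hom_comp[OF dmap \<Lambda>_hom] add_hom_comp[OF \<delta>map \<Lambda>_hom] _ v])
    fix q y assume q: "q \<in> carrier (Q (Suc j))" and y: "y \<in> carrier (J j)"
    show "\<Lambda> (Suc j) (\<lambda>b. d j (scaled_vector (J j) q y b)) = \<Lambda> j (\<delta> j (scaled_vector (J j) q y))"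
      unfolding scaled_vector_map[OF d q y] \<Lambda>_sv[OF q mod_homD(1)[OF d y]] matrix_map_scaled_vector[OF J \<Delta> q y]
        \<Lambda>_sv[OF mod_homD(1)[OF \<Delta> q] y] cd[OF y] by (rule d_apply[OF q])
  qed
  define z where "z j = \<delta> j (w j)" for j
  have \<Lambda>_const: "\<Lambda> j (z j) = \<Lambda> 0 (z 0)" for j
  proof (induction j)
    case (Suc j)
    then show ?case unfolding z_def w(2)[symmetric] \<Lambda>_Suc[OF w(1)] .
  qed simp
  have zT: "z j \<in> carrier (T j)" for j unfolding z_def by (rule mod_homD(1)[OF \<delta> w(1)])
  have zJ: "z j b' \<in> carrier (J j)" for j b' using direct_power_carrierD(1)[OF zT] by simp
  have z_cocycle: "d j (z j b') = \<zero>\<^bsub>J (Suc j)\<^esub>" for j b'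
  proof (cases j)
    case 0
    then show ?thesis using fun_cong[OF w0(1), of b'] unfolding z_def by simp
  next
    case (Suc l)
    have "w l b' \<in> carrier (J l)" using direct_power_carrierD(1)[OF w(1)] by simp
    then show ?thesis
      using inj_coresolution_dd[OF dual_coresolution] unfolding z_def Suc w(2)[symmetric] by simp
  qed
  have cl: "c j (z j b') p \<in> carrier E" if "p \<in> carrier (Q j)" for j b' p
    by (rule dual_apply(1)[OF mod_homD(1)[OF c zJ] that])
  \<comment> \<open>The two sides differ by the composite of \<open>f\<close> and \<open>g\<close>
    on the free side. The components of \<open>z k\<close> are cocycles and stay so under
    \<open>c\<close>, so \<open>cocycle_comparison\<close> removes it.\<close>
  have \<Psi>\<Lambda>: "\<Psi> 0 = \<Lambda> k (z k)"
  proof -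
    have "\<Psi> 0 = \<Theta> 0 (\<Oplus>\<^bsub>TC.T (int 0) (- int k)\<^esub>b'\<in>{..<m k}. TC.tn (int 0) (- int k) (f 0 (unit_vector R b')) (a k (z k b')))"
      unfolding \<Psi>_def \<tau>_def pw_sum_def z_def by simp
    also have "\<dots> = (\<Oplus>\<^bsub>E\<^esub>b'\<in>{..<m k}. \<Theta> 0 (TC.tn (int 0) (- int k) (f 0 (unit_vector R b')) (a k (z k b'))))"
    proof (rule add_hom_finsum[OF TC.T_abelian EA])
      show "\<Theta> 0 \<in> add_hom (TC.T (int 0) (- int k)) E" using \<Theta>[of 0] by simp
      show "(\<lambda>b'. TC.tn (int 0) (- int k) (f 0 (unit_vector R b')) (a k (z k b'))) \<in> {..<m k} \<rightarrow> carrier (TC.T (int 0) (- int k))"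
        using ten_closed[OF TC.P_facts(1) TC.I_facts(1) mod_homD(1)[OF f(1)[of 0]] mod_homD(1)[OF a(1)[of k] zJ]]
          unit_vector_Fr by fastforce
    qed simp
    also have "\<dots> = \<Lambda> k (z k)"
      unfolding \<Lambda>_def pw_sum_def
    proof (rule E.M.finsum_cong')
      fix b' assume "b' \<in> {..<m k}"
      then have u: "unit_vector R b' \<in> carrier (Q k)" using unit_vector_Fr by simp
      have fu: "f 0 (unit_vector R b') \<in> carrier (cobj P (int 0))" using mod_homD(1)[OF f(1)[of 0]] u by simp
      have gfu: "g 0 (f 0 (unit_vector R b')) \<in> carrier (Q k)" using mod_homD(1)[OF g(1)[of 0]] fu by simp
      have az: "a k (z k b') \<in> carrier (cobj I (- int (0 + k)))" using mod_homD(1)[OF a(1) zJ] by simp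
      have "\<Theta> 0 (TC.tn (int 0) (- int k) (f 0 (unit_vector R b')) (a k (z k b'))) = c k (z k b') (g 0 (f 0 (unit_vector R b')))"
        using \<Theta>_ten[OF fu az] unfolding c_def by simp
      also have "\<dots> = c k (z k b') (unit_vector R b')"
      proof (rule cocycle_comparison[OF e(1) M ker mod_homD(1)[OF c zJ] _ gfu u])
        show "d k (c k (z k b')) = \<zero>\<^bsub>J (Suc k)\<^esub>"
          unfolding cd[OF zJ, symmetric] z_cocycle by (rule mod_hom_zero[OF J J c])
        show "e (g 0 (f 0 (unit_vector R b'))) = e (unit_vector R b')" using g(3)[OF fu] f(3) u by simp
      qed
      finally show "\<Theta> 0 (TC.tn (int 0) (- int k) (f 0 (unit_vector R b')) (a k (z k b'))) = c k (z k b') (unit_vector R b')" .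
    qed (use cl unit_vector_Fr in auto)
    finally show ?thesis .
  qed
  \<comment> \<open>In degree 0 the components of \<open>z 0\<close> are cocycles, hence values of
    \<open>\<eta>\<close>, and these are fixed by \<open>c 0\<close>.\<close>
  have "\<Lambda> 0 (z 0) = pairing (m 0) (z 0)"
    unfolding \<Lambda>_def pw_sum_def pairing_def
  proof (rule E.M.finsum_cong')
    fix b' assume "b' \<in> {..<m 0}"
    have "z 0 b' \<in> {y \<in> carrier (J 0). d 0 y = \<zero>\<^bsub>J 1\<^esub>}" using zJ z_cocycle[of 0 b'] by simp
    then obtain x where "x \<in> carrier N" "z 0 b' = \<eta> x" unfolding d_kernel_zero by blast
    then show "c 0 (z 0 b') (unit_vector R b') = z 0 b' (unit_vector R b')" using c\<eta> by simp
  qed (use dual_apply(1)[OF zJ] unit_vector_Fr in auto)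
  then show False using \<Psi>0 \<Psi>\<Lambda> \<Lambda>_const[of k] w0(2) unfolding z_def by simp
qed

end

section \<open>Test modules in the universe and the equivalence of the four conditions\<close>

context artin_dual
begin

text \<open>The test modules have to lie in the type \<open>'u\<close> over which the theorem
  quantifies. The kernel of \<open>e\<close> is kept equal to that of \<open>h\<close>, so that
  exactness statements carry over to the copy.\<close>

lemma fin_gen_image_copy:
  assumes Y: "left_module R Y" and h: "h \<in> mod_hom R (Fr m) Y"
  obtains M :: "('r, 'u) module" and e where "left_module R M" "fin_gen_module R M"
    "e \<in> mod_hom R (Fr m) M" "e ` carrier (Fr m) = carrier M"
    "\<And>q. q \<in> carrier (Fr m) \<Longrightarrow> e q = \<zero>\<^bsub>M\<^esub> \<longleftrightarrow> h q = \<zero>\<^bsub>Y\<^esub>"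
proof -
  interpret F: left_module R "Fr m" by (rule left_module_Fr)
  interpret Y: left_module R Y by (rule Y)
  let ?S = "h ` carrier (Fr m)"
  let ?Y = "Y\<lparr>carrier := ?S\<rparr>"
  have Y': "left_module R ?Y"
    by (rule Y.left_module_sub[OF submodule_image[OF left_module_Fr Y h F.submodule_carrier]])
  have h': "h \<in> mod_hom R (Fr m) ?Y" by (rule mod_hom_into_sub[OF h order_refl])
  have fl: "finite_length K (restr A)"
    if "left_module R A" "f \<in> mod_hom R (Fr m) A" "f ` carrier (Fr m) = carrier A" for A :: "('r, 'x) module" and f
    by (rule finite_length_image[OF left_module_restrict[OF left_module_Fr] left_module_restrict[OF that(1)]
          mod_hom_restrict[OF that(2)] _ finite_length_free]) (use that(3) in simp)
  obtain M :: "('r, 'u) module" and c d where M: "left_module R M" and c: "c \<in> mod_hom R ?Y M"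
    and d: "d \<in> mod_hom R M ?Y" and dc: "\<And>x. x \<in> carrier ?Y \<Longrightarrow> d (c x) = x" and car: "carrier M = c ` carrier ?Y"
    by (rule copy_exists[OF Y' finite_length_small[OF Y' finite_length_image[OF left_module_restrict[OF left_module_Fr]
            left_module_restrict[OF Y'] mod_hom_restrict[OF h'] _ finite_length_free]]]) simp_all
  let ?e = "\<lambda>q. c (h q)"
  have e: "?e \<in> mod_hom R (Fr m) M" by (rule mod_hom_comp[OF h' c])
  have onto: "?e ` carrier (Fr m) = carrier M" unfolding car by (auto simp: image_image)
  have "c (h q) = \<zero>\<^bsub>M\<^esub> \<longleftrightarrow> h q = \<zero>\<^bsub>Y\<^esub>" if q: "q \<in> carrier (Fr m)" for q
  proof
    assume "c (h q) = \<zero>\<^bsub>M\<^esub>"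
    then have "h q = d \<zero>\<^bsub>M\<^esub>" using dc[of "h q"] q by simp
    then show "h q = \<zero>\<^bsub>Y\<^esub>" using mod_hom_zero[OF M Y' d] by simp
  next
    assume "h q = \<zero>\<^bsub>Y\<^esub>"
    then show "c (h q) = \<zero>\<^bsub>M\<^esub>" using mod_hom_zero[OF Y' M c] by simp
  qed
  moreover have "fin_gen_module R M"
    by (rule finite_length_fin_gen[OF M finite_length_image[OF left_module_restrict[OF left_module_Fr]
            left_module_restrict[OF M] mod_hom_restrict[OF e] _ finite_length_free]]) (use onto in simp)
  ultimately show ?thesis using that[OF M _ e onto] by blast
qed

lemma chosen_proj_res:
  assumes "left_module R M" "carrier M \<lesssim> (UNIV :: 'u set)"
  obtains \<epsilon> where "projective_resolution U R M (chosen_proj_res U R M) \<epsilon>"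
proof -
  have "carrier R \<lesssim> (UNIV :: 'u set)" using finite_length_small[OF R.left_module_regular R_finite_length] by simp
  then have "\<exists>P \<epsilon>. projective_resolution U R M P \<epsilon>"
    by (rule projective_resolution_exists[OF universe_infinite _ assms])
  then have "\<exists>\<epsilon>. projective_resolution U R M (chosen_proj_res U R M) \<epsilon>"
    unfolding chosen_proj_res_def by (rule someI_ex)
  then show ?thesis using that by blast
qed

end

context dual_resolution
begin

lemma chosen_inj_res:
  obtains \<eta>' where "injective_resolution U (op_ring R) N (chosen_inj_res U (op_ring R) N) \<eta>'"
proof -
  have "\<exists>I \<eta>'. injective_resolution U (op_ring R) N I \<eta>'"
    using coresolution_copy[OF dual_coresolution] by blast
  then have "\<exists>\<eta>'. injective_resolution U (op_ring R) N (chosen_inj_res U (op_ring R) N) \<eta>'"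
    unfolding chosen_inj_res_def by (rule someI_ex)
  then show ?thesis using that by blast
qed

lemma stable_Tor_nontrivial:
  assumes inf: "\<not> inj_dim U (op_ring R) N < \<infinity>"
    and M: "left_module R M" and e: "e \<in> mod_hom R (Q k) M" "e ` carrier (Q k) = carrier M"
    and ker: "\<Delta> k ` carrier (Q (Suc k)) = {q \<in> carrier (Q k). e q = \<zero>\<^bsub>M\<^esub>}"
  shows "\<not> trivial_module (stable_Tor U (op_ring R) (- int k) M N)"
proof -
  have "carrier M \<lesssim> carrier (Q k)" unfolding e(2)[symmetric] by (rule image_lepoll)
  then have "carrier M \<lesssim> (UNIV :: 'u set)"
    using finite_length_small[OF left_module_Fr finite_length_free] by (rule lepoll_trans)
  then obtain \<epsilon>P where P: "projective_resolution U R M (chosen_proj_res U R M) \<epsilon>P" using chosen_proj_res[OF M] by blast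
  obtain \<eta>I where I: "injective_resolution U (op_ring R) N (chosen_inj_res U (op_ring R) N) \<eta>I" by (rule chosen_inj_res)
  show ?thesis
    unfolding stable_Tor_def using stable_tensor_nontrivial[OF inf M e ker P I] by simp
qed

lemma stable_Tor_nontrivial_fin_gen:
  assumes inf: "\<not> inj_dim U (op_ring R) N < \<infinity>"
  obtains M :: "('r, 'u) module" where "left_module R M" "fin_gen_module R M"
    "\<not> trivial_module (stable_Tor U (op_ring R) (- int k) M N)"
proof -
  have "\<exists>(M :: ('r, 'u) module) e. left_module R M \<and> fin_gen_module R M \<and> e \<in> mod_hom R (Q k) M \<and>
      e ` carrier (Q k) = carrier M \<and> \<Delta> k ` carrier (Q (Suc k)) = {q \<in> carrier (Q k). e q = \<zero>\<^bsub>M\<^esub>}"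
  \<comment> \<open>By exactness the cokernel of \<open>\<Delta> k\<close> is an image: of
    \<open>\<epsilon>\<close> for k = 0, of the preceding differential otherwise.\<close>
  proof (cases k)
    case 0
    obtain M :: "('r, 'u) module" and e where M: "left_module R M" "fin_gen_module R M" "e \<in> mod_hom R (Q 0) M"
      "e ` carrier (Q 0) = carrier M" "\<And>q. q \<in> carrier (Q 0) \<Longrightarrow> e q = \<zero>\<^bsub>M\<^esub> \<longleftrightarrow> \<epsilon> q = \<zero>\<^bsub>DN\<^esub>"
      using fin_gen_image_copy[OF DN \<epsilon>(1)] by blast
    have "\<Delta> 0 ` carrier (Q (Suc 0)) = {q \<in> carrier (Q 0). e q = \<zero>\<^bsub>M\<^esub>}"
      unfolding \<epsilon>_exact[unfolded One_nat_def] using M(5) by blast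
    then show ?thesis using M(1-4) unfolding 0 by blast
  next
    case (Suc l)
    obtain M :: "('r, 'u) module" and e where M: "left_module R M" "fin_gen_module R M" "e \<in> mod_hom R (Q (Suc l)) M"
      "e ` carrier (Q (Suc l)) = carrier M"
      "\<And>q. q \<in> carrier (Q (Suc l)) \<Longrightarrow> e q = \<zero>\<^bsub>M\<^esub> \<longleftrightarrow> \<Delta> l q = \<zero>\<^bsub>Q l\<^esub>"
      using fin_gen_image_copy[OF left_module_Fr \<Delta>] by blast
    have "\<Delta> (Suc l) ` carrier (Q (Suc (Suc l))) = {q \<in> carrier (Q (Suc l)). e q = \<zero>\<^bsub>M\<^esub>}"
      unfolding \<Delta>_exact using M(5) by blast
    then show ?thesis using M(1-4) unfolding Suc by blast
  qed
  then obtain M :: "('r, 'u) module" and e where M: "left_module R M" "fin_gen_module R M" "e \<in> mod_hom R (Q k) M"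
    "e ` carrier (Q k) = carrier M" "\<Delta> k ` carrier (Q (Suc k)) = {q \<in> carrier (Q k). e q = \<zero>\<^bsub>M\<^esub>}"
    by (elim exE conjE)
  show ?thesis by (rule that[OF M(1,2) stable_Tor_nontrivial[OF inf M(1,3,4,5)]])
qed

lemma stable_Tor_trivial:
  assumes fin: "inj_dim U (op_ring R) N < \<infinity>"
    and M: "left_module R M" "carrier M \<lesssim> (UNIV :: 'u set)"
  shows "trivial_module (stable_Tor U (op_ring R) i M N)"
proof -
  let ?I = "chosen_inj_res U (op_ring R) N"
  obtain \<epsilon>P where P: "projective_resolution U R M (chosen_proj_res U R M) \<epsilon>P" by (rule chosen_proj_res[OF M])
  obtain \<eta>I where I: "injective_resolution U (op_ring R) N ?I \<eta>I" by (rule chosen_inj_res)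
  interpret TC: two_complexes "op_ring R" "chosen_proj_res U R M" ?I
    using P I by unfold_locales (simp_all add: projective_resolution_def injective_resolution_def)
  obtain s L where s: "\<And>n. s n \<in> mod_hom (op_ring R) (cobj ?I (- int (Suc n))) (cobj ?I (- int n))"
    "\<And>n x. n \<ge> L \<Longrightarrow> x \<in> carrier (cobj ?I (- int (Suc n))) \<Longrightarrow>
      cdiff ?I (- int n) (s n x) \<oplus>\<^bsub>cobj ?I (- int (Suc n))\<^esub> s (Suc n) (cdiff ?I (- int (Suc n)) x) = x"
    using inj_dim_finiteD[OF N fin injective_resolution_coresolution[OF N I]] by blast
  \<comment> \<open>\<open>s n\<close> goes from degree -(n + 1) to degree -n, so it is the
    contraction that starts in degree j = -(n + 1).\<close>
  define S where "S j = s (nat (- j - 1))" for j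
  have S_neg: "S (- int (Suc n)) = s n" for n by (simp add: S_def)
  have neg: "\<exists>n\<ge>L. j = - int (Suc n)" if "j < - int L" for j
    using that by (intro exI[of _ "nat (- j - 1)"]) auto
  show ?thesis
    unfolding stable_Tor_def op_ring_simps
  proof (rule TC.contraction_stable_trivial[of "- int L" S])
    show "trivial_module (cobj (chosen_proj_res U R M) i)" if "i < 0" for i
      using P that by (simp add: projective_resolution_def)
    show "S j \<in> mod_hom (op_ring R) (cobj ?I j) (cobj ?I (j + 1))" if "j < - int L" for j
    proof -
      from neg[OF that] obtain n where n: "j = - int (Suc n)" by blast
      show ?thesis unfolding n S_neg TC.succ_eqs by (rule s(1))
    qed
    show "cdiff ?I (j + 1 + 1) (S (j + 1) x) \<oplus>\<^bsub>cobj ?I (j + 1)\<^esub> S j (cdiff ?I (j + 1) x) = x"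
      if j: "j + 1 < - int L" and x: "x \<in> carrier (cobj ?I (j + 1))" for j x
    proof -
      from neg[OF j] obtain n where n: "j + 1 = - int (Suc n)" "n \<ge> L" by blast
      have j: "j = - int (Suc (Suc n))" using n(1) by simp
      show ?thesis using s(2)[OF n(2)] x unfolding j TC.succ_eqs S_neg by blast
    qed
  qed
qed

end

lemma (in artin_dual) dual_resolution_exists:
  assumes N: "left_module (op_ring R) N" and fl: "finite_length K (orestr N)"
  obtains m \<Delta> \<epsilon> where "dual_resolution U K E R N m \<Delta> \<epsilon>"
proof -
  have DN: "left_module R (dual_module K (op_ring R) E N)" "finite_length K (restr (dual_module K (op_ring R) E N))"
    using artin_dual.left_module_dual[OF op N] artin_dual.finite_length_dual[OF op N fl] by simp_all
  show ?thesis
  proof (rule free_resolution_exists[OF DN])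
    fix m \<Delta> \<epsilon>
    assume F: "\<epsilon> \<in> mod_hom R (Fr (m 0)) (dual_module K (op_ring R) E N)"
      "\<epsilon> ` carrier (Fr (m 0)) = carrier (dual_module K (op_ring R) E N)"
      "\<And>j. \<Delta> j \<in> mod_hom R (Fr (m (Suc j))) (Fr (m j))"
      "\<Delta> 0 ` carrier (Fr (m 1)) = {q \<in> carrier (Fr (m 0)). \<epsilon> q = \<zero>\<^bsub>dual_module K (op_ring R) E N\<^esub>}"
      "\<And>j. \<Delta> (Suc j) ` carrier (Fr (m (Suc (Suc j)))) = {q \<in> carrier (Fr (m (Suc j))). \<Delta> j q = \<zero>\<^bsub>Fr (m j)\<^esub>}"
    have "dual_resolution U K E R N m \<Delta> \<epsilon>"
      by (intro dual_resolution.intro artin_dual_axioms dual_resolution_axioms.intro N fl F)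
    then show ?thesis by (rule that)
  qed
qed

theorem proposition5p1:
  fixes K :: "'k ring" and R :: "('k, 'r) module" and E :: "('k, 'e) module"
    and N :: "('r, 'n) module"
  assumes "infinite (UNIV :: 'u set)" and "carrier K \<lesssim> (UNIV :: 'u set)"
    and "artin_algebra K R"
    and "injective_hull TYPE('u) K (residue_module K) E"
    and "left_module R N" and "fin_gen_module R N"
  shows "(inj_dim TYPE('u) R N < \<infinity> \<longleftrightarrow>
      (\<forall>i. \<forall>M :: ('r, 'u) module. left_module (op_ring R) M \<longrightarrow>
        trivial_module (stable_Tor TYPE('u) R i M N))) \<and>
    (inj_dim TYPE('u) R N < \<infinity> \<longleftrightarrow>
      (\<exists>i\<le>0. \<forall>M :: ('r, 'u) module.
        left_module (op_ring R) M \<and> fin_gen_module (op_ring R) M \<longrightarrow>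
        trivial_module (stable_Tor TYPE('u) R i M N))) \<and>
    (inj_dim TYPE('u) R N < \<infinity> \<longleftrightarrow>
      trivial_module (stable_Tor TYPE('u) R 0 (dual_module K R E N) N))"
proof -
  interpret AR: artin_dual "TYPE('u)" K E R
    using assms(1-4) by (simp add: artin_dual_def artinian_hull_def artin_algebra.artinian)
  \<comment> \<open>\<open>dual_resolution\<close> views \<open>N\<close> as a module over the
    opposite of its ring. It is applied to \<open>op_ring R\<close>, whose opposite is
    \<open>R\<close> again.\<close>
  have N: "left_module (op_ring (op_ring R)) N" using assms(5) by simp
  have fl: "finite_length K (restrict_scalars (op_ring (op_ring R)) N)"
    using AR.fin_gen_finite_length[OF assms(5,6)] by simp
  obtain m \<Delta> \<epsilon> where "dual_resolution TYPE('u) K E (op_ring R) N m \<Delta> \<epsilon>"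
    by (rule artin_dual.dual_resolution_exists[OF AR.op N fl])
  then interpret D: dual_resolution "TYPE('u)" K E "op_ring R" N m \<Delta> \<epsilon> .
  note op = op_ring_simps(6)
  \<comment> \<open>The type of \<open>M\<close> is left open because D(N), needed for the last
    condition, consists of functions and is not of type \<open>'u\<close>.\<close>
  have trivial: "trivial_module (stable_Tor TYPE('u) R i M N)"
    if "inj_dim TYPE('u) R N < \<infinity>" "left_module (op_ring R) M" "carrier M \<lesssim> (UNIV :: 'u set)"
    for i and M :: "('r, 'x) module"
    by (rule D.stable_Tor_trivial[unfolded op, OF that])
  have in_universe: "carrier M \<lesssim> (UNIV :: 'u set)" for M :: "('r, 'u) module" by (simp add: subset_imp_lepoll)
  have ii: "inj_dim TYPE('u) R N < \<infinity> \<Longrightarrow> left_module (op_ring R) M \<Longrightarrow>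
      trivial_module (stable_Tor TYPE('u) R i M N)" for i and M :: "('r, 'u) module"
    using trivial in_universe by blast
  have iii: "inj_dim TYPE('u) R N < \<infinity>"
    if i: "i \<le> 0" and triv: "\<And>M :: ('r, 'u) module. left_module (op_ring R) M \<Longrightarrow> fin_gen_module (op_ring R) M \<Longrightarrow>
        trivial_module (stable_Tor TYPE('u) R i M N)" for i
  proof (rule ccontr)
    assume "\<not> inj_dim TYPE('u) R N < \<infinity>"
    then obtain M :: "('r, 'u) module" where "left_module (op_ring R) M" "fin_gen_module (op_ring R) M"
      "\<not> trivial_module (stable_Tor TYPE('u) R (- int (nat (- i))) M N)"
      using D.stable_Tor_nontrivial_fin_gen[unfolded op] by blast
    then show False using triv[of M] i by simp
  qed
  have iv: "inj_dim TYPE('u) R N < \<infinity> \<longleftrightarrow> trivial_module (stable_Tor TYPE('u) R 0 (dual_module K R E N) N)"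
  proof
    assume "inj_dim TYPE('u) R N < \<infinity>"
    then show "trivial_module (stable_Tor TYPE('u) R 0 (dual_module K R E N) N)"
      by (rule trivial[OF _ D.DN[unfolded op] D.finite_length_small[OF D.DN D.DN_length, unfolded op]])
  next
    assume "trivial_module (stable_Tor TYPE('u) R 0 (dual_module K R E N) N)"
    \<comment> \<open>This is the case k = 0 with D(N) itself as the module and
      \<open>\<epsilon>\<close> as its cover, so no isomorphic copy intervenes.\<close>
    then show "inj_dim TYPE('u) R N < \<infinity>"
      using D.stable_Tor_nontrivial[OF _ D.DN D.\<epsilon>, unfolded op] D.\<epsilon>_exact by force
  qed
  show ?thesis
    by (intro conjI iv) (use ii iii in blast)+
qed

end
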